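(* Let $n\ge 1$ be an integer, $s\in(0,1)$, $1\le p<\infty$, and let $\Omega\subset\mathbb{R}^n$ be a bounded, Lipschitz, open set. Then the following embeddings, given by the restriction $u\mapsto u|_\Omega$ (respectively $u|_{\overline\Omega}$ for the continuous representative of $u$ in case (c)), are compact: (a) (Subcritical case) If $sp<n$, then $H^{s,p}(\mathbb{R}^n)$ is compactly embedded into $L^q(\Omega)$ for every $1\le q<p_s^*:=\frac{np}{n-sp}$. (b) (Critical case) If $sp=n$, then $H^{s,p}(\mathbb{R}^n)$ is compactly embedded into $L^q(\Omega)$ for every $1\le q<\infty$. (c) (Supercritical case) If $sp>n$, then $H^{s,p}(\mathbb{R}^n)$ is compactly embedded into $C^{0,\mu}(\overline{\Omega})$ for every $0<\mu<\mu_s^*:=s-\frac{n}{p}$.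
   Context: For $s\in(0,1)$ and $u\in C_c^\infty(\mathbb{R}^n)$, the Riesz fractional gradient of order $s$ is $$D^s u(x)=c_{n,s}\int_{\mathbb{R}^n}\frac{u(x)-u(y)}{|x-y|^{n+s}}\,\frac{x-y}{|x-y|}\,dy,\qquad c_{n,s}=(n+s-1)\frac{\Gamma\left(\frac{n+s-1}{2}\right)}{\pi^{n/2}2^{1-s}\Gamma\left(\frac{1-s}{2}\right)}.$$ For $1\le p<\infty$, the Bessel potential space $H^{s,p}(\mathbb{R}^n)$ is the closure (completion) of $C_c^\infty(\mathbb{R}^n)$ with respect to the norm $\|u\|_{D^s,p}=\|u\|_{L^p(\mathbb{R}^n)}+\|D^su\|_{L^p(\mathbb{R}^n,\mathbb{R}^n)}$. Concretely, it is the space of $u\in L^p(\mathbb{R}^n)$ for which there are $u_j\in C_c^\infty(\mathbb{R}^n)$ with $u_j\to u$ in $L^p$ and $(D^su_j)_j$ convergent in $L^p(\mathbb{R}^n,\mathbb{R}^n)$; the limit is denoted $D^su$. For $1<p<\infty$ this space coincides, with equivalent norms, with the complex interpolation space $[L^p(\mathbb{R}^n),W^{1,p}(\mathbb{R}^n)]_s$ and with the space $\{f\in\mathcal{S}'(\mathbb{R}^n): \mathcal{F}^{-1}((1+4\pi^2|\xi|^2)^{s/2}\mathcal{F}f)\in L^p(\mathbb{R}^n)\}$ normed by the $L^p$ norm of $\mathcal{F}^{-1}((1+4\pi^2|\xi|^2)^{s/2}\mathcal{F}f)$, where $\mathcal{F}$ is the Fourier transform with kernel $e^{-2\pi i x\cdot\xi}$.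 A Banach space $E$ is compactly embedded into $F$ if the embedding is continuous and bounded subsets of $E$ are relatively compact in $F$. $C^{0,\mu}(\overline\Omega)$ is the space of bounded $\mu$-Hölder continuous functions on $\overline\Omega$ with its usual norm. *)

theory Defs
  imports "HOL-Analysis.Analysis"
begin

section \<open>Lebesgue spaces\<close>

text \<open>
  The elements of a function space are represented by functions rather than by classes of
  functions. The (semi)norm of a difference is zero exactly if the two functions represent
  the same element.
\<close>

definition Lp_space :: "'a measure \<Rightarrow> real \<Rightarrow> ('a \<Rightarrow> 'b::real_normed_vector) set" where
  "Lp_space M p = {f \<in> borel_measurable M. integrable M (\<lambda>x. norm (f x) powr p)}"

definition Lp_norm :: "'a measure \<Rightarrow> real \<Rightarrow> ('a \<Rightarrow> 'b::real_normed_vector) \<Rightarrow> real" where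
  "Lp_norm M p f = (LINT x|M. norm (f x) powr p) powr (1 / p)"

definition Lp_tendsto ::
  "'a measure \<Rightarrow> real \<Rightarrow> (nat \<Rightarrow> 'a \<Rightarrow> 'b::real_normed_vector) \<Rightarrow> ('a \<Rightarrow> 'b) \<Rightarrow> bool" where
  "Lp_tendsto M p F f \<longleftrightarrow>
     (\<forall>j. F j \<in> Lp_space M p) \<and> f \<in> Lp_space M p \<and>
     (\<lambda>j. Lp_norm M p (\<lambda>x. F j x - f x)) \<longlonglongrightarrow> 0"

section \<open>Riesz fractional gradient and Bessel potential spaces\<close>

fun Ck_function :: "nat \<Rightarrow> ('a::euclidean_space \<Rightarrow> real) \<Rightarrow> bool" where
  "Ck_function 0 f \<longleftrightarrow> continuous_on UNIV f"
| "Ck_function (Suc k) f \<longleftrightarrow>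
     (\<forall>x. f differentiable (at x)) \<and>
     (\<forall>b\<in>Basis. Ck_function k (\<lambda>x. frechet_derivative f (at x) b))"

definition Cc_infinity :: "('a::euclidean_space \<Rightarrow> real) set" where
  "Cc_infinity = {f. (\<forall>k. Ck_function k f) \<and> compact (closure {x. f x \<noteq> 0})}"

definition riesz_const :: "real \<Rightarrow> real \<Rightarrow> real" where
  "riesz_const n s =
     (n + s - 1) * (Gamma ((n + s - 1) / 2) /
       (pi powr (n / 2) * 2 powr (1 - s) * Gamma ((1 - s) / 2)))"

definition riesz_gradient ::
  "real \<Rightarrow> ('a::euclidean_space \<Rightarrow> real) \<Rightarrow> 'a \<Rightarrow> 'a" where
  "riesz_gradient s u x =
     riesz_const (real DIM('a)) s *\<^sub>R
       (LINT y|lebesgue. ((u x - u y) / norm (x - y) powr (real DIM('a) + s)) *\<^sub>R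
          ((x - y) /\<^sub>R norm (x - y)))"

text \<open>\<open>g\<close> represents $D^s u$, the gradient of \<open>u\<close> extended from test functions by closure.\<close>

definition has_riesz_gradient ::
  "real \<Rightarrow> real \<Rightarrow> ('a::euclidean_space \<Rightarrow> real) \<Rightarrow> ('a \<Rightarrow> 'a) \<Rightarrow> bool" where
  "has_riesz_gradient s p u g \<longleftrightarrow>
     (\<exists>\<phi>. (\<forall>j. \<phi> j \<in> Cc_infinity) \<and>
          Lp_tendsto lebesgue p \<phi> u \<and>
          Lp_tendsto lebesgue p (\<lambda>j. riesz_gradient s (\<phi> j)) g)"

definition bessel_space :: "real \<Rightarrow> real \<Rightarrow> ('a::euclidean_space \<Rightarrow> real) set" where
  "bessel_space s p = {u. \<exists>g. has_riesz_gradient s p u g}"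

text \<open>
  Since $D^s$ is closable, \<open>g\<close> is determined by \<open>u\<close> almost everywhere, so the choice
  below does not affect the norm.
\<close>

definition bessel_norm :: "real \<Rightarrow> real \<Rightarrow> ('a::euclidean_space \<Rightarrow> real) \<Rightarrow> real" where
  "bessel_norm s p u =
     Lp_norm lebesgue p u + Lp_norm lebesgue p (SOME g. has_riesz_gradient s p u g)"

section \<open>Hoelder spaces\<close>

definition holder_space :: "real \<Rightarrow> 'a::metric_space set \<Rightarrow> ('a \<Rightarrow> real) set" where
  "holder_space \<mu> S =
     {f. bounded (f ` S) \<and>
         (\<exists>C. \<forall>x\<in>S. \<forall>y\<in>S. \<bar>f x - f y\<bar> \<le> C * dist x y powr \<mu>)}"

text \<open>
  Inserting 0 into the sets only matters for empty \<open>S\<close>, where the norm is then 0.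
  Pairs with \<open>x = y\<close> contribute \<open>0 / 0 = 0\<close>.
\<close>

definition holder_norm :: "real \<Rightarrow> 'a::metric_space set \<Rightarrow> ('a \<Rightarrow> real) \<Rightarrow> real" where
  "holder_norm \<mu> S f =
     Sup (insert 0 {\<bar>f x\<bar> | x. x \<in> S}) +
     Sup (insert 0 {\<bar>f x - f y\<bar> / dist x y powr \<mu> | x y. x \<in> S \<and> y \<in> S})"

definition continuous_representative :: "('a::euclidean_space \<Rightarrow> real) \<Rightarrow> ('a \<Rightarrow> real) \<Rightarrow> bool" where
  "continuous_representative u v \<longleftrightarrow> continuous_on UNIV v \<and> (AE x in lebesgue. v x = u x)"

definition continuous_rep :: "('a::euclidean_space \<Rightarrow> real) \<Rightarrow> 'a \<Rightarrow> real" where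
  "continuous_rep u = (THE v. continuous_representative u v)"

section \<open>Compact embeddings\<close>

definition seminorm_topology ::
  "('a \<Rightarrow> 'b::real_vector) set \<Rightarrow> (('a \<Rightarrow> 'b) \<Rightarrow> real) \<Rightarrow> ('a \<Rightarrow> 'b) topology" where
  "seminorm_topology E N = topology (\<lambda>U. U \<subseteq> E \<and>
     (\<forall>f\<in>U. \<exists>e>0. \<forall>g\<in>E. N (\<lambda>x. g x - f x) < e \<longrightarrow> g \<in> U))"

lemma openin_seminorm_topology:
  "openin (seminorm_topology E N) U \<longleftrightarrow>
     U \<subseteq> E \<and> (\<forall>f\<in>U. \<exists>e>0. \<forall>g\<in>E. N (\<lambda>x. g x - f x) < e \<longrightarrow> g \<in> U)"
proof -
  let ?P = "\<lambda>U. U \<subseteq> E \<and> (\<forall>f\<in>U. \<exists>e>0. \<forall>g\<in>E. N (\<lambda>x. g x - f x) < e \<longrightarrow> g \<in> U)"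
  have "istopology ?P"
    unfolding istopology_def
  proof (intro conjI allI impI)
    fix S T assume S: "?P S" and T: "?P T"
    show "S \<inter> T \<subseteq> E" using S by blast
    show "\<forall>f\<in>S \<inter> T. \<exists>e>0. \<forall>g\<in>E. N (\<lambda>x. g x - f x) < e \<longrightarrow> g \<in> S \<inter> T"
    proof
      fix f assume "f \<in> S \<inter> T"
      then obtain d e where "d > 0" "e > 0"
        "\<forall>g\<in>E. N (\<lambda>x. g x - f x) < d \<longrightarrow> g \<in> S"
        "\<forall>g\<in>E. N (\<lambda>x. g x - f x) < e \<longrightarrow> g \<in> T"
        using S T by blast
      then show "\<exists>e>0. \<forall>g\<in>E. N (\<lambda>x. g x - f x) < e \<longrightarrow> g \<in> S \<inter> T"
        by (intro exI[of _ "min d e"]) auto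
    qed
  next
    fix \<K> assume K: "\<forall>U\<in>\<K>. ?P U"
    show "\<Union>\<K> \<subseteq> E" using K by blast
    show "\<forall>f\<in>\<Union>\<K>. \<exists>e>0. \<forall>g\<in>E. N (\<lambda>x. g x - f x) < e \<longrightarrow> g \<in> \<Union>\<K>"
      using K by (meson UnionE UnionI)
  qed
  then show ?thesis
    unfolding seminorm_topology_def by (simp add: topology_inverse')
qed

lemma topspace_seminorm_topology [simp]: "topspace (seminorm_topology E N) = E"
proof
  show "topspace (seminorm_topology E N) \<subseteq> E"
    using openin_topspace openin_seminorm_topology by blast
  have "openin (seminorm_topology E N) E"
    unfolding openin_seminorm_topology using zero_less_one by blast
  then show "E \<subseteq> topspace (seminorm_topology E N)"
    by (rule openin_subset)
qed

definition compact_embedding ::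
  "('a \<Rightarrow> 'b::real_vector) set \<Rightarrow> (('a \<Rightarrow> 'b) \<Rightarrow> real) \<Rightarrow>
   ('c \<Rightarrow> 'd::real_vector) set \<Rightarrow> (('c \<Rightarrow> 'd) \<Rightarrow> real) \<Rightarrow>
   (('a \<Rightarrow> 'b) \<Rightarrow> ('c \<Rightarrow> 'd)) \<Rightarrow> bool" where
  "compact_embedding E NE F NF T \<longleftrightarrow>
     continuous_map (seminorm_topology E NE) (seminorm_topology F NF) T \<and>
     (\<forall>B. B \<subseteq> E \<and> (\<exists>C. \<forall>u\<in>B. NE u \<le> C) \<longrightarrow>
        compactin (seminorm_topology F NF) (seminorm_topology F NF closure_of (T ` B)))"

section \<open>Lipschitz sets\<close>

text \<open>
  Near each boundary point, the set is the part above the graph of a Lipschitz function over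
  a hyperplane orthogonal to a unit vector \<open>e\<close>, which is the last coordinate direction
  after a rotation.
\<close>

definition lipschitz_boundary :: "'a::euclidean_space set \<Rightarrow> bool" where
  "lipschitz_boundary \<Omega> \<longleftrightarrow>
     (\<forall>x\<in>frontier \<Omega>. \<exists>r>0. \<exists>e \<gamma> L. norm e = 1 \<and>
        L-lipschitz_on {z. z \<bullet> e = 0} \<gamma> \<and>
        (\<forall>y\<in>ball x r. y \<in> \<Omega> \<longleftrightarrow> y \<bullet> e > (\<gamma> (y - (y \<bullet> e) *\<^sub>R e) :: real)))"

end

theory Submission
  imports Defs "HOL-Complex_Analysis.Great_Picard" "HOL-Library.Diagonal_Subsequence"
    "HOL-Real_Asymp.Real_Asymp"
begin

text \<open>
  All operators are written as superpositions of Gaussians. The kernel of $D^s$ is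
  $\int_0^\infty \tau^{-a} V_\tau\,d\tau$ up to a constant, where $a = (1+s)/2$ and $V_\tau$ is a
  multiple of the gradient of the heat kernel. Hence $V_r * D^s\varphi$ is a fractional integral in
  time of $\partial_w (E_w * \varphi)$, and Abel's inversion recovers
  $E_t * \varphi = c \int_0^\infty \rho^{a-1}\, V_{t+\rho} * D^s\varphi\,d\rho$, including
  $\varphi$ itself as the case $t = 0$. Young's inequality in the form
  $\|V_r * f\|_q \le C r^{-1/2-(n/2)(1/p-1/q)} \|f\|_p$ then bounds
  $\|\varphi - E_t * \varphi\|_q$ by a positive power of $t$ whenever $n(1/p-1/q) < s$, which covers
  the subcritical and the critical case: the family $E_t * \varphi$ is equicontinuous for fixed $t$,
  so Arzela-Ascoli and a diagonal argument give convergent subsequences. For $sp > n$ the same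
  formula with $t = 0$ gives a Hoelder estimate with exponent $s - n/p$, and interpolation with the
  supremum norm yields compactness for every smaller exponent. All estimates are proved for test
  functions and pass to the completion.
\<close>

section \<open>Lebesgue spaces\<close>

text \<open>The kernel of D^s has size |v|^(-n-s) near 0 and is not integrable there, so only
  increments of \<phi> can be integrated against it. Superposing odd integrable fields moves this
  singularity into a one-dimensional weight at small times: at each fixed time the constant
  \<phi>(x) drops out by oddness. The inversion rests on a composition law. Since
  \<open>gauss_vec\<close> is -1/2 times a gradient, the scalar convolution of two such fields is,
  up to a constant, the Laplacian of a Gaussian whose times are added, and this is a time
  derivative. Recovering \<phi> therefore becomes a scalar Abel equation on the half-line. All norms
  are then controlled by the mass and the supremum of one kernel, which treats p = 1 like p > 1. The
  condition n(1/p - 1/q) < s expresses integrability at 0 of r^(a-1-b), where b = 1/2 + (n/2)(1/p -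
  1/q) is the order of growth of the L^p to L^q bound at time r; at equality the integral diverges
  logarithmically. For sp > n, splitting the time integral at r = |x-y|^2 balances size against
  smoothness and produces the exponent 2(a - 1/2 - n/(2p)) = s - n/p.\<close>

lemma Lp_norm_nonneg [simp]: "0 \<le> Lp_norm M p f"
  unfolding Lp_norm_def by simp

lemma Lp_norm_powr:
  assumes "p > 0"
  shows "Lp_norm M p f powr p = (LINT x|M. norm (f x) powr p)"
  using assms unfolding Lp_norm_def by (simp add: powr_powr)

lemma Lp_norm_cong_norm:
  assumes "\<And>x. x \<in> space M \<Longrightarrow> norm (f x) = norm (g x)"
  shows "Lp_norm M p f = Lp_norm M p g"
  unfolding Lp_norm_def using assms by (simp cong: Bochner_Integration.integral_cong)

lemma Lp_norm_minus_commute: "Lp_norm M p (\<lambda>x. f x - g x) = Lp_norm M p (\<lambda>x. g x - f x)"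
  by (rule Lp_norm_cong_norm) (simp add: norm_minus_commute)

lemma Lp_norm_zero: "Lp_norm M p (\<lambda>x. f x - f x) = 0"
  unfolding Lp_norm_def by simp

text \<open>Convexity of \<open>x powr p\<close> at the combination
  \<open>\<alpha> * (x / \<alpha>) + \<beta> * (y / \<beta>)\<close>. The weights stay free so that
  Minkowski's inequality can choose them in proportion to the two norms.\<close>

lemma powr_add_le_weighted:
  fixes x y :: real
  assumes p: "1 \<le> p" and xy: "0 \<le> x" "0 \<le> y" and ab: "0 < \<alpha>" "0 < \<beta>" "\<alpha> + \<beta> = 1"
  shows "(x + y) powr p \<le> \<alpha> * (x / \<alpha>) powr p + \<beta> * (y / \<beta>) powr p"
proof -
  \<comment> \<open>Convexity is available on the open half-line only; \<open>ge\<close> covers the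
    cases where \<open>x\<close> or \<open>y\<close> vanishes.\<close>
  have ge: "z powr p \<le> \<gamma> * (z / \<gamma>) powr p" if "0 < \<gamma>" "\<gamma> \<le> 1" "0 \<le> z" for \<gamma> z :: real
  proof -
    have "1 \<le> \<gamma> powr (1 - p)"
      using that p powr_mono'[of "1 - p" 0 \<gamma>] by simp
    then have "z powr p \<le> \<gamma> powr (1 - p) * z powr p" by (simp add: mult_le_cancel_right1)
    also have "\<dots> = \<gamma> * (z / \<gamma>) powr p"
      using that by (simp add: powr_divide powr_diff)
    finally show ?thesis .
  qed
  consider "x = 0" | "y = 0" | "x > 0" "y > 0" using xy by linarith
  then show ?thesis
  proof cases
    case 3
    have "convex_on {0<..} (\<lambda>x. x powr p)" using p by (rule powr_convex)
    then have "(\<lambda>x. x powr p) (\<alpha> *\<^sub>R (x / \<alpha>) + \<beta> *\<^sub>R (y / \<beta>))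
        \<le> \<alpha> * (x / \<alpha>) powr p + \<beta> * (y / \<beta>) powr p"
      using assms 3 unfolding convex_on_def by (auto simp del: real_scaleR_def)
    then show ?thesis using ab by simp
  qed (use ge[of \<alpha> x] ge[of \<beta> y] ab xy p in auto)
qed

lemma powr_add_le_two:
  fixes x y :: real
  assumes p: "1 \<le> p" and xy: "0 \<le> x" "0 \<le> y"
  shows "(x + y) powr p \<le> 2 powr (p - 1) * (x powr p + y powr p)"
proof -
  have "(x + y) powr p \<le> 1/2 * (x / (1/2)) powr p + 1/2 * (y / (1/2)) powr p"
    by (rule powr_add_le_weighted) (use assms in auto)
  also have "\<dots> = 2 powr (p - 1) * (x powr p + y powr p)"
    using xy by (simp add: powr_mult powr_diff algebra_simps)
  finally show ?thesis .
qed

lemma Lp_space_add: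
  fixes f g :: "'a \<Rightarrow> 'b::{second_countable_topology, real_normed_vector}"
  assumes p: "1 \<le> p" and f: "f \<in> Lp_space M p" and g: "g \<in> Lp_space M p"
  shows "(\<lambda>x. f x + g x) \<in> Lp_space M p"
proof -
  have fg [measurable]: "f \<in> borel_measurable M" "g \<in> borel_measurable M"
    and int: "integrable M (\<lambda>x. norm (f x) powr p)" "integrable M (\<lambda>x. norm (g x) powr p)"
    using f g unfolding Lp_space_def by auto
  have "integrable M (\<lambda>x. norm (f x + g x) powr p)"
  proof (rule Bochner_Integration.integrable_bound)
    show "integrable M (\<lambda>x. 2 powr (p - 1) * (norm (f x) powr p + norm (g x) powr p))"
      using int by auto
    show "AE x in M. norm (norm (f x + g x) powr p) \<le> norm (2 powr (p - 1) * (norm (f x) powr p + norm (g x) powr p))"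
    proof (rule AE_I2)
      fix x
      have "norm (f x + g x) powr p \<le> (norm (f x) + norm (g x)) powr p"
        using p by (intro powr_mono2 norm_triangle_ineq) auto
      also have "\<dots> \<le> 2 powr (p - 1) * (norm (f x) powr p + norm (g x) powr p)"
        using p by (intro powr_add_le_two) auto
      finally show "norm (norm (f x + g x) powr p) \<le> norm (2 powr (p - 1) * (norm (f x) powr p + norm (g x) powr p))"
        by simp
    qed
  qed measurable
  then show ?thesis unfolding Lp_space_def by simp
qed

lemma Lp_space_minus:
  fixes f :: "'a \<Rightarrow> 'b::{second_countable_topology, real_normed_vector}"
  assumes "f \<in> Lp_space M p" shows "(\<lambda>x. - f x) \<in> Lp_space M p"
  using assms unfolding Lp_space_def by auto

lemma Lp_space_diff:
  fixes f g :: "'a \<Rightarrow> 'b::{second_countable_topology, real_normed_vector}"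
  assumes p: "1 \<le> p" and f: "f \<in> Lp_space M p" and g: "g \<in> Lp_space M p"
  shows "(\<lambda>x. f x - g x) \<in> Lp_space M p"
  using Lp_space_add[OF p f Lp_space_minus[OF g]] by simp

lemma Lp_norm_minus: "Lp_norm M p (\<lambda>x. - f x) = Lp_norm M p f"
  by (rule Lp_norm_cong_norm) simp

lemma Lp_norm_le_powr:
  assumes "p > 0" "0 \<le> c" "(LINT x|M. norm (f x) powr p) \<le> c powr p"
  shows "Lp_norm M p f \<le> c"
proof -
  have "Lp_norm M p f \<le> (c powr p) powr (1 / p)"
    unfolding Lp_norm_def using assms by (intro powr_mono2) auto
  then show ?thesis using assms by (simp add: powr_powr)
qed

text \<open>For \<open>A\<close> and \<open>B\<close> strictly above the two norms, the weights
  \<open>A / (A + B)\<close> and \<open>B / (A + B)\<close> in \<open>powr_add_le_weighted\<close>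
  give a pointwise bound whose integral is at most \<open>(A + B) powr p\<close>. Strict upper
  bounds are positive, so dividing by them is safe even when a norm is 0; the slack is removed at
  the end.\<close>

lemma Minkowski_Lp:
  fixes f g :: "'a \<Rightarrow> 'b::{second_countable_topology, real_normed_vector}"
  assumes p: "1 \<le> p" and f: "f \<in> Lp_space M p" and g: "g \<in> Lp_space M p"
  shows "Lp_norm M p (\<lambda>x. f x + g x) \<le> Lp_norm M p f + Lp_norm M p g"
proof -
  have int: "integrable M (\<lambda>x. norm (f x) powr p)" "integrable M (\<lambda>x. norm (g x) powr p)"
    "integrable M (\<lambda>x. norm (f x + g x) powr p)"
    using f g Lp_space_add[OF p f g] unfolding Lp_space_def by auto
  have main: "Lp_norm M p (\<lambda>x. f x + g x) \<le> A + B"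
    if A: "A > Lp_norm M p f" and B: "B > Lp_norm M p g" for A B
  proof (rule Lp_norm_le_powr)
    have A0: "A > 0" and B0: "B > 0" using A B Lp_norm_nonneg le_less_trans by blast+
    have iA: "(LINT x|M. norm (f x) powr p) \<le> A powr p"
      using Lp_norm_powr[of p M f] p A by (metis Lp_norm_nonneg less_eq_real_def powr_mono2 zero_less_one le_less_trans not_le)
    have iB: "(LINT x|M. norm (g x) powr p) \<le> B powr p"
      using Lp_norm_powr[of p M g] p B by (metis Lp_norm_nonneg less_eq_real_def powr_mono2 zero_less_one le_less_trans not_le)
    define \<alpha> \<beta> where "\<alpha> = A / (A + B)" and "\<beta> = B / (A + B)"
    have ab: "0 < \<alpha>" "0 < \<beta>" "\<alpha> + \<beta> = 1"
      using A0 B0 unfolding \<alpha>_def \<beta>_def by (auto simp: add_divide_distrib[symmetric])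
    have ApBp: "A powr p > 0" "B powr p > 0" using A0 B0 by auto
    have le: "norm (f x + g x) powr p \<le> (A + B) powr p * (\<alpha> * norm (f x) powr p / A powr p + \<beta> * norm (g x) powr p / B powr p)" for x
    proof -
      have "norm (f x + g x) powr p \<le> (norm (f x) + norm (g x)) powr p"
        using p by (intro powr_mono2 norm_triangle_ineq) auto
      also have "\<dots> \<le> \<alpha> * (norm (f x) / \<alpha>) powr p + \<beta> * (norm (g x) / \<beta>) powr p"
        by (rule powr_add_le_weighted) (use p ab in auto)
      also have "(norm (f x) / \<alpha>) powr p = (A + B) powr p * norm (f x) powr p / A powr p"
        using A0 B0 unfolding \<alpha>_def by (simp add: powr_divide powr_mult)
      also have "(norm (g x) / \<beta>) powr p = (A + B) powr p * norm (g x) powr p / B powr p"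
        using A0 B0 unfolding \<beta>_def by (simp add: powr_divide powr_mult)
      finally show ?thesis by (simp add: algebra_simps)
    qed
    have "(LINT x|M. norm (f x + g x) powr p) \<le>
      (LINT x|M. (A + B) powr p * (\<alpha> * norm (f x) powr p / A powr p + \<beta> * norm (g x) powr p / B powr p))"
      using int by (intro integral_mono le) auto
    also have "\<dots> = (A + B) powr p * (\<alpha> * (LINT x|M. norm (f x) powr p) / A powr p + \<beta> * (LINT x|M. norm (g x) powr p) / B powr p)"
      using int by (simp add: Bochner_Integration.integral_add)
    also have "\<dots> \<le> (A + B) powr p * (\<alpha> * 1 + \<beta> * 1)"
      using iA iB ab ApBp
      by (intro mult_left_mono add_mono) (auto simp: divide_le_eq intro: mult_left_mono)
    finally show "(LINT x|M. norm (f x + g x) powr p) \<le> (A + B) powr p" using ab by simp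
    show "0 \<le> A + B" using A0 B0 by simp
  qed (use p in auto)
  show ?thesis
  proof (rule field_le_epsilon)
    fix e :: real assume "e > 0"
    then show "Lp_norm M p (\<lambda>x. f x + g x) \<le> Lp_norm M p f + Lp_norm M p g + e"
      using main[of "Lp_norm M p f + e/2" "Lp_norm M p g + e/2"] by simp
  qed
qed

lemma Lp_norm_triangle:
  fixes f g h :: "'a \<Rightarrow> 'b::{second_countable_topology, real_normed_vector}"
  assumes p: "1 \<le> p" and "f \<in> Lp_space M p" "g \<in> Lp_space M p" "h \<in> Lp_space M p"
  shows "Lp_norm M p (\<lambda>x. f x - h x) \<le> Lp_norm M p (\<lambda>x. f x - g x) + Lp_norm M p (\<lambda>x. g x - h x)"
  using Minkowski_Lp[OF p Lp_space_diff[OF p assms(2,3)] Lp_space_diff[OF p assms(3,4)]] by simp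

lemma Lp_norm_le_add:
  fixes f g :: "'a \<Rightarrow> 'b::{second_countable_topology, real_normed_vector}"
  assumes p: "1 \<le> p" and "f \<in> Lp_space M p" "g \<in> Lp_space M p"
  shows "Lp_norm M p f \<le> Lp_norm M p g + Lp_norm M p (\<lambda>x. f x - g x)"
  using Minkowski_Lp[OF p assms(3) Lp_space_diff[OF p assms(2,3)]] by simp

text \<open>One bound of the extended integral yields integrability and the norm estimate together.
  The estimates below are therefore stated for nonnegative integrals and converted here.\<close>

lemma Lp_space_nn_integral:
  assumes p: "0 < p" and f: "f \<in> borel_measurable M" and c: "0 \<le> c"
    and le: "(\<integral>\<^sup>+x. ennreal (norm (f x) powr p) \<partial>M) \<le> ennreal (c powr p)"
  shows "f \<in> Lp_space M p" "Lp_norm M p f \<le> c"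
proof -
  have [measurable]: "(\<lambda>x. norm (f x) powr p) \<in> borel_measurable M" using f by measurable
  have int: "integrable M (\<lambda>x. norm (f x) powr p)"
    using le by (intro integrableI_nonneg) (auto intro: le_less_trans)
  then show "f \<in> Lp_space M p" using f unfolding Lp_space_def by auto
  have "ennreal (LINT x|M. norm (f x) powr p) \<le> ennreal (c powr p)"
    using le nn_integral_eq_integral[OF int] by simp
  then show "Lp_norm M p f \<le> c" using c p by (intro Lp_norm_le_powr) auto
qed

lemma nn_integral_Lp_norm:
  assumes p: "0 < p" and f: "f \<in> Lp_space M p"
  shows "(\<integral>\<^sup>+x. ennreal (norm (f x) powr p) \<partial>M) = ennreal (Lp_norm M p f powr p)"
  using assms nn_integral_eq_integral[of M "\<lambda>x. norm (f x) powr p"]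
  unfolding Lp_space_def Lp_norm_powr[OF p] by simp

lemma Lp_Fatou:
  fixes F :: "nat \<Rightarrow> 'a \<Rightarrow> 'b::{second_countable_topology, real_normed_vector}"
  assumes p: "0 < p" and F: "\<And>j. F j \<in> Lp_space M p" and f: "f \<in> borel_measurable M"
    and lim: "AE x in M. (\<lambda>j. F j x) \<longlonglongrightarrow> f x" and le: "eventually (\<lambda>j. Lp_norm M p (F j) \<le> c) sequentially"
  shows "f \<in> Lp_space M p" "Lp_norm M p f \<le> c"
proof -
  obtain J where J: "\<And>j. j \<ge> J \<Longrightarrow> Lp_norm M p (F j) \<le> c"
    using le unfolding eventually_sequentially by blast
  have c: "0 \<le> c" using J[of J] Lp_norm_nonneg order_trans by blast
  have [measurable]: "\<And>j. F j \<in> borel_measurable M" using F unfolding Lp_space_def by auto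
  have "(\<integral>\<^sup>+x. ennreal (norm (f x) powr p) \<partial>M)
      = (\<integral>\<^sup>+x. liminf (\<lambda>j. ennreal (norm (F j x) powr p)) \<partial>M)"
  proof (rule nn_integral_cong_AE)
    show "AE x in M. ennreal (norm (f x) powr p) = liminf (\<lambda>j. ennreal (norm (F j x) powr p))"
      using lim
    proof eventually_elim
      case (elim x)
      have "(\<lambda>j. norm (F j x) powr p) \<longlonglongrightarrow> norm (f x) powr p"
        using elim p by (intro tendsto_powr') (auto intro: tendsto_norm)
      then have "(\<lambda>j. ennreal (norm (F j x) powr p)) \<longlonglongrightarrow> ennreal (norm (f x) powr p)"
        by (rule tendsto_ennrealI)
      then show ?case using lim_imp_Liminf[of sequentially] by (metis trivial_limit_sequentially)
    qed
  qed
  also have "\<dots> \<le> liminf (\<lambda>j. \<integral>\<^sup>+x. ennreal (norm (F j x) powr p) \<partial>M)"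
    by (rule nn_integral_liminf) measurable
  also have "\<dots> = liminf (\<lambda>j. ennreal (Lp_norm M p (F j) powr p))"
    using nn_integral_Lp_norm[OF p F] by simp
  also have "\<dots> \<le> ennreal (c powr p)"
  proof (rule Liminf_le)
    show "\<forall>\<^sub>F j in sequentially. ennreal (Lp_norm M p (F j) powr p) \<le> ennreal (c powr p)"
      using le by eventually_elim (use p in \<open>auto intro!: ennreal_leI powr_mono2\<close>)
  qed simp
  finally show "f \<in> Lp_space M p" "Lp_norm M p f \<le> c"
    using Lp_space_nn_integral[OF p f c] by auto
qed

lemma Lp_tendsto_AE_subseq:
  fixes F :: "nat \<Rightarrow> 'a \<Rightarrow> 'b::{second_countable_topology, real_normed_vector}"
  assumes p: "1 \<le> p" and lim: "Lp_tendsto M p F f"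
  shows "\<exists>r. strict_mono r \<and> (AE x in M. (\<lambda>j. F (r j) x) \<longlonglongrightarrow> f x)"
proof -
  have F: "\<And>j. F j \<in> Lp_space M p" "f \<in> Lp_space M p"
    and l: "(\<lambda>j. Lp_norm M p (\<lambda>x. F j x - f x)) \<longlonglongrightarrow> 0"
    using lim unfolding Lp_tendsto_def by auto
  have "(\<lambda>j. Lp_norm M p (\<lambda>x. F j x - f x) powr p) \<longlonglongrightarrow> 0"
    using l p by (intro tendsto_eq_intros) (auto intro: tendsto_eq_rhs[OF tendsto_powr'])
  then have "(\<lambda>j. LINT x|M. norm (norm (F j x - f x) powr p)) \<longlonglongrightarrow> 0"
    using p by (simp add: Lp_norm_powr)
  moreover have "integrable M (\<lambda>x. norm (F j x - f x) powr p)" for j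
    using Lp_space_diff[OF p F(1) F(2)] unfolding Lp_space_def by auto
  ultimately obtain r where r: "strict_mono r" "AE x in M. (\<lambda>j. norm (F (r j) x - f x) powr p) \<longlonglongrightarrow> 0"
    using tendsto_L1_AE_subseq[of M "\<lambda>j x. norm (F j x - f x) powr p"] by blast
  have "AE x in M. (\<lambda>j. F (r j) x) \<longlonglongrightarrow> f x"
    using r(2)
  proof eventually_elim
    case (elim x)
    have "(\<lambda>j. (norm (F (r j) x - f x) powr p) powr (1/p)) \<longlonglongrightarrow> 0"
    proof (rule tendsto_eq_rhs[OF tendsto_powr'[OF elim tendsto_const]])
      show "0 powr (1/p) = (0::real)" by simp
    qed (use p in auto)
    moreover have "(norm (F (r j) x - f x) powr p) powr (1/p) = norm (F (r j) x - f x)" for j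
      using p by (subst powr_powr) simp
    ultimately have "(\<lambda>j. norm (F (r j) x - f x)) \<longlonglongrightarrow> 0" by simp
    then show ?case by (simp add: LIM_zero_iff tendsto_norm_zero_iff)
  qed
  then show ?thesis using r(1) by blast
qed

text \<open>After division of \<open>f\<close> by a number \<open>N\<close> above its norm,
  \<open>y powr q \<le> 1 + y powr p\<close> integrates to at most the total mass plus 1. This is
  the origin of the summand 1 in the constant; it also keeps the constant positive on a null
  space.\<close>

lemma Lp_finite_measure_mono:
  fixes f :: "'a \<Rightarrow> 'b::{second_countable_topology, real_normed_vector}"
  assumes M: "finite_measure M" and q: "0 < q" "q \<le> p" and f: "f \<in> Lp_space M p"
  shows "f \<in> Lp_space M q"
    and "Lp_norm M q f \<le> (measure M (space M) + 1) powr (1/q) * Lp_norm M p f"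
proof -
  interpret finite_measure M by fact
  have p: "0 < p" using q by simp
  have f' [measurable]: "f \<in> borel_measurable M" and int: "integrable M (\<lambda>x. norm (f x) powr p)"
    using f unfolding Lp_space_def by auto
  have le: "y powr q \<le> 1 + y powr p" if "0 \<le> y" for y :: real
  proof (cases "y \<le> 1")
    case True
    then have "y powr q \<le> 1" using that q by (simp add: powr_le1)
    then show ?thesis using powr_ge_zero[of y p] by linarith
  next
    case False
    then have "y powr q \<le> y powr p" using q by (intro powr_mono) auto
    then show ?thesis by simp
  qed
  have int_q: "integrable M (\<lambda>x. norm (f x) powr q)"
  proof (rule Bochner_Integration.integrable_bound)
    show "integrable M (\<lambda>x. 1 + norm (f x) powr p)" using int by simp
    show "AE x in M. norm (norm (f x) powr q) \<le> norm (1 + norm (f x) powr p)"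
      using le[of "norm (f x)" for x] by (intro AE_I2) simp
  qed measurable
  then show "f \<in> Lp_space M q" unfolding Lp_space_def by simp
  let ?m = "measure M (space M) + 1"
  have m: "?m > 0" by (simp add: add_nonneg_pos)
  have main: "Lp_norm M q f \<le> ?m powr (1/q) * N" if N: "N > Lp_norm M p f" for N
  proof (rule Lp_norm_le_powr)
    have N0: "N > 0" using N Lp_norm_nonneg le_less_trans by blast
    have "Lp_norm M p f powr p \<le> N powr p" using N p by (intro powr_mono2) auto
    then have B: "(LINT x|M. norm (f x) powr p) \<le> N powr p" by (simp add: Lp_norm_powr[OF p])
    have "(LINT x|M. norm (f x) powr q) \<le> (LINT x|M. N powr q * (1 + norm (f x) powr p / N powr p))"
    proof (intro integral_mono int_q)
      show "integrable M (\<lambda>x. N powr q * (1 + norm (f x) powr p / N powr p))" using int by simp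
      fix x
      have "norm (f x) powr q = N powr q * (norm (f x) / N) powr q"
        using N0 by (simp add: powr_divide)
      also have "\<dots> \<le> N powr q * (1 + (norm (f x) / N) powr p)"
        using N0 by (intro mult_left_mono le) auto
      finally show "norm (f x) powr q \<le> N powr q * (1 + norm (f x) powr p / N powr p)"
        using N0 by (simp add: powr_divide)
    qed
    also have "\<dots> = N powr q * (measure M (space M) + (LINT x|M. norm (f x) powr p) / N powr p)"
      using int by simp
    also have "\<dots> \<le> N powr q * ?m"
      using B N0 by (intro mult_left_mono add_mono) (auto simp: divide_le_eq)
    also have "\<dots> = (?m powr (1/q) * N) powr q"
      using m N0 q by (simp add: powr_mult powr_powr)
    finally show "(LINT x|M. norm (f x) powr q) \<le> (?m powr (1/q) * N) powr q" .
    show "0 \<le> ?m powr (1/q) * N" using N0 by simp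
  qed (use q in auto)
  show "Lp_norm M q f \<le> ?m powr (1/q) * Lp_norm M p f"
  proof (rule field_le_epsilon)
    fix e :: real assume e: "e > 0"
    have mp: "?m powr (1/q) > 0" using m by simp
    have "Lp_norm M q f \<le> ?m powr (1/q) * (Lp_norm M p f + e / ?m powr (1/q))"
      using e mp by (intro main) simp
    then show "Lp_norm M q f \<le> ?m powr (1/q) * Lp_norm M p f + e"
      using mp by (simp add: distrib_left)
  qed
qed

text \<open>Riesz-Fischer. On a finite measure the \<open>L^p\<close> bounds of consecutive
  differences pass to \<open>L^1\<close>, so a rapidly Cauchy subsequence is absolutely summable
  almost everywhere. Fatou's lemma then bounds the distance of every late term of the full sequence
  to the pointwise limit.\<close>

lemma Lp_complete:
  fixes F :: "nat \<Rightarrow> 'a \<Rightarrow> 'b::{second_countable_topology, banach}"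
  assumes M: "finite_measure M" and p: "1 \<le> p" and F: "\<And>j. F j \<in> Lp_space M p"
    and cauchy: "\<And>e. e > 0 \<Longrightarrow> \<exists>J. \<forall>i\<ge>J. \<forall>j\<ge>J. Lp_norm M p (\<lambda>x. F i x - F j x) < e"
  shows "\<exists>f. Lp_tendsto M p F f"
proof -
  interpret finite_measure M by fact
  have F' [measurable]: "\<And>j. F j \<in> borel_measurable M" using F unfolding Lp_space_def by auto
  have "\<forall>k. \<exists>J. \<forall>i\<ge>J. \<forall>j\<ge>J. Lp_norm M p (\<lambda>x. F i x - F j x) < (1/2)^k"
    using cauchy by simp
  then obtain J where J: "\<And>k i j. i \<ge> J k \<Longrightarrow> j \<ge> J k \<Longrightarrow> Lp_norm M p (\<lambda>x. F i x - F j x) < (1/2)^k"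
    by metis
  define r where "r k = (\<Sum>i\<le>k. J i) + k" for k
  have r: "strict_mono r" unfolding strict_mono_Suc_iff r_def by simp
  have rJ: "r k \<ge> J k" for k unfolding r_def by (simp add: member_le_sum trans_le_add1)
  define g where "g k x = F (r (Suc k)) x - F (r k) x" for k x
  have [measurable]: "g k \<in> borel_measurable M" for k unfolding g_def by measurable
  have g: "g k \<in> Lp_space M p" for k unfolding g_def by (intro Lp_space_diff p F)
  have gn: "Lp_norm M p (g k) \<le> (1/2)^k" for k
    unfolding g_def using J[of k "r (Suc k)" "r k"] rJ[of k] strict_monoD[OF r, of k "Suc k"] by simp
  define m where "m = (measure M (space M) + 1) powr (1/1)"
  have "(\<integral>\<^sup>+x. ennreal (norm (g k x)) \<partial>M) \<le> ennreal (m * (1/2)^k)" for k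
  proof -
    have "(\<integral>\<^sup>+x. ennreal (norm (g k x)) \<partial>M) = ennreal (Lp_norm M 1 (g k))"
      using nn_integral_Lp_norm[OF _ Lp_finite_measure_mono(1)[OF M _ p g], of k] by simp
    also have "\<dots> \<le> ennreal (m * (1/2)^k)"
    proof (rule ennreal_leI)
      have "Lp_norm M 1 (g k) \<le> m * Lp_norm M p (g k)"
        unfolding m_def by (rule Lp_finite_measure_mono(2)[OF M _ p g]) simp
      also have "\<dots> \<le> m * (1/2)^k" by (intro mult_left_mono gn) (simp add: m_def)
      finally show "Lp_norm M 1 (g k) \<le> m * (1/2)^k" .
    qed
    finally show ?thesis .
  qed
  then have "(\<Sum>k. \<integral>\<^sup>+x. ennreal (norm (g k x)) \<partial>M) \<le> (\<Sum>k. ennreal (m * (1/2)^k))"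
    by (intro suminf_le) auto
  also have "\<dots> = ennreal (\<Sum>k. m * (1/2)^k)"
    by (intro suminf_ennreal2) (auto simp: m_def intro!: summable_mult summable_geometric)
  finally have "(\<integral>\<^sup>+x. (\<Sum>k. ennreal (norm (g k x))) \<partial>M) < \<infinity>"
    by (subst nn_integral_suminf) (auto intro: le_less_trans)
  then have "AE x in M. (\<Sum>k. ennreal (norm (g k x))) \<noteq> \<infinity>"
    by (intro nn_integral_noteq_infinite) (auto simp: less_top)
  then have conv: "AE x in M. convergent (\<lambda>k. F (r k) x)"
  proof eventually_elim
    case (elim x)
    then have "summable (\<lambda>k. norm (g k x))" by (intro summable_suminf_not_top) auto
    then have "summable (\<lambda>k. g k x)" by (rule summable_norm_cancel)
    then have "convergent (\<lambda>K. \<Sum>k<K. g k x)" by (simp add: summable_iff_convergent)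
    then have "convergent (\<lambda>K. (\<Sum>k<K. g k x) + F (r 0) x)" by (intro convergent_add convergent_const)
    moreover have "(\<Sum>k<K. g k x) + F (r 0) x = F (r K) x" for K
      unfolding g_def using sum_lessThan_telescope[of "\<lambda>k. F (r k) x" K] by simp
    ultimately show ?case by simp
  qed
  define f where "f x = lim (\<lambda>k. F (r k) x)" for x
  have f [measurable]: "f \<in> borel_measurable M" unfolding f_def by measurable
  have lim: "AE x in M. (\<lambda>k. F (r k) x) \<longlonglongrightarrow> f x"
    using conv unfolding f_def by eventually_elim (simp add: convergent_LIMSEQ_iff)
  have key: "(\<lambda>x. F j x - f x) \<in> Lp_space M p \<and> Lp_norm M p (\<lambda>x. F j x - f x) \<le> (1/2)^k" if j: "j \<ge> J k" for j k
  proof -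
    have ev: "\<forall>\<^sub>F i in sequentially. Lp_norm M p (\<lambda>x. F j x - F (r i) x) \<le> (1/2)^k"
      unfolding eventually_sequentially
    proof (intro exI[of _ k] allI impI)
      fix i assume "k \<le> i"
      then have "r i \<ge> J k" using rJ[of k] strict_mono_less_eq[OF r, of k i] by linarith
      then show "Lp_norm M p (\<lambda>x. F j x - F (r i) x) \<le> (1/2)^k" using J[OF j] less_imp_le by blast
    qed
    have lim': "AE x in M. (\<lambda>i. F j x - F (r i) x) \<longlonglongrightarrow> F j x - f x"
      using lim by eventually_elim (intro tendsto_intros)
    have p0: "0 < p" using p by simp
    have m: "(\<lambda>x. F j x - f x) \<in> borel_measurable M" by measurable
    show ?thesis
      using Lp_Fatou[OF p0 Lp_space_diff[OF p F F] m lim' ev] by blast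
  qed
  have "f \<in> Lp_space M p"
    using Lp_space_diff[OF p F[of "J 0"] key[of 0 "J 0", THEN conjunct1]] by simp
  moreover have "(\<lambda>j. Lp_norm M p (\<lambda>x. F j x - f x)) \<longlonglongrightarrow> 0"
  proof (rule LIMSEQ_I)
    fix e :: real assume "e > 0"
    then obtain k where k: "(1/2)^k < e" using real_arch_pow_inv[of e "1/2"] by auto
    show "\<exists>no. \<forall>n\<ge>no. norm (Lp_norm M p (\<lambda>x. F n x - f x) - 0) < e"
    proof (intro exI[of _ "J k"] allI impI)
      fix j assume "j \<ge> J k"
      then show "norm (Lp_norm M p (\<lambda>x. F j x - f x) - 0) < e" using key[of k j] k by simp
    qed
  qed
  ultimately show ?thesis using F unfolding Lp_tendsto_def by blast
qed

section \<open>Compactness in seminormed spaces\<close>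

text \<open>Functions stand for classes, so the target topology need not be Hausdorff. One
  representative per class gives a genuine metric space \<open>R\<close>, where sequential
  compactness yields a compact closure. Covers can be moved between the two spaces because a
  seminorm-open set contains, with a function, everything at distance 0 from it.\<close>

lemma compact_embeddingI:
  fixes E :: "('a \<Rightarrow> 'b::real_vector) set" and F :: "('c \<Rightarrow> 'd::real_vector) set"
  assumes nonneg: "\<And>f g. f \<in> F \<Longrightarrow> g \<in> F \<Longrightarrow> 0 \<le> NF (\<lambda>x. f x - g x)"
    and refl: "\<And>f. f \<in> F \<Longrightarrow> NF (\<lambda>x. f x - f x) = 0"
    and sym: "\<And>f g. f \<in> F \<Longrightarrow> g \<in> F \<Longrightarrow> NF (\<lambda>x. f x - g x) = NF (\<lambda>x. g x - f x)"
    and tri: "\<And>f g h. f \<in> F \<Longrightarrow> g \<in> F \<Longrightarrow> h \<in> F \<Longrightarrow>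
        NF (\<lambda>x. f x - h x) \<le> NF (\<lambda>x. f x - g x) + NF (\<lambda>x. g x - h x)"
    and C: "0 \<le> C"
    and T: "\<And>u. u \<in> E \<Longrightarrow> T u \<in> F"
    and bound: "\<And>u v. u \<in> E \<Longrightarrow> v \<in> E \<Longrightarrow>
        NF (\<lambda>x. T u x - T v x) \<le> C * NE (\<lambda>x. u x - v x)"
    and seq: "\<And>\<sigma> c. (\<And>j::nat. \<sigma> j \<in> E \<and> NE (\<sigma> j) \<le> c) \<Longrightarrow>
        \<exists>l\<in>F. \<exists>r. strict_mono r \<and> (\<lambda>j. NF (\<lambda>x. T (\<sigma> (r j)) x - l x)) \<longlonglongrightarrow> 0"
  shows "compact_embedding E NE F NF T"
proof -
  let ?X = "seminorm_topology E NE" and ?Y = "seminorm_topology F NF"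
  define d where "d f g = NF (\<lambda>x. f x - g x)" for f g
  have d0: "0 \<le> d f g" "d f f = 0" "d f g = d g f" if "f \<in> F" "g \<in> F" for f g
    using that nonneg refl sym unfolding d_def by auto
  have d3: "d f h \<le> d f g + d g h" if "f \<in> F" "g \<in> F" "h \<in> F" for f g h
    using that tri unfolding d_def by auto
  have opY: "openin ?Y U \<longleftrightarrow> U \<subseteq> F \<and> (\<forall>f\<in>U. \<exists>e>0. \<forall>g\<in>F. d g f < e \<longrightarrow> g \<in> U)" for U
    unfolding openin_seminorm_topology d_def ..
  have ball: "openin ?Y {g \<in> F. d g f < e}" if "f \<in> F" for f e
    unfolding opY
  proof (intro conjI ballI)
    fix g assume "g \<in> {g \<in> F. d g f < e}"
    then have g: "g \<in> F" "d g f < e" by auto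
    show "\<exists>\<delta>>0. \<forall>h\<in>F. d h g < \<delta> \<longrightarrow> h \<in> {g \<in> F. d g f < e}"
    proof (intro exI[of _ "e - d g f"] conjI ballI impI)
      fix h assume "h \<in> F" "d h g < e - d g f"
      then show "h \<in> {g \<in> F. d g f < e}" using d3[of h g f] g that by auto
    qed (use g in auto)
  qed auto
  have cont: "continuous_map ?X ?Y T"
    unfolding continuous_map_def
  proof (intro conjI allI impI)
    show "T \<in> topspace ?X \<rightarrow> topspace ?Y" using T by auto
    fix U assume U: "openin ?Y U"
    show "openin ?X {x \<in> topspace ?X. T x \<in> U}"
      unfolding openin_seminorm_topology topspace_seminorm_topology
    proof (intro conjI ballI)
      fix f assume "f \<in> {x \<in> E. T x \<in> U}"
      then have f: "f \<in> E" "T f \<in> U" by auto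
      then obtain e where e: "e > 0" "\<forall>g\<in>F. d g (T f) < e \<longrightarrow> g \<in> U"
        using U unfolding opY by blast
      show "\<exists>e>0. \<forall>g\<in>E. NE (\<lambda>x. g x - f x) < e \<longrightarrow> g \<in> {x \<in> E. T x \<in> U}"
      proof (intro exI[of _ "e / (\<bar>C\<bar> + 1)"] conjI ballI impI)
        show "0 < e / (\<bar>C\<bar> + 1)" using e by (simp add: add_nonneg_pos)
        fix g assume g: "g \<in> E" and lt: "NE (\<lambda>x. g x - f x) < e / (\<bar>C\<bar> + 1)"
        have "d (T g) (T f) \<le> C * NE (\<lambda>x. g x - f x)"
          unfolding d_def using bound g f by auto
        moreover have "d (T g) (T f) \<ge> 0" using d0 T g f by auto
        \<comment> \<open>\<open>NE\<close> is an arbitrary functional here, so a negative value has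
          to be dealt with. The 1 in the radius \<open>e / (\<bar>C\<bar> + 1)\<close> keeps the
          radius positive for \<open>C = 0\<close>.\<close>
        moreover have "C * NE (\<lambda>x. g x - f x) < e"
        proof (cases "NE (\<lambda>x. g x - f x) \<ge> 0")
          case True
          then have "C * NE (\<lambda>x. g x - f x) \<le> (\<bar>C\<bar> + 1) * NE (\<lambda>x. g x - f x)"
            by (intro mult_right_mono) auto
          also have "\<dots> < e"
            using lt by (simp add: pos_less_divide_eq add_nonneg_pos mult.commute)
          finally show ?thesis .
        next
          case False
          then have "C * NE (\<lambda>x. g x - f x) \<le> 0"
            using C by (intro mult_nonneg_nonpos) auto
          then show ?thesis using e by linarith
        qed
        ultimately have "d (T g) (T f) < e" by linarith
        then show "g \<in> {x \<in> E. T x \<in> U}" using e g T by auto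
      qed
    qed auto
  qed
  have comp: "compactin ?Y (?Y closure_of (T ` B))"
    if B: "B \<subseteq> E" and c: "\<forall>u\<in>B. NE u \<le> c" for B c
  proof -
    \<comment> \<open>The choice depends on \<open>f\<close> only through the predicate, so
      functions at distance 0 receive the same representative; this is
      \<open>rep_eq\<close>.\<close>
    define rep where "rep f = (SOME g. g \<in> F \<and> d f g = 0)" for f
    have rep: "rep f \<in> F" "d f (rep f) = 0" "d (rep f) f = 0" if "f \<in> F" for f
    proof -
      have "\<exists>g. g \<in> F \<and> d f g = 0" using d0 that by blast
      then have "rep f \<in> F \<and> d f (rep f) = 0" unfolding rep_def by (rule someI_ex)
      then show "rep f \<in> F" "d f (rep f) = 0" "d (rep f) f = 0" using d0 that by auto
    qed
    have rep_eq: "rep f = rep g" if "f \<in> F" "g \<in> F" "d f g = 0" for f g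
    proof -
      have "d f h = d g h" if "h \<in> F" for h
        using d3[of f g h] d3[of g f h] d0[of f g] that \<open>f \<in> F\<close> \<open>g \<in> F\<close> \<open>d f g = 0\<close> by auto
      then have "(\<lambda>h. h \<in> F \<and> d f h = 0) = (\<lambda>h. h \<in> F \<and> d g h = 0)" by auto
      then show ?thesis unfolding rep_def by simp
    qed
    have d_rep1: "d (rep f) g = d f g" if "f \<in> F" "g \<in> F" for f g
      using d3[of "rep f" f g] d3[of f "rep f" g] rep[OF that(1)] that by auto
    have d_rep2: "d f (rep g) = d f g" if "f \<in> F" "g \<in> F" for f g
      using d_rep1[OF that(2,1)] d0 rep that by metis
    define R where "R = rep ` F"
    have RF: "R \<subseteq> F" unfolding R_def using rep by auto
    \<comment> \<open>\<open>Metric_space\<close> asks for nonnegativity and symmetry on the whole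
      type, hence the value 0 off \<open>R\<close>.\<close>
    define d' where "d' f g = (if f \<in> R \<and> g \<in> R then d f g else 0)" for f g
    interpret M: Metric_space R d'
    proof
      show "0 \<le> d' f g" "d' f g = d' g f" for f g
        using d0[of f g] RF unfolding d'_def by (auto simp: subset_iff)
      show "d' f g = 0 \<longleftrightarrow> f = g" if "f \<in> R" "g \<in> R" for f g
      proof -
        obtain f' g' where fg: "f' \<in> F" "g' \<in> F" "f = rep f'" "g = rep g'"
          using \<open>f \<in> R\<close> \<open>g \<in> R\<close> unfolding R_def by auto
        have "d f' g' = d f g" using fg d_rep1 d_rep2 rep by metis
        then show ?thesis using that rep_eq[of f' g'] fg d0(2) rep(1) unfolding d'_def by auto
      qed
      show "d' f h \<le> d' f g + d' g h" if "f \<in> R" "g \<in> R" "h \<in> R" for f g h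
        using d3[of f g h] RF that unfolding d'_def by auto
    qed
    have repR: "rep f \<in> R" if "f \<in> F" for f using that unfolding R_def by auto
    have d'_rep: "d' (rep f) g = d f g" if "f \<in> F" "g \<in> R" for f g
      using that RF repR d_rep1 unfolding d'_def by auto
    define S where "S = rep ` T ` B"
    have TB: "T u \<in> F" if "u \<in> B" for u using that B T by auto
    have SR: "S \<subseteq> R" unfolding S_def using TB repR by auto
    define K where "K = ?Y closure_of (T ` B)"
    have KF: "K \<subseteq> F" unfolding K_def using closure_of_subset_topspace[of ?Y] by simp
    \<comment> \<open>Bolzano-Weierstrass form: every infinite subset of \<open>S\<close> needs a
      limit point. An injective sequence in the subset lifts to a sequence in \<open>B\<close>, to
      which \<open>seq\<close> applies.\<close>
    have comp: "compactin M.mtopology (M.mtopology closure_of S)"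
      unfolding M.compact_closure_of_eq_Bolzano_Weierstrass
    proof (intro allI impI)
      fix A assume A: "infinite A \<and> A \<subseteq> S \<and> A \<subseteq> R"
      then obtain a :: "nat \<Rightarrow> 'c \<Rightarrow> 'd" where a: "inj a" "range a \<subseteq> A"
        using infinite_countable_subset by blast
      then have "\<forall>j. \<exists>u\<in>B. a j = rep (T u)" using A unfolding S_def by blast
      then obtain \<sigma> where \<sigma>: "\<And>j. \<sigma> j \<in> B" "\<And>j. a j = rep (T (\<sigma> j))" by metis
      obtain l r where l: "l \<in> F" and r: "strict_mono r"
        and lim: "(\<lambda>j. d (T (\<sigma> (r j))) l) \<longlonglongrightarrow> 0"
        using seq[of \<sigma> c] \<sigma>(1) B c unfolding d_def by blast
      have aj: "d' (rep l) (a (r j)) = d (T (\<sigma> (r j))) l" for j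
        using l TB[OF \<sigma>(1)] unfolding \<sigma>(2)
        by (metis d'_rep repR d_rep2 d0(3) rep(1))
      have "rep l \<in> M.mtopology derived_set_of A"
        unfolding M.metric_derived_set_of
      proof (intro CollectI conjI allI impI)
        show "rep l \<in> R" using l repR by auto
        fix e :: real assume e: "e > 0"
        then obtain J where J: "\<And>j. j \<ge> J \<Longrightarrow> d (T (\<sigma> (r j))) l < e"
          using lim order_tendstoD(2)[OF lim e] unfolding eventually_sequentially by auto
        \<comment> \<open>The sequence is injective, so two successive terms cannot both be
          \<open>rep l\<close>; one of them lies in the punctured ball.\<close>
        have "a (r J) \<noteq> a (r (Suc J))"
          using a(1) strict_monoD[OF r, of J "Suc J"] by (auto dest: injD)
        then obtain j where j: "j \<ge> J" "a (r j) \<noteq> rep l"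
          by (metis le_SucI order_refl)
        show "\<exists>y\<in>A. y \<noteq> rep l \<and> y \<in> M.mball (rep l) e"
          using j J[OF j(1)] aj a(2) A l repR by (intro bexI[of _ "a (r j)"]) (auto simp: subset_iff)
      qed
      then show "M.mtopology derived_set_of A \<noteq> {}" by blast
    qed
    \<comment> \<open>\<open>K1\<close> and \<open>K2\<close> match the closure in the seminorm
      topology with the metric closure of the representatives.\<close>
    have K1: "rep f \<in> M.mtopology closure_of S" if "f \<in> K" for f
      unfolding M.metric_closure_of
    proof (intro CollectI conjI allI impI)
      have f: "f \<in> F" using that KF by auto
      then show "rep f \<in> R" by (rule repR)
      fix e :: real assume e: "e > 0"
      have "f \<in> {g \<in> F. d g f < e}" using f d0 e by auto
      moreover have "openin ?Y {g \<in> F. d g f < e}" by (rule ball[OF f])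
      ultimately have "\<exists>y. y \<in> T ` B \<and> y \<in> {g \<in> F. d g f < e}"
        using that unfolding K_def in_closure_of by (elim conjE allE[of _ "{g \<in> F. d g f < e}"]) simp
      then obtain g where g: "g \<in> T ` B" "d g f < e" by blast
      then have "rep g \<in> S" "g \<in> F" unfolding S_def using TB by auto
      moreover have "d' (rep f) (rep g) < e"
        using g d'_rep[OF f repR[OF \<open>g \<in> F\<close>]] d_rep2[OF f \<open>g \<in> F\<close>] d0(3)[OF f \<open>g \<in> F\<close>] by simp
      ultimately show "\<exists>y\<in>S. y \<in> M.mball (rep f) e"
        using repR f by (intro bexI[of _ "rep g"]) auto
    qed
    have K2: "f \<in> K" if f: "f \<in> M.mtopology closure_of S" for f
      unfolding K_def in_closure_of
    proof (intro conjI allI impI)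
      have fR: "f \<in> R" using f unfolding M.metric_closure_of by auto
      then have fF: "f \<in> F" using RF by auto
      then show "f \<in> topspace ?Y" by simp
      fix U assume U: "f \<in> U \<and> openin ?Y U"
      then obtain e where e: "e > 0" "\<forall>g\<in>F. d g f < e \<longrightarrow> g \<in> U"
        unfolding opY by blast
      obtain y where y: "y \<in> S" "y \<in> M.mball f e"
        using f e(1) unfolding M.metric_closure_of by blast
      then obtain u where u: "u \<in> B" "y = rep (T u)" unfolding S_def by auto
      have "d' y f = d (T u) f" using d'_rep[OF TB[OF u(1)] fR] u by simp
      moreover have "d' f y < e" using y(2) by (simp only: M.in_mball)
      ultimately have "d (T u) f < e" using M.commute[of f y] by simp
      then show "\<exists>y. y \<in> T ` B \<and> y \<in> U" using e TB[OF u(1)] u(1) by blast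
    qed
    show ?thesis
      unfolding compactin_def K_def[symmetric]
    proof (intro conjI allI impI)
      show "K \<subseteq> topspace ?Y" using KF by simp
      fix \<U> assume \<U>: "Ball \<U> (openin ?Y) \<and> K \<subseteq> \<Union>\<U>"
      \<comment> \<open>The trace on \<open>R\<close> of a seminorm-open set is open for the metric,
        so a cover of \<open>K\<close> induces a cover of the metric closure of \<open>S\<close>. A
        finite subcover catches \<open>rep f\<close>, and with it \<open>f\<close>.\<close>
      have op: "openin M.mtopology (U \<inter> R)" if "U \<in> \<U>" for U
        unfolding M.openin_mtopology
      proof (intro conjI allI impI)
        fix x assume x: "x \<in> U \<inter> R"
        moreover have "openin ?Y U" using \<U> that by blast
        ultimately obtain e where e: "e > 0" "\<forall>g\<in>F. d g x < e \<longrightarrow> g \<in> U"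
          unfolding opY by blast
        have "M.mball x e \<subseteq> U \<inter> R"
        proof
          fix y assume y: "y \<in> M.mball x e"
          then have yR: "y \<in> R" by auto
          have "d y x = d' x y" using x yR RF d0(3)[of x y] unfolding d'_def by (simp add: subset_iff)
          then show "y \<in> U \<inter> R" using e y yR RF by auto
        qed
        then show "\<exists>r>0. M.mball x r \<subseteq> U \<inter> R" using e by blast
      qed auto
      have "M.mtopology closure_of S \<subseteq> \<Union>((\<lambda>U. U \<inter> R) ` \<U>)"
      proof
        fix f assume f: "f \<in> M.mtopology closure_of S"
        then have "f \<in> \<Union>\<U>" using K2 \<U> by blast
        moreover have "f \<in> R" using f unfolding M.metric_closure_of by blast
        ultimately show "f \<in> \<Union>((\<lambda>U. U \<inter> R) ` \<U>)" by blast
      qed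
      moreover have "\<forall>V \<in> (\<lambda>U. U \<inter> R) ` \<U>. openin M.mtopology V" using op by blast
      ultimately obtain \<W> where \<W>: "finite \<W>" "\<W> \<subseteq> (\<lambda>U. U \<inter> R) ` \<U>" "M.mtopology closure_of S \<subseteq> \<Union>\<W>"
        using comp unfolding compactin_def by metis
      then obtain \<V> where \<V>: "finite \<V>" "\<V> \<subseteq> \<U>" "\<W> = (\<lambda>U. U \<inter> R) ` \<V>"
        by (meson finite_subset_image)
      have "K \<subseteq> \<Union>\<V>"
      proof
        fix f assume f: "f \<in> K"
        then have fF: "f \<in> F" using KF by auto
        obtain U where U: "U \<in> \<V>" "rep f \<in> U" using K1[OF f] \<W>(3) \<V>(3) by blast
        moreover have "openin ?Y U" using \<U> \<V>(2) U(1) by blast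
        ultimately obtain e where e: "e > 0" "\<forall>g\<in>F. d g (rep f) < e \<longrightarrow> g \<in> U"
          unfolding opY by blast
        then show "f \<in> \<Union>\<V>" using rep(2)[OF fF] fF U(1) by auto
      qed
      then show "\<exists>\<F>. finite \<F> \<and> \<F> \<subseteq> \<U> \<and> K \<subseteq> \<Union>\<F>" using \<V> by blast
    qed
  qed
  show ?thesis
    unfolding compact_embedding_def using cont comp by blast
qed

section \<open>Gaussian integrals\<close>

lemma nn_integral_lborel_affine:
  fixes t :: "'a::euclidean_space"
  assumes [measurable]: "f \<in> borel_measurable borel" and c: "c \<noteq> 0"
  shows "(\<integral>\<^sup>+x. f x \<partial>lborel) = ennreal (\<bar>c\<bar> ^ DIM('a)) * (\<integral>\<^sup>+x. f (t + c *\<^sub>R x) \<partial>lborel)"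
  by (subst lborel_affine[OF c, of t])
    (simp add: nn_integral_density nn_integral_distr nn_integral_cmult)

lemma integral_lborel_affine:
  fixes t :: "'a::euclidean_space" and f :: "'a \<Rightarrow> 'b::{banach, second_countable_topology}"
  assumes [measurable]: "f \<in> borel_measurable borel" and c: "c \<noteq> 0"
  shows "(LINT x|lborel. f x) = (\<bar>c\<bar> ^ DIM('a)) *\<^sub>R (LINT x|lborel. f (t + c *\<^sub>R x))"
  by (subst lborel_affine[OF c, of t])
    (simp add: integral_density integral_distr)

lemma integrable_lborel_affine_iff:
  fixes t :: "'a::euclidean_space" and f :: "'a \<Rightarrow> 'b::{banach, second_countable_topology}"
  assumes [measurable]: "f \<in> borel_measurable borel" and c: "c \<noteq> 0"
  shows "integrable lborel (\<lambda>x. f (t + c *\<^sub>R x)) \<longleftrightarrow> integrable lborel f"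
proof -
  have "integrable lborel f \<longleftrightarrow> integrable lborel (\<lambda>x. \<bar>c\<bar> ^ DIM('a) *\<^sub>R f (t + c *\<^sub>R x))"
    by (subst lborel_affine[OF c, of t]) (simp add: integrable_density integrable_distr_eq)
  also have "\<dots> \<longleftrightarrow> integrable lborel (\<lambda>x. f (t + c *\<^sub>R x))"
  proof
    assume "integrable lborel (\<lambda>x. \<bar>c\<bar> ^ DIM('a) *\<^sub>R f (t + c *\<^sub>R x))"
    then have "integrable lborel (\<lambda>x. inverse (\<bar>c\<bar> ^ DIM('a)) *\<^sub>R (\<bar>c\<bar> ^ DIM('a)) *\<^sub>R f (t + c *\<^sub>R x))"
      by (rule integrable_scaleR_right)
    then show "integrable lborel (\<lambda>x. f (t + c *\<^sub>R x))" using c by simp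
  qed (rule integrable_scaleR_right)
  finally show ?thesis by simp
qed

text \<open>Fubini in \<open>v\<close> and \<open>t\<close>: for fixed \<open>t \<ge> 0\<close> the
  admissible points \<open>v\<close> form the ball of radius \<open>sqrt t\<close>. Radial integrals
  thus become half-line integrals of Gamma type.\<close>

lemma nn_integral_layer_cake_norm_sq:
  fixes g :: "real \<Rightarrow> real"
  assumes [measurable]: "g \<in> borel_measurable borel" and g: "\<And>t. 0 \<le> g t"
  shows "(\<integral>\<^sup>+v. (\<integral>\<^sup>+t. ennreal (g t) * indicator {(norm (v::'a::euclidean_space))\<^sup>2..} t \<partial>lborel) \<partial>lborel)
     = (\<integral>\<^sup>+t. ennreal (indicator {0..} t * (g t * (unit_ball_vol (real DIM('a)) * t powr (real DIM('a) / 2)))) \<partial>lborel)"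
proof -
  have "(\<integral>\<^sup>+v. (\<integral>\<^sup>+t. ennreal (g t) * indicator {(norm (v::'a))\<^sup>2..} t \<partial>lborel) \<partial>lborel)
     = (\<integral>\<^sup>+v. (\<integral>\<^sup>+t. ennreal (g t) * indicator {z. (norm (fst z::'a))\<^sup>2 \<le> snd z} (v, t) \<partial>lborel) \<partial>lborel)"
    by (intro nn_integral_cong) (auto split: split_indicator)
  also have "\<dots> = (\<integral>\<^sup>+t. (\<integral>\<^sup>+v. ennreal (g t) * indicator {z. (norm (fst z::'a))\<^sup>2 \<le> snd z} (v, t) \<partial>lborel) \<partial>lborel)"
    by (rule lborel_pair.Fubini'[symmetric]) measurable
  also have "\<dots> = (\<integral>\<^sup>+t. ennreal (indicator {0..} t * (g t * (unit_ball_vol (real DIM('a)) * t powr (real DIM('a) / 2)))) \<partial>lborel)"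
  proof (intro nn_integral_cong)
    fix t :: real
    have "(\<integral>\<^sup>+v. ennreal (g t) * indicator {z. (norm (fst z::'a))\<^sup>2 \<le> snd z} (v, t) \<partial>lborel)
        = (\<integral>\<^sup>+v. ennreal (g t) * indicator {v::'a. (norm v)\<^sup>2 \<le> t} v \<partial>lborel)"
      by (intro nn_integral_cong) (auto split: split_indicator)
    also have "\<dots> = ennreal (g t) * emeasure lborel {v::'a. (norm v)\<^sup>2 \<le> t}"
      by (subst nn_integral_cmult_indicator) auto
    also have "\<dots> = ennreal (indicator {0..} t * (g t * (unit_ball_vol (real DIM('a)) * t powr (real DIM('a) / 2))))"
    proof (cases "t \<ge> 0")
      case True
      have "{v::'a. (norm v)\<^sup>2 \<le> t} = cball 0 (sqrt t)"
      proof (auto simp: real_le_rsqrt)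
        fix v :: 'a assume "norm v \<le> sqrt t"
        then show "(norm v)\<^sup>2 \<le> t" using True power_mono[of "norm v" "sqrt t" 2] by simp
      qed
      moreover have "sqrt t ^ DIM('a) = t powr (real DIM('a) / 2)"
        using True by (cases "t = 0") (simp_all add: powr_half_sqrt[symmetric] powr_powr powr_realpow[symmetric])
      ultimately show ?thesis
        using True g by (simp add: emeasure_cball ennreal_mult)
    next
      case False
      then have "{v::'a. (norm v)\<^sup>2 \<le> t} = {}" by (auto simp: not_le intro: less_le_trans[OF _ zero_le_power2])
      then show ?thesis using False by simp
    qed
    finally show "(\<integral>\<^sup>+v. ennreal (g t) * indicator {z. (norm (fst z::'a))\<^sup>2 \<le> snd z} (v, t) \<partial>lborel)
      = ennreal (indicator {0..} t * (g t * (unit_ball_vol (real DIM('a)) * t powr (real DIM('a) / 2))))" .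
  qed
  finally show ?thesis .
qed

lemma nn_integral_exp_norm_sq:
  "(\<integral>\<^sup>+v. ennreal (exp (- (norm (v::'a::euclidean_space))\<^sup>2)) \<partial>lborel)
    = ennreal (unit_ball_vol (real DIM('a)) * Gamma (real DIM('a) / 2 + 1))"
proof -
  \<comment> \<open>The value \<open>exp (- m)\<close> is the tail mass beyond \<open>m\<close> of
    the density \<open>exp (- t)\<close>, which is the layer-cake form.\<close>
  have *: "ennreal (exp (- m)) = (\<integral>\<^sup>+t. ennreal (exp (- t)) * indicator {m..} t \<partial>lborel)" for m :: real
  proof -
    have "((\<lambda>x::real. - exp (- x)) \<longlongrightarrow> - 0) at_top"
      by (intro tendsto_minus filterlim_compose[OF exp_at_bot] filterlim_uminus_at_bot_at_top)
    then show ?thesis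
      by (subst nn_integral_FTC_atLeast[where F="\<lambda>x. - exp (- x)" and T=0])
        (auto intro!: derivative_eq_intros)
  qed
  have "(\<integral>\<^sup>+v. ennreal (exp (- (norm (v::'a))\<^sup>2)) \<partial>lborel)
    = (\<integral>\<^sup>+v. (\<integral>\<^sup>+t. ennreal (exp (- t)) * indicator {(norm (v::'a))\<^sup>2..} t \<partial>lborel) \<partial>lborel)"
    by (intro nn_integral_cong *)
  also have "\<dots> = (\<integral>\<^sup>+t. ennreal (indicator {0..} t * (exp (- t) * (unit_ball_vol (real DIM('a)) * t powr (real DIM('a) / 2)))) \<partial>lborel)"
    by (rule nn_integral_layer_cake_norm_sq) auto
  also have "\<dots> = (\<integral>\<^sup>+t. ennreal (unit_ball_vol (real DIM('a))) * ennreal (indicator {0..} t * t powr ((real DIM('a) / 2 + 1) - 1) / exp t) \<partial>lborel)"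
    by (intro nn_integral_cong)
      (simp add: ennreal_mult'[symmetric] exp_minus field_simps split: split_indicator)
  also have "\<dots> = ennreal (unit_ball_vol (real DIM('a))) * ennreal (Gamma (real DIM('a) / 2 + 1))"
    by (subst nn_integral_cmult) (auto simp: Gamma_conv_nn_integral_real add_nonneg_pos)
  finally show ?thesis by (simp add: ennreal_mult')
qed

text \<open>The density \<open>t * exp (- t)\<close> has the tail
  \<open>(1 + m) * exp (- m)\<close>. This is why the second moment is computed together with the
  mass and separated by subtraction afterwards.\<close>

lemma nn_integral_one_plus_norm_sq_exp_norm_sq:
  "(\<integral>\<^sup>+v. ennreal ((1 + (norm v)\<^sup>2) * exp (- (norm (v::'a::euclidean_space))\<^sup>2)) \<partial>lborel)
    = ennreal (unit_ball_vol (real DIM('a)) * Gamma (real DIM('a) / 2 + 2))"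
proof -
  have "ennreal ((1 + m) * exp (- m)) = (\<integral>\<^sup>+t. ennreal (max 0 t * exp (- t)) * indicator {m..} t \<partial>lborel)" if "0 \<le> m" for m :: real
  proof -
    have "(\<integral>\<^sup>+t. ennreal (max 0 t * exp (- t)) * indicator {m..} t \<partial>lborel) = ennreal (0 - (- ((1 + m) * exp (- m))))"
    proof (rule nn_integral_FTC_atLeast)
      show "((\<lambda>x::real. - ((1 + x) * exp (- x))) \<longlongrightarrow> 0) at_top" by real_asymp
      fix x assume "m \<le> x"
      then have "max 0 x = x" using that by simp
      then show "((\<lambda>x. - ((1 + x) * exp (- x))) has_real_derivative max 0 x * exp (- x)) (at x)"
        by (auto intro!: derivative_eq_intros simp: algebra_simps)
    qed auto
    then show ?thesis by simp
  qed
  then have "(\<integral>\<^sup>+v. ennreal ((1 + (norm v)\<^sup>2) * exp (- (norm (v::'a))\<^sup>2)) \<partial>lborel)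
    = (\<integral>\<^sup>+v. (\<integral>\<^sup>+t. ennreal (max 0 t * exp (- t)) * indicator {(norm (v::'a))\<^sup>2..} t \<partial>lborel) \<partial>lborel)" by simp
  also have "\<dots> = (\<integral>\<^sup>+t. ennreal (indicator {0..} t * (max 0 t * exp (- t) * (unit_ball_vol (real DIM('a)) * t powr (real DIM('a) / 2)))) \<partial>lborel)"
    by (rule nn_integral_layer_cake_norm_sq) auto
  also have "\<dots> = (\<integral>\<^sup>+t. ennreal (unit_ball_vol (real DIM('a))) * ennreal (indicator {0..} t * t powr ((real DIM('a) / 2 + 2) - 1) / exp t) \<partial>lborel)"
  proof (intro nn_integral_cong)
    fix t :: real
    have "t * t powr (real DIM('a) / 2) = t powr (real DIM('a) / 2 + 1)" if "t \<ge> 0"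
      using that by (cases "t = 0") (simp_all add: powr_add)
    then show "ennreal (indicator {0..} t * (max 0 t * exp (- t) * (unit_ball_vol (real DIM('a)) * t powr (real DIM('a) / 2))))
      = ennreal (unit_ball_vol (real DIM('a))) * ennreal (indicator {0..} t * t powr ((real DIM('a) / 2 + 2) - 1) / exp t)"
      by (simp add: ennreal_mult'[symmetric] exp_minus field_simps split: split_indicator)
  qed
  also have "\<dots> = ennreal (unit_ball_vol (real DIM('a))) * ennreal (Gamma (real DIM('a) / 2 + 2))"
    by (subst nn_integral_cmult) (auto simp: Gamma_conv_nn_integral_real add_nonneg_pos)
  finally show ?thesis by (simp add: ennreal_mult')
qed

text \<open>By the formula for the volume of the unit ball this number is
  \<open>pi powr (n / 2)\<close>. The product is the form in which the layer-cake computation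
  returns it.\<close>

definition gauss_mass :: "'a::euclidean_space itself \<Rightarrow> real" where
  "gauss_mass _ = unit_ball_vol (real DIM('a)) * Gamma (real DIM('a) / 2 + 1)"

lemma gauss_mass_pos: "gauss_mass TYPE('a::euclidean_space) > 0"
  unfolding gauss_mass_def by (simp add: add_nonneg_pos)

lemma has_bochner_integral_exp_norm_sq:
  "has_bochner_integral lborel (\<lambda>v::'a::euclidean_space. exp (- (norm v)\<^sup>2)) (gauss_mass TYPE('a))"
  by (rule has_bochner_integral_nn_integral)
    (use gauss_mass_pos[where 'a='a] in \<open>auto simp: nn_integral_exp_norm_sq gauss_mass_def\<close>)

lemma has_bochner_integral_norm_sq_exp_norm_sq:
  "has_bochner_integral lborel (\<lambda>v::'a::euclidean_space. (norm v)\<^sup>2 * exp (- (norm v)\<^sup>2))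
     (real DIM('a) / 2 * gauss_mass TYPE('a))"
proof -
  let ?n = "real DIM('a)"
  have "has_bochner_integral lborel (\<lambda>v::'a. (1 + (norm v)\<^sup>2) * exp (- (norm v)\<^sup>2))
      (unit_ball_vol ?n * Gamma (?n / 2 + 2))"
  proof (rule has_bochner_integral_nn_integral)
    have "Gamma (?n / 2 + 2) > 0" by (intro Gamma_real_pos) (simp add: add_nonneg_pos)
    then show "0 \<le> unit_ball_vol ?n * Gamma (?n / 2 + 2)" by simp
    show "(\<integral>\<^sup>+v. ennreal ((1 + (norm v)\<^sup>2) * exp (- (norm (v::'a))\<^sup>2)) \<partial>lborel)
      = ennreal (unit_ball_vol ?n * Gamma (?n / 2 + 2))"
      by (rule nn_integral_one_plus_norm_sq_exp_norm_sq)
  qed auto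
  from has_bochner_integral_diff[OF this has_bochner_integral_exp_norm_sq]
  have "has_bochner_integral lborel (\<lambda>v::'a. (norm v)\<^sup>2 * exp (- (norm v)\<^sup>2))
      (unit_ball_vol ?n * Gamma (?n / 2 + 2) - gauss_mass TYPE('a))"
    by (simp add: algebra_simps)
  also have "Gamma (?n / 2 + 2) = (?n / 2 + 1) * Gamma (?n / 2 + 1)"
  proof -
    have "?n / 2 + 1 > 0" by (simp add: add_nonneg_pos)
    then have "?n / 2 + 1 \<notin> \<int>\<^sub>\<le>\<^sub>0" by (auto elim!: nonpos_Ints_cases)
    then show ?thesis using Gamma_plus1[of "?n / 2 + 1"] by (simp add: add.assoc)
  qed
  finally show ?thesis unfolding gauss_mass_def by (simp add: algebra_simps)
qed

lemma has_bochner_integral_lborel_affine: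
  fixes t :: "'a::euclidean_space" and f :: "'a \<Rightarrow> 'b::{banach, second_countable_topology}"
  assumes f: "f \<in> borel_measurable borel" and c: "c \<noteq> 0"
    and h: "has_bochner_integral lborel (\<lambda>x. f (t + c *\<^sub>R x)) I"
  shows "has_bochner_integral lborel f (\<bar>c\<bar> ^ DIM('a) *\<^sub>R I)"
  using integrable_lborel_affine_iff[OF f c, of t] integral_lborel_affine[OF f c, of t] h
  by (simp add: has_bochner_integral_iff)

text \<open>Reflection changes the sign of the integral. Non-integrable functions are covered too,
  since their integral is 0 by convention.\<close>

lemma integral_lborel_odd:
  fixes f :: "'a::euclidean_space \<Rightarrow> 'b::{banach, second_countable_topology}"
  assumes f: "f \<in> borel_measurable borel" and odd: "\<And>x. f (- x) = - f x"
  shows "(LINT x|lborel. f x) = 0"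
proof -
  have "(LINT x|lborel. f x) = (LINT x|lborel. f (- x))"
    using integral_lborel_affine[OF f, of "-1" 0] by simp
  also have "\<dots> = - (LINT x|lborel. f x)" by (simp add: odd)
  finally have "2 *\<^sub>R (LINT x|lborel. f x) = 0" by (simp add: scaleR_2 eq_neg_iff_add_eq_0)
  then show ?thesis by simp
qed

text \<open>\<open>gauss\<close> is the heat kernel at time \<open>r / 4\<close> without its normalising constant, \<open>gauss_vec\<close> is
  \<open>- 1 / 2\<close> times its gradient and \<open>gauss_dt\<close> its derivative in \<open>r\<close>.\<close>

definition gauss :: "real \<Rightarrow> 'a::euclidean_space \<Rightarrow> real" where
  "gauss r z = r powr (- real DIM('a) / 2) * exp (- (norm z)\<^sup>2 / r)"

definition gauss_vec :: "real \<Rightarrow> 'a::euclidean_space \<Rightarrow> 'a" where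
  "gauss_vec r z = (gauss r z / r) *\<^sub>R z"

definition gauss_dt :: "real \<Rightarrow> 'a::euclidean_space \<Rightarrow> real" where
  "gauss_dt r z = ((norm z)\<^sup>2 / r\<^sup>2 - real DIM('a) / (2 * r)) * gauss r z"

lemma gauss_measurable [measurable]: "gauss r \<in> borel_measurable borel"
  unfolding gauss_def by measurable

lemma gauss_measurable2 [measurable (raw)]:
  assumes [measurable]: "f \<in> borel_measurable M" "g \<in> borel_measurable M"
  shows "(\<lambda>x. gauss (f x) (g x)) \<in> borel_measurable M"
  unfolding gauss_def by measurable

lemma gauss_vec_measurable2 [measurable (raw)]:
  assumes [measurable]: "f \<in> borel_measurable M" "g \<in> borel_measurable M"
  shows "(\<lambda>x. gauss_vec (f x) (g x)) \<in> borel_measurable M"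
  unfolding gauss_vec_def by measurable

lemma gauss_dt_measurable2 [measurable (raw)]:
  assumes [measurable]: "f \<in> borel_measurable M" "g \<in> borel_measurable M"
  shows "(\<lambda>x. gauss_dt (f x) (g x)) \<in> borel_measurable M"
  unfolding gauss_dt_def by measurable

lemma gauss_nonneg [simp]: "0 \<le> gauss r z"
  unfolding gauss_def by simp

lemma gauss_minus [simp]: "gauss r (- z) = gauss r z"
  unfolding gauss_def by simp

lemma gauss_vec_minus [simp]: "gauss_vec r (- z) = - gauss_vec r z"
  unfolding gauss_vec_def by simp

lemma gauss_le: "r > 0 \<Longrightarrow> gauss r (z::'a::euclidean_space) \<le> r powr (- real DIM('a) / 2)"
  unfolding gauss_def by (simp add: mult_le_cancel_left1)

lemma gauss_wide_le:
  fixes z :: "'a::euclidean_space"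
  assumes r: "r > 0" and c: "1 \<le> c"
  shows "gauss (c * r) z \<le> r powr (- real DIM('a) / 2)"
proof -
  have "gauss (c * r) z \<le> (c * r) powr (- real DIM('a) / 2)" using r c by (intro gauss_le) auto
  also have "\<dots> \<le> r powr (- real DIM('a) / 2)"
    using r c powr_mono2'[of "- real DIM('a) / 2" r "c * r"] by (simp add: mult_le_cancel_right1)
  finally show ?thesis .
qed

lemma sqrt_power_DIM:
  assumes "r > 0" shows "sqrt r ^ n * r powr (- real n / 2) = 1"
proof -
  have "sqrt r ^ n = r powr (real n / 2)"
    using assms by (simp add: powr_half_sqrt[symmetric] powr_powr powr_realpow[symmetric])
  then show ?thesis using assms by (simp add: powr_add[symmetric])
qed

lemma has_bochner_integral_gauss:
  assumes r: "r > 0"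
  shows "has_bochner_integral lborel (gauss r :: 'a::euclidean_space \<Rightarrow> real) (gauss_mass TYPE('a))"
proof -
  have eq: "gauss r (0 + sqrt r *\<^sub>R v) = r powr (- real DIM('a) / 2) * exp (- (norm v)\<^sup>2)" for v :: 'a
    using r unfolding gauss_def by (simp add: power_mult_distrib)
  have h: "has_bochner_integral lborel (\<lambda>v::'a. gauss r (0 + sqrt r *\<^sub>R v)) (r powr (- real DIM('a) / 2) * gauss_mass TYPE('a))"
    unfolding eq by (intro has_bochner_integral_mult_right has_bochner_integral_exp_norm_sq)
  have "sqrt r \<noteq> 0" using r by simp
  from has_bochner_integral_lborel_affine[OF gauss_measurable this h]
  show ?thesis using sqrt_power_DIM[OF r, of "DIM('a)"] r by (simp add: mult.assoc[symmetric])
qed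

lemma has_bochner_integral_norm_sq_gauss:
  assumes r: "r > 0"
  shows "has_bochner_integral lborel (\<lambda>z::'a::euclidean_space. (norm z)\<^sup>2 * gauss r z)
    (r * (real DIM('a) / 2) * gauss_mass TYPE('a))"
proof -
  let ?f = "\<lambda>z::'a. (norm z)\<^sup>2 * gauss r z"
  have eq: "?f (0 + sqrt r *\<^sub>R v) = (r * r powr (- real DIM('a) / 2)) * ((norm v)\<^sup>2 * exp (- (norm v)\<^sup>2))" for v :: 'a
    using r unfolding gauss_def by (simp add: power_mult_distrib)
  have h: "has_bochner_integral lborel (\<lambda>v. ?f (0 + sqrt r *\<^sub>R v))
      ((r * r powr (- real DIM('a) / 2)) * (real DIM('a) / 2 * gauss_mass TYPE('a)))"
    unfolding eq by (intro has_bochner_integral_mult_right has_bochner_integral_norm_sq_exp_norm_sq)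
  have s: "sqrt r \<noteq> 0" and f: "?f \<in> borel_measurable borel" using r by auto
  from has_bochner_integral_lborel_affine[OF f s h]
  show ?thesis using sqrt_power_DIM[OF r, of "DIM('a)"] r
    by (simp add: mult.assoc[symmetric] mult.commute[of _ r]) (simp add: mult.assoc)
qed

lemma integrable_gauss [simp]: "r > 0 \<Longrightarrow> integrable lborel (gauss r :: 'a::euclidean_space \<Rightarrow> real)"
  using has_bochner_integral_gauss by (auto simp: has_bochner_integral_iff)

lemma integral_gauss: "r > 0 \<Longrightarrow> (LINT z|lborel. gauss r (z::'a::euclidean_space)) = gauss_mass TYPE('a)"
  using has_bochner_integral_gauss by (auto simp: has_bochner_integral_iff)

lemma nn_integral_gauss: "r > 0 \<Longrightarrow> (\<integral>\<^sup>+z. ennreal (gauss r (z::'a::euclidean_space)) \<partial>lborel) = ennreal (gauss_mass TYPE('a))"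
  by (simp add: nn_integral_eq_integral integral_gauss)

lemma nn_integral_gauss_shift:
  "r > 0 \<Longrightarrow> (\<integral>\<^sup>+z. ennreal (gauss r (x - z :: 'a::euclidean_space)) \<partial>lborel) = ennreal (gauss_mass TYPE('a))"
  using nn_integral_lborel_affine[of "\<lambda>z. ennreal (gauss r z)" "-1" x] nn_integral_gauss[of r, where 'a='a] by simp

section \<open>Pointwise bounds of the kernels by wider Gaussians\<close>

lemma power_exp_le:
  fixes x :: real
  assumes x: "0 \<le> x" and k: "k \<le> 3"
  shows "x ^ k * exp (- x\<^sup>2) \<le> 32 * exp (- x\<^sup>2 / 2)"
proof -
  have x4: "x ^ k \<le> 1 + x ^ 4"
  proof (cases "x \<le> 1")
    case True
    then have "x ^ k \<le> 1" using x by (simp add: power_le_one)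
    then show ?thesis using x by (simp add: add_increasing2)
  next
    case False
    then have "x ^ k \<le> x ^ 4" using k by (intro power_increasing) auto
    then show ?thesis by simp
  qed
  have "1 + x\<^sup>2 / 2 + (x\<^sup>2 / 2)\<^sup>2 / 2 \<le> exp (x\<^sup>2 / 2)"
    by (rule exp_lower_Taylor_quadratic) simp
  moreover have "(x\<^sup>2 / 2)\<^sup>2 / 2 = x ^ 4 / 8" by (simp add: power_divide power_mult[symmetric])
  ultimately have "1 + x ^ 4 / 8 \<le> exp (x\<^sup>2 / 2)" using zero_le_power2[of x] by linarith
  \<comment> \<open>The term \<open>x ^ 4 / 8\<close> of the Taylor bound makes
    \<open>1 + x ^ 4\<close> at most 8 times the exponential, so 32 leaves room.\<close>
  then have "x ^ k \<le> 32 * exp (x\<^sup>2 / 2)" using x4 zero_le_power[OF x, of 4] by linarith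
  then have "x ^ k * exp (- x\<^sup>2) \<le> 32 * exp (x\<^sup>2 / 2) * exp (- x\<^sup>2)"
    by (intro mult_right_mono) auto
  also have "\<dots> = 32 * exp (- x\<^sup>2 / 2)" by (simp add: exp_add[symmetric])
  finally show ?thesis .
qed

text \<open>Half of the exponent absorbs up to three powers of the norm, at the cost of the factor 32. The
  power of 2 renormalises the wider Gaussian.\<close>

definition gauss_bd :: "'a::euclidean_space itself \<Rightarrow> real" where
  "gauss_bd _ = 32 * 2 powr (real DIM('a) / 2)"

lemma gauss_bd_pos: "gauss_bd TYPE('a::euclidean_space) > 0"
  unfolding gauss_bd_def by simp

lemma norm_power_gauss_le:
  fixes z :: "'a::euclidean_space"
  assumes r: "r > 0" and k: "k \<le> 3"
  shows "norm z ^ k * gauss r z \<le> gauss_bd TYPE('a) * r powr (real k / 2) * gauss (2 * r) z"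
proof -
  define x where "x = norm z / sqrt r"
  have x: "x \<ge> 0" "norm z = x * sqrt r" using r unfolding x_def by auto
  have rk: "sqrt r ^ k = r powr (real k / 2)"
    using r by (simp add: powr_half_sqrt[symmetric] powr_powr powr_realpow[symmetric])
  have x2: "(norm z)\<^sup>2 = x\<^sup>2 * r" using r x by (simp add: power_mult_distrib)
  have "norm z ^ k * gauss r z = r powr (real k / 2) * r powr (- real DIM('a) / 2) * (x ^ k * exp (- x\<^sup>2))"
    unfolding gauss_def x2 using r x(2) rk by (simp add: power_mult_distrib)
  also have "\<dots> \<le> r powr (real k / 2) * r powr (- real DIM('a) / 2) * (32 * exp (- x\<^sup>2 / 2))"
    by (intro mult_left_mono power_exp_le x k) auto
  also have "\<dots> = gauss_bd TYPE('a) * r powr (real k / 2) * gauss (2 * r) z"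
    unfolding gauss_def gauss_bd_def x2 using r by (simp add: powr_mult powr_minus field_simps)
  finally show ?thesis .
qed

lemma norm_gauss_vec: "r > 0 \<Longrightarrow> norm (gauss_vec r z) = norm z * gauss r z / r"
  unfolding gauss_vec_def by simp

lemma norm_gauss_vec_le:
  fixes z :: "'a::euclidean_space"
  assumes r: "r > 0"
  shows "norm (gauss_vec r z) \<le> gauss_bd TYPE('a) * r powr (- 1 / 2) * gauss (2 * r) z"
proof -
  have "norm z * gauss r z / r \<le> gauss_bd TYPE('a) * r powr (1 / 2) * gauss (2 * r) z / r"
    using norm_power_gauss_le[OF r, of 1 z] r by (intro divide_right_mono) auto
  also have "\<dots> = gauss_bd TYPE('a) * r powr (- 1 / 2) * gauss (2 * r) z"
    using r powr_add[of r "-1/2" 1] by (simp add: field_simps)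
  finally show ?thesis using r by (simp add: norm_gauss_vec)
qed

lemma norm_gauss_vec_le_sup:
  fixes z :: "'a::euclidean_space"
  assumes r: "r > 0"
  shows "norm (gauss_vec r z) \<le> gauss_bd TYPE('a) * r powr (- 1 / 2 - real DIM('a) / 2)"
proof -
  have "gauss (2 * r) z \<le> r powr (- real DIM('a) / 2)" using r by (intro gauss_wide_le) auto
  then have "gauss_bd TYPE('a) * r powr (- 1 / 2) * gauss (2 * r) z
    \<le> gauss_bd TYPE('a) * r powr (- 1 / 2) * r powr (- real DIM('a) / 2)"
    using gauss_bd_pos[where 'a='a] by (intro mult_left_mono) auto
  also have "\<dots> = gauss_bd TYPE('a) * r powr (- 1 / 2 - real DIM('a) / 2)"
    by (simp add: powr_diff[symmetric] mult.assoc powr_add[symmetric])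
  finally show ?thesis using norm_gauss_vec_le[OF r, of z] by linarith
qed

lemma norm_mult_gauss_vec_le:
  fixes z :: "'a::euclidean_space"
  assumes r: "r > 0"
  shows "norm z * norm (gauss_vec r z) \<le> gauss_bd TYPE('a) * gauss (2 * r) z"
  using norm_power_gauss_le[OF r, of 2 z] r
  by (simp add: norm_gauss_vec power2_eq_square field_simps)

text \<open>The weighted version is for Lipschitz functions: the factor \<open>norm z\<close> from
  an increment improves \<open>1 / r\<close> to \<open>r powr (- 1 / 2)\<close>, which is integrable
  at 0. It consumes the third power of the norm, the largest one that
  \<open>norm_power_gauss_le\<close> provides.\<close>

lemma abs_gauss_dt_le:
  fixes z :: "'a::euclidean_space"
  assumes r: "r > 0"
  shows "\<bar>gauss_dt r z\<bar> \<le> (1 + real DIM('a)) * gauss_bd TYPE('a) / r * gauss (2 * r) z"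
    and "norm z * \<bar>gauss_dt r z\<bar> \<le> (1 + real DIM('a)) * gauss_bd TYPE('a) * r powr (- 1 / 2) * gauss (2 * r) z"
proof -
  let ?n = "real DIM('a)" and ?B = "gauss_bd TYPE('a)"
  have a: "\<bar>gauss_dt r z\<bar> \<le> ((norm z)\<^sup>2 * gauss r z) / r\<^sup>2 + ?n * gauss r z / r"
  proof -
    have "\<bar>(norm z)\<^sup>2 / r\<^sup>2 - ?n / (2 * r)\<bar> \<le> (norm z)\<^sup>2 / r\<^sup>2 + ?n / r"
    proof -
      have "0 \<le> (norm z)\<^sup>2 / r\<^sup>2" "0 \<le> ?n / (2 * r)" "?n / (2 * r) \<le> ?n / r"
        using r by (auto simp: field_simps)
      then show ?thesis by linarith
    qed
    then have "\<bar>gauss_dt r z\<bar> \<le> ((norm z)\<^sup>2 / r\<^sup>2 + ?n / r) * gauss r z"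
      unfolding gauss_dt_def abs_mult by (simp add: mult_right_mono)
    then show ?thesis by (simp add: algebra_simps)
  qed
  have k0: "gauss r z \<le> ?B * gauss (2 * r) z"
    and k1: "norm z * gauss r z \<le> ?B * r powr (1 / 2) * gauss (2 * r) z"
    and k2: "(norm z)\<^sup>2 * gauss r z \<le> ?B * r * gauss (2 * r) z"
    and k3: "norm z ^ 3 * gauss r z \<le> ?B * r powr (3 / 2) * gauss (2 * r) z"
    using norm_power_gauss_le[OF r, of 0 z] norm_power_gauss_le[OF r, of 1 z]
      norm_power_gauss_le[OF r, of 2 z] norm_power_gauss_le[OF r, of 3 z] r by auto
  have "\<bar>gauss_dt r z\<bar> \<le> (?B * r * gauss (2 * r) z) / r\<^sup>2 + ?n * (?B * gauss (2 * r) z) / r"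
    using a k0 k2 r
    by (intro order.trans[OF a] add_mono divide_right_mono mult_left_mono) auto
  also have "\<dots> = (1 + ?n) * ?B / r * gauss (2 * r) z"
    using r by (simp add: field_simps power2_eq_square)
  finally show "\<bar>gauss_dt r z\<bar> \<le> (1 + ?n) * ?B / r * gauss (2 * r) z" .
  have "norm z * \<bar>gauss_dt r z\<bar> \<le> norm z * (((norm z)\<^sup>2 * gauss r z) / r\<^sup>2 + ?n * gauss r z / r)"
    by (intro mult_left_mono a) auto
  also have "\<dots> = (norm z ^ 3 * gauss r z) / r\<^sup>2 + ?n * (norm z * gauss r z) / r"
    by (simp add: algebra_simps power2_eq_square power3_eq_cube)
  also have "\<dots> \<le> (?B * r powr (3 / 2) * gauss (2 * r) z) / r\<^sup>2 + ?n * (?B * r powr (1 / 2) * gauss (2 * r) z) / r"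
    using k1 k3 r by (intro add_mono divide_right_mono mult_left_mono) auto
  also have "\<dots> = (1 + ?n) * ?B * r powr (- 1 / 2) * gauss (2 * r) z"
  proof -
    have "r powr (3 / 2) = r powr (-1/2) * r\<^sup>2" "r powr (1 / 2) = r powr (-1/2) * r"
      using r powr_add[of r "-1/2" 2] powr_add[of r "-1/2" 1] by (simp_all add: powr_numeral)
    then show ?thesis using r by (simp add: field_simps)
  qed
  finally show "norm z * \<bar>gauss_dt r z\<bar> \<le> (1 + ?n) * ?B * r powr (- 1 / 2) * gauss (2 * r) z" .
qed

lemma abs_gauss_dt_le_sup:
  fixes z :: "'a::euclidean_space"
  assumes r: "r > 0"
  shows "\<bar>gauss_dt r z\<bar> \<le> (1 + real DIM('a)) * gauss_bd TYPE('a) * r powr (- 1 - real DIM('a) / 2)"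
proof -
  let ?K = "(1 + real DIM('a)) * gauss_bd TYPE('a)"
  have "?K / r * gauss (2 * r) z \<le> ?K / r * r powr (- real DIM('a) / 2)"
    using gauss_bd_pos[where 'a='a] r by (intro mult_left_mono gauss_wide_le) auto
  also have "\<dots> = ?K * r powr (- 1 - real DIM('a) / 2)"
    using r by (simp add: powr_diff powr_minus_divide)
  finally show ?thesis using abs_gauss_dt_le(1)[OF r, of z] by linarith
qed

lemma integrable_gauss_vec [simp]:
  assumes r: "r > 0" shows "integrable lborel (gauss_vec r :: 'a::euclidean_space \<Rightarrow> 'a)"
proof (rule Bochner_Integration.integrable_bound)
  show "integrable lborel (\<lambda>z::'a. gauss_bd TYPE('a) * r powr (- 1 / 2) * gauss (2 * r) z)"
    using r by simp
  show "AE z in lborel. norm (gauss_vec r (z::'a)) \<le> norm (gauss_bd TYPE('a) * r powr (- 1 / 2) * gauss (2 * r) z)"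
    using norm_gauss_vec_le[OF r] gauss_bd_pos[where 'a='a] by (intro AE_I2) (simp add: abs_mult)
qed measurable

text \<open>The mass of \<open>gauss r\<close> does not depend on \<open>r\<close>, so its
  derivative in \<open>r\<close> integrates to 0. The computation balances the second moment against
  the mass.\<close>

lemma has_bochner_integral_gauss_dt:
  assumes r: "r > 0" shows "has_bochner_integral lborel (gauss_dt r :: 'a::euclidean_space \<Rightarrow> real) 0"
proof -
  have "has_bochner_integral lborel (\<lambda>z::'a. (norm z)\<^sup>2 * gauss r z / r\<^sup>2 - real DIM('a) / (2 * r) * gauss r z)
    (r * (real DIM('a) / 2) * gauss_mass TYPE('a) / r\<^sup>2 - real DIM('a) / (2 * r) * gauss_mass TYPE('a))"
    using r by (intro has_bochner_integral_diff has_bochner_integral_mult_right has_bochner_integral_divide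
        has_bochner_integral_gauss has_bochner_integral_norm_sq_gauss) auto
  moreover have "r * (real DIM('a) / 2) * gauss_mass TYPE('a) / r\<^sup>2 - real DIM('a) / (2 * r) * gauss_mass TYPE('a) = 0"
    using r by (simp add: field_simps power2_eq_square)
  ultimately show ?thesis
    unfolding gauss_dt_def by (simp add: left_diff_distrib)
qed

section \<open>Time derivative and composition law of the kernels\<close>

lemma DERIV_gauss_time:
  fixes z :: "'a::euclidean_space"
  assumes r: "r > 0"
  shows "((\<lambda>r. gauss r z) has_real_derivative gauss_dt r z) (at r)"
proof -
  have "r powr ((- real DIM('a) - 2) / 2) = r powr (- (real DIM('a) / 2)) / r"
    using r powr_diff[of r "- (real DIM('a) / 2)" 1] by (simp add: diff_divide_distrib)
  then show ?thesis
    unfolding gauss_def gauss_dt_def using r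
    by (auto intro!: derivative_eq_intros simp: power2_eq_square powr_diff field_simps)
qed

text \<open>Completing the square turns the product into one Gaussian centred at \<open>(t / (r + t)) \<xi>\<close>.\<close>

lemma has_bochner_integral_gauss_vec_conv:
  fixes \<xi> :: "'a::euclidean_space"
  assumes r: "r > 0" and t: "t > 0"
  shows "has_bochner_integral lborel (\<lambda>y. gauss_vec r (\<xi> - y) \<bullet> gauss_vec t y)
    (gauss_mass TYPE('a) * gauss_dt (r + t) \<xi>)"
proof -
  let ?n = "real DIM('a)" and ?f = "\<lambda>y. gauss_vec r (\<xi> - y) \<bullet> gauss_vec t y"
  define w where "w = r + t"
  \<comment> \<open>The width left after completing the square satisfies
    \<open>1 / \<rho> = 1 / r + 1 / t\<close>. Below, \<open>G\<close> collects the factors that do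
    not involve the integration variable.\<close>
  define \<rho> where "\<rho> = r * t / w"
  have w: "w > 0" and \<rho>: "\<rho> > 0" using r t unfolding w_def \<rho>_def by auto
  define G where "G = exp (- (norm \<xi>)\<^sup>2 / w) * w powr (- ?n / 2) / (r * t)"
  have eq: "?f ((t / w) *\<^sub>R \<xi> + 1 *\<^sub>R \<zeta>) =
      G * (r * t * (norm \<xi>)\<^sup>2 / w\<^sup>2 * gauss \<rho> \<zeta> + ((r - t) / w) * (\<xi> \<bullet> (gauss \<rho> \<zeta> *\<^sub>R \<zeta>)) - (norm \<zeta>)\<^sup>2 * gauss \<rho> \<zeta>)" for \<zeta>
  proof -
    have d: "\<xi> - ((t / w) *\<^sub>R \<xi> + 1 *\<^sub>R \<zeta>) = (r / w) *\<^sub>R \<xi> - \<zeta>"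
    proof -
      have "\<xi> = (r / w) *\<^sub>R \<xi> + (t / w) *\<^sub>R \<xi>"
        using w by (simp add: scaleR_add_left[symmetric] add_divide_distrib[symmetric] w_def)
      then show ?thesis by (simp add: algebra_simps)
    qed
    have ip: "((r / w) *\<^sub>R \<xi> - \<zeta>) \<bullet> ((t / w) *\<^sub>R \<xi> + \<zeta>) = r * t * (norm \<xi>)\<^sup>2 / w\<^sup>2 + ((r - t) / w) * (\<xi> \<bullet> \<zeta>) - (norm \<zeta>)\<^sup>2"
      by (simp add: inner_diff_left inner_add_right power2_norm_eq_inner inner_commute[of \<zeta> \<xi>]
          power2_eq_square[of w] algebra_simps diff_divide_distrib)
    have nsq1: "(norm ((r / w) *\<^sub>R \<xi> - \<zeta>))\<^sup>2 = (r / w)\<^sup>2 * (norm \<xi>)\<^sup>2 - 2 * (r / w) * (\<xi> \<bullet> \<zeta>) + (norm \<zeta>)\<^sup>2"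
      unfolding power2_norm_eq_inner
      by (simp add: inner_diff_left inner_diff_right inner_commute[of \<zeta> \<xi>] power2_eq_square
          algebra_simps diff_divide_distrib add_divide_distrib)
    have nsq2: "(norm ((t / w) *\<^sub>R \<xi> + \<zeta>))\<^sup>2 = (t / w)\<^sup>2 * (norm \<xi>)\<^sup>2 + 2 * (t / w) * (\<xi> \<bullet> \<zeta>) + (norm \<zeta>)\<^sup>2"
      unfolding power2_norm_eq_inner
      by (simp add: inner_add_left inner_add_right inner_commute[of \<zeta> \<xi>] power2_eq_square
          algebra_simps diff_divide_distrib add_divide_distrib)
    have ex: "(norm ((r / w) *\<^sub>R \<xi> - \<zeta>))\<^sup>2 / r + (norm ((t / w) *\<^sub>R \<xi> + \<zeta>))\<^sup>2 / t = (norm \<xi>)\<^sup>2 / w + (norm \<zeta>)\<^sup>2 / \<rho>"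
    proof -
      have "(norm ((r / w) *\<^sub>R \<xi> - \<zeta>))\<^sup>2 / r = r * (norm \<xi>)\<^sup>2 / w\<^sup>2 - 2 * (\<xi> \<bullet> \<zeta>) / w + (norm \<zeta>)\<^sup>2 / r"
        unfolding nsq1 using r w by (simp add: field_simps power2_eq_square)
      moreover have "(norm ((t / w) *\<^sub>R \<xi> + \<zeta>))\<^sup>2 / t = t * (norm \<xi>)\<^sup>2 / w\<^sup>2 + 2 * (\<xi> \<bullet> \<zeta>) / w + (norm \<zeta>)\<^sup>2 / t"
        unfolding nsq2 using t w by (simp add: field_simps power2_eq_square)
      moreover have "r * (norm \<xi>)\<^sup>2 / w\<^sup>2 + t * (norm \<xi>)\<^sup>2 / w\<^sup>2 = (norm \<xi>)\<^sup>2 / w"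
      proof -
        have "r * (norm \<xi>)\<^sup>2 / w\<^sup>2 + t * (norm \<xi>)\<^sup>2 / w\<^sup>2 = w * (norm \<xi>)\<^sup>2 / w\<^sup>2"
          unfolding w_def by (simp add: add_divide_distrib[symmetric] distrib_right)
        then show ?thesis using w by (simp add: power2_eq_square)
      qed
      moreover have "(norm \<zeta>)\<^sup>2 / r + (norm \<zeta>)\<^sup>2 / t = (norm \<zeta>)\<^sup>2 / \<rho>"
        using r t unfolding \<rho>_def w_def by (simp add: field_simps)
      ultimately show ?thesis by linarith
    qed
    have E: "exp (- (norm ((r / w) *\<^sub>R \<xi> - \<zeta>))\<^sup>2 / r) * exp (- (norm ((t / w) *\<^sub>R \<xi> + \<zeta>))\<^sup>2 / t)
        = exp (- (norm \<xi>)\<^sup>2 / w) * exp (- (norm \<zeta>)\<^sup>2 / \<rho>)"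
      unfolding exp_add[symmetric] using ex by (simp add: algebra_simps)
    have P: "r powr (- ?n / 2) * t powr (- ?n / 2) = w powr (- ?n / 2) * \<rho> powr (- ?n / 2)"
      using r t w unfolding \<rho>_def by (simp add: powr_mult powr_divide)
    have "?f ((t / w) *\<^sub>R \<xi> + 1 *\<^sub>R \<zeta>) =
       (r powr (- ?n / 2) * t powr (- ?n / 2)) * (exp (- (norm ((r / w) *\<^sub>R \<xi> - \<zeta>))\<^sup>2 / r) * exp (- (norm ((t / w) *\<^sub>R \<xi> + \<zeta>))\<^sup>2 / t))
        / (r * t) * (((r / w) *\<^sub>R \<xi> - \<zeta>) \<bullet> ((t / w) *\<^sub>R \<xi> + \<zeta>))"
      unfolding d by (simp add: gauss_vec_def gauss_def mult.commute mult.left_commute)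
    also have "\<dots> = G * gauss \<rho> \<zeta> * (r * t * (norm \<xi>)\<^sup>2 / w\<^sup>2 + ((r - t) / w) * (\<xi> \<bullet> \<zeta>) - (norm \<zeta>)\<^sup>2)"
      unfolding E P ip unfolding G_def gauss_def by simp
    finally show ?thesis by (simp add: algebra_simps)
  qed
  have i1: "integrable lborel (\<lambda>\<zeta>::'a. gauss \<rho> \<zeta> *\<^sub>R \<zeta>)"
  proof -
    have "integrable lborel (\<lambda>\<zeta>::'a. \<rho> *\<^sub>R gauss_vec \<rho> \<zeta>)" using \<rho> by simp
    then show ?thesis unfolding gauss_vec_def using \<rho> by simp
  qed
  \<comment> \<open>Oddness removes the mixed term. The mass and the second moment that remain
    combine to \<open>gauss_dt\<close>.\<close>
  have "(LINT \<zeta>|lborel. gauss \<rho> \<zeta> *\<^sub>R (\<zeta>::'a)) = 0"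
    by (rule integral_lborel_odd) auto
  with i1 have h1: "has_bochner_integral lborel (\<lambda>\<zeta>::'a. gauss \<rho> \<zeta> *\<^sub>R \<zeta>) 0"
    by (simp add: has_bochner_integral_iff)
  have "has_bochner_integral lborel (\<lambda>\<zeta>. ?f ((t / w) *\<^sub>R \<xi> + 1 *\<^sub>R \<zeta>))
    (G * (r * t * (norm \<xi>)\<^sup>2 / w\<^sup>2 * gauss_mass TYPE('a) + ((r - t) / w) * (\<xi> \<bullet> 0) - \<rho> * (?n / 2) * gauss_mass TYPE('a)))"
    unfolding eq
    by (intro has_bochner_integral_mult_right has_bochner_integral_diff has_bochner_integral_add
        has_bochner_integral_gauss has_bochner_integral_norm_sq_gauss \<rho>
        has_bochner_integral_inner_right h1)
  from has_bochner_integral_lborel_affine[OF _ _ this]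
  have "has_bochner_integral lborel ?f
    (G * (r * t * (norm \<xi>)\<^sup>2 / w\<^sup>2 * gauss_mass TYPE('a) - \<rho> * (?n / 2) * gauss_mass TYPE('a)))"
    by simp
  also have "G * (r * t * (norm \<xi>)\<^sup>2 / w\<^sup>2 * gauss_mass TYPE('a) - \<rho> * (?n / 2) * gauss_mass TYPE('a))
      = gauss_mass TYPE('a) * gauss_dt w \<xi>"
    unfolding G_def gauss_dt_def gauss_def \<rho>_def using r t w by (simp add: field_simps)
  finally show ?thesis unfolding w_def .
qed

text \<open>The mean value theorem produces a factor \<open>2 * z\<close>, absorbed by half of the
  exponent through \<open>z \<le> exp (z^2 / 2)\<close>. The other half, taken at the smaller
  argument, keeps the decay that \<open>gauss_vec_diff_le\<close> relies on.\<close>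

lemma abs_exp_neg_sq_diff_le:
  fixes x y :: real
  assumes x: "0 \<le> x" and y: "0 \<le> y"
  shows "\<bar>exp (- x\<^sup>2) - exp (- y\<^sup>2)\<bar> \<le> 2 * \<bar>x - y\<bar> * exp (- (min x y)\<^sup>2 / 2)"
proof -
  have *: "\<bar>exp (- x\<^sup>2) - exp (- y\<^sup>2)\<bar> \<le> 2 * \<bar>x - y\<bar> * exp (- x\<^sup>2 / 2)" if "0 \<le> x" "x < y" for x y :: real
  proof -
    have "\<exists>z>x. z < y \<and> exp (- y\<^sup>2) - exp (- x\<^sup>2) = (y - x) * (- 2 * z * exp (- z\<^sup>2))"
      using that by (intro MVT2) (auto intro!: derivative_eq_intros)
    then obtain z where z: "x < z" "z < y" "exp (- y\<^sup>2) - exp (- x\<^sup>2) = (y - x) * (- 2 * z * exp (- z\<^sup>2))" by blast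
    have "z \<le> exp (z\<^sup>2 / 2)"
    proof -
      have "z \<le> 1 + z\<^sup>2 / 2" using sum_squares_bound[of 1 z] by (simp add: power2_eq_square)
      also have "\<dots> \<le> exp (z\<^sup>2 / 2)" by (rule exp_ge_add_one_self)
      finally show ?thesis .
    qed
    then have "z * exp (- z\<^sup>2) \<le> exp (z\<^sup>2 / 2) * exp (- z\<^sup>2)" by (intro mult_right_mono) auto
    also have "\<dots> = exp (- z\<^sup>2 / 2)" by (simp add: exp_add[symmetric])
    also have "\<dots> \<le> exp (- x\<^sup>2 / 2)" using z that by (simp add: power_mono)
    finally have "z * exp (- z\<^sup>2) \<le> exp (- x\<^sup>2 / 2)" .
    then have "(y - x) * (2 * (z * exp (- z\<^sup>2))) \<le> (y - x) * (2 * exp (- x\<^sup>2 / 2))"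
      using that by (intro mult_left_mono) auto
    moreover have "\<bar>exp (- x\<^sup>2) - exp (- y\<^sup>2)\<bar> = (y - x) * (2 * (z * exp (- z\<^sup>2)))"
    proof -
      have "exp (- y\<^sup>2) \<le> exp (- x\<^sup>2)" using that by (simp add: power_mono)
      then show ?thesis using z(3) by (simp add: algebra_simps)
    qed
    ultimately show ?thesis using that by (simp add: algebra_simps)
  qed
  show ?thesis
    using *[of x y] *[of y x] x y
    by (cases x y rule: linorder_cases) (auto simp: min_def abs_minus_commute)
qed

lemma gauss_lipschitz:
  fixes z y :: "'a::euclidean_space"
  assumes r: "r > 0"
  shows "\<bar>gauss r z - gauss r y\<bar> \<le> 2 * r powr (- real DIM('a) / 2 - 1 / 2) * norm (z - y)"
proof -
  let ?P = "r powr (- real DIM('a) / 2)"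
  define a b where "a = norm z / sqrt r" and "b = norm y / sqrt r"
  have ab: "a \<ge> 0" "b \<ge> 0" using r unfolding a_def b_def by auto
  have sq: "(norm z)\<^sup>2 / r = a\<^sup>2" "(norm y)\<^sup>2 / r = b\<^sup>2"
    using r unfolding a_def b_def by (auto simp: power_divide)
  have "\<bar>a - b\<bar> = \<bar>norm z - norm y\<bar> / sqrt r"
    using r unfolding a_def b_def by (simp add: diff_divide_distrib[symmetric])
  also have "\<dots> \<le> norm (z - y) / sqrt r" using r by (intro divide_right_mono norm_triangle_ineq3) auto
  finally have d: "\<bar>a - b\<bar> \<le> norm (z - y) / sqrt r" .
  have "\<bar>gauss r z - gauss r y\<bar> = ?P * \<bar>exp (- a\<^sup>2) - exp (- b\<^sup>2)\<bar>"
    unfolding gauss_def using sq by (simp add: right_diff_distrib[symmetric] abs_mult)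
  also have "\<dots> \<le> ?P * (2 * \<bar>a - b\<bar> * exp (- (min a b)\<^sup>2 / 2))"
    by (intro mult_left_mono abs_exp_neg_sq_diff_le ab) auto
  also have "\<dots> \<le> ?P * (2 * (norm (z - y) / sqrt r) * 1)"
    using d by (intro mult_left_mono mult_mono) auto
  also have "\<dots> = 2 * r powr (- real DIM('a) / 2 - 1 / 2) * norm (z - y)"
    using r by (simp add: powr_diff powr_half_sqrt)
  finally show ?thesis .
qed

text \<open>By symmetry \<open>y\<close> may be taken to have the smaller norm. Writing the
  difference as a multiple of \<open>z - y\<close> plus a multiple of \<open>y\<close> leaves an
  extra factor \<open>norm y\<close>, which half of the remaining exponent absorbs. A quarter of the
  exponent survives, hence the width \<open>4 * r\<close> and its normalising factor.\<close>

lemma gauss_vec_diff_le: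
  fixes z y :: "'a::euclidean_space"
  assumes r: "r > 0"
  shows "norm (gauss_vec r z - gauss_vec r y) \<le>
    2 * 4 powr (real DIM('a) / 2) / r * norm (z - y) * (gauss (4 * r) z + gauss (4 * r) y)"
proof -
  have *: "norm (gauss_vec r z - gauss_vec r y) \<le>
    2 * 4 powr (real DIM('a) / 2) / r * norm (z - y) * (gauss (4 * r) z + gauss (4 * r) y)"
    if le: "norm y \<le> norm z" for z y :: 'a
  proof -
    let ?P = "r powr (- real DIM('a) / 2)"
    define a b where "a = norm z / sqrt r" and "b = norm y / sqrt r"
    have ab: "a \<ge> 0" "b \<ge> 0" using r unfolding a_def b_def by auto
    have sq: "(norm z)\<^sup>2 / r = a\<^sup>2" "(norm y)\<^sup>2 / r = b\<^sup>2"
      using r unfolding a_def b_def by (auto simp: power_divide)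
    have "\<bar>a - b\<bar> = \<bar>norm z - norm y\<bar> / sqrt r"
      using r unfolding a_def b_def by (simp add: diff_divide_distrib[symmetric])
    also have "\<dots> \<le> norm (z - y) / sqrt r" using r by (intro divide_right_mono norm_triangle_ineq3) auto
    finally have d: "\<bar>a - b\<bar> \<le> norm (z - y) / sqrt r" .
    have m: "min a b = b" using le r unfolding a_def b_def by (simp add: divide_right_mono)
    have b1: "b * exp (- b\<^sup>2 / 2) \<le> exp (- b\<^sup>2 / 4)"
    proof -
      have "b \<le> 1 + b\<^sup>2 / 4" using sum_squares_bound[of 1 "b / 2"] by (simp add: power2_eq_square)
      also have "\<dots> \<le> exp (b\<^sup>2 / 4)" by (rule exp_ge_add_one_self)
      finally have "b * exp (- b\<^sup>2 / 2) \<le> exp (b\<^sup>2 / 4) * exp (- b\<^sup>2 / 2)" by (intro mult_right_mono) auto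
      also have "\<dots> = exp (- b\<^sup>2 / 4)" by (simp add: exp_add[symmetric])
      finally show ?thesis .
    qed
    have "exp (- a\<^sup>2) *\<^sub>R z - exp (- b\<^sup>2) *\<^sub>R y = exp (- a\<^sup>2) *\<^sub>R (z - y) + (exp (- a\<^sup>2) - exp (- b\<^sup>2)) *\<^sub>R y"
      by (simp add: algebra_simps)
    then have "norm (exp (- a\<^sup>2) *\<^sub>R z - exp (- b\<^sup>2) *\<^sub>R y) \<le> exp (- a\<^sup>2) * norm (z - y) + \<bar>exp (- a\<^sup>2) - exp (- b\<^sup>2)\<bar> * norm y"
      using norm_triangle_ineq[of "exp (- a\<^sup>2) *\<^sub>R (z - y)" "(exp (- a\<^sup>2) - exp (- b\<^sup>2)) *\<^sub>R y"] by simp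
    also have "\<dots> \<le> exp (- a\<^sup>2 / 4) * norm (z - y) + (2 * (norm (z - y) / sqrt r) * exp (- b\<^sup>2 / 2)) * norm y"
    proof (intro add_mono mult_right_mono)
      have "\<bar>exp (- a\<^sup>2) - exp (- b\<^sup>2)\<bar> \<le> 2 * \<bar>a - b\<bar> * exp (- b\<^sup>2 / 2)"
        using abs_exp_neg_sq_diff_le[OF ab] m by simp
      also have "\<dots> \<le> 2 * (norm (z - y) / sqrt r) * exp (- b\<^sup>2 / 2)"
        using d by (intro mult_right_mono) auto
      finally show "\<bar>exp (- a\<^sup>2) - exp (- b\<^sup>2)\<bar> \<le> 2 * (norm (z - y) / sqrt r) * exp (- b\<^sup>2 / 2)" .
    qed auto
    also have "(2 * (norm (z - y) / sqrt r) * exp (- b\<^sup>2 / 2)) * norm y = 2 * norm (z - y) * (b * exp (- b\<^sup>2 / 2))"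
      unfolding b_def by simp
    also have "exp (- a\<^sup>2 / 4) * norm (z - y) + 2 * norm (z - y) * (b * exp (- b\<^sup>2 / 2))
      \<le> exp (- a\<^sup>2 / 4) * norm (z - y) + 2 * norm (z - y) * exp (- b\<^sup>2 / 4)"
      by (intro add_left_mono mult_left_mono b1) auto
    also have "\<dots> \<le> 2 * norm (z - y) * (exp (- a\<^sup>2 / 4) + exp (- b\<^sup>2 / 4))"
      by (simp add: algebra_simps)
    finally have main: "norm (exp (- a\<^sup>2) *\<^sub>R z - exp (- b\<^sup>2) *\<^sub>R y) \<le> 2 * norm (z - y) * (exp (- a\<^sup>2 / 4) + exp (- b\<^sup>2 / 4))" .
    have e4: "exp (- a\<^sup>2 / 4) = exp (- (norm z)\<^sup>2 / (4 * r))" "exp (- b\<^sup>2 / 4) = exp (- (norm y)\<^sup>2 / (4 * r))"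
      unfolding sq[symmetric] by (simp_all add: mult.commute)
    have P4: "?P = 4 powr (real DIM('a) / 2) * (4 * r) powr (- real DIM('a) / 2)"
      using r by (simp add: powr_mult powr_minus)
    have "gauss_vec r z - gauss_vec r y = (?P / r) *\<^sub>R (exp (- a\<^sup>2) *\<^sub>R z - exp (- b\<^sup>2) *\<^sub>R y)"
      unfolding gauss_vec_def gauss_def using sq by (simp add: scaleR_diff_right)
    then have "norm (gauss_vec r z - gauss_vec r y) = ?P / r * norm (exp (- a\<^sup>2) *\<^sub>R z - exp (- b\<^sup>2) *\<^sub>R y)"
      using r by simp
    also have "\<dots> \<le> ?P / r * (2 * norm (z - y) * (exp (- a\<^sup>2 / 4) + exp (- b\<^sup>2 / 4)))"
      using r by (intro mult_left_mono main) auto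
    also have "\<dots> = 2 * 4 powr (real DIM('a) / 2) / r * norm (z - y) * (gauss (4 * r) z + gauss (4 * r) y)"
      unfolding gauss_def e4 P4 by (simp add: algebra_simps add_divide_distrib)
    finally show ?thesis .
  qed
  show ?thesis
    using *[of y z] *[of z y] by (cases "norm y \<le> norm z") (auto simp: norm_minus_commute add.commute)
qed

section \<open>Fractional integrals on the half-line\<close>

lemma lborel_Fubini:
  fixes f :: "'a::euclidean_space \<Rightarrow> 'b::euclidean_space \<Rightarrow> 'c::{banach, second_countable_topology}"
  assumes [measurable]: "(\<lambda>(x, y). f x y) \<in> borel_measurable (lborel \<Otimes>\<^sub>M lborel)"
    and fin: "(\<integral>\<^sup>+x. (\<integral>\<^sup>+y. ennreal (norm (f x y)) \<partial>lborel) \<partial>lborel) < \<infinity>"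
  shows "(LINT x|lborel. (LINT y|lborel. f x y)) = (LINT y|lborel. (LINT x|lborel. f x y))"
    and "integrable lborel (\<lambda>x. LINT y|lborel. f x y)"
    and "integrable lborel (\<lambda>y. LINT x|lborel. f x y)"
    and "AE x in lborel. integrable lborel (\<lambda>y. f x y)"
proof -
  have int: "integrable (lborel \<Otimes>\<^sub>M lborel) (\<lambda>(x, y). f x y)"
  proof (rule integrableI_bounded)
    have "(\<integral>\<^sup>+z. ennreal (norm (case z of (x, y) \<Rightarrow> f x y)) \<partial>(lborel \<Otimes>\<^sub>M lborel))
      = (\<integral>\<^sup>+x. (\<integral>\<^sup>+y. ennreal (norm (f x y)) \<partial>lborel) \<partial>lborel)"
      by (subst lborel.nn_integral_fst[symmetric]) auto
    then show "(\<integral>\<^sup>+z. ennreal (norm (case z of (x, y) \<Rightarrow> f x y)) \<partial>(lborel \<Otimes>\<^sub>M lborel)) < \<infinity>"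
      using fin by simp
  qed measurable
  show "(LINT x|lborel. (LINT y|lborel. f x y)) = (LINT y|lborel. (LINT x|lborel. f x y))"
    using lborel_pair.Fubini_integral[OF int] by simp
  show "integrable lborel (\<lambda>x. LINT y|lborel. f x y)"
    using lborel_pair.integrable_fst[OF int] .
  show "integrable lborel (\<lambda>y. LINT x|lborel. f x y)"
    using lborel_pair.integrable_snd[OF int] .
  show "AE x in lborel. integrable lborel (\<lambda>y. f x y)"
    using lborel_pair.AE_integrable_fst[OF int] .
qed

lemma nn_integral_powr_from_0:
  fixes e c :: real
  assumes e: "-1 < e" and c: "0 \<le> c"
  shows "(\<integral>\<^sup>+x. ennreal (indicator {0<..c} x * x powr e) \<partial>lborel) = ennreal (c powr (e + 1) / (e + 1))"
proof -
  have "(\<integral>\<^sup>+x. ennreal (indicator {0..c} x * x powr e) \<partial>lborel) = ennreal (c powr (e + 1) / (e + 1))"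
    by (rule nn_integral_has_integral_lebesgue[OF _ has_integral_powr_from_0[OF e c]]) auto
  moreover have "indicator {0..c} x * x powr e = indicator {0<..c} x * x powr e" for x :: real
    by (auto split: split_indicator)
  ultimately show ?thesis by simp
qed

lemma nn_integral_powr_to_inf:
  fixes e c :: real
  assumes e: "e < -1" and c: "0 < c"
  shows "(\<integral>\<^sup>+x. ennreal (indicator {c..} x * x powr e) \<partial>lborel) = ennreal (- (c powr (e + 1)) / (e + 1))"
  by (rule nn_integral_has_integral_lebesgue[OF _ has_integral_powr_to_inf[OF e c]]) auto

text \<open>The right-hand side is the maximum of the left one, attained at \<open>y = c\<close>;
  the proof is \<open>ln x \<le> x - 1\<close> at \<open>x = y / c\<close>.\<close>

lemma powr_exp_minus_le:
  fixes y c :: real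
  assumes y: "0 < y" and c: "0 < c"
  shows "y powr c * exp (- y) \<le> exp (c * ln c - c)"
proof -
  have "ln (y / c) \<le> y / c - 1" using y c by (intro ln_le_minus_one) auto
  then have "c * (ln y - ln c) \<le> c * (y / c - 1)"
    using y c by (intro mult_left_mono) (auto simp: ln_div)
  then have "c * ln y - y \<le> c * ln c - c" using c by (simp add: algebra_simps)
  then have "exp (c * ln y - y) \<le> exp (c * ln c - c)" by simp
  then show ?thesis using y by (simp add: powr_def exp_diff exp_minus field_simps)
qed

text \<open>Substituting \<open>1 / t\<close> for \<open>t\<close> shows that this is
  \<open>Gamma b\<close>; later steps use its finiteness and positivity.\<close>

definition power_kernel_const :: "real \<Rightarrow> real" where
  "power_kernel_const b = (LINT t|lborel. indicator {0<..} t * (t powr (- b - 1) * exp (- 1 / t)))"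

lemma integrable_power_kernel:
  fixes b :: real
  assumes b: "0 < b"
  shows "integrable lborel (\<lambda>t. indicator {0<..} t * (t powr (- b - 1) * exp (- 1 / t)))"
proof (rule integrableI_bounded)
  \<comment> \<open>The maximum of \<open>y powr (b + 1) * exp (- y)\<close> with
    \<open>y = 1 / t\<close>. It controls the integrand up to time 1, beyond which the power alone
    is integrable.\<close>
  define C where "C = exp ((b + 1) * ln (b + 1) - (b + 1))"
  have le: "norm (indicator {0<..} t * (t powr (- b - 1) * exp (- 1 / t)))
    \<le> C * (indicator {0<..1} t * t powr 0) + indicator {1..} t * t powr (- b - 1)" for t :: real
  proof (cases "t > 0")
    case True
    have 1: "t powr (- b - 1) * exp (- 1 / t) \<le> C"
    proof -
      have "(1 / t) powr (b + 1) = t powr (- b - 1)"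
        using True powr_minus_divide[of t "b + 1"] by (simp add: powr_divide)
      then show ?thesis
        using powr_exp_minus_le[of "1 / t" "b + 1"] True b unfolding C_def by simp
    qed
    have 2: "t powr (- b - 1) * exp (- 1 / t) \<le> t powr (- b - 1)"
      using True by (simp add: mult_le_cancel_left1)
    show ?thesis using 1 2 True by (auto split: split_indicator)
  qed (auto split: split_indicator)
  have "(\<integral>\<^sup>+t. ennreal (norm (indicator {0<..} t * (t powr (- b - 1) * exp (- 1 / t)))) \<partial>lborel)
    \<le> (\<integral>\<^sup>+t. ennreal C * ennreal (indicator {0<..1} t * t powr 0) + ennreal (indicator {1..} t * t powr (- b - 1)) \<partial>lborel)"
    using le by (intro nn_integral_mono) (simp add: ennreal_mult'[symmetric] ennreal_plus[symmetric] C_def ennreal_leI del: ennreal_plus)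
  also have "\<dots> = ennreal C * ennreal (1 powr (0 + 1) / (0 + 1)) + ennreal (- (1 powr (- b - 1 + 1)) / (- b - 1 + 1))"
    using b by (simp add: nn_integral_add nn_integral_cmult nn_integral_powr_from_0[of 0 1] nn_integral_powr_to_inf[of "- b - 1" 1] del: powr_one_eq_one powr_zero_eq_one powr_one)
  also have "\<dots> < \<infinity>" by (simp add: ennreal_mult_less_top)
  finally show "(\<integral>\<^sup>+t. ennreal (norm (indicator {0<..} t * (t powr (- b - 1) * exp (- 1 / t)))) \<partial>lborel) < \<infinity>" .
qed measurable

lemma power_kernel_const_pos:
  assumes b: "0 < b" shows "0 < power_kernel_const b"
proof -
  let ?f = "\<lambda>t::real. indicator {0<..} t * (t powr (- b - 1) * exp (- 1 / t)) :: real"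
  have "0 \<le> power_kernel_const b" unfolding power_kernel_const_def by (intro Bochner_Integration.integral_nonneg) auto
  moreover have "power_kernel_const b \<noteq> 0"
  proof
    assume "power_kernel_const b = 0"
    then have "AE t in lborel. ?f t = 0"
      unfolding power_kernel_const_def
      by (subst (asm) integral_nonneg_eq_0_iff_AE[OF integrable_power_kernel[OF b]]) auto
    then have "AE t in lborel. t \<notin> {0<..<1::real}"
      by eventually_elim (auto split: split_indicator_asm)
    then have "emeasure lborel {0<..<1::real} = 0"
      by (subst (asm) AE_iff_measurable[of "{0<..<1}"]) auto
    then show False by simp
  qed
  ultimately show ?thesis by simp
qed

lemma has_bochner_integral_power_kernel:
  assumes b: "0 < b" and m: "0 < m"
  shows "has_bochner_integral lborel (\<lambda>t. indicator {0<..} t * (t powr (- b - 1) * exp (- m / t)))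
    (power_kernel_const b * m powr (- b))"
proof -
  let ?f = "\<lambda>t::real. indicator {0<..} t * (t powr (- b - 1) * exp (- m / t)) :: real"
  have "has_bochner_integral lborel (\<lambda>t. indicator {0<..} t * (t powr (- b - 1) * exp (- 1 / t))) (power_kernel_const b)"
    unfolding power_kernel_const_def using integrable_power_kernel[OF b] by (simp add: has_bochner_integral_iff)
  then have "has_bochner_integral lborel (\<lambda>t. m powr (- b - 1) * (indicator {0<..} t * (t powr (- b - 1) * exp (- 1 / t))))
     (m powr (- b - 1) * power_kernel_const b)"
    by (rule has_bochner_integral_mult_right)
  moreover have "m powr (- b - 1) * (indicator {0<..} t * (t powr (- b - 1) * exp (- 1 / t))) = ?f (0 + m *\<^sub>R t)" for t
    using m by (auto simp: powr_mult zero_less_mult_iff split: split_indicator)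
  ultimately have h: "has_bochner_integral lborel (\<lambda>t. ?f (0 + m *\<^sub>R t)) (m powr (- b - 1) * power_kernel_const b)"
    by simp
  have "?f \<in> borel_measurable borel" "m \<noteq> 0" using m by auto
  from has_bochner_integral_lborel_affine[OF this h]
  show ?thesis using m powr_add[of m 1 "- b - 1"] by (simp add: mult.commute mult.left_commute)
qed

text \<open>Subordination of the Riesz kernel to Gaussians. Counting negative powers of
  \<open>t\<close>, the weight contributes \<open>(1 + s) / 2\<close>, the Gaussian
  \<open>n / 2\<close> and the division in \<open>gauss_vec\<close> one more; the total is
  \<open>b + 1\<close> with \<open>2 * b = n + s + 1\<close>, the homogeneity of the Riesz kernel.
  This fixes the exponent of the weight.\<close>

lemma has_bochner_integral_powr_gauss_vec:
  fixes v :: "'a::euclidean_space"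
  assumes s: "0 < s"
  shows "has_bochner_integral lborel (\<lambda>t. indicator {0<..} t *\<^sub>R (t powr (- ((1 + s) / 2)) *\<^sub>R gauss_vec t v))
    (power_kernel_const ((1 + s + real DIM('a)) / 2) *\<^sub>R (norm v powr (- (real DIM('a) + s + 1)) *\<^sub>R v))"
proof (cases "v = 0")
  case True
  then show ?thesis by (simp add: gauss_vec_def has_bochner_integral_zero)
next
  case False
  let ?n = "real DIM('a)"
  define b where "b = (1 + s + ?n) / 2"
  have b: "0 < b" unfolding b_def using s by simp
  have "has_bochner_integral lborel (\<lambda>t. (indicator {0<..} t * (t powr (- b - 1) * exp (- (norm v)\<^sup>2 / t))) *\<^sub>R v)
    ((power_kernel_const b * (norm v)\<^sup>2 powr (- b)) *\<^sub>R v)"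
    using False by (intro has_bochner_integral_scaleR_left has_bochner_integral_power_kernel b) auto
  moreover have "(norm v)\<^sup>2 powr (- b) = norm v powr (- (?n + s + 1))"
  proof -
    have "(norm v)\<^sup>2 = norm v powr 2" using False by (simp add: powr_numeral)
    then have "(norm v)\<^sup>2 powr (- b) = norm v powr (2 * (- b))" by (simp only: powr_powr)
    moreover have "2 * (- b) = - (?n + s + 1)"
    proof -
      have "2 * b = 1 + s + ?n" unfolding b_def by simp
      then show ?thesis by linarith
    qed
    ultimately show ?thesis by simp
  qed
  moreover have "(indicator {0<..} t * (t powr (- b - 1) * exp (- (norm v)\<^sup>2 / t))) *\<^sub>R v
    = indicator {0<..} t *\<^sub>R (t powr (- ((1 + s) / 2)) *\<^sub>R gauss_vec t v)" for t
  proof (cases "t > 0")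
    case True
    have "t powr (- b - 1) = t powr (- ((1 + s) / 2)) * (t powr (- ?n / 2) * t powr (-1))"
    proof -
      have "2 * b = 1 + s + ?n" unfolding b_def by simp
      then have "- b - 1 = - ((1 + s) / 2) + (- ?n / 2 + (- 1))"
        by (simp add: field_simps)
      then show ?thesis by (simp only: powr_add)
    qed
    then show ?thesis unfolding gauss_vec_def gauss_def using True by (simp add: powr_minus_divide)
  qed simp
  ultimately show ?thesis unfolding b_def by simp
qed

text \<open>Abel's computation: half-line fractional integrals of orders \<open>a\<close> and \<open>1 - a\<close> compose to
  ordinary integration.\<close>

lemma Abel_integral:
  fixes g :: "real \<Rightarrow> real"
  assumes a: "0 < a" "a < 1" and g [measurable]: "g \<in> borel_measurable borel"
    and int: "integrable lborel (\<lambda>w. indicator {0<..} w * g w)"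
  shows "has_bochner_integral lborel
    (\<lambda>\<rho>. indicator {0<..} \<rho> * (\<rho> powr (a - 1) * (LINT \<tau>|lborel. indicator {0<..} \<tau> * (\<tau> powr (- a) * g (\<rho> + \<tau>)))))
    (Beta a (1 - a) * (LINT w|lborel. indicator {0<..} w * g w))"
proof -
  \<comment> \<open>With \<open>w = \<rho> + \<tau>\<close> the composed integrals have the kernel
    \<open>k \<rho> w\<close>. Its two exponents add up to -1, so by scaling its integral over
    \<open>\<rho>\<close> is the same Beta value for every \<open>w > 0\<close>.\<close>
  define k where "k \<rho> w = indicator {0<..} \<rho> * indicator {0<..} (w - \<rho>) * (\<rho> powr (a - 1) * (w - \<rho>) powr (- a))" for \<rho> w :: real
  have k0: "0 \<le> k \<rho> w" for \<rho> w unfolding k_def by simp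
  have [measurable]: "(\<lambda>(\<rho>, w). k \<rho> w) \<in> borel_measurable (lborel \<Otimes>\<^sub>M lborel)"
    unfolding k_def by measurable
  have kw: "(\<integral>\<^sup>+\<rho>. ennreal (k \<rho> w) \<partial>lborel) = ennreal (indicator {0<..} w * Beta a (1 - a))" for w
  proof (cases "w > 0")
    case True
    have "(\<integral>\<^sup>+\<rho>. ennreal (k \<rho> w) \<partial>lborel) = ennreal w * (\<integral>\<^sup>+x. ennreal (k (w * x) w) \<partial>lborel)"
      using nn_integral_real_affine[of "\<lambda>\<rho>. ennreal (k \<rho> w)" w 0] True by (simp add: k_def)
    also have "(\<integral>\<^sup>+x. ennreal (k (w * x) w) \<partial>lborel) = (\<integral>\<^sup>+x. ennreal (1 / w) * ennreal (indicator {0..1} x * (x powr (a - 1) * (1 - x) powr ((1 - a) - 1))) \<partial>lborel)"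
    proof (rule nn_integral_cong_AE)
      have "AE x in lborel. x \<noteq> 0 \<and> x \<noteq> (1::real)"
        using AE_lborel_singleton[of 0] AE_lborel_singleton[of 1] by eventually_elim auto
      then show "AE x in lborel. ennreal (k (w * x) w) = ennreal (1 / w) * ennreal (indicator {0..1} x * (x powr (a - 1) * (1 - x) powr ((1 - a) - 1)))"
      proof eventually_elim
        case (elim x)
        show ?case
        proof (cases "0 < x \<and> x < 1")
          case x: True
          have "w - w * x = w * (1 - x)" by (simp add: algebra_simps)
          moreover have "w powr (a - 1) * w powr (- a) = 1 / w"
            using True by (simp add: powr_diff powr_minus_divide)
          then have "x powr (a - 1) * w powr (a - 1) * (w powr (- a) * (1 - x) powr (- a)) = 1 / w * (x powr (a - 1) * (1 - x) powr (- a))"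
            by (metis mult.assoc mult.commute)
          ultimately have "k (w * x) w = 1 / w * (x powr (a - 1) * (1 - x) powr (- a))"
            unfolding k_def using x True
            by (simp add: powr_mult zero_less_mult_iff) (simp add: mult.assoc mult.left_commute)
          then show ?thesis using x True by (simp add: ennreal_mult[symmetric])
        next
          case False
          then have "k (w * x) w = 0" "x \<notin> {0..1}"
            using True elim unfolding k_def by (auto simp: zero_less_mult_iff not_less mult_le_cancel_left1)
          then show ?thesis by simp
        qed
      qed
    qed
    also have "\<dots> = ennreal (1 / w) * ennreal (Beta a (1 - a))"
      using a has_integral_Beta_real[of a "1 - a"]
      by (subst nn_integral_cmult) (auto intro!: arg_cong2[of _ _ _ _ "(*)"] nn_integral_has_integral_lebesgue)
    also have "ennreal w * \<dots> = ennreal (Beta a (1 - a))"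
      using True by (simp add: mult.assoc[symmetric] ennreal_mult[symmetric])
    finally show ?thesis using True by simp
  next
    case False
    then have "k \<rho> w = 0" for \<rho> unfolding k_def by (auto split: split_indicator)
    then show ?thesis using False by simp
  qed
  have B0: "0 \<le> Beta a (1 - a)"
    using a by (simp add: Beta_def less_imp_le)
  have kw': "has_bochner_integral lborel (\<lambda>\<rho>. k \<rho> w) (indicator {0<..} w * Beta a (1 - a))" for w
    by (rule has_bochner_integral_nn_integral) (use kw k0 B0 in \<open>auto simp: k_def\<close>)
  have fin: "(\<integral>\<^sup>+w. (\<integral>\<^sup>+\<rho>. ennreal (norm (k \<rho> w * g w)) \<partial>lborel) \<partial>lborel) < \<infinity>"
  proof -
    have "(\<integral>\<^sup>+w. (\<integral>\<^sup>+\<rho>. ennreal (norm (k \<rho> w * g w)) \<partial>lborel) \<partial>lborel)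
      = (\<integral>\<^sup>+w. ennreal (Beta a (1 - a)) * ennreal (norm (indicator {0<..} w * g w)) \<partial>lborel)"
    proof (intro nn_integral_cong)
      fix w
      have "(\<integral>\<^sup>+\<rho>. ennreal (norm (k \<rho> w * g w)) \<partial>lborel) = (\<integral>\<^sup>+\<rho>. ennreal (k \<rho> w) * ennreal \<bar>g w\<bar> \<partial>lborel)"
        using k0 by (intro nn_integral_cong) (simp add: abs_mult ennreal_mult)
      also have "\<dots> = ennreal (indicator {0<..} w * Beta a (1 - a)) * ennreal \<bar>g w\<bar>"
        using kw by (subst nn_integral_multc) (auto simp: k_def)
      also have "\<dots> = ennreal (Beta a (1 - a)) * ennreal (norm (indicator {0<..} w * g w))"
        using B0 by (simp add: ennreal_mult[symmetric] split: split_indicator)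
      finally show "(\<integral>\<^sup>+\<rho>. ennreal (norm (k \<rho> w * g w)) \<partial>lborel) = ennreal (Beta a (1 - a)) * ennreal (norm (indicator {0<..} w * g w))" .
    qed
    also have "\<dots> = ennreal (Beta a (1 - a)) * (\<integral>\<^sup>+w. ennreal (norm (indicator {0<..} w * g w)) \<partial>lborel)"
      by (subst nn_integral_cmult) auto
    also have "\<dots> < \<infinity>"
      using int by (simp add: ennreal_mult_less_top integrable_iff_bounded)
    finally show ?thesis .
  qed
  have [measurable]: "(\<lambda>(w, \<rho>). k \<rho> w * g w) \<in> borel_measurable (lborel \<Otimes>\<^sub>M lborel)"
    unfolding k_def by measurable
  note F = lborel_Fubini[of "\<lambda>w \<rho>. k \<rho> w * g w", OF _ fin, simplified]
  have inner: "(LINT w|lborel. k \<rho> w * g w) = indicator {0<..} \<rho> * (\<rho> powr (a - 1) * (LINT \<tau>|lborel. indicator {0<..} \<tau> * (\<tau> powr (- a) * g (\<rho> + \<tau>))))" for \<rho>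
  proof -
    have "(LINT w|lborel. k \<rho> w * g w) = (LINT \<tau>|lborel. k \<rho> (\<rho> + \<tau>) * g (\<rho> + \<tau>))"
      using integral_lborel_affine[of "\<lambda>w. k \<rho> w * g w" 1 \<rho>] by (simp add: k_def)
    also have "\<dots> = (LINT \<tau>|lborel. (indicator {0<..} \<rho> * \<rho> powr (a - 1)) * (indicator {0<..} \<tau> * (\<tau> powr (- a) * g (\<rho> + \<tau>))))"
      unfolding k_def by (intro Bochner_Integration.integral_cong) auto
    finally show ?thesis by simp
  qed
  have "(LINT w|lborel. (LINT \<rho>|lborel. k \<rho> w * g w)) = (LINT w|lborel. Beta a (1 - a) * (indicator {0<..} w * g w))"
  proof (intro Bochner_Integration.integral_cong refl)
    fix w
    have "(LINT \<rho>|lborel. k \<rho> w * g w) = (LINT \<rho>|lborel. k \<rho> w) * g w" by simp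
    also have "\<dots> = Beta a (1 - a) * (indicator {0<..} w * g w)"
      using has_bochner_integral_integral_eq[OF kw', of w] by simp
    finally show "(LINT \<rho>|lborel. k \<rho> w * g w) = Beta a (1 - a) * (indicator {0<..} w * g w)" .
  qed
  then have "(LINT \<rho>|lborel. (LINT w|lborel. k \<rho> w * g w)) = Beta a (1 - a) * (LINT w|lborel. indicator {0<..} w * g w)"
    using F(1) by simp
  then show ?thesis
    using F(3) unfolding inner by (simp add: has_bochner_integral_iff)
qed

section \<open>Reconstruction of a function from its Riesz gradient\<close>

text \<open>Boundedness and the Lipschitz condition make the increment integral of D^s converge
  absolutely, and integrability gives decay for large times. \<open>S\<close> and \<open>L\<close>
  serve convergence; the quantitative bounds obtained at the end do not contain them.\<close>

locale lipschitz_test =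
  fixes \<phi> :: "'a::euclidean_space \<Rightarrow> real" and S L s :: real
  assumes s: "0 < s" "s < 1"
    and bdd: "\<And>x. \<bar>\<phi> x\<bar> \<le> S"
    and lip: "\<And>x y. \<bar>\<phi> x - \<phi> y\<bar> \<le> L * norm (x - y)"
    and int: "integrable lborel \<phi>"
begin

abbreviation "a \<equiv> (1 + s) / 2"

lemma phi_measurable [measurable]: "\<phi> \<in> borel_measurable borel"
  using borel_measurable_integrable[OF int] by simp

lemma S_nonneg: "0 \<le> S" using bdd[of 0] by linarith

lemma L_nonneg: "0 \<le> L"
proof -
  obtain b :: 'a where "b \<in> Basis" using nonempty_Basis by blast
  then show ?thesis using lip[of b 0] by (simp add: norm_Basis)
qed

lemma mass_pos: "0 < gauss_mass TYPE('a)" by (rule gauss_mass_pos)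

lemma bd_pos: "0 < gauss_bd TYPE('a)" by (rule gauss_bd_pos)

text \<open>Up to a constant this bounds increments averaged against
  \<open>gauss_vec \<tau>\<close>: the Lipschitz condition wins at short times, boundedness at long
  ones. Since \<open>1 / 2 < a < 1\<close>, the product with \<open>\<tau> powr (- a)\<close> is
  integrable at both ends.\<close>

definition inc :: "real \<Rightarrow> real" where
  "inc \<tau> = min L (2 * S * \<tau> powr (- 1 / 2))"

lemma inc_nonneg: "0 \<le> inc \<tau>" using L_nonneg S_nonneg unfolding inc_def by simp

lemma inc_measurable [measurable]: "inc \<in> borel_measurable borel"
  unfolding inc_def by measurable

lemma nn_integral_increment:
  assumes \<tau>: "0 < \<tau>"
  shows "(\<integral>\<^sup>+v. ennreal (\<bar>\<phi> x - \<phi> (x - v)\<bar> * norm (gauss_vec \<tau> v)) \<partial>lborel) \<le> ennreal (gauss_bd TYPE('a) * gauss_mass TYPE('a) * inc \<tau>)"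
proof -
  have le: "\<bar>\<phi> x - \<phi> (x - v)\<bar> * norm (gauss_vec \<tau> v) \<le> inc \<tau> * gauss_bd TYPE('a) * gauss (2 * \<tau>) v" for v
  proof -
    have "\<bar>\<phi> x - \<phi> (x - v)\<bar> * norm (gauss_vec \<tau> v) \<le> L * (norm v * norm (gauss_vec \<tau> v))"
      using lip[of x "x - v"] by (simp add: mult.assoc[symmetric] mult_right_mono)
    also have "\<dots> \<le> L * (gauss_bd TYPE('a) * gauss (2 * \<tau>) v)"
      by (intro mult_left_mono norm_mult_gauss_vec_le \<tau> L_nonneg)
    finally have 1: "\<bar>\<phi> x - \<phi> (x - v)\<bar> * norm (gauss_vec \<tau> v) \<le> L * (gauss_bd TYPE('a) * gauss (2 * \<tau>) v)" .
    have "\<bar>\<phi> x - \<phi> (x - v)\<bar> \<le> 2 * S" using bdd[of x] bdd[of "x - v"] by linarith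
    then have "\<bar>\<phi> x - \<phi> (x - v)\<bar> * norm (gauss_vec \<tau> v) \<le> (2 * S) * (gauss_bd TYPE('a) * \<tau> powr (- 1 / 2) * gauss (2 * \<tau>) v)"
      by (intro mult_mono norm_gauss_vec_le \<tau>) (use S_nonneg in auto)
    then have 2: "\<bar>\<phi> x - \<phi> (x - v)\<bar> * norm (gauss_vec \<tau> v) \<le> (2 * S * \<tau> powr (- 1 / 2)) * (gauss_bd TYPE('a) * gauss (2 * \<tau>) v)"
      by (simp add: algebra_simps)
    show ?thesis using 1 2 unfolding inc_def by (simp add: min_def)
  qed
  have "(\<integral>\<^sup>+v. ennreal (\<bar>\<phi> x - \<phi> (x - v)\<bar> * norm (gauss_vec \<tau> v)) \<partial>lborel)
    \<le> (\<integral>\<^sup>+v. ennreal (inc \<tau> * gauss_bd TYPE('a)) * ennreal (gauss (2 * \<tau>) (v::'a)) \<partial>lborel)"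
    using le inc_nonneg bd_pos by (intro nn_integral_mono) (simp add: ennreal_mult'[symmetric] ennreal_leI)
  also have "\<dots> = ennreal (inc \<tau> * gauss_bd TYPE('a)) * ennreal (gauss_mass TYPE('a))"
    using \<tau> by (subst nn_integral_cmult) (auto simp: nn_integral_gauss)
  also have "\<dots> = ennreal (gauss_bd TYPE('a) * gauss_mass TYPE('a) * inc \<tau>)"
    using inc_nonneg bd_pos mass_pos by (simp add: ennreal_mult'[symmetric] algebra_simps)
  finally show ?thesis .
qed

lemma nn_integral_inc: "(\<integral>\<^sup>+\<tau>. ennreal (indicator {0<..} \<tau> * (\<tau> powr (- a) * inc \<tau>)) \<partial>lborel) < \<infinity>"
proof -
  have le: "indicator {0<..} \<tau> * (\<tau> powr (- a) * inc \<tau>)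
      \<le> L * (indicator {0<..1} \<tau> * \<tau> powr (- a)) + (2 * S) * (indicator {1..} \<tau> * \<tau> powr (- a - 1 / 2))" for \<tau> :: real
  proof -
    have 1: "\<tau> powr (- a) * inc \<tau> \<le> L * \<tau> powr (- a)"
      using mult_right_mono[of "inc \<tau>" L "\<tau> powr (- a)"] unfolding inc_def by (simp add: mult.commute)
    have "\<tau> powr (- a) * inc \<tau> \<le> \<tau> powr (- a) * (2 * S * \<tau> powr (- 1 / 2))"
      unfolding inc_def by (intro mult_left_mono) auto
    also have "\<dots> = (2 * S) * \<tau> powr (- a - 1 / 2)"
      by (simp add: powr_add[of \<tau> "- a" "- 1 / 2", simplified])
    finally show ?thesis using 1 S_nonneg L_nonneg by (auto split: split_indicator)
  qed
  have "(\<integral>\<^sup>+\<tau>. ennreal (indicator {0<..} \<tau> * (\<tau> powr (- a) * inc \<tau>)) \<partial>lborel)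
    \<le> (\<integral>\<^sup>+\<tau>. ennreal L * ennreal (indicator {0<..1} \<tau> * \<tau> powr (- a)) + ennreal (2 * S) * ennreal (indicator {1..} \<tau> * \<tau> powr (- a - 1 / 2)) \<partial>lborel)"
    using le L_nonneg S_nonneg by (intro nn_integral_mono) (simp add: ennreal_mult'[symmetric] ennreal_plus[symmetric] ennreal_leI del: ennreal_plus)
  also have "\<dots> = ennreal L * (\<integral>\<^sup>+\<tau>. ennreal (indicator {0<..1} \<tau> * \<tau> powr (- a)) \<partial>lborel)
      + ennreal (2 * S) * (\<integral>\<^sup>+\<tau>. ennreal (indicator {1..} \<tau> * \<tau> powr (- a - 1 / 2)) \<partial>lborel)"
    by (subst nn_integral_add) (auto simp: nn_integral_cmult)
  also have "\<dots> < \<infinity>"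
  proof -
    have e: "-1 < - a" "- a - 1 / 2 < -1" using s by (auto simp: field_simps)
    show ?thesis
      unfolding nn_integral_powr_from_0[OF e(1) zero_le_one] nn_integral_powr_to_inf[OF e(2) zero_less_one]
      by (simp add: ennreal_mult_less_top)
  qed
  finally show ?thesis .
qed

section \<open>The fractional gradient as a superposition of Gaussian convolutions\<close>

definition vconv :: "real \<Rightarrow> 'a \<Rightarrow> 'a" where
  "vconv \<tau> x = (LINT v|lborel. \<phi> (x - v) *\<^sub>R gauss_vec \<tau> v)"

lemma vconv_measurable [measurable (raw)]:
  assumes [measurable]: "f \<in> borel_measurable M" "g \<in> borel_measurable M"
  shows "(\<lambda>z. vconv (f z) (g z)) \<in> borel_measurable M"
  unfolding vconv_def by measurable

lemma integrable_vconv: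
  assumes \<tau>: "0 < \<tau>" shows "integrable lborel (\<lambda>v. \<phi> (x - v) *\<^sub>R gauss_vec \<tau> v)"
proof (rule Bochner_Integration.integrable_bound)
  show "integrable lborel (\<lambda>v. S *\<^sub>R gauss_vec \<tau> (v::'a))" using \<tau> by simp
  show "AE v in lborel. norm (\<phi> (x - v) *\<^sub>R gauss_vec \<tau> v) \<le> norm (S *\<^sub>R gauss_vec \<tau> v)"
    using bdd S_nonneg by (intro AE_I2) (simp add: mult_right_mono)
qed measurable

text \<open>\<open>gauss_vec\<close> is odd, so the constant \<open>\<phi> x\<close> contributes
  nothing at a fixed time.\<close>

lemma vconv_increment:
  assumes \<tau>: "0 < \<tau>"
  shows "(LINT v|lborel. (\<phi> x - \<phi> (x - v)) *\<^sub>R gauss_vec \<tau> v) = - vconv \<tau> x"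
proof -
  have "(LINT v|lborel. gauss_vec \<tau> (v::'a)) = 0" by (rule integral_lborel_odd) auto
  then show ?thesis
    unfolding vconv_def using integrable_vconv[OF \<tau>] \<tau> by (simp add: scaleR_diff_left)
qed

lemma norm_vconv_le:
  assumes \<tau>: "0 < \<tau>"
  shows "norm (vconv \<tau> x) \<le> gauss_bd TYPE('a) * gauss_mass TYPE('a) * inc \<tau>"
proof -
  have "ennreal (norm (LINT v|lborel. (\<phi> x - \<phi> (x - v)) *\<^sub>R gauss_vec \<tau> v))
    \<le> (\<integral>\<^sup>+v. ennreal (norm ((\<phi> x - \<phi> (x - v)) *\<^sub>R gauss_vec \<tau> v)) \<partial>lborel)"
    by (rule integral_norm_bound_ennreal)
      (use integrable_vconv[OF \<tau>] \<tau> in \<open>auto simp: scaleR_diff_left\<close>)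
  also have "\<dots> \<le> ennreal (gauss_bd TYPE('a) * gauss_mass TYPE('a) * inc \<tau>)"
    using nn_integral_increment[OF \<tau>, of x] by simp
  finally show ?thesis
    unfolding vconv_increment[OF \<tau>] using bd_pos mass_pos inc_nonneg by (simp add: ennreal_le_iff)
qed

definition kappa :: real where "kappa = power_kernel_const ((1 + s + real DIM('a)) / 2)"

lemma kappa_pos: "0 < kappa"
  unfolding kappa_def using s by (intro power_kernel_const_pos) auto

text \<open>The order of the steps matters. The integrals are exchanged while the increments are
  still present, because near \<open>\<tau> = 0\<close> it is the increments that give absolute
  convergence. The constant \<open>\<phi> x\<close> is dropped afterwards, at each fixed
  time.\<close>

lemma riesz_gradient_eq:
  "riesz_gradient s \<phi> x =
    - (riesz_const (real DIM('a)) s / kappa) *\<^sub>R (LINT \<tau>|lborel. indicator {0<..} \<tau> *\<^sub>R (\<tau> powr (- a) *\<^sub>R vconv \<tau> x))"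
proof -
  let ?k = "\<lambda>\<tau> v. indicator {0<..} \<tau> *\<^sub>R (\<tau> powr (- a) *\<^sub>R gauss_vec \<tau> v) :: 'a"
  let ?g = "\<lambda>\<tau> v. (\<phi> x - \<phi> (x - v)) *\<^sub>R ?k \<tau> v"
  define J where "J v = (\<phi> x - \<phi> (x - v)) *\<^sub>R (norm v powr (- (real DIM('a) + s + 1)) *\<^sub>R v)" for v
  have [measurable]: "J \<in> borel_measurable borel" unfolding J_def by measurable
  have Jeq: "((\<phi> x - \<phi> y) / norm (x - y) powr (real DIM('a) + s)) *\<^sub>R ((x - y) /\<^sub>R norm (x - y)) = J (x - y)" for y
  proof (cases "x = y")
    case False
    have "norm (x - y) powr (- (real DIM('a) + s + 1)) = 1 / norm (x - y) powr (real DIM('a) + s) * inverse (norm (x - y))"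
    proof -
      have "- (real DIM('a) + s + 1) = - (real DIM('a) + s) + (- 1)" by simp
      then have "norm (x - y) powr (- (real DIM('a) + s + 1)) = norm (x - y) powr (- (real DIM('a) + s)) * norm (x - y) powr (- 1)"
        by (simp only: powr_add)
      then show ?thesis using False powr_minus_divide[of "norm (x - y)" "real DIM('a) + s"] powr_minus_divide[of "norm (x - y)" 1]
        by (simp add: divide_inverse)
    qed
    then show ?thesis unfolding J_def by simp
  qed (simp add: J_def)
  have "(LINT y|lebesgue. ((\<phi> x - \<phi> y) / norm (x - y) powr (real DIM('a) + s)) *\<^sub>R ((x - y) /\<^sub>R norm (x - y)))
    = (LINT y|lborel. J (x - y))"
    unfolding Jeq by (subst integral_completion) auto
  also have "\<dots> = (LINT v|lborel. J v)"
    using integral_lborel_affine[of J "-1" x] by simp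
  also have "\<dots> = (LINT v|lborel. inverse kappa *\<^sub>R (LINT \<tau>|lborel. ?g \<tau> v))"
  proof (intro Bochner_Integration.integral_cong refl)
    fix v
    have "(LINT \<tau>|lborel. ?g \<tau> v) = (\<phi> x - \<phi> (x - v)) *\<^sub>R (LINT \<tau>|lborel. ?k \<tau> v)"
      by (rule integral_scaleR_right)
    also have "(LINT \<tau>|lborel. ?k \<tau> v) = kappa *\<^sub>R (norm v powr (- (real DIM('a) + s + 1)) *\<^sub>R v)"
      unfolding kappa_def by (rule has_bochner_integral_integral_eq[OF has_bochner_integral_powr_gauss_vec[OF s(1)]])
    finally have "(LINT \<tau>|lborel. ?g \<tau> v) = (\<phi> x - \<phi> (x - v)) *\<^sub>R (kappa *\<^sub>R (norm v powr (- (real DIM('a) + s + 1)) *\<^sub>R v))" .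
    then show "J v = inverse kappa *\<^sub>R (LINT \<tau>|lborel. ?g \<tau> v)"
      unfolding J_def using kappa_pos by simp
  qed
  also have "\<dots> = inverse kappa *\<^sub>R (LINT v|lborel. (LINT \<tau>|lborel. ?g \<tau> v))" by simp
  also have "(LINT v|lborel. (LINT \<tau>|lborel. ?g \<tau> v)) = (LINT \<tau>|lborel. (LINT v|lborel. ?g \<tau> v))"
  proof (rule lborel_Fubini(1)[symmetric])
    have "(\<integral>\<^sup>+\<tau>. (\<integral>\<^sup>+v. ennreal (norm (?g \<tau> v)) \<partial>lborel) \<partial>lborel)
      \<le> (\<integral>\<^sup>+\<tau>. ennreal (gauss_bd TYPE('a) * gauss_mass TYPE('a)) * ennreal (indicator {0<..} \<tau> * (\<tau> powr (- a) * inc \<tau>)) \<partial>lborel)"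
    proof (intro nn_integral_mono)
      fix \<tau> :: real
      show "(\<integral>\<^sup>+v. ennreal (norm (?g \<tau> v)) \<partial>lborel) \<le> ennreal (gauss_bd TYPE('a) * gauss_mass TYPE('a)) * ennreal (indicator {0<..} \<tau> * (\<tau> powr (- a) * inc \<tau>))"
      proof (cases "\<tau> > 0")
        case True
        have "(\<integral>\<^sup>+v. ennreal (norm (?g \<tau> v)) \<partial>lborel)
          = (\<integral>\<^sup>+v. ennreal (\<tau> powr (- a)) * ennreal (\<bar>\<phi> x - \<phi> (x - v)\<bar> * norm (gauss_vec \<tau> v)) \<partial>lborel)"
          using True by (intro nn_integral_cong) (simp add: ennreal_mult'[symmetric] abs_mult mult.left_commute)
        also have "\<dots> \<le> ennreal (\<tau> powr (- a)) * ennreal (gauss_bd TYPE('a) * gauss_mass TYPE('a) * inc \<tau>)"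
          by (subst nn_integral_cmult) (auto intro!: mult_left_mono nn_integral_increment True)
        also have "\<dots> = ennreal (gauss_bd TYPE('a) * gauss_mass TYPE('a)) * ennreal (indicator {0<..} \<tau> * (\<tau> powr (- a) * inc \<tau>))"
          using True bd_pos mass_pos inc_nonneg by (simp add: ennreal_mult'[symmetric] mult.left_commute mult.commute)
        finally show ?thesis .
      qed simp
    qed
    also have "\<dots> < \<infinity>"
      using nn_integral_inc by (subst nn_integral_cmult) (auto simp: ennreal_mult_less_top)
    finally show "(\<integral>\<^sup>+\<tau>. (\<integral>\<^sup>+v. ennreal (norm (?g \<tau> v)) \<partial>lborel) \<partial>lborel) < \<infinity>" .
  qed measurable
  also have "\<dots> = (LINT \<tau>|lborel. - (indicator {0<..} \<tau> *\<^sub>R (\<tau> powr (- a) *\<^sub>R vconv \<tau> x)))"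
  proof (intro Bochner_Integration.integral_cong refl)
    fix \<tau> :: real
    show "(LINT v|lborel. ?g \<tau> v) = - (indicator {0<..} \<tau> *\<^sub>R (\<tau> powr (- a) *\<^sub>R vconv \<tau> x))"
    proof (cases "\<tau> > 0")
      case True
      have "(LINT v|lborel. ?g \<tau> v) = (LINT v|lborel. \<tau> powr (- a) *\<^sub>R ((\<phi> x - \<phi> (x - v)) *\<^sub>R gauss_vec \<tau> v))"
        using True by (intro Bochner_Integration.integral_cong) (auto simp: mult.commute)
      also have "\<dots> = \<tau> powr (- a) *\<^sub>R (- vconv \<tau> x)"
        unfolding integral_scaleR_right vconv_increment[OF True] ..
      finally show ?thesis using True by simp
    qed simp
  qed
  also have "\<dots> = - (LINT \<tau>|lborel. indicator {0<..} \<tau> *\<^sub>R (\<tau> powr (- a) *\<^sub>R vconv \<tau> x))"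
    by (rule Bochner_Integration.integral_minus)
  finally have "(LINT y|lebesgue. ((\<phi> x - \<phi> y) / norm (x - y) powr (real DIM('a) + s)) *\<^sub>R ((x - y) /\<^sub>R norm (x - y)))
    = inverse kappa *\<^sub>R - (LINT \<tau>|lborel. indicator {0<..} \<tau> *\<^sub>R (\<tau> powr (- a) *\<^sub>R vconv \<tau> x))" .
  then show ?thesis
    unfolding riesz_gradient_def
    by (simp only: scaleR_minus_right scaleR_minus_left scaleR_scaleR divide_inverse)
qed

lemma riesz_gradient_measurable [measurable]: "riesz_gradient s \<phi> \<in> borel_measurable borel"
proof -
  have "(\<lambda>x. - (riesz_const (real DIM('a)) s / kappa) *\<^sub>R (LINT \<tau>|lborel. indicator {0<..} \<tau> *\<^sub>R (\<tau> powr (- a) *\<^sub>R vconv \<tau> x)))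
     \<in> borel_measurable borel" by measurable
  moreover have "riesz_gradient s \<phi> = (\<lambda>x. - (riesz_const (real DIM('a)) s / kappa) *\<^sub>R (LINT \<tau>|lborel. indicator {0<..} \<tau> *\<^sub>R (\<tau> powr (- a) *\<^sub>R vconv \<tau> x)))"
    by (rule ext) (rule riesz_gradient_eq)
  ultimately show ?thesis by (simp only:)
qed

section \<open>Abel's integral equation for the smoothed gradient\<close>

definition dconv :: "real \<Rightarrow> 'a \<Rightarrow> real" where
  "dconv w x = (LINT z|lborel. gauss_dt w (x - z) * \<phi> z)"

definition heat :: "real \<Rightarrow> 'a \<Rightarrow> real" where
  "heat t x = (LINT z|lborel. gauss t (x - z) * \<phi> z)"

lemma dconv_measurable [measurable (raw)]:
  assumes [measurable]: "f \<in> borel_measurable M" "g \<in> borel_measurable M"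
  shows "(\<lambda>z. dconv (f z) (g z)) \<in> borel_measurable M"
  unfolding dconv_def by measurable

lemma heat_measurable [measurable (raw)]:
  assumes [measurable]: "f \<in> borel_measurable M" "g \<in> borel_measurable M"
  shows "(\<lambda>z. heat (f z) (g z)) \<in> borel_measurable M"
  unfolding heat_def by measurable

text \<open>After Fubini, a translation by \<open>z\<close> brings the inner integral into the form
  of the composition law at \<open>x - z\<close>. Absolute convergence comes from the supremum of
  one kernel, the mass of the other and the integrability of \<open>\<phi>\<close>.\<close>

lemma integral_gauss_vec_vconv:
  assumes r: "0 < r" and \<tau>: "0 < \<tau>"
  shows "(LINT y|lborel. gauss_vec r (x - y) \<bullet> vconv \<tau> y) = gauss_mass TYPE('a) * dconv (r + \<tau>) x"
proof -
  let ?f = "\<lambda>y z. \<phi> z * (gauss_vec r (x - y) \<bullet> gauss_vec \<tau> (y - z))"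
  have v: "vconv \<tau> y = (LINT z|lborel. \<phi> z *\<^sub>R gauss_vec \<tau> (y - z))"
    and vi: "integrable lborel (\<lambda>z. \<phi> z *\<^sub>R gauss_vec \<tau> (y - z))" for y
    using integral_lborel_affine[of "\<lambda>v. \<phi> (y - v) *\<^sub>R gauss_vec \<tau> v" "-1" y]
      integrable_lborel_affine_iff[of "\<lambda>v. \<phi> (y - v) *\<^sub>R gauss_vec \<tau> v" "-1" y] integrable_vconv[OF \<tau>, of y]
    unfolding vconv_def by simp_all
  have "(LINT y|lborel. gauss_vec r (x - y) \<bullet> vconv \<tau> y) = (LINT y|lborel. (LINT z|lborel. ?f y z))"
    unfolding v using vi by (intro Bochner_Integration.integral_cong refl) (simp flip: integral_inner_right)
  also have "\<dots> = (LINT z|lborel. (LINT y|lborel. ?f y z))"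
  proof (rule lborel_Fubini(1))
    let ?G = "gauss_bd TYPE('a) * r powr (- 1 / 2)" and ?S = "gauss_bd TYPE('a) * \<tau> powr (- 1 / 2 - real DIM('a) / 2)"
    have "(\<integral>\<^sup>+y. (\<integral>\<^sup>+z. ennreal (norm (?f y z)) \<partial>lborel) \<partial>lborel)
      \<le> (\<integral>\<^sup>+y. ennreal (?G * ?S) * (\<integral>\<^sup>+z. ennreal \<bar>\<phi> z\<bar> \<partial>lborel) * ennreal (gauss (2 * r) (x - y)) \<partial>lborel)"
    proof (intro nn_integral_mono)
      fix y
      have "norm (?f y z) \<le> ?G * gauss (2 * r) (x - y) * ?S * \<bar>\<phi> z\<bar>" for z
      proof -
        have "\<bar>gauss_vec r (x - y) \<bullet> gauss_vec \<tau> (y - z)\<bar> \<le> norm (gauss_vec r (x - y)) * norm (gauss_vec \<tau> (y - z))"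
          by (rule Cauchy_Schwarz_ineq2)
        also have "\<dots> \<le> (?G * gauss (2 * r) (x - y)) * ?S"
          by (intro mult_mono norm_gauss_vec_le norm_gauss_vec_le_sup r \<tau>) (use bd_pos in auto)
        finally have "\<bar>gauss_vec r (x - y) \<bullet> gauss_vec \<tau> (y - z)\<bar> \<le> (?G * gauss (2 * r) (x - y)) * ?S" .
        from mult_left_mono[OF this abs_ge_zero[of "\<phi> z"]]
        show ?thesis by (simp add: abs_mult algebra_simps)
      qed
      then have "(\<integral>\<^sup>+z. ennreal (norm (?f y z)) \<partial>lborel) \<le> (\<integral>\<^sup>+z. ennreal (?G * gauss (2 * r) (x - y) * ?S) * ennreal \<bar>\<phi> z\<bar> \<partial>lborel)"
        using bd_pos by (intro nn_integral_mono) (simp add: ennreal_mult'[symmetric] ennreal_leI)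
      also have "\<dots> = ennreal (?G * ?S) * (\<integral>\<^sup>+z. ennreal \<bar>\<phi> z\<bar> \<partial>lborel) * ennreal (gauss (2 * r) (x - y))"
        using bd_pos by (subst nn_integral_cmult) (auto simp: ennreal_mult' algebra_simps)
      finally show "(\<integral>\<^sup>+z. ennreal (norm (?f y z)) \<partial>lborel) \<le> ennreal (?G * ?S) * (\<integral>\<^sup>+z. ennreal \<bar>\<phi> z\<bar> \<partial>lborel) * ennreal (gauss (2 * r) (x - y))" .
    qed
    also have "\<dots> = ennreal (?G * ?S) * (\<integral>\<^sup>+z. ennreal \<bar>\<phi> z\<bar> \<partial>lborel) * ennreal (gauss_mass TYPE('a))"
      using r by (subst nn_integral_cmult) (auto simp: nn_integral_gauss_shift)
    also have "\<dots> < \<infinity>"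
      using int by (simp add: ennreal_mult_less_top integrable_iff_bounded)
    finally show "(\<integral>\<^sup>+y. (\<integral>\<^sup>+z. ennreal (norm (?f y z)) \<partial>lborel) \<partial>lborel) < \<infinity>" .
  qed measurable
  also have "\<dots> = (LINT z|lborel. gauss_mass TYPE('a) * (gauss_dt (r + \<tau>) (x - z) * \<phi> z))"
  proof (intro Bochner_Integration.integral_cong refl)
    fix z
    have "(LINT y|lborel. gauss_vec r (x - y) \<bullet> gauss_vec \<tau> (y - z))
      = (LINT \<eta>|lborel. gauss_vec r ((x - z) - \<eta>) \<bullet> gauss_vec \<tau> \<eta>)"
      using integral_lborel_affine[of "\<lambda>y. gauss_vec r (x - y) \<bullet> gauss_vec \<tau> (y - z)" 1 z]
      by (simp add: algebra_simps)
    also have "\<dots> = gauss_mass TYPE('a) * gauss_dt (r + \<tau>) (x - z)"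
      using has_bochner_integral_integral_eq[OF has_bochner_integral_gauss_vec_conv[OF r \<tau>]] .
    finally show "(LINT y|lborel. ?f y z) = gauss_mass TYPE('a) * (gauss_dt (r + \<tau>) (x - z) * \<phi> z)" by simp
  qed
  finally show ?thesis unfolding dconv_def by simp
qed

lemma integrable_powr_vconv: "integrable lborel (\<lambda>\<tau>. indicator {0<..} \<tau> *\<^sub>R (\<tau> powr (- a) *\<^sub>R vconv \<tau> x))"
proof (rule Bochner_Integration.integrable_bound)
  have le: "norm (indicator {0<..} \<tau> *\<^sub>R (\<tau> powr (- a) *\<^sub>R vconv \<tau> x)) \<le> gauss_bd TYPE('a) * gauss_mass TYPE('a) * (indicator {0<..} \<tau> * (\<tau> powr (- a) * inc \<tau>))" for \<tau>
    using mult_left_mono[OF norm_vconv_le[of \<tau> x], of "\<tau> powr (- a)"]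
    by (simp add: mult.left_commute split: split_indicator)
  show "integrable lborel (\<lambda>\<tau>. gauss_bd TYPE('a) * gauss_mass TYPE('a) * (indicator {0<..} \<tau> * (\<tau> powr (- a) * inc \<tau>)))"
    using nn_integral_inc inc_nonneg by (intro integrable_mult_right integrableI_nonneg) auto
  show "AE \<tau> in lborel. norm (indicator {0<..} \<tau> *\<^sub>R (\<tau> powr (- a) *\<^sub>R vconv \<tau> x)) \<le> norm (gauss_bd TYPE('a) * gauss_mass TYPE('a) * (indicator {0<..} \<tau> * (\<tau> powr (- a) * inc \<tau>)))"
    using order_trans[OF le abs_ge_self] by (intro AE_I2) (simp only: real_norm_def)
qed measurable

text \<open>Up to the factor -1/2 this is the divergence of the fractional gradient averaged with a
  Gaussian.\<close>

definition hgrad :: "real \<Rightarrow> 'a \<Rightarrow> real" where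
  "hgrad r x = (LINT y|lborel. gauss_vec r (x - y) \<bullet> riesz_gradient s \<phi> y)"

lemma hgrad_measurable [measurable (raw)]:
  assumes [measurable]: "f \<in> borel_measurable M" "g \<in> borel_measurable M"
  shows "(\<lambda>z. hgrad (f z) (g z)) \<in> borel_measurable M"
  unfolding hgrad_def by measurable

text \<open>The composition law turns the convolution with \<open>vconv \<tau>\<close> into a time
  derivative at \<open>r + \<tau>\<close>. What remains is, up to constants, the fractional integral
  of order \<open>1 - a\<close> of \<open>dconv\<close> started at \<open>r\<close>, the form that
  \<open>Abel_integral\<close> inverts.\<close>

lemma hgrad_eq:
  assumes r: "0 < r"
  shows "hgrad r x = - (riesz_const (real DIM('a)) s / kappa * gauss_mass TYPE('a)) *
    (LINT \<tau>|lborel. indicator {0<..} \<tau> * (\<tau> powr (- a) * dconv (r + \<tau>) x))"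
proof -
  let ?W = "\<lambda>\<tau> y. indicator {0<..} \<tau> *\<^sub>R (\<tau> powr (- a) *\<^sub>R vconv \<tau> y)"
  let ?f = "\<lambda>y \<tau>. gauss_vec r (x - y) \<bullet> ?W \<tau> y"
  let ?M = "(\<integral>\<^sup>+\<tau>. ennreal (indicator {0<..} \<tau> * (\<tau> powr (- a) * inc \<tau>)) \<partial>lborel)"
  have Wle: "norm (?W \<tau> y) \<le> gauss_bd TYPE('a) * gauss_mass TYPE('a) * (indicator {0<..} \<tau> * (\<tau> powr (- a) * inc \<tau>))" for \<tau> y
    using mult_left_mono[OF norm_vconv_le[of \<tau> y], of "\<tau> powr (- a)"]
    by (simp add: mult.left_commute split: split_indicator)
  have "hgrad r x = (LINT y|lborel. - (riesz_const (real DIM('a)) s / kappa) * (LINT \<tau>|lborel. ?f y \<tau>))"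
    unfolding hgrad_def riesz_gradient_eq using integrable_powr_vconv
    by (intro Bochner_Integration.integral_cong refl) (simp flip: integral_inner_right)
  also have "\<dots> = - (riesz_const (real DIM('a)) s / kappa) * (LINT y|lborel. (LINT \<tau>|lborel. ?f y \<tau>))" by simp
  also have "(LINT y|lborel. (LINT \<tau>|lborel. ?f y \<tau>)) = (LINT \<tau>|lborel. (LINT y|lborel. ?f y \<tau>))"
  proof (rule lborel_Fubini(1))
    let ?G = "gauss_bd TYPE('a) * r powr (- 1 / 2)"
    have "(\<integral>\<^sup>+y. (\<integral>\<^sup>+\<tau>. ennreal (norm (?f y \<tau>)) \<partial>lborel) \<partial>lborel)
      \<le> (\<integral>\<^sup>+y. ennreal (?G * (gauss_bd TYPE('a) * gauss_mass TYPE('a))) * ?M * ennreal (gauss (2 * r) (x - y)) \<partial>lborel)"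
    proof (intro nn_integral_mono)
      fix y
      have "norm (?f y \<tau>) \<le> (?G * (gauss_bd TYPE('a) * gauss_mass TYPE('a)) * gauss (2 * r) (x - y)) * (indicator {0<..} \<tau> * (\<tau> powr (- a) * inc \<tau>))" for \<tau>
      proof -
        have "norm (?f y \<tau>) \<le> norm (gauss_vec r (x - y)) * norm (?W \<tau> y)"
          unfolding real_norm_def by (rule Cauchy_Schwarz_ineq2)
        also have "\<dots> \<le> (?G * gauss (2 * r) (x - y)) * (gauss_bd TYPE('a) * gauss_mass TYPE('a) * (indicator {0<..} \<tau> * (\<tau> powr (- a) * inc \<tau>)))"
          by (intro mult_mono norm_gauss_vec_le r Wle) (use bd_pos in auto)
        finally show ?thesis by (simp add: algebra_simps)
      qed
      then have "(\<integral>\<^sup>+\<tau>. ennreal (norm (?f y \<tau>)) \<partial>lborel) \<le> (\<integral>\<^sup>+\<tau>. ennreal (?G * (gauss_bd TYPE('a) * gauss_mass TYPE('a)) * gauss (2 * r) (x - y)) * ennreal (indicator {0<..} \<tau> * (\<tau> powr (- a) * inc \<tau>)) \<partial>lborel)"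
        using bd_pos mass_pos by (intro nn_integral_mono) (simp add: ennreal_mult'[symmetric] ennreal_leI)
      also have "\<dots> = ennreal (?G * (gauss_bd TYPE('a) * gauss_mass TYPE('a))) * ?M * ennreal (gauss (2 * r) (x - y))"
        using bd_pos mass_pos by (subst nn_integral_cmult) (auto simp: ennreal_mult' algebra_simps)
      finally show "(\<integral>\<^sup>+\<tau>. ennreal (norm (?f y \<tau>)) \<partial>lborel) \<le> ennreal (?G * (gauss_bd TYPE('a) * gauss_mass TYPE('a))) * ?M * ennreal (gauss (2 * r) (x - y))" .
    qed
    also have "\<dots> = ennreal (?G * (gauss_bd TYPE('a) * gauss_mass TYPE('a))) * ?M * ennreal (gauss_mass TYPE('a))"
      using r by (subst nn_integral_cmult) (auto simp: nn_integral_gauss_shift)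
    also have "\<dots> < \<infinity>"
      using nn_integral_inc by (simp add: ennreal_mult_less_top)
    finally show "(\<integral>\<^sup>+y. (\<integral>\<^sup>+\<tau>. ennreal (norm (?f y \<tau>)) \<partial>lborel) \<partial>lborel) < \<infinity>" .
  qed measurable
  also have "\<dots> = (LINT \<tau>|lborel. gauss_mass TYPE('a) * (indicator {0<..} \<tau> * (\<tau> powr (- a) * dconv (r + \<tau>) x)))"
  proof (intro Bochner_Integration.integral_cong refl)
    fix \<tau> :: real
    show "(LINT y|lborel. ?f y \<tau>) = gauss_mass TYPE('a) * (indicator {0<..} \<tau> * (\<tau> powr (- a) * dconv (r + \<tau>) x))"
      using integral_gauss_vec_vconv[OF r, of \<tau> x] by (auto split: split_indicator)
  qed
  finally show ?thesis by (simp add: mult.assoc)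
qed

end

context lipschitz_test
begin

text \<open>Two regimes. For large \<open>w\<close>, integrability of \<open>\<phi>\<close> gives
  decay faster than \<open>1 / w\<close>. For small \<open>w\<close>, the kernel has mean 0, so
  \<open>\<phi>\<close> may be replaced by its increments, and the Lipschitz condition improves
  \<open>1 / w\<close> to \<open>w powr (- 1 / 2)\<close>.\<close>

lemma abs_dconv_le:
  assumes w: "0 < w"
  shows "\<bar>dconv w x\<bar> \<le> (1 + real DIM('a)) * gauss_bd TYPE('a) * w powr (- 1 - real DIM('a) / 2) * (LINT z|lborel. \<bar>\<phi> z\<bar>)"
    and "\<bar>dconv w x\<bar> \<le> (1 + real DIM('a)) * gauss_bd TYPE('a) * gauss_mass TYPE('a) * L * w powr (- 1 / 2)"
    and "integrable lborel (\<lambda>z. gauss_dt w (x - z) * \<phi> z)"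
proof -
  let ?K = "(1 + real DIM('a)) * gauss_bd TYPE('a)"
  have K: "0 < ?K" using bd_pos by simp
  have le: "\<bar>gauss_dt w (x - z) * \<phi> z\<bar> \<le> ?K * w powr (- 1 - real DIM('a) / 2) * \<bar>\<phi> z\<bar>" for z
    unfolding abs_mult by (intro mult_right_mono abs_gauss_dt_le_sup w) auto
  show i: "integrable lborel (\<lambda>z. gauss_dt w (x - z) * \<phi> z)"
  proof (rule Bochner_Integration.integrable_bound)
    show "integrable lborel (\<lambda>z. ?K * w powr (- 1 - real DIM('a) / 2) * \<bar>\<phi> z\<bar>)" using int by simp
    show "AE z in lborel. norm (gauss_dt w (x - z) * \<phi> z) \<le> norm (?K * w powr (- 1 - real DIM('a) / 2) * \<bar>\<phi> z\<bar>)"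
      using order_trans[OF le abs_ge_self] by (intro AE_I2) (simp only: real_norm_def)
  qed measurable
  have "\<bar>dconv w x\<bar> \<le> (LINT z|lborel. ?K * w powr (- 1 - real DIM('a) / 2) * \<bar>\<phi> z\<bar>)"
    unfolding dconv_def using i int le
    by (intro order_trans[OF integral_abs_bound] integral_mono integrable_abs) auto
  then show "\<bar>dconv w x\<bar> \<le> ?K * w powr (- 1 - real DIM('a) / 2) * (LINT z|lborel. \<bar>\<phi> z\<bar>)" by simp
  have z: "has_bochner_integral lborel (gauss_dt w :: 'a \<Rightarrow> real) 0" by (rule has_bochner_integral_gauss_dt[OF w])
  then have zi: "integrable lborel (\<lambda>z. gauss_dt w (x - z))" and z0: "(LINT z|lborel. gauss_dt w (x - z)) = 0"
    using integrable_lborel_affine_iff[of "gauss_dt w :: 'a \<Rightarrow> real" "-1" x] integral_lborel_affine[of "gauss_dt w :: 'a \<Rightarrow> real" "-1" x]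
    by (auto simp: has_bochner_integral_iff)
  have gi: "integrable lborel (\<lambda>z. gauss (2 * w) (x - z))" "(LINT z|lborel. gauss (2 * w) (x - z)) = gauss_mass TYPE('a)"
    using integrable_lborel_affine_iff[of "gauss (2 * w) :: 'a \<Rightarrow> real" "-1" x] integral_lborel_affine[of "gauss (2 * w) :: 'a \<Rightarrow> real" "-1" x] w
      integral_gauss[of "2 * w", where 'a='a] by auto
  have "dconv w x = (LINT z|lborel. gauss_dt w (x - z) * \<phi> z - gauss_dt w (x - z) * \<phi> x)"
    unfolding dconv_def using i zi z0 by simp
  also have "\<bar>\<dots>\<bar> \<le> (LINT z|lborel. L * (?K * w powr (- 1 / 2) * gauss (2 * w) (x - z)))"
  proof (intro order_trans[OF integral_abs_bound] integral_mono integrable_abs)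
    fix z
    have "\<bar>gauss_dt w (x - z) * \<phi> z - gauss_dt w (x - z) * \<phi> x\<bar> = \<bar>gauss_dt w (x - z)\<bar> * \<bar>\<phi> x - \<phi> z\<bar>"
      by (simp add: abs_mult[symmetric] algebra_simps abs_minus_commute)
    also have "\<dots> \<le> \<bar>gauss_dt w (x - z)\<bar> * (L * norm (x - z))" by (intro mult_left_mono lip) auto
    also have "\<dots> = L * (norm (x - z) * \<bar>gauss_dt w (x - z)\<bar>)" by simp
    also have "\<dots> \<le> L * (?K * w powr (- 1 / 2) * gauss (2 * w) (x - z))"
      by (intro mult_left_mono abs_gauss_dt_le(2) w L_nonneg)
    finally show "\<bar>gauss_dt w (x - z) * \<phi> z - gauss_dt w (x - z) * \<phi> x\<bar> \<le> L * (?K * w powr (- 1 / 2) * gauss (2 * w) (x - z))" .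
  qed (use i zi gi in auto)
  also have "\<dots> = ?K * gauss_mass TYPE('a) * L * w powr (- 1 / 2)" using gi by simp
  finally show "\<bar>dconv w x\<bar> \<le> ?K * gauss_mass TYPE('a) * L * w powr (- 1 / 2)" .
qed

lemma integrable_dconv: "integrable lborel (\<lambda>w. indicator {0<..} w * dconv w x)"
proof (rule integrableI_bounded)
  let ?K = "(1 + real DIM('a)) * gauss_bd TYPE('a)"
  define K1 where "K1 = ?K * gauss_mass TYPE('a) * L"
  define K2 where "K2 = ?K * (LINT z|lborel. \<bar>\<phi> z\<bar>)"
  have K: "0 \<le> K1" "0 \<le> K2" unfolding K1_def K2_def using bd_pos mass_pos L_nonneg by auto
  have le: "norm (indicator {0<..} w * dconv w x)
    \<le> K1 * (indicator {0<..1} w * w powr (- 1 / 2)) + K2 * (indicator {1..} w * w powr (- 1 - real DIM('a) / 2))" for w :: real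
  proof (cases "w > 0")
    case True
    have "\<bar>dconv w x\<bar> \<le> K1 * w powr (- 1 / 2)" "\<bar>dconv w x\<bar> \<le> K2 * w powr (- 1 - real DIM('a) / 2)"
      using abs_dconv_le(1,2)[OF True, of x] unfolding K1_def K2_def by (simp_all add: algebra_simps)
    then show ?thesis using True K by (auto split: split_indicator)
  qed (use K in \<open>auto split: split_indicator\<close>)
  have "(\<integral>\<^sup>+w. ennreal (norm (indicator {0<..} w * dconv w x)) \<partial>lborel)
    \<le> (\<integral>\<^sup>+w. ennreal K1 * ennreal (indicator {0<..1} w * w powr (- 1 / 2)) + ennreal K2 * ennreal (indicator {1..} w * w powr (- 1 - real DIM('a) / 2)) \<partial>lborel)"
    using le K by (intro nn_integral_mono) (simp add: ennreal_mult'[symmetric] ennreal_plus[symmetric] ennreal_leI del: ennreal_plus)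
  also have "\<dots> = ennreal K1 * (\<integral>\<^sup>+w. ennreal (indicator {0<..1} w * w powr (- 1 / 2)) \<partial>lborel)
      + ennreal K2 * (\<integral>\<^sup>+w. ennreal (indicator {1..} w * w powr (- 1 - real DIM('a) / 2)) \<partial>lborel)"
    by (subst nn_integral_add) (auto simp: nn_integral_cmult)
  also have "\<dots> < \<infinity>"
  proof -
    have e: "-1 < - 1 / (2::real)" "- 1 - real DIM('a) / 2 < -1" by auto
    show ?thesis
      unfolding nn_integral_powr_from_0[OF e(1) zero_le_one] nn_integral_powr_to_inf[OF e(2) zero_less_one]
      by (simp add: ennreal_mult_less_top)
  qed
  finally show "(\<integral>\<^sup>+w. ennreal (norm (indicator {0<..} w * dconv w x)) \<partial>lborel) < \<infinity>" .
qed measurable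

end

section \<open>Integration in time and the limit at time 0\<close>

lemma integral_gauss_dt_time:
  fixes z :: "'a::euclidean_space"
  assumes t: "0 < t"
  shows "has_bochner_integral lborel (\<lambda>w. indicator {t<..} w * gauss_dt w z) (- gauss t z)"
proof -
  have e: "einterval (ereal t) \<infinity> = {t<..}" by (auto simp: einterval_def)
  let ?K = "(1 + real DIM('a)) * gauss_bd TYPE('a)"
  have K: "0 < ?K" using gauss_bd_pos[where 'a='a] by simp
  have int: "integrable lborel (\<lambda>w. indicator {t<..} w * gauss_dt w z)"
  proof (rule integrableI_bounded)
    have le: "norm (indicator {t<..} w * gauss_dt w z) \<le> ?K * (indicator {t..} w * w powr (- 1 - real DIM('a) / 2))" for w :: real
    proof (cases "w > t")
      case True
      then have w: "w > 0" using t by simp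
      show ?thesis using abs_gauss_dt_le_sup[OF w, of z] True by simp
    qed (use K in simp)
    have "(\<integral>\<^sup>+w. ennreal (norm (indicator {t<..} w * gauss_dt w z)) \<partial>lborel)
      \<le> (\<integral>\<^sup>+w. ennreal ?K * ennreal (indicator {t..} w * w powr (- 1 - real DIM('a) / 2)) \<partial>lborel)"
      using le K by (intro nn_integral_mono) (simp add: ennreal_mult'[symmetric] ennreal_leI)
    also have "\<dots> = ennreal ?K * (\<integral>\<^sup>+w. ennreal (indicator {t..} w * w powr (- 1 - real DIM('a) / 2)) \<partial>lborel)"
      by (rule nn_integral_cmult) measurable
    also have "\<dots> < \<infinity>"
    proof -
      have e: "- 1 - real DIM('a) / 2 < -1" by auto
      show ?thesis unfolding nn_integral_powr_to_inf[OF e t] by (simp add: ennreal_mult_less_top)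
    qed
    finally show "(\<integral>\<^sup>+w. ennreal (norm (indicator {t<..} w * gauss_dt w z)) \<partial>lborel) < \<infinity>" .
  qed measurable
  have lim_t: "((\<lambda>w. gauss w z) \<longlongrightarrow> gauss t z) (at_right t)"
    using DERIV_isCont[OF DERIV_gauss_time[OF t, of z]] by (auto simp: isCont_def intro: tendsto_within_subset)
  have lim_inf: "((\<lambda>w. gauss w z) \<longlongrightarrow> 0) at_top"
  proof (rule tendsto_sandwich[OF _ _ tendsto_const])
    show "\<forall>\<^sub>F w in at_top. gauss w z \<le> w powr (- real DIM('a) / 2)"
      using eventually_gt_at_top[of 0] by eventually_elim (rule gauss_le)
    show "((\<lambda>w. w powr (- real DIM('a) / 2)) \<longlongrightarrow> 0) at_top"
      by (rule tendsto_neg_powr) (auto simp: filterlim_ident)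
  qed auto
  have "(LBINT w=ereal t..\<infinity>. gauss_dt w z) = 0 - gauss t z"
  proof (rule interval_integral_FTC_integrable[where F="\<lambda>w. gauss w z"])
    fix w assume "ereal t < ereal w"
    then have w: "0 < w" using t by simp
    show "((\<lambda>w. gauss w z) has_vector_derivative gauss_dt w z) (at w)"
      using DERIV_gauss_time[OF w, of z] by (simp add: has_real_derivative_iff_has_vector_derivative)
    show "isCont (\<lambda>w. gauss_dt w z) w"
      unfolding gauss_dt_def gauss_def using w by (intro continuous_intros) auto
  next
    show "set_integrable lborel (einterval (ereal t) \<infinity>) (\<lambda>w. gauss_dt w z)"
      unfolding e set_integrable_def using int by simp
    show "(((\<lambda>w. gauss w z) \<circ> real_of_ereal) \<longlongrightarrow> gauss t z) (at_right (ereal t))"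
      using lim_t by (simp add: ereal_tendsto_simps)
    show "(((\<lambda>w. gauss w z) \<circ> real_of_ereal) \<longlongrightarrow> 0) (at_left \<infinity>)"
      using lim_inf by (simp add: ereal_tendsto_simps)
  qed simp
  then have "(LINT w|lborel. indicator {t<..} w * gauss_dt w z) = - gauss t z"
    unfolding interval_lebesgue_integral_def set_lebesgue_integral_def e by simp
  then show ?thesis using int by (simp add: has_bochner_integral_iff)
qed

context lipschitz_test
begin

text \<open>Fubini is applied away from time 0, because the \<open>L^1\<close> norm of
  \<open>gauss_dt w\<close> grows like \<open>1 / w\<close> as \<open>w\<close> tends to 0.\<close>

lemma integral_dconv_tail:
  assumes t: "0 < t"
  shows "(LINT w|lborel. indicator {t<..} w * dconv w x) = - heat t x"
proof -
  let ?f = "\<lambda>w z. indicator {t<..} w * (gauss_dt w (x - z) * \<phi> z)"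
  let ?K = "(1 + real DIM('a)) * gauss_bd TYPE('a)"
  have K: "0 < ?K" using bd_pos by simp
  have "(LINT w|lborel. indicator {t<..} w * dconv w x) = (LINT w|lborel. (LINT z|lborel. ?f w z))"
    unfolding dconv_def by simp
  also have "\<dots> = (LINT z|lborel. (LINT w|lborel. ?f w z))"
  proof (rule lborel_Fubini(1))
    have "(\<integral>\<^sup>+w. (\<integral>\<^sup>+z. ennreal (norm (?f w z)) \<partial>lborel) \<partial>lborel)
      \<le> (\<integral>\<^sup>+w. ennreal ?K * (\<integral>\<^sup>+z. ennreal \<bar>\<phi> z\<bar> \<partial>lborel) * ennreal (indicator {t..} w * w powr (- 1 - real DIM('a) / 2)) \<partial>lborel)"
    proof (intro nn_integral_mono)
      fix w :: real
      have le: "norm (?f w z) \<le> (?K * (indicator {t..} w * w powr (- 1 - real DIM('a) / 2))) * \<bar>\<phi> z\<bar>" for z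
      proof (cases "w > t")
        case True
        then have w: "w > 0" using t by simp
        from mult_right_mono[OF abs_gauss_dt_le_sup[OF w, of "x - z"] abs_ge_zero[of "\<phi> z"]]
        show ?thesis using True by (simp add: abs_mult)
      qed (use K in simp)
      have "(\<integral>\<^sup>+z. ennreal (norm (?f w z)) \<partial>lborel) \<le> (\<integral>\<^sup>+z. ennreal (?K * (indicator {t..} w * w powr (- 1 - real DIM('a) / 2))) * ennreal \<bar>\<phi> z\<bar> \<partial>lborel)"
        using le K by (intro nn_integral_mono) (simp add: ennreal_mult'[symmetric] ennreal_leI)
      also have "\<dots> = ennreal (?K * (indicator {t..} w * w powr (- 1 - real DIM('a) / 2))) * (\<integral>\<^sup>+z. ennreal \<bar>\<phi> z\<bar> \<partial>lborel)"
        by (rule nn_integral_cmult) measurable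
      also have "ennreal (?K * (indicator {t..} w * w powr (- 1 - real DIM('a) / 2)))
          = ennreal ?K * ennreal (indicator {t..} w * w powr (- 1 - real DIM('a) / 2))"
        using K by (intro ennreal_mult) auto
      also have "\<dots> * (\<integral>\<^sup>+z. ennreal \<bar>\<phi> z\<bar> \<partial>lborel)
          = ennreal ?K * (\<integral>\<^sup>+z. ennreal \<bar>\<phi> z\<bar> \<partial>lborel) * ennreal (indicator {t..} w * w powr (- 1 - real DIM('a) / 2))"
        by (simp only: mult_ac)
      finally show "(\<integral>\<^sup>+z. ennreal (norm (?f w z)) \<partial>lborel) \<le> ennreal ?K * (\<integral>\<^sup>+z. ennreal \<bar>\<phi> z\<bar> \<partial>lborel) * ennreal (indicator {t..} w * w powr (- 1 - real DIM('a) / 2))" .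
    qed
    also have "\<dots> = ennreal ?K * (\<integral>\<^sup>+z. ennreal \<bar>\<phi> z\<bar> \<partial>lborel) * (\<integral>\<^sup>+w. ennreal (indicator {t..} w * w powr (- 1 - real DIM('a) / 2)) \<partial>lborel)"
      by (rule nn_integral_cmult) measurable
    also have "\<dots> < \<infinity>"
    proof -
      have e: "- 1 - real DIM('a) / 2 < -1" by auto
      show ?thesis unfolding nn_integral_powr_to_inf[OF e t] using int
        by (simp add: ennreal_mult_less_top integrable_iff_bounded)
    qed
    finally show "(\<integral>\<^sup>+w. (\<integral>\<^sup>+z. ennreal (norm (?f w z)) \<partial>lborel) \<partial>lborel) < \<infinity>" .
  qed measurable
  also have "\<dots> = (LINT z|lborel. - (gauss t (x - z) * \<phi> z))"
  proof (intro Bochner_Integration.integral_cong refl)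
    fix z
    have "(LINT w|lborel. ?f w z) = (LINT w|lborel. (indicator {t<..} w * gauss_dt w (x - z)) * \<phi> z)"
      by (simp add: mult.assoc)
    also have "\<dots> = - (gauss t (x - z) * \<phi> z)"
      using has_bochner_integral_integral_eq[OF integral_gauss_dt_time[OF t, of "x - z"]] by simp
    finally show "(LINT w|lborel. ?f w z) = - (gauss t (x - z) * \<phi> z)" .
  qed
  finally show ?thesis unfolding heat_def by simp
qed

lemma integrable_gauss_phi:
  assumes t: "0 < t" shows "integrable lborel (\<lambda>z. gauss t (x - z) * \<phi> z)"
proof (rule Bochner_Integration.integrable_bound)
  show "integrable lborel (\<lambda>z. t powr (- real DIM('a) / 2) * \<phi> z)" using int by simp
  show "AE z in lborel. norm (gauss t (x - z) * \<phi> z) \<le> norm (t powr (- real DIM('a) / 2) * \<phi> z)"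
    using gauss_le[OF t, of "x - z" for z] by (intro AE_I2) (simp add: abs_mult mult_right_mono)
qed measurable

text \<open>The kernel has total mass \<open>gauss_mass\<close>, so the difference is an average of
  increments. These are of size \<open>L * norm (x - z)\<close>, and the average distance at time
  \<open>t\<close> is of order \<open>sqrt t\<close>.\<close>

lemma heat_minus_le:
  assumes t: "0 < t"
  shows "\<bar>heat t x - gauss_mass TYPE('a) * \<phi> x\<bar> \<le> L * gauss_bd TYPE('a) * gauss_mass TYPE('a) * t powr (1 / 2)"
proof -
  have gi: "integrable lborel (\<lambda>z. gauss r (x - z))" "(LINT z|lborel. gauss r (x - z)) = gauss_mass TYPE('a)"
    if "0 < r" for r
    using integrable_lborel_affine_iff[of "gauss r :: 'a \<Rightarrow> real" "-1" x] integral_lborel_affine[of "gauss r :: 'a \<Rightarrow> real" "-1" x]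
      integral_gauss[of r, where 'a='a] that by auto
  have t2: "0 < 2 * t" using t by simp
  have "heat t x - gauss_mass TYPE('a) * \<phi> x = (LINT z|lborel. gauss t (x - z) * \<phi> z - gauss t (x - z) * \<phi> x)"
    unfolding heat_def using gi[OF t] integrable_gauss_phi[OF t, of x] by simp
  also have "\<bar>\<dots>\<bar> \<le> (LINT z|lborel. L * (gauss_bd TYPE('a) * t powr (1 / 2) * gauss (2 * t) (x - z)))"
  proof (intro order_trans[OF integral_abs_bound] integral_mono integrable_abs)
    fix z
    have "\<bar>gauss t (x - z) * \<phi> z - gauss t (x - z) * \<phi> x\<bar> = gauss t (x - z) * \<bar>\<phi> x - \<phi> z\<bar>"
      by (simp add: right_diff_distrib[symmetric] abs_mult abs_minus_commute)
    also have "\<dots> \<le> gauss t (x - z) * (L * norm (x - z))" by (intro mult_left_mono lip) auto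
    also have "\<dots> = L * (norm (x - z) ^ 1 * gauss t (x - z))" by simp
    also have "\<dots> \<le> L * (gauss_bd TYPE('a) * t powr (real 1 / 2) * gauss (2 * t) (x - z))"
      by (intro mult_left_mono norm_power_gauss_le t L_nonneg) auto
    finally show "\<bar>gauss t (x - z) * \<phi> z - gauss t (x - z) * \<phi> x\<bar> \<le> L * (gauss_bd TYPE('a) * t powr (1 / 2) * gauss (2 * t) (x - z))"
      by simp
  qed (use gi[OF t] gi[OF t2] integrable_gauss_phi[OF t, of x] in auto)
  also have "\<dots> = L * gauss_bd TYPE('a) * gauss_mass TYPE('a) * t powr (1 / 2)" using gi[OF t2] by simp
  finally show ?thesis .
qed

text \<open>The value \<open>heat 0 x\<close> is 0 because \<open>0 powr y = 0\<close>. The limit at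
  time 0 is \<open>gauss_mass\<close> times \<open>\<phi>\<close>, and this version takes that limit
  as its value.\<close>

definition heat0 :: "real \<Rightarrow> 'a \<Rightarrow> real" where
  "heat0 t x = (if t = 0 then gauss_mass TYPE('a) * \<phi> x else heat t x)"

text \<open>Time 0 is reached along \<open>e k\<close>: dominated convergence handles the time
  integrals, with the integrable function of \<open>integrable_dconv\<close>, and
  \<open>heat_minus_le\<close> identifies the limit of the heat means.\<close>

lemma integral_dconv:
  assumes t: "0 \<le> t"
  shows "(LINT w|lborel. indicator {t<..} w * dconv w x) = - heat0 t x"
proof (cases "t = 0")
  case False
  then show ?thesis using integral_dconv_tail[of t x] t by (simp add: heat0_def)
next
  case True
  define e where "e k = 1 / (real k + 1)" for k
  have e: "e k > 0" for k unfolding e_def by simp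
  have e0: "e \<longlonglongrightarrow> 0" unfolding e_def using LIMSEQ_inverse_real_of_nat by (simp add: inverse_eq_divide add.commute)
  have "(\<lambda>k. LINT w|lborel. indicator {e k<..} w * dconv w x) \<longlonglongrightarrow> (LINT w|lborel. indicator {0<..} w * dconv w x)"
  proof (rule integral_dominated_convergence)
    show "integrable lborel (\<lambda>w. norm (indicator {0<..} w * dconv w x))" using integrable_dconv by (rule integrable_norm)
    show "AE w in lborel. norm (indicator {e k<..} w * dconv w x) \<le> norm (indicator {0<..} w * dconv w x)" for k
      using e[of k] by (intro AE_I2) (auto split: split_indicator)
    show "AE w in lborel. (\<lambda>k. indicator {e k<..} w * dconv w x) \<longlonglongrightarrow> indicator {0<..} w * dconv w x"
    proof (rule AE_I2)
      fix w :: real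
      have "eventually (\<lambda>k. indicator {e k<..} w * dconv w x = indicator {0<..} w * dconv w x) sequentially"
      proof (cases "w > 0")
        case True
        have "eventually (\<lambda>k. e k < w) sequentially" using order_tendstoD(2)[OF e0 True] .
        then show ?thesis by eventually_elim (use True in simp)
      next
        case False
        then have "indicator {e k<..} w = (0::real)" for k using e[of k] by (auto split: split_indicator)
        then show ?thesis using False by simp
      qed
      then show "(\<lambda>k. indicator {e k<..} w * dconv w x) \<longlonglongrightarrow> indicator {0<..} w * dconv w x"
        by (rule tendsto_eventually)
    qed
  qed measurable
  then have 1: "(\<lambda>k. - heat (e k) x) \<longlonglongrightarrow> (LINT w|lborel. indicator {0<..} w * dconv w x)"
    by (simp add: integral_dconv_tail[OF e])
  have "(\<lambda>k. heat (e k) x - gauss_mass TYPE('a) * \<phi> x) \<longlonglongrightarrow> 0"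
  proof (rule Lim_null_comparison)
    show "\<forall>\<^sub>F k in sequentially. norm (heat (e k) x - gauss_mass TYPE('a) * \<phi> x) \<le> L * gauss_bd TYPE('a) * gauss_mass TYPE('a) * e k powr (1 / 2)"
      using heat_minus_le[OF e, of _ x] by (intro always_eventually allI) simp
    have "(\<lambda>k. e k powr (1 / 2)) \<longlonglongrightarrow> 0"
      using tendsto_powr'[OF e0 tendsto_const[of "1/2"]] less_imp_le[OF e] by simp
    then show "(\<lambda>k. L * gauss_bd TYPE('a) * gauss_mass TYPE('a) * e k powr (1 / 2)) \<longlonglongrightarrow> 0"
      using tendsto_mult_right_zero by blast
  qed
  then have "(\<lambda>k. heat (e k) x) \<longlonglongrightarrow> gauss_mass TYPE('a) * \<phi> x" by (simp add: LIM_zero_iff)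
  then have "(\<lambda>k. - heat (e k) x) \<longlonglongrightarrow> - (gauss_mass TYPE('a) * \<phi> x)" by (rule tendsto_minus)
  then have "(LINT w|lborel. indicator {0<..} w * dconv w x) = - (gauss_mass TYPE('a) * \<phi> x)"
    using 1 LIMSEQ_unique by blast
  then show ?thesis using True by (simp add: heat0_def)
qed

text \<open>The factors are the normalisation of D^s relative to its Gaussian superposition, the
  mass from the composition law, and the Beta value from Abel's inversion.\<close>

definition repr_const :: real where
  "repr_const = riesz_const (real DIM('a)) s / kappa * gauss_mass TYPE('a) * Beta a (1 - a)"

text \<open>Fractional fundamental theorem of calculus: the Gaussian means, and \<open>\<phi>\<close> itself, are
  recovered from the fractional gradient by inverting Abel's integral equation.\<close>

lemma representation:
  assumes t: "0 \<le> t"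
  shows "has_bochner_integral lborel (\<lambda>\<rho>. indicator {0<..} \<rho> * (\<rho> powr (a - 1) * hgrad (t + \<rho>) x)) (repr_const * heat0 t x)"
proof -
  let ?c = "- (riesz_const (real DIM('a)) s / kappa * gauss_mass TYPE('a))"
  have a: "0 < a" "a < 1" using s by auto
  \<comment> \<open>A translation in time by \<open>t\<close> makes the tail integral start at 0, as
    \<open>Abel_integral\<close> expects.\<close>
  have shift: "integrable lborel (\<lambda>w. indicator {0<..} w * dconv (t + w) x)"
    "(LINT w|lborel. indicator {0<..} w * dconv (t + w) x) = - heat0 t x"
  proof -
    let ?g = "\<lambda>w. indicator {t<..} w * dconv w x"
    have i: "integrable lborel ?g"
      using integrable_mult_indicator[OF _ integrable_dconv[of x], of "{t<..}"] t
      by (auto simp: indicator_inter_arith[symmetric] mult.assoc[symmetric] Int_absorb2 greaterThan_subset_iff elim!: back_subst[of "integrable lborel"] split: split_indicator)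
    have eq: "?g (t + 1 *\<^sub>R w) = indicator {0<..} w * dconv (t + w) x" for w
      by (simp split: split_indicator)
    show "integrable lborel (\<lambda>w. indicator {0<..} w * dconv (t + w) x)"
      using integrable_lborel_affine_iff[of ?g 1 t] i unfolding eq by simp
    show "(LINT w|lborel. indicator {0<..} w * dconv (t + w) x) = - heat0 t x"
      using integral_lborel_affine[of ?g 1 t] integral_dconv[OF t, of x] unfolding eq by simp
  qed
  have m: "(\<lambda>w. dconv (t + w) x) \<in> borel_measurable borel" by measurable
  from has_bochner_integral_mult_right[OF Abel_integral[OF a m shift(1)], of ?c]
  have "has_bochner_integral lborel (\<lambda>\<rho>. ?c * (indicator {0<..} \<rho> * (\<rho> powr (a - 1) *
      (LINT \<tau>|lborel. indicator {0<..} \<tau> * (\<tau> powr (- a) * dconv (t + (\<rho> + \<tau>)) x)))))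
      (?c * (Beta a (1 - a) * - heat0 t x))"
    unfolding shift(2) .
  moreover have "?c * (indicator {0<..} \<rho> * (\<rho> powr (a - 1) *
      (LINT \<tau>|lborel. indicator {0<..} \<tau> * (\<tau> powr (- a) * dconv (t + (\<rho> + \<tau>)) x))))
     = indicator {0<..} \<rho> * (\<rho> powr (a - 1) * hgrad (t + \<rho>) x)" for \<rho> :: real
  proof (cases "\<rho> > 0")
    case True
    then have "0 < t + \<rho>" using t by simp
    from hgrad_eq[OF this, of x] show ?thesis using True by (simp add: add.assoc)
  qed simp
  ultimately show ?thesis unfolding repr_const_def by (simp add: mult.assoc)
qed

lemma repr_const_pos: "0 < repr_const"
proof -
  have "riesz_const (real DIM('a)) s > 0"
  proof -
    \<comment> \<open>In dimension 1 the factor \<open>n + s - 1\<close> equals \<open>s\<close>, so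
      positivity of \<open>s\<close> keeps the constant from vanishing.\<close>
    have d: "1 \<le> real DIM('a)" using DIM_positive[where 'a='a] by (simp add: Suc_le_eq)
    then have p: "0 < real DIM('a) + s - 1" using s by linarith
    have "0 < Gamma ((real DIM('a) + s - 1) / 2)" "0 < Gamma ((1 - s) / 2)"
      using p s by (auto intro!: Gamma_real_pos simp del: DIM_ge_Suc0)
    then show ?thesis unfolding riesz_const_def using p by (intro mult_pos_pos divide_pos_pos) auto
  qed
  moreover have "0 < Beta a (1 - a)" using s by (simp add: Beta_def Gamma_real_pos)
  ultimately show ?thesis unfolding repr_const_def using kappa_pos mass_pos by simp
qed

end

section \<open>Estimates through the heat semigroup\<close>

lemma powr_above_tangent:
  fixes x p :: real
  assumes p: "1 \<le> p" and x: "0 \<le> x"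
  shows "1 + p * (x - 1) \<le> x powr p"
proof (cases "x = 0")
  case True
  then show ?thesis using p by simp
next
  case False
  have "(\<lambda>x. x powr p) x - (\<lambda>x. x powr p) 1 \<ge> p * (x - 1)"
  proof (rule convex_on_imp_above_tangent)
    show "convex_on {0<..} (\<lambda>x. x powr p)" using p by (rule powr_convex)
    show "((\<lambda>x. x powr p) has_real_derivative p) (at 1 within {0<..})"
      by (rule DERIV_subset[of _ _ _ UNIV]) (auto intro!: derivative_eq_intros)
  qed (use False x in \<open>auto simp: interior_open\<close>)
  then show ?thesis by simp
qed

text \<open>Jensen's inequality for the weight \<open>k\<close>. The tangent of \<open>x powr p\<close> at the mean value
  \<open>h / K\<close> gives it directly.\<close>

lemma Jensen_nn_integral:
  fixes k g :: "'a \<Rightarrow> real"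
  assumes [measurable]: "k \<in> borel_measurable M" "g \<in> borel_measurable M"
    and k: "\<And>x. 0 \<le> k x" and g: "\<And>x. 0 \<le> g x" and p: "1 \<le> p" and K: "0 < K"
    and kK: "(\<integral>\<^sup>+x. ennreal (k x) \<partial>M) \<le> ennreal K"
    and h: "0 \<le> h" and hk: "ennreal h \<le> (\<integral>\<^sup>+x. ennreal (k x * g x) \<partial>M)"
  shows "ennreal (h powr p) \<le> ennreal (K powr (p - 1)) * (\<integral>\<^sup>+x. ennreal (k x * g x powr p) \<partial>M)"
proof (cases "h = 0 \<or> (\<integral>\<^sup>+x. ennreal (k x * g x powr p) \<partial>M) = \<infinity>")
  case True
  then show ?thesis using K p by (auto simp: ennreal_mult_top)
next
  case False
  define R where "R = enn2real (\<integral>\<^sup>+x. ennreal (k x * g x powr p) \<partial>M)"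
  have R: "(\<integral>\<^sup>+x. ennreal (k x * g x powr p) \<partial>M) = ennreal R" "0 \<le> R"
    using False unfolding R_def by (auto simp: less_top)
  define \<mu> where "\<mu> = h / K"
  have \<mu>: "0 < \<mu>" using False h K unfolding \<mu>_def by auto
  have Young: "y \<le> \<mu> powr (1 - p) / p * y powr p + (1 - 1 / p) * \<mu>" if "0 \<le> y" for y
  proof -
    have "1 + p * (y / \<mu> - 1) \<le> (y / \<mu>) powr p" using that \<mu> p by (intro powr_above_tangent) auto
    then have "\<mu> / p * (1 + p * (y / \<mu> - 1)) \<le> \<mu> / p * (y / \<mu>) powr p"
      using \<mu> p by (intro mult_left_mono) auto
    moreover have "\<mu> / p * (1 + p * (y / \<mu> - 1)) = y - (1 - 1 / p) * \<mu>"
      using \<mu> p by (simp add: field_simps)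
    moreover have "\<mu> / p * (y / \<mu>) powr p = \<mu> powr (1 - p) / p * y powr p"
      using \<mu> that by (simp add: powr_divide powr_diff)
    ultimately show ?thesis by linarith
  qed
  define A B where "A = \<mu> powr (1 - p) / p" and "B = (1 - 1 / p) * \<mu>"
  have AB: "0 \<le> A" "0 \<le> B" using p \<mu> unfolding A_def B_def by auto
  have "ennreal h \<le> (\<integral>\<^sup>+x. ennreal A * ennreal (k x * g x powr p) + ennreal B * ennreal (k x) \<partial>M)"
  proof (rule order_trans[OF hk nn_integral_mono])
    fix x
    have "k x * g x \<le> k x * (A * g x powr p + B)"
      unfolding A_def B_def by (intro mult_left_mono Young g k)
    then have "k x * g x \<le> A * (k x * g x powr p) + B * k x" by (simp add: algebra_simps)
    then have "ennreal (k x * g x) \<le> ennreal (A * (k x * g x powr p) + B * k x)" by (rule ennreal_leI)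
    also have "\<dots> = ennreal A * ennreal (k x * g x powr p) + ennreal B * ennreal (k x)"
      using AB k[of x] by (simp add: ennreal_mult)
    finally show "ennreal (k x * g x) \<le> ennreal A * ennreal (k x * g x powr p) + ennreal B * ennreal (k x)" .
  qed
  also have "\<dots> = ennreal A * ennreal R + ennreal B * (\<integral>\<^sup>+x. ennreal (k x) \<partial>M)"
    by (simp add: nn_integral_add nn_integral_cmult R(1))
  also have "\<dots> \<le> ennreal A * ennreal R + ennreal B * ennreal K"
    by (intro add_left_mono mult_left_mono kK) auto
  also have "\<dots> = ennreal (A * R + B * K)"
    using AB K R(2) by (simp add: ennreal_mult)
  finally have "h \<le> A * R + B * K"
    using AB K R(2) by (subst (asm) ennreal_le_iff) auto
  then have "h \<le> \<mu> powr (1 - p) / p * R + (1 - 1 / p) * \<mu> * K" unfolding A_def B_def .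
  moreover have "(1 - 1 / p) * \<mu> * K = h - h / p" using K unfolding \<mu>_def by (simp add: algebra_simps)
  ultimately have "h / p \<le> \<mu> powr (1 - p) / p * R" by linarith
  then have "h \<le> \<mu> powr (1 - p) * R" using p by (simp add: field_simps)
  then have "\<mu> powr (p - 1) * h \<le> \<mu> powr (p - 1) * (\<mu> powr (1 - p) * R)" by (intro mult_left_mono) auto
  also have "\<dots> = R" using \<mu> by (simp add: mult.assoc[symmetric] powr_add[symmetric])
  finally have "K powr (p - 1) * (\<mu> powr (p - 1) * h) \<le> K powr (p - 1) * R" by (intro mult_left_mono) auto
  moreover have "K powr (p - 1) * (\<mu> powr (p - 1) * h) = h powr p"
    using K h False unfolding \<mu>_def by (simp add: powr_divide powr_diff)
  ultimately show ?thesis using R by (simp add: ennreal_mult'[symmetric] ennreal_leI)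
qed

text \<open>Interpolating the kernel between its mass \<open>K\<close> and its supremum
  \<open>U\<close> gives the constant of Hoelder's inequality,
  \<open>K powr ((p - 1) / p) * U powr (1 / p)\<close>. Written in terms of \<open>p\<close> alone
  it covers \<open>p = 1\<close>.\<close>

lemma Jensen_sup_bound:
  fixes k g :: "'a \<Rightarrow> real"
  assumes [measurable]: "k \<in> borel_measurable M" "g \<in> borel_measurable M"
    and k: "\<And>x. 0 \<le> k x" and g: "\<And>x. 0 \<le> g x" and p: "1 \<le> p" and K: "0 < K"
    and kK: "(\<integral>\<^sup>+x. ennreal (k x) \<partial>M) \<le> ennreal K"
    and U: "\<And>x. k x \<le> U" and N: "0 \<le> N" and gN: "(\<integral>\<^sup>+x. ennreal (g x powr p) \<partial>M) \<le> ennreal (N powr p)"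
    and h: "0 \<le> h" and hk: "ennreal h \<le> (\<integral>\<^sup>+x. ennreal (k x * g x) \<partial>M)"
  shows "h \<le> (K powr (p - 1) * U) powr (1 / p) * N"
proof -
  have U0: "0 \<le> U" using order_trans[OF k U] .
  have "ennreal (h powr p) \<le> ennreal (K powr (p - 1)) * (\<integral>\<^sup>+x. ennreal (k x * g x powr p) \<partial>M)"
    by (rule Jensen_nn_integral) (use assms in auto)
  also have "\<dots> \<le> ennreal (K powr (p - 1)) * (\<integral>\<^sup>+x. ennreal U * ennreal (g x powr p) \<partial>M)"
    using U U0 k by (intro mult_left_mono nn_integral_mono) (auto simp: ennreal_mult'[symmetric] intro!: ennreal_leI mult_right_mono)
  also have "\<dots> \<le> ennreal (K powr (p - 1)) * (ennreal U * ennreal (N powr p))"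
    by (subst nn_integral_cmult) (auto intro!: mult_left_mono gN)
  also have "\<dots> = ennreal ((K powr (p - 1) * U) * N powr p)"
    using U0 by (simp add: ennreal_mult'[symmetric] mult.assoc)
  finally have "h powr p \<le> (K powr (p - 1) * U) * N powr p"
    using U0 by (subst (asm) ennreal_le_iff) auto
  then have "(h powr p) powr (1 / p) \<le> ((K powr (p - 1) * U) * N powr p) powr (1 / p)"
    using p by (intro powr_mono2) auto
  then show ?thesis using p h N U0 by (simp add: powr_powr powr_mult)
qed

text \<open>For a non-integrable function the left-hand side is 0 by convention, which lets bounds
  be stated before integrability is known.\<close>

lemma norm_integral_le_nn_integral:
  fixes f :: "'a \<Rightarrow> 'b::{banach, second_countable_topology}"
  shows "ennreal (norm (integral\<^sup>L M f)) \<le> (\<integral>\<^sup>+x. ennreal (norm (f x)) \<partial>M)"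
  by (cases "integrable M f") (auto intro: integral_norm_bound_ennreal simp: not_integrable_integral_eq)

lemma nn_integral_gauss_vec_shift_le:
  fixes x :: "'a::euclidean_space"
  assumes r: "0 < r"
  shows "(\<integral>\<^sup>+y. ennreal (norm (gauss_vec r (x - y))) \<partial>lborel) \<le> ennreal (gauss_bd TYPE('a) * gauss_mass TYPE('a) * r powr (- 1 / 2))"
    and "(\<integral>\<^sup>+x. ennreal (norm (gauss_vec r (x - y :: 'a))) \<partial>lborel) \<le> ennreal (gauss_bd TYPE('a) * gauss_mass TYPE('a) * r powr (- 1 / 2))"
proof -
  let ?B = "gauss_bd TYPE('a)" and ?C = "gauss_mass TYPE('a)"
  have B: "0 < ?B" and C: "0 < ?C" by (rule gauss_bd_pos, rule gauss_mass_pos)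
  show *: "(\<integral>\<^sup>+y. ennreal (norm (gauss_vec r (x - y))) \<partial>lborel) \<le> ennreal (?B * ?C * r powr (- 1 / 2))" for x :: 'a
  proof -
    have "(\<integral>\<^sup>+y. ennreal (norm (gauss_vec r (x - y))) \<partial>lborel)
      \<le> (\<integral>\<^sup>+y. ennreal (?B * r powr (- 1 / 2)) * ennreal (gauss (2 * r) (x - y)) \<partial>lborel)"
      using norm_gauss_vec_le[OF r] B by (intro nn_integral_mono) (simp add: ennreal_mult'[symmetric] ennreal_leI)
    also have "\<dots> = ennreal (?B * r powr (- 1 / 2)) * ennreal ?C"
      using r by (subst nn_integral_cmult) (auto simp: nn_integral_gauss_shift)
    finally show ?thesis using B C by (simp add: ennreal_mult'[symmetric] mult.assoc mult.commute[of ?C])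
  qed
  have "norm (gauss_vec r (x - y)) = norm (gauss_vec r (y - x))" for x
    using gauss_vec_minus[of r "y - x"] by (metis minus_diff_eq norm_minus_cancel)
  then show "(\<integral>\<^sup>+x. ennreal (norm (gauss_vec r (x - y :: 'a))) \<partial>lborel) \<le> ennreal (?B * ?C * r powr (- 1 / 2))"
    using *[of y] by simp
qed

section \<open>Bounds of the smoothed gradient from L^p to L^q\<close>

context lipschitz_test
begin

text \<open>The bound depends on \<open>S\<close> and \<open>L\<close>; its purpose is to make the
  integrals defining \<open>hgrad\<close> absolutely convergent.\<close>

lemma riesz_gradient_bounded:
  obtains M where "0 \<le> M" "\<And>x. norm (riesz_gradient s \<phi> x) \<le> M"
proof -
  define I where "I = enn2real (\<integral>\<^sup>+\<tau>. ennreal (indicator {0<..} \<tau> * (\<tau> powr (- a) * inc \<tau>)) \<partial>lborel)"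
  have I: "(\<integral>\<^sup>+\<tau>. ennreal (indicator {0<..} \<tau> * (\<tau> powr (- a) * inc \<tau>)) \<partial>lborel) = ennreal I"
    using nn_integral_inc unfolding I_def by simp
  have I0: "0 \<le> I" unfolding I_def by simp
  let ?BC = "gauss_bd TYPE('a) * gauss_mass TYPE('a)"
  have BC: "0 < ?BC" using bd_pos mass_pos by simp
  have "norm (LINT \<tau>|lborel. indicator {0<..} \<tau> *\<^sub>R (\<tau> powr (- a) *\<^sub>R vconv \<tau> x)) \<le> ?BC * I" for x
  proof -
    have "ennreal (norm (LINT \<tau>|lborel. indicator {0<..} \<tau> *\<^sub>R (\<tau> powr (- a) *\<^sub>R vconv \<tau> x)))
      \<le> (\<integral>\<^sup>+\<tau>. ennreal (norm (indicator {0<..} \<tau> *\<^sub>R (\<tau> powr (- a) *\<^sub>R vconv \<tau> x))) \<partial>lborel)"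
      by (rule norm_integral_le_nn_integral)
    also have "\<dots> \<le> (\<integral>\<^sup>+\<tau>. ennreal ?BC * ennreal (indicator {0<..} \<tau> * (\<tau> powr (- a) * inc \<tau>)) \<partial>lborel)"
    proof (intro nn_integral_mono)
      fix \<tau> :: real
      have "norm (indicator {0<..} \<tau> *\<^sub>R (\<tau> powr (- a) *\<^sub>R vconv \<tau> x)) \<le> ?BC * (indicator {0<..} \<tau> * (\<tau> powr (- a) * inc \<tau>))"
        using mult_left_mono[OF norm_vconv_le[of \<tau> x], of "\<tau> powr (- a)"]
        by (simp add: mult.left_commute split: split_indicator)
      then show "ennreal (norm (indicator {0<..} \<tau> *\<^sub>R (\<tau> powr (- a) *\<^sub>R vconv \<tau> x))) \<le> ennreal ?BC * ennreal (indicator {0<..} \<tau> * (\<tau> powr (- a) * inc \<tau>))"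
        using BC by (simp add: ennreal_mult'[symmetric] ennreal_leI)
    qed
    also have "\<dots> = ennreal (?BC * I)"
    proof -
      have "(\<integral>\<^sup>+\<tau>. ennreal ?BC * ennreal (indicator {0<..} \<tau> * (\<tau> powr (- a) * inc \<tau>)) \<partial>lborel)
        = ennreal ?BC * (\<integral>\<^sup>+\<tau>. ennreal (indicator {0<..} \<tau> * (\<tau> powr (- a) * inc \<tau>)) \<partial>lborel)"
        by (rule nn_integral_cmult) measurable
      then show ?thesis unfolding I using BC by (simp only: ennreal_mult'[OF less_imp_le[OF BC]])
    qed
    finally show ?thesis using BC I0 by (subst (asm) ennreal_le_iff) auto
  qed
  then have "norm (riesz_gradient s \<phi> x) \<le> \<bar>riesz_const (real DIM('a)) s / kappa\<bar> * (?BC * I)" for x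
    unfolding riesz_gradient_eq norm_scaleR abs_minus_cancel by (intro mult_left_mono) auto
  moreover have "0 \<le> \<bar>riesz_const (real DIM('a)) s / kappa\<bar> * (?BC * I)" using BC I0 by simp
  ultimately show thesis using that by blast
qed

lemma integrable_hgrad:
  assumes r: "0 < r"
  shows "integrable lborel (\<lambda>y. gauss_vec r (x - y) \<bullet> riesz_gradient s \<phi> y)"
proof -
  obtain M where M: "0 \<le> M" "\<And>x. norm (riesz_gradient s \<phi> x) \<le> M"
    using riesz_gradient_bounded by blast
  show ?thesis
  proof (rule Bochner_Integration.integrable_bound)
    show "integrable lborel (\<lambda>y. M * norm (gauss_vec r (x - y)))"
      using integrable_lborel_affine_iff[of "gauss_vec r" "-1" x] r by simp
    show "AE y in lborel. norm (gauss_vec r (x - y) \<bullet> riesz_gradient s \<phi> y) \<le> norm (M * norm (gauss_vec r (x - y)))"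
    proof (rule AE_I2)
      fix y
      have "\<bar>gauss_vec r (x - y) \<bullet> riesz_gradient s \<phi> y\<bar> \<le> norm (gauss_vec r (x - y)) * norm (riesz_gradient s \<phi> y)"
        by (rule Cauchy_Schwarz_ineq2)
      also have "\<dots> \<le> norm (gauss_vec r (x - y)) * M" by (intro mult_left_mono M) auto
      finally show "norm (gauss_vec r (x - y) \<bullet> riesz_gradient s \<phi> y) \<le> norm (M * norm (gauss_vec r (x - y)))"
        using M(1) by (simp add: mult.commute)
    qed
  qed measurable
qed

definition kernel_const :: real where "kernel_const = gauss_bd TYPE('a) * (1 + gauss_mass TYPE('a))"

lemma kernel_const: "0 < kernel_const" "gauss_bd TYPE('a) \<le> kernel_const" "gauss_bd TYPE('a) * gauss_mass TYPE('a) \<le> kernel_const"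
proof -
  show "0 < kernel_const" using bd_pos mass_pos unfolding kernel_const_def by (intro mult_pos_pos add_pos_pos) auto
  show "gauss_bd TYPE('a) \<le> kernel_const" "gauss_bd TYPE('a) * gauss_mass TYPE('a) \<le> kernel_const"
    using bd_pos mass_pos unfolding kernel_const_def by (auto simp: distrib_left)
qed

lemma abs_hgrad_le_nn_integral:
  "ennreal \<bar>hgrad r x\<bar> \<le> (\<integral>\<^sup>+y. ennreal (norm (gauss_vec r (x - y)) * norm (riesz_gradient s \<phi> y)) \<partial>lborel)"
proof -
  have "ennreal \<bar>hgrad r x\<bar> \<le> (\<integral>\<^sup>+y. ennreal (norm (gauss_vec r (x - y) \<bullet> riesz_gradient s \<phi> y)) \<partial>lborel)"
    unfolding hgrad_def using norm_integral_le_nn_integral[of lborel "\<lambda>y. gauss_vec r (x - y) \<bullet> riesz_gradient s \<phi> y"] by simp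
  also have "\<dots> \<le> (\<integral>\<^sup>+y. ennreal (norm (gauss_vec r (x - y)) * norm (riesz_gradient s \<phi> y)) \<partial>lborel)"
    by (intro nn_integral_mono ennreal_leI) (simp add: Cauchy_Schwarz_ineq2)
  finally show ?thesis .
qed

text \<open>Bookkeeping for \<open>Jensen_sup_bound\<close> when the mass is of order
  \<open>r powr e\<close> and the supremum of order \<open>r powr (e - m)\<close>. For the gradient
  kernel \<open>e\<close> is -1/2 and \<open>m\<close> is half the dimension.\<close>

lemma powr_const_bound:
  assumes p: "1 \<le> p" and r: "0 < r" and c: "0 \<le> c" "c \<le> kernel_const" and d: "0 \<le> d" "d \<le> kernel_const"
  shows "((c * r powr e) powr (p - 1) * (d * r powr (e - m))) powr (1 / p) \<le> kernel_const * r powr (e - m / p)"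
proof -
  have "(c * r powr e) powr (p - 1) * (d * r powr (e - m)) \<le> (kernel_const * r powr e) powr (p - 1) * (kernel_const * r powr (e - m))"
    using c d p by (intro mult_mono powr_mono2 mult_right_mono) auto
  also have "\<dots> = kernel_const powr p * (r powr (e * (p - 1)) * r powr (e - m))"
    using kernel_const(1) powr_add[of kernel_const "p - 1" 1] by (simp add: powr_mult powr_powr)
  also have "r powr (e * (p - 1)) * r powr (e - m) = (r powr (e - m / p)) powr p"
  proof -
    have "e * (p - 1) + (e - m) = (e - m / p) * p" using p by (simp add: field_simps)
    then show ?thesis by (simp only: powr_add[symmetric] powr_powr)
  qed
  finally have "(c * r powr e) powr (p - 1) * (d * r powr (e - m)) \<le> (kernel_const * r powr (e - m / p)) powr p"
    using kernel_const(1) by (simp add: powr_mult)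
  then have "((c * r powr e) powr (p - 1) * (d * r powr (e - m))) powr (1 / p) \<le> ((kernel_const * r powr (e - m / p)) powr p) powr (1 / p)"
    using p d by (intro powr_mono2) auto
  also have "\<dots> = kernel_const * r powr (e - m / p)" using p kernel_const(1) by (simp add: powr_powr)
  finally show ?thesis .
qed

lemma abs_hgrad_le:
  assumes p: "1 \<le> p" and r: "0 < r" and N: "0 \<le> N"
    and f: "(\<integral>\<^sup>+y. ennreal (norm (riesz_gradient s \<phi> y) powr p) \<partial>lborel) \<le> ennreal (N powr p)"
  shows "\<bar>hgrad r x\<bar> \<le> kernel_const * r powr (- 1 / 2 - real DIM('a) / 2 / p) * N"
proof -
  let ?B = "gauss_bd TYPE('a)" and ?C = "gauss_mass TYPE('a)"
  have "\<bar>hgrad r x\<bar> \<le> ((?B * ?C * r powr (- 1 / 2)) powr (p - 1) * (?B * r powr (- 1 / 2 - real DIM('a) / 2))) powr (1 / p) * N"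
    by (rule Jensen_sup_bound[OF _ _ _ _ p _ nn_integral_gauss_vec_shift_le(1)[OF r] norm_gauss_vec_le_sup[OF r] N f _ abs_hgrad_le_nn_integral])
      (use bd_pos mass_pos r in auto)
  also have "\<dots> \<le> kernel_const * r powr (- 1 / 2 - real DIM('a) / 2 / p) * N"
    using bd_pos mass_pos kernel_const by (intro mult_right_mono powr_const_bound p r N) auto
  finally show ?thesis .
qed

text \<open>Jensen at each point, then Tonelli. The kernel has the same mass bound in
  \<open>x\<close> as in \<open>y\<close>: it enters with the power \<open>p - 1\<close> from Jensen
  and once more from integrating in \<open>x\<close>.\<close>

lemma nn_integral_hgrad_p:
  assumes p: "1 \<le> p" and r: "0 < r" and N: "0 \<le> N"
    and f: "(\<integral>\<^sup>+y. ennreal (norm (riesz_gradient s \<phi> y) powr p) \<partial>lborel) \<le> ennreal (N powr p)"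
  shows "(\<integral>\<^sup>+x. ennreal (\<bar>hgrad r x\<bar> powr p) \<partial>lborel) \<le> ennreal ((kernel_const * r powr (- 1 / 2) * N) powr p)"
proof -
  let ?K = "gauss_bd TYPE('a) * gauss_mass TYPE('a) * r powr (- 1 / 2)"
  let ?f = "riesz_gradient s \<phi>"
  have K: "0 < ?K" using bd_pos mass_pos r by simp
  have "(\<integral>\<^sup>+x. ennreal (\<bar>hgrad r x\<bar> powr p) \<partial>lborel)
    \<le> (\<integral>\<^sup>+x. ennreal (?K powr (p - 1)) * (\<integral>\<^sup>+y. ennreal (norm (gauss_vec r (x - y)) * norm (?f y) powr p) \<partial>lborel) \<partial>lborel)"
    by (intro nn_integral_mono Jensen_nn_integral[OF _ _ _ _ p K nn_integral_gauss_vec_shift_le(1)[OF r] _ abs_hgrad_le_nn_integral]) auto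
  also have "\<dots> = ennreal (?K powr (p - 1)) * (\<integral>\<^sup>+x. (\<integral>\<^sup>+y. ennreal (norm (gauss_vec r (x - y)) * norm (?f y) powr p) \<partial>lborel) \<partial>lborel)"
    by (rule nn_integral_cmult) measurable
  also have "(\<integral>\<^sup>+x. (\<integral>\<^sup>+y. ennreal (norm (gauss_vec r (x - y)) * norm (?f y) powr p) \<partial>lborel) \<partial>lborel)
    = (\<integral>\<^sup>+y. (\<integral>\<^sup>+x. ennreal (norm (gauss_vec r (x - y)) * norm (?f y) powr p) \<partial>lborel) \<partial>lborel)"
    by (rule lborel_pair.Fubini'[symmetric]) measurable
  also have "\<dots> \<le> (\<integral>\<^sup>+y. ennreal ?K * ennreal (norm (?f y) powr p) \<partial>lborel)"
  proof (intro nn_integral_mono)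
    fix y
    have "(\<integral>\<^sup>+x. ennreal (norm (gauss_vec r (x - y)) * norm (?f y) powr p) \<partial>lborel)
      = (\<integral>\<^sup>+x. ennreal (norm (gauss_vec r (x - y))) \<partial>lborel) * ennreal (norm (?f y) powr p)"
      by (subst nn_integral_multc[symmetric]) (auto simp: ennreal_mult')
    then show "(\<integral>\<^sup>+x. ennreal (norm (gauss_vec r (x - y)) * norm (?f y) powr p) \<partial>lborel) \<le> ennreal ?K * ennreal (norm (?f y) powr p)"
      using nn_integral_gauss_vec_shift_le(2)[OF r, of y] by (simp add: mult_right_mono)
  qed
  also have "\<dots> = ennreal ?K * (\<integral>\<^sup>+y. ennreal (norm (?f y) powr p) \<partial>lborel)"
    by (rule nn_integral_cmult) measurable
  also have "\<dots> \<le> ennreal ?K * ennreal (N powr p)" by (intro mult_left_mono f) auto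
  also have "ennreal (?K powr (p - 1)) * (ennreal ?K * ennreal (N powr p)) = ennreal ((?K * N) powr p)"
  proof -
    have "ennreal (c powr (p - 1)) * (ennreal c * ennreal (N powr p)) = ennreal ((c * N) powr p)" if "0 < c" for c
    proof -
      have "c powr (p - 1) * (c * N powr p) = (c * N) powr p" using that N by (simp add: powr_mult powr_diff)
      then show ?thesis using that by (simp add: ennreal_mult[symmetric])
    qed
    then show ?thesis using K by blast
  qed
  also have "\<dots> \<le> ennreal ((kernel_const * r powr (- 1 / 2) * N) powr p)"
    using K N kernel_const p by (intro ennreal_leI powr_mono2 mult_right_mono) auto
  finally show ?thesis by (simp add: mult_left_mono)
qed

text \<open>Pointwise interpolation: of the \<open>q\<close> powers, \<open>q - p\<close> are
  estimated by the supremum bound and the remaining \<open>p\<close> by the \<open>L^p\<close>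
  bound.\<close>

lemma nn_integral_hgrad_q:
  assumes p: "1 \<le> p" and q: "p \<le> q" and r: "0 < r" and N: "0 \<le> N"
    and f: "(\<integral>\<^sup>+y. ennreal (norm (riesz_gradient s \<phi> y) powr p) \<partial>lborel) \<le> ennreal (N powr p)"
  shows "(\<integral>\<^sup>+x. ennreal (\<bar>hgrad r x\<bar> powr q) \<partial>lborel)
    \<le> ennreal ((kernel_const * r powr (- (1 / 2 + real DIM('a) / 2 * (1 / p - 1 / q))) * N) powr q)"
proof -
  let ?U = "kernel_const * r powr (- 1 / 2 - real DIM('a) / 2 / p) * N"
  have U: "0 \<le> ?U" using kernel_const N by simp
  have "(\<integral>\<^sup>+x. ennreal (\<bar>hgrad r x\<bar> powr q) \<partial>lborel) \<le> (\<integral>\<^sup>+x. ennreal (?U powr (q - p)) * ennreal (\<bar>hgrad r x\<bar> powr p) \<partial>lborel)"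
  proof (intro nn_integral_mono)
    fix x
    have "\<bar>hgrad r x\<bar> powr q = \<bar>hgrad r x\<bar> powr (q - p) * \<bar>hgrad r x\<bar> powr p"
      by (simp add: powr_add[symmetric])
    also have "\<dots> \<le> ?U powr (q - p) * \<bar>hgrad r x\<bar> powr p"
      using abs_hgrad_le[OF p r N f, of x] q by (intro mult_right_mono powr_mono2) auto
    finally show "ennreal (\<bar>hgrad r x\<bar> powr q) \<le> ennreal (?U powr (q - p)) * ennreal (\<bar>hgrad r x\<bar> powr p)"
      by (simp add: ennreal_mult'[symmetric] ennreal_leI)
  qed
  also have "\<dots> = ennreal (?U powr (q - p)) * (\<integral>\<^sup>+x. ennreal (\<bar>hgrad r x\<bar> powr p) \<partial>lborel)"
    by (rule nn_integral_cmult) measurable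
  also have "\<dots> \<le> ennreal (?U powr (q - p)) * ennreal ((kernel_const * r powr (- 1 / 2) * N) powr p)"
    by (intro mult_left_mono nn_integral_hgrad_p p r N f) auto
  also have "\<dots> = ennreal ((kernel_const * r powr (- (1 / 2 + real DIM('a) / 2 * (1 / p - 1 / q))) * N) powr q)"
  proof -
    have "(- 1 / 2 - real DIM('a) / 2 / p) * (q - p) + (- 1 / 2) * p = - (1 / 2 + real DIM('a) / 2 * (1 / p - 1 / q)) * q"
      using p q by (simp add: field_simps)
    then have "r powr ((- 1 / 2 - real DIM('a) / 2 / p) * (q - p)) * r powr ((- 1 / 2) * p)
      = r powr (- (1 / 2 + real DIM('a) / 2 * (1 / p - 1 / q)) * q)"
      by (simp only: powr_add[symmetric])
    moreover have "kernel_const powr (q - p) * kernel_const powr p = kernel_const powr q" "N powr (q - p) * N powr p = N powr q"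
      by (simp_all add: powr_add[symmetric])
    moreover have "?U powr (q - p) * (kernel_const * r powr (- 1 / 2) * N) powr p =
       (kernel_const powr (q - p) * kernel_const powr p) *
       (r powr ((- 1 / 2 - real DIM('a) / 2 / p) * (q - p)) * r powr ((- 1 / 2) * p)) *
       (N powr (q - p) * N powr p)"
      using N kernel_const(1) by (simp only: powr_mult powr_powr mult_ac)
    moreover have "(kernel_const * r powr (- (1 / 2 + real DIM('a) / 2 * (1 / p - 1 / q))) * N) powr q
      = kernel_const powr q * r powr (- (1 / 2 + real DIM('a) / 2 * (1 / p - 1 / q)) * q) * N powr q"
      using N kernel_const(1) by (simp only: powr_mult powr_powr)
    ultimately have "?U powr (q - p) * (kernel_const * r powr (- 1 / 2) * N) powr p
      = (kernel_const * r powr (- (1 / 2 + real DIM('a) / 2 * (1 / p - 1 / q))) * N) powr q"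
      by (simp only:)
    then show ?thesis by (simp add: ennreal_mult'[symmetric])
  qed
  finally show ?thesis .
qed

end

section \<open>Approximation by heat means\<close>

lemma powr_diff_shift_le:
  fixes \<rho> t c :: real
  assumes \<rho>: "0 < \<rho>" and t: "0 < t" and c: "0 \<le> c" "c \<le> 1"
  shows "0 \<le> \<rho> powr (- c) - (\<rho> + t) powr (- c)" "\<rho> powr (- c) - (\<rho> + t) powr (- c) \<le> t * \<rho> powr (- c - 1)"
proof -
  show "0 \<le> \<rho> powr (- c) - (\<rho> + t) powr (- c)"
    using powr_mono2'[of "- c" \<rho> "\<rho> + t"] assms by simp
  define x where "x = t / \<rho>"
  have x: "0 \<le> x" using t \<rho> unfolding x_def by simp
  have "\<rho> + t = \<rho> * (1 + x)" using \<rho> unfolding x_def by (simp add: field_simps)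
  then have "(\<rho> + t) powr (- c) = \<rho> powr (- c) * (1 + x) powr (- c)" by (simp add: powr_mult)
  \<comment> \<open>Since \<open>c \<le> 1\<close>, it is enough to treat the exponent -1, where the
    claim is \<open>(1 - x) * (1 + x) \<le> 1\<close>.\<close>
  moreover have "1 - x \<le> (1 + x) powr (- c)"
  proof -
    have "(1 - x) * (1 + x) \<le> 1" using x by (simp add: algebra_simps)
    then have "1 - x \<le> 1 / (1 + x)" using x by (simp add: field_simps)
    also have "\<dots> = (1 + x) powr (- 1)" using x by (simp add: powr_minus_divide)
    also have "\<dots> \<le> (1 + x) powr (- c)" using x c by (intro powr_mono) auto
    finally show ?thesis .
  qed
  ultimately have "\<rho> powr (- c) * (1 - x) \<le> (\<rho> + t) powr (- c)" by (simp add: mult_left_mono)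
  then have "\<rho> powr (- c) - (\<rho> + t) powr (- c) \<le> \<rho> powr (- c) * x" by (simp add: algebra_simps)
  also have "\<dots> = t * \<rho> powr (- c - 1)" using \<rho> unfolding x_def by (simp add: powr_diff)
  finally show "\<rho> powr (- c) - (\<rho> + t) powr (- c) \<le> t * \<rho> powr (- c - 1)" .
qed

text \<open>The weight in the difference of the representations at times 0 and \<open>t\<close>,
  both written in the time variable of \<open>hgrad\<close>. For large \<open>r\<close> the two
  powers cancel to leading order.\<close>

definition abel_weight :: "real \<Rightarrow> real \<Rightarrow> real \<Rightarrow> real" where
  "abel_weight a t r = indicator {0<..} r * r powr (a - 1) - indicator {t<..} r * (r - t) powr (a - 1)"

lemma abel_weight_measurable [measurable]: "abel_weight a t \<in> borel_measurable borel"
  unfolding abel_weight_def by measurable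

text \<open>Three ranges give the three constants. Up to \<open>t\<close> only the first power is
  present, and integrability at 0 requires \<open>b < a\<close>, which is the subcritical condition.
  Between \<open>t\<close> and \<open>2 * t\<close> the shifted power dominates. Beyond
  \<open>2 * t\<close> the difference is at most \<open>t * (r - t) powr (a - 2)\<close>, integrable
  because \<open>a < 1\<close>.\<close>

lemma nn_integral_abel_weight:
  assumes a: "0 < a" "a < 1" and b: "0 \<le> b" "b < a" and t: "0 < t"
  shows "(\<integral>\<^sup>+r. ennreal (\<bar>abel_weight a t r\<bar> * r powr (- b)) \<partial>lborel)
    \<le> ennreal ((1 / (a - b) + 1 / a + 1 / (1 - a)) * t powr (a - b))"
proof -
  define f1 where "f1 r = indicator {0<..t} r * r powr (a - 1 - b)" for r :: real
  define f2 where "f2 r = indicator {0<..t} r * r powr (a - 1)" for r :: real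
  define f3 where "f3 r = indicator {t..} r * r powr (a - 2)" for r :: real
  have [measurable]: "f1 \<in> borel_measurable borel" "f2 \<in> borel_measurable borel" "f3 \<in> borel_measurable borel"
    unfolding f1_def f2_def f3_def by measurable
  have nn: "0 \<le> f1 r" "0 \<le> f2 r" "0 \<le> f3 r" for r unfolding f1_def f2_def f3_def by auto
  have le: "\<bar>abel_weight a t r\<bar> * r powr (- b) \<le> f1 r + t powr (- b) * (f2 (r - t) + t * f3 (r - t))" for r
  proof -
    consider "r \<le> 0" | "0 < r" "r \<le> t" | "t < r" by linarith
    then show ?thesis
    proof cases
      case 1
      then show ?thesis using nn t by (simp add: abel_weight_def)
    next
      case 2
      then have "\<bar>abel_weight a t r\<bar> * r powr (- b) = f1 r"
        unfolding abel_weight_def f1_def by (simp add: powr_add[symmetric])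
      then show ?thesis using nn t by simp
    next
      case 3
      define \<rho> where "\<rho> = r - t"
      have \<rho>: "0 < \<rho>" "r = \<rho> + t" using 3 unfolding \<rho>_def by auto
      have d: "0 \<le> \<rho> powr (- (1 - a)) - (\<rho> + t) powr (- (1 - a))"
        "\<rho> powr (- (1 - a)) - (\<rho> + t) powr (- (1 - a)) \<le> t * \<rho> powr (- (1 - a) - 1)"
        using powr_diff_shift_le[OF \<rho>(1) t, of "1 - a"] a by auto
      have abs: "\<bar>abel_weight a t r\<bar> = \<rho> powr (a - 1) - (\<rho> + t) powr (a - 1)"
        unfolding abel_weight_def using 3 t \<rho> d(1) by simp
      have "\<bar>abel_weight a t r\<bar> \<le> f2 \<rho> + t * f3 \<rho>"
      proof (cases "\<rho> \<le> t")
        case True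
        then have "\<bar>abel_weight a t r\<bar> \<le> f2 \<rho>" unfolding abs f2_def using \<rho> by simp
        then show ?thesis using nn t by (simp add: add_increasing2)
      next
        case False
        then have "\<bar>abel_weight a t r\<bar> \<le> t * f3 \<rho>" unfolding abs f3_def using d(2) by (simp add: algebra_simps)
        then show ?thesis using nn(2)[of \<rho>] by linarith
      qed
      moreover have "r powr (- b) \<le> t powr (- b)" using 3 t b by (intro powr_mono2') auto
      ultimately have "\<bar>abel_weight a t r\<bar> * r powr (- b) \<le> (f2 \<rho> + t * f3 \<rho>) * t powr (- b)"
        by (intro mult_mono) auto
      then show ?thesis using nn(1)[of r] unfolding \<rho>_def by (simp add: mult.commute)
    qed
  qed
  have shift: "(\<integral>\<^sup>+r. ennreal (g (r - t)) \<partial>lborel) = (\<integral>\<^sup>+r. ennreal (g r) \<partial>lborel)"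
    if "g \<in> borel_measurable borel" for g :: "real \<Rightarrow> real"
    using nn_integral_lborel_affine[of "\<lambda>r. ennreal (g (r - t))" 1 t] that by simp
  have i1: "(\<integral>\<^sup>+r. ennreal (f1 r) \<partial>lborel) = ennreal (t powr (a - b) / (a - b))"
    unfolding f1_def using nn_integral_powr_from_0[of "a - 1 - b" t] a b t by simp
  have i2: "(\<integral>\<^sup>+r. ennreal (f2 r) \<partial>lborel) = ennreal (t powr a / a)"
    unfolding f2_def using nn_integral_powr_from_0[of "a - 1" t] a t by simp
  have i3: "(\<integral>\<^sup>+r. ennreal (f3 r) \<partial>lborel) = ennreal (t powr (a - 1) / (1 - a))"
    unfolding f3_def using nn_integral_powr_to_inf[of "a - 2" t] a t
    by (simp add: minus_divide_left[symmetric] minus_divide_right)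
  have "(\<integral>\<^sup>+r. ennreal (\<bar>abel_weight a t r\<bar> * r powr (- b)) \<partial>lborel)
    \<le> (\<integral>\<^sup>+r. ennreal (f1 r) + ennreal (t powr (- b)) * (ennreal (f2 (r - t)) + ennreal t * ennreal (f3 (r - t))) \<partial>lborel)"
  proof (rule nn_integral_mono)
    fix r
    have "ennreal (\<bar>abel_weight a t r\<bar> * r powr (- b)) \<le> ennreal (f1 r + t powr (- b) * (f2 (r - t) + t * f3 (r - t)))"
      by (rule ennreal_leI[OF le])
    also have "\<dots> = ennreal (f1 r) + ennreal (t powr (- b)) * (ennreal (f2 (r - t)) + ennreal t * ennreal (f3 (r - t)))"
      using nn t by (simp add: ennreal_mult)
    finally show "ennreal (\<bar>abel_weight a t r\<bar> * r powr (- b)) \<le> ennreal (f1 r) + ennreal (t powr (- b)) * (ennreal (f2 (r - t)) + ennreal t * ennreal (f3 (r - t)))" .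
  qed
  also have "\<dots> = (\<integral>\<^sup>+r. ennreal (f1 r) \<partial>lborel) + ennreal (t powr (- b)) * ((\<integral>\<^sup>+r. ennreal (f2 (r - t)) \<partial>lborel) + ennreal t * (\<integral>\<^sup>+r. ennreal (f3 (r - t)) \<partial>lborel))"
    by (simp add: nn_integral_add nn_integral_cmult)
  also have "\<dots> = ennreal (t powr (a - b) / (a - b)) + ennreal (t powr (- b)) * (ennreal (t powr a / a) + ennreal t * ennreal (t powr (a - 1) / (1 - a)))"
    by (simp only: shift[of f2] shift[of f3] i1 i2 i3) (simp add: shift i2 i3)
  also have "\<dots> = ennreal (t powr (a - b) / (a - b) + t powr (- b) * (t powr a / a + t * (t powr (a - 1) / (1 - a))))"
  proof -
    have "0 \<le> t powr (a - 1) / (1 - a)" "0 \<le> t powr a / a" "0 \<le> t powr (a - b) / (a - b)"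
      using a b by auto
    then show ?thesis
      using t by (simp only: ennreal_mult ennreal_plus add_nonneg_nonneg mult_nonneg_nonneg less_imp_le powr_ge_zero)
  qed
  also have "t powr (a - b) / (a - b) + t powr (- b) * (t powr a / a + t * (t powr (a - 1) / (1 - a))) = (1 / (a - b) + 1 / a + 1 / (1 - a)) * t powr (a - b)"
  proof -
    have "t * t powr (a - 1) = t powr a" "t powr (- b) * t powr a = t powr (a - b)"
      using t by (simp_all add: powr_diff powr_minus_divide)
    then have "t powr (- b) * (t powr a / a + t * (t powr (a - 1) / (1 - a))) = t powr (a - b) / a + t powr (a - b) / (1 - a)"
      by (metis (no_types, lifting) distrib_left times_divide_eq_right)
    then show ?thesis by (simp add: distrib_right)
  qed
  finally show ?thesis .
qed

context lipschitz_test
begin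

lemma heat_minus_le_nn_integral:
  assumes t: "0 < t"
  shows "ennreal (repr_const * \<bar>gauss_mass TYPE('a) * \<phi> x - heat t x\<bar>) \<le> (\<integral>\<^sup>+r. ennreal (\<bar>abel_weight a t r\<bar> * \<bar>hgrad r x\<bar>) \<partial>lborel)"
proof -
  let ?f = "\<lambda>r. indicator {t<..} r * ((r - t) powr (a - 1) * hgrad r x)"
  have 0: "has_bochner_integral lborel (\<lambda>\<rho>. indicator {0<..} \<rho> * (\<rho> powr (a - 1) * hgrad \<rho> x)) (repr_const * (gauss_mass TYPE('a) * \<phi> x))"
    using representation[of 0 x] by (simp add: heat0_def)
  have eq: "?f (t + 1 *\<^sub>R \<rho>) = indicator {0<..} \<rho> * (\<rho> powr (a - 1) * hgrad (t + \<rho>) x)" for \<rho>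
    by (simp split: split_indicator)
  have "has_bochner_integral lborel (\<lambda>\<rho>. ?f (t + 1 *\<^sub>R \<rho>)) (repr_const * heat t x)"
    unfolding eq using representation[of t x] t by (simp add: heat0_def)
  from has_bochner_integral_lborel_affine[OF _ _ this]
  have 1: "has_bochner_integral lborel ?f (repr_const * heat t x)" by simp
  from has_bochner_integral_diff[OF 0 1]
  have "has_bochner_integral lborel (\<lambda>r. abel_weight a t r * hgrad r x) (repr_const * (gauss_mass TYPE('a) * \<phi> x - heat t x))"
    unfolding abel_weight_def by (simp add: algebra_simps)
  then have "repr_const * (gauss_mass TYPE('a) * \<phi> x - heat t x) = (LINT r|lborel. abel_weight a t r * hgrad r x)"
    by (simp add: has_bochner_integral_iff)
  then have "ennreal \<bar>repr_const * (gauss_mass TYPE('a) * \<phi> x - heat t x)\<bar> \<le> (\<integral>\<^sup>+r. ennreal \<bar>abel_weight a t r * hgrad r x\<bar> \<partial>lborel)"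
    using norm_integral_le_nn_integral[of lborel "\<lambda>r. abel_weight a t r * hgrad r x"] by simp
  then show ?thesis using repr_const_pos by (simp add: abs_mult)
qed

definition heat_rate :: "real \<Rightarrow> real" where
  "heat_rate b = (1 / (a - b) + 1 / a + 1 / (1 - a)) * kernel_const / (repr_const * gauss_mass TYPE('a))"

text \<open>Jensen in the time variable plays the role of Minkowski's integral inequality. The power
  \<open>r powr b\<close> is moved from the weight into \<open>g\<close>, so that the
  \<open>L^q\<close> norm of \<open>g\<close> at time \<open>r\<close> is bounded independently of
  \<open>r\<close>, while the weight \<open>k\<close> has mass of order
  \<open>t powr (a - b)\<close>.\<close>

lemma Lq_heat_approx:
  assumes p: "1 \<le> p" and q: "p \<le> q" and t: "0 < t" and N: "0 \<le> N"
    and f: "(\<integral>\<^sup>+y. ennreal (norm (riesz_gradient s \<phi> y) powr p) \<partial>lborel) \<le> ennreal (N powr p)"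
    and b_def: "b = 1 / 2 + real DIM('a) / 2 * (1 / p - 1 / q)" and b: "b < a"
  shows "(\<integral>\<^sup>+x. ennreal (\<bar>\<phi> x - heat t x / gauss_mass TYPE('a)\<bar> powr q) \<partial>lborel)
    \<le> ennreal ((heat_rate b * t powr (a - b) * N) powr q)"
proof -
  have a: "0 < a" "a < 1" using s by auto
  have b0: "0 \<le> b" unfolding b_def using p q by (simp add: divide_left_mono)
  define Kw where "Kw = (1 / (a - b) + 1 / a + 1 / (1 - a)) * t powr (a - b)"
  have Kw: "0 < Kw" unfolding Kw_def using a b t by (intro mult_pos_pos add_pos_pos) auto
  define A where "A = repr_const * gauss_mass TYPE('a)"
  have A: "0 < A" unfolding A_def using repr_const_pos mass_pos by simp
  define k where "k r = \<bar>abel_weight a t r\<bar> * r powr (- b)" for r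
  define g where "g x r = r powr b * \<bar>hgrad r x\<bar>" for x r
  have [measurable]: "k \<in> borel_measurable borel" unfolding k_def by measurable
  have [measurable]: "(\<lambda>(x, r). g x r) \<in> borel_measurable (lborel \<Otimes>\<^sub>M lborel)" "\<And>x. g x \<in> borel_measurable borel"
    unfolding g_def by measurable
  have k0: "0 \<le> k r" and g0: "0 \<le> g x r" for x r unfolding k_def g_def by auto
  have kg: "k r * g x r = \<bar>abel_weight a t r\<bar> * \<bar>hgrad r x\<bar>" for x r
  proof (cases "r > 0")
    case True
    then have "r powr (- b) * r powr b = 1" by (simp add: powr_add[symmetric])
    then show ?thesis unfolding k_def g_def by (metis mult.assoc mult.commute mult.right_neutral)
  next
    case False
    then show ?thesis using t unfolding k_def abel_weight_def by simp
  qed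
  have hk: "ennreal (A * \<bar>\<phi> x - heat t x / gauss_mass TYPE('a)\<bar>) \<le> (\<integral>\<^sup>+r. ennreal (k r * g x r) \<partial>lborel)" for x
  proof -
    have "gauss_mass TYPE('a) * \<bar>\<phi> x - heat t x / gauss_mass TYPE('a)\<bar> = \<bar>gauss_mass TYPE('a) * (\<phi> x - heat t x / gauss_mass TYPE('a))\<bar>"
      using mass_pos by (simp only: abs_mult abs_of_pos)
    also have "\<dots> = \<bar>gauss_mass TYPE('a) * \<phi> x - heat t x\<bar>" using mass_pos by (simp add: right_diff_distrib)
    finally show ?thesis unfolding kg A_def using heat_minus_le_nn_integral[OF t, of x] by (simp add: mult.assoc)
  qed
  have kK: "(\<integral>\<^sup>+r. ennreal (k r) \<partial>lborel) \<le> ennreal Kw"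
    unfolding k_def Kw_def by (rule nn_integral_abel_weight[OF a b0 b t])
  have q1: "1 \<le> q" using p q by simp
  have "(\<integral>\<^sup>+x. (\<integral>\<^sup>+r. ennreal (k r * g x r powr q) \<partial>lborel) \<partial>lborel) = (\<integral>\<^sup>+r. (\<integral>\<^sup>+x. ennreal (k r * g x r powr q) \<partial>lborel) \<partial>lborel)"
    by (rule lborel_pair.Fubini'[symmetric]) measurable
  also have "\<dots> \<le> (\<integral>\<^sup>+r. ennreal (k r) * ennreal ((kernel_const * N) powr q) \<partial>lborel)"
  proof (intro nn_integral_mono)
    fix r
    show "(\<integral>\<^sup>+x. ennreal (k r * g x r powr q) \<partial>lborel) \<le> ennreal (k r) * ennreal ((kernel_const * N) powr q)"
    proof (cases "r > 0")
      case True
      have "(\<integral>\<^sup>+x. ennreal (k r * g x r powr q) \<partial>lborel)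
        = (\<integral>\<^sup>+x. ennreal (k r) * (ennreal ((r powr b) powr q) * ennreal (\<bar>hgrad r x\<bar> powr q)) \<partial>lborel)"
        unfolding g_def using k0 by (intro nn_integral_cong) (simp add: powr_mult ennreal_mult)
      also have "\<dots> = ennreal (k r) * (ennreal ((r powr b) powr q) * (\<integral>\<^sup>+x. ennreal (\<bar>hgrad r x\<bar> powr q) \<partial>lborel))"
        by (simp add: nn_integral_cmult)
      also have "\<dots> \<le> ennreal (k r) * (ennreal ((r powr b) powr q) * ennreal ((kernel_const * r powr (- b) * N) powr q))"
        unfolding b_def by (intro mult_left_mono nn_integral_hgrad_q p q True N f) auto
      also have "ennreal ((r powr b) powr q) * ennreal ((kernel_const * r powr (- b) * N) powr q) = ennreal ((kernel_const * N) powr q)"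
      proof -
        have "(r powr b) powr q * (kernel_const * r powr (- b) * N) powr q = (kernel_const * N * (r powr b * r powr (- b))) powr q"
          by (simp only: powr_mult[symmetric] mult_ac)
        also have "r powr b * r powr (- b) = 1" using True by (simp add: powr_add[symmetric])
        finally show ?thesis by (simp add: ennreal_mult'[symmetric])
      qed
      finally show ?thesis .
    next
      case False
      then have "k r = 0" using t unfolding k_def abel_weight_def by simp
      then show ?thesis by simp
    qed
  qed
  also have "\<dots> = (\<integral>\<^sup>+r. ennreal (k r) \<partial>lborel) * ennreal ((kernel_const * N) powr q)"
    by (rule nn_integral_multc) measurable
  also have "\<dots> \<le> ennreal Kw * ennreal ((kernel_const * N) powr q)" by (intro mult_right_mono kK) auto
  finally have inner: "(\<integral>\<^sup>+x. (\<integral>\<^sup>+r. ennreal (k r * g x r powr q) \<partial>lborel) \<partial>lborel) \<le> ennreal Kw * ennreal ((kernel_const * N) powr q)" .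
  have "(\<integral>\<^sup>+x. ennreal ((A * \<bar>\<phi> x - heat t x / gauss_mass TYPE('a)\<bar>) powr q) \<partial>lborel)
    \<le> (\<integral>\<^sup>+x. ennreal (Kw powr (q - 1)) * (\<integral>\<^sup>+r. ennreal (k r * g x r powr q) \<partial>lborel) \<partial>lborel)"
    using A by (intro nn_integral_mono Jensen_nn_integral[OF _ _ k0 g0 q1 Kw kK _ hk]) auto
  also have "\<dots> = ennreal (Kw powr (q - 1)) * (\<integral>\<^sup>+x. (\<integral>\<^sup>+r. ennreal (k r * g x r powr q) \<partial>lborel) \<partial>lborel)"
    by (rule nn_integral_cmult) measurable
  also have "\<dots> \<le> ennreal (Kw powr (q - 1)) * (ennreal Kw * ennreal ((kernel_const * N) powr q))"
    by (intro mult_left_mono inner) auto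
  also have "\<dots> = ennreal ((Kw * (kernel_const * N)) powr q)"
  proof -
    have e: "ennreal X * (ennreal Kw * ennreal Y) = ennreal (X * (Kw * Y))" if "0 \<le> X" "0 \<le> Y" for X Y
      using Kw that by (simp add: ennreal_mult)
    have "Kw powr (q - 1) * (Kw * (kernel_const * N) powr q) = (Kw * (kernel_const * N)) powr q"
      unfolding powr_mult[of Kw] using Kw by (simp add: powr_diff)
    then show ?thesis by (subst e) simp_all
  qed
  finally have main: "(\<integral>\<^sup>+x. ennreal ((A * \<bar>\<phi> x - heat t x / gauss_mass TYPE('a)\<bar>) powr q) \<partial>lborel) \<le> ennreal ((Kw * (kernel_const * N)) powr q)" .
  have "(\<integral>\<^sup>+x. ennreal (\<bar>\<phi> x - heat t x / gauss_mass TYPE('a)\<bar> powr q) \<partial>lborel)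
    = (\<integral>\<^sup>+x. ennreal ((1 / A) powr q) * ennreal ((A * \<bar>\<phi> x - heat t x / gauss_mass TYPE('a)\<bar>) powr q) \<partial>lborel)"
  proof (intro nn_integral_cong)
    fix x
    have "(1 / A) powr q * (A * \<bar>\<phi> x - heat t x / gauss_mass TYPE('a)\<bar>) powr q = ((1 / A) * (A * \<bar>\<phi> x - heat t x / gauss_mass TYPE('a)\<bar>)) powr q"
      by (simp only: powr_mult)
    also have "(1 / A) * (A * \<bar>\<phi> x - heat t x / gauss_mass TYPE('a)\<bar>) = \<bar>\<phi> x - heat t x / gauss_mass TYPE('a)\<bar>"
      using A by simp
    finally show "ennreal (\<bar>\<phi> x - heat t x / gauss_mass TYPE('a)\<bar> powr q)
      = ennreal ((1 / A) powr q) * ennreal ((A * \<bar>\<phi> x - heat t x / gauss_mass TYPE('a)\<bar>) powr q)"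
      by (simp add: ennreal_mult'[symmetric])
  qed
  also have "\<dots> = ennreal ((1 / A) powr q) * (\<integral>\<^sup>+x. ennreal ((A * \<bar>\<phi> x - heat t x / gauss_mass TYPE('a)\<bar>) powr q) \<partial>lborel)"
    by (rule nn_integral_cmult) measurable
  also have "\<dots> \<le> ennreal ((1 / A) powr q) * ennreal ((Kw * (kernel_const * N)) powr q)" by (intro mult_left_mono main) auto
  also have "\<dots> = ennreal (((1 / A) * (Kw * (kernel_const * N))) powr q)"
    by (simp only: powr_mult ennreal_mult'[symmetric] powr_ge_zero)
  also have "(1 / A) * (Kw * (kernel_const * N)) = heat_rate b * t powr (a - b) * N"
    unfolding heat_rate_def Kw_def A_def by simp
  finally show ?thesis .
qed

section \<open>Equicontinuity of heat means and the Hoelder estimate\<close>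

lemma abs_heat_le:
  assumes p: "1 \<le> p" and t: "0 < t" and N: "0 \<le> N"
    and u: "(\<integral>\<^sup>+y. ennreal (\<bar>\<phi> y\<bar> powr p) \<partial>lborel) \<le> ennreal (N powr p)"
  shows "\<bar>heat t x\<bar> \<le> (gauss_mass TYPE('a) powr (p - 1) * t powr (- real DIM('a) / 2)) powr (1 / p) * N"
proof (rule Jensen_sup_bound[where M=lborel and k="\<lambda>z. gauss t (x - z)" and g="\<lambda>z. \<bar>\<phi> z\<bar>"])
  show "ennreal \<bar>heat t x\<bar> \<le> (\<integral>\<^sup>+z. ennreal (gauss t (x - z) * \<bar>\<phi> z\<bar>) \<partial>lborel)"
    unfolding heat_def using norm_integral_le_nn_integral[of lborel "\<lambda>z. gauss t (x - z) * \<phi> z"] by (simp add: abs_mult)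
  show "gauss t (x - z) \<le> t powr (- real DIM('a) / 2)" for z by (rule gauss_le[OF t])
qed (use p mass_pos N u t in \<open>auto simp: nn_integral_gauss_shift\<close>)

text \<open>The difference of two translated kernels has mass at most \<open>2 * gauss_mass\<close>
  and supremum of order \<open>norm (x - y)\<close>. Interpolation leaves the exponent
  \<open>1 / p\<close> with a constant depending on \<open>t\<close>, which suffices for
  equicontinuity at a fixed time.\<close>

lemma abs_heat_diff_le:
  assumes p: "1 \<le> p" and t: "0 < t" and N: "0 \<le> N"
    and u: "(\<integral>\<^sup>+y. ennreal (\<bar>\<phi> y\<bar> powr p) \<partial>lborel) \<le> ennreal (N powr p)"
  shows "\<bar>heat t x - heat t y\<bar> \<le>
    ((2 * gauss_mass TYPE('a)) powr (p - 1) * (2 * t powr (- real DIM('a) / 2 - 1 / 2) * norm (x - y))) powr (1 / p) * N"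
proof (rule Jensen_sup_bound[where M=lborel and k="\<lambda>z. \<bar>gauss t (x - z) - gauss t (y - z)\<bar>" and g="\<lambda>z. \<bar>\<phi> z\<bar>"])
  show "ennreal \<bar>heat t x - heat t y\<bar> \<le> (\<integral>\<^sup>+z. ennreal (\<bar>gauss t (x - z) - gauss t (y - z)\<bar> * \<bar>\<phi> z\<bar>) \<partial>lborel)"
  proof -
    have "heat t x - heat t y = (LINT z|lborel. (gauss t (x - z) - gauss t (y - z)) * \<phi> z)"
      unfolding heat_def using integrable_gauss_phi[OF t] by (simp add: left_diff_distrib)
    then show ?thesis
      using norm_integral_le_nn_integral[of lborel "\<lambda>z. (gauss t (x - z) - gauss t (y - z)) * \<phi> z"] by (simp add: abs_mult)
  qed
  show "\<bar>gauss t (x - z) - gauss t (y - z)\<bar> \<le> 2 * t powr (- real DIM('a) / 2 - 1 / 2) * norm (x - y)" for z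
    using gauss_lipschitz[OF t, of "x - z" "y - z"] by simp
  have "(\<integral>\<^sup>+z. ennreal \<bar>gauss t (x - z) - gauss t (y - z)\<bar> \<partial>lborel) \<le> (\<integral>\<^sup>+z. ennreal (gauss t (x - z)) + ennreal (gauss t (y - z)) \<partial>lborel)"
  proof (rule nn_integral_mono)
    fix z
    have "\<bar>gauss t (x - z) - gauss t (y - z)\<bar> \<le> gauss t (x - z) + gauss t (y - z)"
      using gauss_nonneg[of t "x - z"] gauss_nonneg[of t "y - z"] by linarith
    then show "ennreal \<bar>gauss t (x - z) - gauss t (y - z)\<bar> \<le> ennreal (gauss t (x - z)) + ennreal (gauss t (y - z))"
      by (simp add: ennreal_plus[symmetric] ennreal_leI del: ennreal_plus)
  qed
  also have "\<dots> = ennreal (gauss_mass TYPE('a)) + ennreal (gauss_mass TYPE('a))"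
    using t by (simp add: nn_integral_add nn_integral_gauss_shift)
  also have "\<dots> = ennreal (2 * gauss_mass TYPE('a))"
    using mass_pos by (simp add: ennreal_plus[symmetric] del: ennreal_plus)
  finally show "(\<integral>\<^sup>+z. ennreal \<bar>gauss t (x - z) - gauss t (y - z)\<bar> \<partial>lborel) \<le> ennreal (2 * gauss_mass TYPE('a))" .
qed (use p mass_pos N u in auto)

definition lip_rate :: "real \<Rightarrow> real" where
  "lip_rate p = 4 * 4 powr (real DIM('a) / 2) * gauss_mass TYPE('a) powr ((p - 1) / p)"

lemma abs_hgrad_diff_le:
  assumes p: "1 \<le> p" and r: "0 < r" and N: "0 \<le> N"
    and f: "(\<integral>\<^sup>+y. ennreal (norm (riesz_gradient s \<phi> y) powr p) \<partial>lborel) \<le> ennreal (N powr p)"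
  shows "\<bar>hgrad r x - hgrad r y\<bar> \<le> lip_rate p * norm (x - y) * r powr (- 1 - real DIM('a) / 2 / p) * N"
proof (cases "x = y")
  case False
  let ?C = "gauss_mass TYPE('a)"
  \<comment> \<open>Twice the factor in \<open>gauss_vec_diff_le\<close>, since two Gaussians enter
    with the same mass and the same supremum bound.\<close>
  define Z where "Z = 4 * 4 powr (real DIM('a) / 2) / r * norm (x - y)"
  have Z: "0 < Z" unfolding Z_def using r False by simp
  have le: "norm (gauss_vec r (x - z) - gauss_vec r (y - z)) \<le> Z / 2 * (gauss (4 * r) (x - z) + gauss (4 * r) (y - z))" for z
    using gauss_vec_diff_le[OF r, of "x - z" "y - z"] unfolding Z_def
    by (simp add: mult.commute mult.left_commute)
  have "\<bar>hgrad r x - hgrad r y\<bar> \<le> ((Z * ?C) powr (p - 1) * (Z * r powr (- real DIM('a) / 2))) powr (1 / p) * N"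
  proof (rule Jensen_sup_bound[where M=lborel and k="\<lambda>z. norm (gauss_vec r (x - z) - gauss_vec r (y - z))"
        and g="\<lambda>z. norm (riesz_gradient s \<phi> z)"])
    show "ennreal \<bar>hgrad r x - hgrad r y\<bar> \<le> (\<integral>\<^sup>+z. ennreal (norm (gauss_vec r (x - z) - gauss_vec r (y - z)) * norm (riesz_gradient s \<phi> z)) \<partial>lborel)"
    proof -
      have "hgrad r x - hgrad r y = (LINT z|lborel. (gauss_vec r (x - z) - gauss_vec r (y - z)) \<bullet> riesz_gradient s \<phi> z)"
        unfolding hgrad_def using integrable_hgrad[OF r] by (simp add: inner_diff_left)
      then have "ennreal \<bar>hgrad r x - hgrad r y\<bar> \<le> (\<integral>\<^sup>+z. ennreal \<bar>(gauss_vec r (x - z) - gauss_vec r (y - z)) \<bullet> riesz_gradient s \<phi> z\<bar> \<partial>lborel)"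
        using norm_integral_le_nn_integral[of lborel "\<lambda>z. (gauss_vec r (x - z) - gauss_vec r (y - z)) \<bullet> riesz_gradient s \<phi> z"] by simp
      also have "\<dots> \<le> (\<integral>\<^sup>+z. ennreal (norm (gauss_vec r (x - z) - gauss_vec r (y - z)) * norm (riesz_gradient s \<phi> z)) \<partial>lborel)"
        by (intro nn_integral_mono ennreal_leI Cauchy_Schwarz_ineq2)
      finally show ?thesis .
    qed
    show "norm (gauss_vec r (x - z) - gauss_vec r (y - z)) \<le> Z * r powr (- real DIM('a) / 2)" for z
    proof -
      have g: "gauss (4 * r) v \<le> r powr (- real DIM('a) / 2)" for v :: 'a using r by (intro gauss_wide_le) auto
      have "Z / 2 * (gauss (4 * r) (x - z) + gauss (4 * r) (y - z)) \<le> Z / 2 * (r powr (- real DIM('a) / 2) + r powr (- real DIM('a) / 2))"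
        using Z by (intro mult_left_mono add_mono g) auto
      then show ?thesis using le[of z] by simp
    qed
    have "(\<integral>\<^sup>+z. ennreal (norm (gauss_vec r (x - z) - gauss_vec r (y - z))) \<partial>lborel)
      \<le> (\<integral>\<^sup>+z. ennreal (Z / 2) * (ennreal (gauss (4 * r) (x - z)) + ennreal (gauss (4 * r) (y - z))) \<partial>lborel)"
      using le Z by (intro nn_integral_mono) (simp add: ennreal_mult'[symmetric] ennreal_plus[symmetric] ennreal_leI del: ennreal_plus)
    also have "\<dots> = ennreal (Z / 2) * (ennreal ?C + ennreal ?C)"
      using r by (simp add: nn_integral_cmult nn_integral_add nn_integral_gauss_shift)
    also have "\<dots> = ennreal (Z * ?C)"
      using Z mass_pos by (simp add: ennreal_mult'[symmetric] ennreal_plus[symmetric] del: ennreal_plus)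
    finally show "(\<integral>\<^sup>+z. ennreal (norm (gauss_vec r (x - z) - gauss_vec r (y - z))) \<partial>lborel) \<le> ennreal (Z * ?C)" .
  qed (use p mass_pos N Z f in auto)
  also have "((Z * ?C) powr (p - 1) * (Z * r powr (- real DIM('a) / 2))) powr (1 / p) = lip_rate p * norm (x - y) * r powr (- 1 - real DIM('a) / 2 / p)"
  proof -
    let ?R = "r powr (- real DIM('a) / 2)"
    have "(Z * ?C) powr (p - 1) * (Z * ?R) = (Z powr (p - 1) * Z) * (?C powr (p - 1) * ?R)"
      by (simp only: powr_mult mult_ac)
    also have "Z powr (p - 1) * Z = Z powr p" using Z by (simp add: powr_diff)
    finally have "((Z * ?C) powr (p - 1) * (Z * ?R)) powr (1 / p) = (Z powr p) powr (1 / p) * ((?C powr (p - 1)) powr (1 / p) * ?R powr (1 / p))"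
      by (simp only: powr_mult)
    also have "(Z powr p) powr (1 / p) = Z" using Z p by (simp add: powr_powr)
    also have "(?C powr (p - 1)) powr (1 / p) = ?C powr ((p - 1) / p)" by (simp add: powr_powr)
    also have "?R powr (1 / p) = r powr (- real DIM('a) / 2 / p)" by (simp add: powr_powr)
    also have "Z * (?C powr ((p - 1) / p) * r powr (- real DIM('a) / 2 / p))
      = lip_rate p * norm (x - y) * (1 / r * r powr (- real DIM('a) / 2 / p))"
      unfolding Z_def lip_rate_def by simp
    also have "1 / r * r powr (- real DIM('a) / 2 / p) = r powr (- 1 - real DIM('a) / 2 / p)"
    proof -
      have "- 1 - real DIM('a) / 2 / p = - real DIM('a) / 2 / p - 1" by simp
      then have "r powr (- 1 - real DIM('a) / 2 / p) = r powr (- real DIM('a) / 2 / p) / r"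
        using r by (simp only: powr_diff powr_one less_imp_le)
      then show ?thesis by simp
    qed
    finally show ?thesis .
  qed
  finally show ?thesis .
qed simp

definition holder_rate :: "real \<Rightarrow> real" where
  "holder_rate p = (2 * kernel_const / (a - 1 / 2 - real DIM('a) / 2 / p) + lip_rate p / (1 + real DIM('a) / 2 / p - a)) / (repr_const * gauss_mass TYPE('a))"

text \<open>The time integral is split at the parabolic scale \<open>r = d^2\<close> with
  \<open>d = norm (x - y)\<close>. Below it the two smoothed gradients are bounded separately, and
  \<open>r powr (a - 3 / 2 - m)\<close> is integrable at 0 exactly when \<open>s * p > n\<close>.
  Above it the Lipschitz bound gains \<open>d * r powr (- 1 / 2)\<close>, which makes the tail
  integrable. Both parts scale like \<open>d powr (s - n / p)\<close>.\<close>

lemma holder_bound: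
  assumes p: "1 \<le> p" and N: "0 \<le> N" and sp: "real DIM('a) < s * p"
    and f: "(\<integral>\<^sup>+y. ennreal (norm (riesz_gradient s \<phi> y) powr p) \<partial>lborel) \<le> ennreal (N powr p)"
  shows "\<bar>\<phi> x - \<phi> y\<bar> \<le> holder_rate p * norm (x - y) powr (s - real DIM('a) / p) * N"
proof (cases "x = y")
  case False
  define d where "d = norm (x - y)"
  have d: "0 < d" using False unfolding d_def by simp
  define A where "A = repr_const * gauss_mass TYPE('a)"
  have A: "0 < A" unfolding A_def using repr_const_pos mass_pos by simp
  define m where "m = real DIM('a) / 2 / p"
  have m: "0 \<le> m" "m < a - 1 / 2"
    using p sp unfolding m_def by (auto simp: field_simps)
  have m1: "a - m < 1" "0 < 1 + m - a" "0 < a - 1 / 2 - m" using m s by (auto simp: field_simps)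
  define f1 where "f1 r = indicator {0<..d\<^sup>2} r * r powr (a - 3 / 2 - m)" for r :: real
  define f2 where "f2 r = indicator {d\<^sup>2..} r * r powr (a - 2 - m)" for r :: real
  have [measurable]: "f1 \<in> borel_measurable borel" "f2 \<in> borel_measurable borel" unfolding f1_def f2_def by measurable
  have nn: "0 \<le> f1 r" "0 \<le> f2 r" for r unfolding f1_def f2_def by auto
  have lr: "0 \<le> lip_rate p" unfolding lip_rate_def by simp
  have c0: "0 < kernel_const" by (rule kernel_const)
  have "has_bochner_integral lborel (\<lambda>r. indicator {0<..} r * (r powr (a - 1) * hgrad r x)
      - indicator {0<..} r * (r powr (a - 1) * hgrad r y))
     (repr_const * (gauss_mass TYPE('a) * \<phi> x) - repr_const * (gauss_mass TYPE('a) * \<phi> y))"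
    using representation[of 0 x] representation[of 0 y] by (intro has_bochner_integral_diff) (auto simp: heat0_def)
  then have "A * (\<phi> x - \<phi> y) = (LINT r|lborel. indicator {0<..} r * (r powr (a - 1) * hgrad r x)
      - indicator {0<..} r * (r powr (a - 1) * hgrad r y))"
    unfolding A_def by (simp add: has_bochner_integral_iff algebra_simps)
  then have "ennreal \<bar>A * (\<phi> x - \<phi> y)\<bar> \<le> (\<integral>\<^sup>+r. ennreal \<bar>indicator {0<..} r * (r powr (a - 1) * hgrad r x)
      - indicator {0<..} r * (r powr (a - 1) * hgrad r y)\<bar> \<partial>lborel)"
    using norm_integral_le_nn_integral[of lborel "\<lambda>r. indicator {0<..} r * (r powr (a - 1) * hgrad r x)
      - indicator {0<..} r * (r powr (a - 1) * hgrad r y)"] by simp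
  moreover have "\<bar>A * (\<phi> x - \<phi> y)\<bar> = A * \<bar>\<phi> x - \<phi> y\<bar>" using A by (simp add: abs_mult)
  ultimately have "ennreal (A * \<bar>\<phi> x - \<phi> y\<bar>) \<le> (\<integral>\<^sup>+r. ennreal \<bar>indicator {0<..} r * (r powr (a - 1) * hgrad r x)
      - indicator {0<..} r * (r powr (a - 1) * hgrad r y)\<bar> \<partial>lborel)" by (simp only:)
  also have "\<dots> \<le> (\<integral>\<^sup>+r. ennreal (2 * kernel_const * N) * ennreal (f1 r) + ennreal (lip_rate p * d * N) * ennreal (f2 r) \<partial>lborel)"
  proof (rule nn_integral_mono)
    fix r :: real
    have "\<bar>indicator {0<..} r * (r powr (a - 1) * hgrad r x) - indicator {0<..} r * (r powr (a - 1) * hgrad r y)\<bar>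
      \<le> 2 * kernel_const * N * f1 r + lip_rate p * d * N * f2 r"
    proof (cases "r > 0")
      case True
      have e: "\<bar>indicator {0<..} r * (r powr (a - 1) * hgrad r x) - indicator {0<..} r * (r powr (a - 1) * hgrad r y)\<bar>
        = r powr (a - 1) * \<bar>hgrad r x - hgrad r y\<bar>"
        using True by (simp add: right_diff_distrib[symmetric] abs_mult)
      show ?thesis
      proof (cases "r \<le> d\<^sup>2")
        case le: True
        have "\<bar>hgrad r x - hgrad r y\<bar> \<le> 2 * (kernel_const * r powr (- 1 / 2 - m) * N)"
          using abs_hgrad_le[OF p True N f, of x] abs_hgrad_le[OF p True N f, of y] unfolding m_def by linarith
        then have "r powr (a - 1) * \<bar>hgrad r x - hgrad r y\<bar> \<le> r powr (a - 1) * (2 * (kernel_const * r powr (- 1 / 2 - m) * N))"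
          by (intro mult_left_mono) auto
        also have "\<dots> = 2 * kernel_const * N * (r powr (a - 1) * r powr (- 1 / 2 - m))" by simp
        also have "r powr (a - 1) * r powr (- 1 / 2 - m) = f1 r"
        proof -
          have "(a - 1) + (- 1 / 2 - m) = a - 3 / 2 - m" by (simp add: field_simps)
          then have "r powr (a - 1) * r powr (- 1 / 2 - m) = r powr (a - 3 / 2 - m)"
            by (simp only: powr_add[symmetric])
          then show ?thesis unfolding f1_def using True le by simp
        qed
        finally show ?thesis unfolding e using nn lr N d by (simp add: add_increasing2)
      next
        case gt: False
        have "r powr (a - 1) * \<bar>hgrad r x - hgrad r y\<bar> \<le> r powr (a - 1) * (lip_rate p * d * r powr (- 1 - m) * N)"
          using abs_hgrad_diff_le[OF p True N f, of x y] unfolding m_def d_def by (intro mult_left_mono) auto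
        also have "\<dots> = lip_rate p * d * N * (r powr (a - 1) * r powr (- 1 - m))" by simp
        also have "r powr (a - 1) * r powr (- 1 - m) = f2 r"
        proof -
          have "(a - 1) + (- 1 - m) = a - 2 - m" by (simp add: field_simps)
          then have "r powr (a - 1) * r powr (- 1 - m) = r powr (a - 2 - m)"
            by (simp only: powr_add[symmetric])
          then show ?thesis unfolding f2_def using True gt by simp
        qed
        finally show ?thesis unfolding e using nn c0 N by (simp add: add_increasing)
      qed
    qed (use nn c0 lr N d in simp)
    then have "ennreal \<bar>indicator {0<..} r * (r powr (a - 1) * hgrad r x) - indicator {0<..} r * (r powr (a - 1) * hgrad r y)\<bar>
      \<le> ennreal (2 * kernel_const * N * f1 r + lip_rate p * d * N * f2 r)" by (rule ennreal_leI)
    also have "\<dots> = ennreal (2 * kernel_const * N) * ennreal (f1 r) + ennreal (lip_rate p * d * N) * ennreal (f2 r)"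
      using nn c0 lr N d by (simp add: ennreal_mult)
    finally show "ennreal \<bar>indicator {0<..} r * (r powr (a - 1) * hgrad r x) - indicator {0<..} r * (r powr (a - 1) * hgrad r y)\<bar>
      \<le> ennreal (2 * kernel_const * N) * ennreal (f1 r) + ennreal (lip_rate p * d * N) * ennreal (f2 r)" .
  qed
  also have "\<dots> = ennreal (2 * kernel_const * N) * (\<integral>\<^sup>+r. ennreal (f1 r) \<partial>lborel) + ennreal (lip_rate p * d * N) * (\<integral>\<^sup>+r. ennreal (f2 r) \<partial>lborel)"
    by (simp add: nn_integral_add nn_integral_cmult)
  also have "(\<integral>\<^sup>+r. ennreal (f1 r) \<partial>lborel) = ennreal (d powr (s - real DIM('a) / p) / (a - 1 / 2 - m))"
  proof -
    have e: "-1 < a - 3 / 2 - m" using m by simp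
    have h1: "(d\<^sup>2) powr (a - 3 / 2 - m + 1) = d powr (s - real DIM('a) / p)"
    proof -
      have "(d\<^sup>2) powr (a - 3 / 2 - m + 1) = d powr (2 * (a - 3 / 2 - m + 1))"
      proof -
        have "d\<^sup>2 = d powr 2" using d by (simp add: powr_numeral)
        then show ?thesis by (simp only: powr_powr)
      qed
      also have "2 * (a - 3 / 2 - m + 1) = s - real DIM('a) / p" unfolding m_def by (simp add: field_simps)
      finally show ?thesis .
    qed
    have h2: "a - 3 / 2 - m + 1 = a - 1 / 2 - m" by simp
    show ?thesis unfolding f1_def nn_integral_powr_from_0[OF e zero_le_power2] h1 unfolding h2 ..
  qed
  also have "(\<integral>\<^sup>+r. ennreal (f2 r) \<partial>lborel) = ennreal (d powr (s - real DIM('a) / p - 1) / (1 + m - a))"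
  proof -
    have e: "a - 2 - m < -1" using m1(1) by linarith
    have d2: "0 < d\<^sup>2" using d by simp
    have h1: "(d\<^sup>2) powr (a - 2 - m + 1) = d powr (s - real DIM('a) / p - 1)"
    proof -
      have "(d\<^sup>2) powr (a - 2 - m + 1) = d powr (2 * (a - 2 - m + 1))"
      proof -
        have "d\<^sup>2 = d powr 2" using d by (simp add: powr_numeral)
        then show ?thesis by (simp only: powr_powr)
      qed
      also have "2 * (a - 2 - m + 1) = s - real DIM('a) / p - 1" unfolding m_def by (simp add: field_simps)
      finally show ?thesis .
    qed
    have h2: "a - 2 - m + 1 = - (1 + m - a)" by simp
    show ?thesis unfolding f2_def nn_integral_powr_to_inf[OF e d2] h1 unfolding h2 by (simp only: minus_divide_divide)
  qed
  also have "ennreal (2 * kernel_const * N) * ennreal (d powr (s - real DIM('a) / p) / (a - 1 / 2 - m)) +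
      ennreal (lip_rate p * d * N) * ennreal (d powr (s - real DIM('a) / p - 1) / (1 + m - a))
    = ennreal (2 * kernel_const * N * (d powr (s - real DIM('a) / p) / (a - 1 / 2 - m)) + lip_rate p * d * N * (d powr (s - real DIM('a) / p - 1) / (1 + m - a)))"
    using divide_nonneg_pos[OF powr_ge_zero m1(2), of d] divide_nonneg_pos[OF powr_ge_zero m1(3), of d] c0 lr N d
    by (simp only: ennreal_mult ennreal_plus add_nonneg_nonneg mult_nonneg_nonneg less_imp_le zero_le_numeral)
  also have "lip_rate p * d * N * (d powr (s - real DIM('a) / p - 1) / (1 + m - a)) = lip_rate p * N * (d powr (s - real DIM('a) / p) / (1 + m - a))"
    using d by (simp add: powr_diff)
  also have "2 * kernel_const * N * (d powr (s - real DIM('a) / p) / (a - 1 / 2 - m)) + lip_rate p * N * (d powr (s - real DIM('a) / p) / (1 + m - a))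
    = A * (holder_rate p * d powr (s - real DIM('a) / p) * N)"
  proof -
    have *: "A * (X / A * D * N) = X * D * N" for X D using A by simp
    have "2 * kernel_const * N * (D / P) + lip_rate p * N * (D / Q) = (2 * kernel_const / P + lip_rate p / Q) * D * N" for D P Q
      by (simp add: distrib_left distrib_right mult_ac)
    then show ?thesis
      unfolding holder_rate_def A_def[symmetric] m_def[symmetric] * .
  qed
  finally have le: "ennreal (A * \<bar>\<phi> x - \<phi> y\<bar>) \<le> ennreal (A * (holder_rate p * d powr (s - real DIM('a) / p) * N))" .
  have "0 \<le> holder_rate p"
    unfolding holder_rate_def A_def[symmetric] m_def[symmetric] using A m1 c0 lr
    by (intro divide_nonneg_pos add_nonneg_nonneg) simp_all
  then have "A * \<bar>\<phi> x - \<phi> y\<bar> \<le> A * (holder_rate p * d powr (s - real DIM('a) / p) * N)"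
    using le A N by (subst (asm) ennreal_le_iff) auto
  then show ?thesis using A unfolding d_def by simp
qed simp

end

section \<open>Test functions\<close>

lemma Ck_function_diff:
  "Ck_function k f \<Longrightarrow> Ck_function k g \<Longrightarrow> Ck_function k (\<lambda>x. f x - g x)"
proof (induction k arbitrary: f g)
  case 0
  then show ?case by (auto intro: continuous_on_diff)
next
  case (Suc k)
  have d: "frechet_derivative (\<lambda>x. f x - g x) (at x) b = frechet_derivative f (at x) b - frechet_derivative g (at x) b" for x b
  proof -
    have "((\<lambda>x. f x - g x) has_derivative (\<lambda>h. frechet_derivative f (at x) h - frechet_derivative g (at x) h)) (at x)"
      using Suc.prems by (intro has_derivative_diff) (auto simp: frechet_derivative_works)
    from fun_cong[OF frechet_derivative_at[OF this], of b] show ?thesis by (simp only:)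
  qed
  show ?case using Suc unfolding Ck_function.simps d by (auto intro: differentiable_diff)
qed

lemma Cc_infinity_diff:
  assumes f: "f \<in> Cc_infinity" and g: "g \<in> Cc_infinity"
  shows "(\<lambda>x. f x - g x) \<in> Cc_infinity"
proof -
  have "compact (closure {x. f x \<noteq> 0} \<union> closure {x. g x \<noteq> 0})"
    using f g unfolding Cc_infinity_def by (auto intro: compact_Un)
  moreover have "closure {x. f x - g x \<noteq> 0} \<subseteq> closure {x. f x \<noteq> 0} \<union> closure {x. g x \<noteq> 0}"
    unfolding closure_Un[symmetric] by (rule closure_mono) auto
  ultimately have "compact (closure {x. f x - g x \<noteq> 0})"
    unfolding compact_eq_bounded_closed using bounded_subset closed_closure by blast
  then show ?thesis using f g Ck_function_diff[of _ f g] unfolding Cc_infinity_def by auto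
qed

lemma Cc_infinity_lipschitz_test:
  assumes \<phi>: "\<phi> \<in> Cc_infinity" and s: "0 < s" "s < 1"
  shows "\<exists>S L. lipschitz_test \<phi> S L s"
proof -
  define K where "K = closure {x. \<phi> x \<noteq> 0}"
  have K: "compact K" and Ck: "\<And>k. Ck_function k \<phi>" using \<phi> unfolding K_def Cc_infinity_def by auto
  have out: "\<phi> x = 0" if "x \<notin> K" for x using that closure_subset[of "{x. \<phi> x \<noteq> 0}"] unfolding K_def by auto
  have cont: "continuous_on UNIV \<phi>" using Ck[of 0] by simp
  have diff: "\<And>x. \<phi> differentiable (at x)"
    and pd: "\<And>b. b \<in> Basis \<Longrightarrow> continuous_on UNIV (\<lambda>x. frechet_derivative \<phi> (at x) b)"
    using Ck[of "Suc 0"] by auto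
  have bound: "\<exists>C\<ge>0. \<forall>x. \<bar>f x\<bar> \<le> C" if f: "continuous_on UNIV f" and f0: "\<And>x. x \<notin> K \<Longrightarrow> f x = 0" for f :: "'a \<Rightarrow> real"
  proof -
    have "compact (f ` K)" using K continuous_on_subset[OF f] by (intro compact_continuous_image) auto
    then have "bounded (f ` K)" by (rule compact_imp_bounded)
    then obtain C where C: "\<And>y. y \<in> f ` K \<Longrightarrow> norm y \<le> C" unfolding bounded_iff by blast
    have "\<bar>f x\<bar> \<le> max 0 C" for x
      using C[of "f x"] f0[of x] by (cases "x \<in> K") (auto simp: le_max_iff_disj)
    then show ?thesis by (intro exI[of _ "max 0 C"]) auto
  qed
  obtain S where S: "\<And>x. \<bar>\<phi> x\<bar> \<le> S" using bound[OF cont out] by blast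
  have d0: "frechet_derivative \<phi> (at x) b = 0" if "x \<notin> K" for x b
  proof -
    have "open (- K)" using K by (auto intro: compact_imp_closed)
    then have "(\<phi> has_derivative (\<lambda>_. 0)) (at x)"
      using that out by (intro has_derivative_transform_within_open[OF has_derivative_const[of 0]]) auto
    from fun_cong[OF frechet_derivative_at[OF this], of b] show ?thesis by (simp only:)
  qed
  have "\<forall>b\<in>Basis. \<exists>C. \<forall>x. \<bar>frechet_derivative \<phi> (at x) b\<bar> \<le> C"
    using bound[OF pd d0] by blast
  then obtain C where C: "\<And>b x. b \<in> Basis \<Longrightarrow> \<bar>frechet_derivative \<phi> (at x) b\<bar> \<le> C b" by metis
  define L where "L = (\<Sum>b\<in>Basis. C b)"
  have lip: "norm (\<phi> x - \<phi> y) \<le> L * norm (x - y)" for x y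
  proof (rule differentiable_bound[of UNIV])
    fix z
    show der: "(\<phi> has_derivative frechet_derivative \<phi> (at z)) (at z within UNIV)"
      using diff by (simp add: frechet_derivative_works)
    have lin: "linear (frechet_derivative \<phi> (at z))" using der has_derivative_linear by auto
    show "onorm (frechet_derivative \<phi> (at z)) \<le> L"
    proof (rule onorm_le)
      fix h :: 'a
      have "frechet_derivative \<phi> (at z) h = (\<Sum>b\<in>Basis. (h \<bullet> b) * frechet_derivative \<phi> (at z) b)"
        using linear_sum[OF lin, of "\<lambda>b. (h \<bullet> b) *\<^sub>R b" Basis] linear_scale[OF lin]
        by (simp add: euclidean_representation)
      also have "\<bar>\<dots>\<bar> \<le> (\<Sum>b\<in>Basis. norm h * C b)"
      proof (rule order_trans[OF sum_abs sum_mono])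
        fix b :: 'a assume b: "b \<in> Basis"
        show "\<bar>(h \<bullet> b) * frechet_derivative \<phi> (at z) b\<bar> \<le> norm h * C b"
          unfolding abs_mult using Basis_le_norm[OF b, of h] C[OF b, of z] by (intro mult_mono) auto
      qed
      finally show "norm (frechet_derivative \<phi> (at z) h) \<le> L * norm h"
        unfolding L_def by (simp add: sum_distrib_left sum_distrib_right mult.commute)
    qed
  qed auto
  have meas: "\<phi> \<in> borel_measurable borel" using cont by (rule borel_measurable_continuous_onI)
  have "integrable lborel \<phi>"
  proof (rule Bochner_Integration.integrable_bound)
    show "integrable lborel (\<lambda>x. S * indicator K x)"
      using K emeasure_compact_finite[OF K] by (intro integrable_mult_right integrable_real_indicator) (auto intro: borel_compact)
    show "AE x in lborel. norm (\<phi> x) \<le> norm (S * indicator K x)"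
      using S out by (intro AE_I2) (auto split: split_indicator intro: order_trans[OF _ abs_ge_self])
  qed (use meas in simp)
  then have "lipschitz_test \<phi> S L s" using s S lip by unfold_locales auto
  then show ?thesis by blast
qed

text \<open>Linearity is taken from \<open>riesz_gradient_eq\<close>, whose time integrals are known
  to converge absolutely for each of the functions involved.\<close>

lemma riesz_gradient_diff:
  assumes \<phi>: "\<phi> \<in> Cc_infinity" and \<psi>: "\<psi> \<in> Cc_infinity" and s: "0 < s" "s < 1"
  shows "riesz_gradient s (\<lambda>x. \<phi> x - \<psi> x) x = riesz_gradient s \<phi> x - riesz_gradient s \<psi> x"
proof -
  obtain S1 L1 S2 L2 S3 L3 where "lipschitz_test \<phi> S1 L1 s" "lipschitz_test \<psi> S2 L2 s" "lipschitz_test (\<lambda>x. \<phi> x - \<psi> x) S3 L3 s"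
    using Cc_infinity_lipschitz_test[OF \<phi> s] Cc_infinity_lipschitz_test[OF \<psi> s]
      Cc_infinity_lipschitz_test[OF Cc_infinity_diff[OF \<phi> \<psi>] s] by blast
  then interpret f: lipschitz_test \<phi> S1 L1 s + g: lipschitz_test \<psi> S2 L2 s + h: lipschitz_test "\<lambda>x. \<phi> x - \<psi> x" S3 L3 s
    by simp_all
  have v: "h.vconv \<tau> x = f.vconv \<tau> x - g.vconv \<tau> x" if "0 < \<tau>" for \<tau>
    unfolding f.vconv_def g.vconv_def h.vconv_def
    using f.integrable_vconv[OF that] g.integrable_vconv[OF that] by (simp add: scaleR_diff_left)
  have "(LINT \<tau>|lborel. indicator {0<..} \<tau> *\<^sub>R (\<tau> powr (- ((1 + s) / 2)) *\<^sub>R h.vconv \<tau> x))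
    = (LINT \<tau>|lborel. indicator {0<..} \<tau> *\<^sub>R (\<tau> powr (- ((1 + s) / 2)) *\<^sub>R f.vconv \<tau> x)
       - indicator {0<..} \<tau> *\<^sub>R (\<tau> powr (- ((1 + s) / 2)) *\<^sub>R g.vconv \<tau> x))"
    using v by (intro Bochner_Integration.integral_cong refl) (auto simp: scaleR_diff_right split: split_indicator)
  also have "\<dots> = (LINT \<tau>|lborel. indicator {0<..} \<tau> *\<^sub>R (\<tau> powr (- ((1 + s) / 2)) *\<^sub>R f.vconv \<tau> x))
     - (LINT \<tau>|lborel. indicator {0<..} \<tau> *\<^sub>R (\<tau> powr (- ((1 + s) / 2)) *\<^sub>R g.vconv \<tau> x))"
    by (rule Bochner_Integration.integral_diff[OF f.integrable_powr_vconv g.integrable_powr_vconv])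
  finally show ?thesis
    unfolding f.riesz_gradient_eq g.riesz_gradient_eq h.riesz_gradient_eq by (simp only: scaleR_diff_right)
qed

text \<open>Membership of the gradient in \<open>L^p\<close> is imposed here; for the sequences in
  \<open>has_riesz_gradient\<close> it is contained in \<open>Lp_tendsto\<close>.\<close>

definition test_space :: "real \<Rightarrow> real \<Rightarrow> ('a::euclidean_space \<Rightarrow> real) set" where
  "test_space s p = {\<phi> \<in> Cc_infinity. \<phi> \<in> Lp_space lebesgue p \<and> riesz_gradient s \<phi> \<in> Lp_space lebesgue p}"

definition test_norm :: "real \<Rightarrow> real \<Rightarrow> ('a::euclidean_space \<Rightarrow> real) \<Rightarrow> real" where
  "test_norm s p \<phi> = Lp_norm lebesgue p \<phi> + Lp_norm lebesgue p (riesz_gradient s \<phi>)"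

lemma test_norm_nonneg: "0 \<le> test_norm s p \<phi>"
  unfolding test_norm_def by simp

lemma test_space_diff:
  assumes s: "0 < s" "s < 1" and p: "1 \<le> p" and "\<phi> \<in> test_space s p" "\<psi> \<in> test_space s p"
  shows "(\<lambda>x. \<phi> x - \<psi> x) \<in> test_space s p"
    and "riesz_gradient s (\<lambda>x. \<phi> x - \<psi> x) = (\<lambda>x. riesz_gradient s \<phi> x - riesz_gradient s \<psi> x)"
proof -
  show 1: "riesz_gradient s (\<lambda>x. \<phi> x - \<psi> x) = (\<lambda>x. riesz_gradient s \<phi> x - riesz_gradient s \<psi> x)"
    using assms riesz_gradient_diff unfolding test_space_def by (intro ext) blast
  show "(\<lambda>x. \<phi> x - \<psi> x) \<in> test_space s p"
    using assms unfolding test_space_def by (auto simp: 1 intro: Cc_infinity_diff Lp_space_diff)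
qed

lemma test_space_continuous: "\<phi> \<in> test_space s p \<Longrightarrow> continuous_on UNIV \<phi>"
  unfolding test_space_def Cc_infinity_def using Ck_function.simps(1) by blast

lemma test_space_borel: "\<phi> \<in> test_space s p \<Longrightarrow> \<phi> \<in> borel_measurable borel"
  using test_space_continuous borel_measurable_continuous_onI by blast

lemma test_space_nn_integral:
  fixes \<phi> :: "'a::euclidean_space \<Rightarrow> real"
  assumes s: "0 < s" "s < 1" and p: "1 \<le> p" and \<phi>: "\<phi> \<in> test_space s p"
  shows "(\<integral>\<^sup>+x. ennreal (\<bar>\<phi> x\<bar> powr p) \<partial>lborel) = ennreal (Lp_norm lebesgue p \<phi> powr p)"
    and "(\<integral>\<^sup>+x. ennreal (norm (riesz_gradient s \<phi> x) powr p) \<partial>lborel) = ennreal (Lp_norm lebesgue p (riesz_gradient s \<phi>) powr p)"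
proof -
  obtain S L where "lipschitz_test \<phi> S L s"
    using \<phi> Cc_infinity_lipschitz_test[OF _ s] unfolding test_space_def by blast
  then interpret lipschitz_test \<phi> S L s .
  have p0: "0 < p" using p by simp
  have "\<phi> \<in> Lp_space lebesgue p" "riesz_gradient s \<phi> \<in> Lp_space lebesgue p" using \<phi> unfolding test_space_def by auto
  then show "(\<integral>\<^sup>+x. ennreal (\<bar>\<phi> x\<bar> powr p) \<partial>lborel) = ennreal (Lp_norm lebesgue p \<phi> powr p)"
    "(\<integral>\<^sup>+x. ennreal (norm (riesz_gradient s \<phi> x) powr p) \<partial>lborel) = ennreal (Lp_norm lebesgue p (riesz_gradient s \<phi>) powr p)"
    using nn_integral_Lp_norm[OF p0, of \<phi> lebesgue] nn_integral_Lp_norm[OF p0, of "riesz_gradient s \<phi>" lebesgue]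
    by (simp_all add: nn_integral_completion)
qed

text \<open>Interface between the heat estimates and the compactness argument. It hides the locale,
  whose parameters vary with \<open>\<phi>\<close>, behind constants that are uniform in
  \<open>\<phi>\<close>.\<close>

definition heat_family ::
  "real \<Rightarrow> real \<Rightarrow> real \<Rightarrow> (real \<Rightarrow> ('a::euclidean_space \<Rightarrow> real) \<Rightarrow> 'a \<Rightarrow> real) \<Rightarrow>
   real \<Rightarrow> real \<Rightarrow> (real \<Rightarrow> real) \<Rightarrow> (real \<Rightarrow> real) \<Rightarrow> bool" where
  "heat_family s p q h K e M \<Lambda> \<longleftrightarrow> 0 \<le> K \<and> 0 < e \<and> (\<forall>t>0. \<forall>\<phi>\<in>test_space s p.
     h t \<phi> \<in> borel_measurable borel \<and>
     (\<integral>\<^sup>+x. ennreal (\<bar>\<phi> x - h t \<phi> x\<bar> powr q) \<partial>lborel) \<le> ennreal ((K * t powr e * test_norm s p \<phi>) powr q) \<and>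
     0 \<le> M t \<and> 0 \<le> \<Lambda> t \<and>
     (\<forall>x. \<bar>h t \<phi> x\<bar> \<le> M t * test_norm s p \<phi>) \<and>
     (\<forall>x y. \<bar>h t \<phi> x - h t \<phi> y\<bar> \<le> \<Lambda> t * norm (x - y) powr (1 / p) * test_norm s p \<phi>))"

lemma heat_familyD:
  assumes "heat_family s p q h K e M \<Lambda>" "0 < t" "\<phi> \<in> test_space s p"
  shows "h t \<phi> \<in> borel_measurable borel"
    and "(\<integral>\<^sup>+x. ennreal (\<bar>\<phi> x - h t \<phi> x\<bar> powr q) \<partial>lborel) \<le> ennreal ((K * t powr e * test_norm s p \<phi>) powr q)"
    and "0 \<le> M t" "0 \<le> \<Lambda> t" "\<bar>h t \<phi> x\<bar> \<le> M t * test_norm s p \<phi>"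
    and "\<bar>h t \<phi> x - h t \<phi> y\<bar> \<le> \<Lambda> t * norm (x - y) powr (1 / p) * test_norm s p \<phi>"
  using assms unfolding heat_family_def by simp_all

lemma heat_family_exists:
  fixes q :: real
  assumes s: "0 < s" "s < 1" and p: "1 \<le> p" and q: "p \<le> q"
    and sub: "real DIM('a::euclidean_space) * (1 / p - 1 / q) < s"
  shows "\<exists>(h::real \<Rightarrow> ('a \<Rightarrow> real) \<Rightarrow> 'a \<Rightarrow> real) K e M \<Lambda>. heat_family s p q h K e M \<Lambda>"
proof -
  define b where "b = 1 / 2 + real DIM('a) / 2 * (1 / p - 1 / q)"
  have b: "b < (1 + s) / 2" using sub unfolding b_def by simp
  let ?C = "gauss_mass TYPE('a)"
  have C: "0 < ?C" by (rule gauss_mass_pos)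
  define h where "h t \<phi> x = lipschitz_test.heat \<phi> t x / ?C" for t and \<phi> :: "'a \<Rightarrow> real" and x
  \<comment> \<open>Outside the locale the rate depends on the type, \<open>s\<close> and
    \<open>b\<close> only; this is the uniformity in \<open>\<phi>\<close>. The absolute value makes
    \<open>K\<close> visibly nonnegative.\<close>
  define K where "K = \<bar>lipschitz_test.heat_rate TYPE('a) s b\<bar>"
  define M where "M t = (?C powr (p - 1) * t powr (- real DIM('a) / 2)) powr (1 / p) / ?C" for t
  define \<Lambda> where "\<Lambda> t = ((2 * ?C) powr (p - 1) * (2 * t powr (- real DIM('a) / 2 - 1 / 2))) powr (1 / p) / ?C" for t
  have main: "h t \<phi> \<in> borel_measurable borel \<and>
     (\<integral>\<^sup>+x. ennreal (\<bar>\<phi> x - h t \<phi> x\<bar> powr q) \<partial>lborel) \<le> ennreal ((K * t powr ((1 + s) / 2 - b) * test_norm s p \<phi>) powr q) \<and>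
     0 \<le> M t \<and> 0 \<le> \<Lambda> t \<and>
     (\<forall>x. \<bar>h t \<phi> x\<bar> \<le> M t * test_norm s p \<phi>) \<and>
     (\<forall>x y. \<bar>h t \<phi> x - h t \<phi> y\<bar> \<le> \<Lambda> t * norm (x - y) powr (1 / p) * test_norm s p \<phi>)"
    if t: "0 < t" and \<phi>: "\<phi> \<in> test_space s p" for t \<phi>
  proof -
    obtain S L where "lipschitz_test \<phi> S L s"
      using \<phi> Cc_infinity_lipschitz_test[OF _ s] unfolding test_space_def by blast
    then interpret lipschitz_test \<phi> S L s .
    note nn = test_space_nn_integral[OF s p \<phi>]
    let ?N1 = "Lp_norm lebesgue p \<phi>" and ?N2 = "Lp_norm lebesgue p (riesz_gradient s \<phi>)"
    have N: "0 \<le> ?N1" "0 \<le> ?N2" "?N1 \<le> test_norm s p \<phi>" "?N2 \<le> test_norm s p \<phi>"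
      unfolding test_norm_def by auto
    have 1: "h t \<phi> \<in> borel_measurable borel" unfolding h_def by measurable
    have M: "0 \<le> M t" "0 \<le> \<Lambda> t" unfolding M_def \<Lambda>_def using C by auto
    have 2: "(\<integral>\<^sup>+x. ennreal (\<bar>\<phi> x - h t \<phi> x\<bar> powr q) \<partial>lborel) \<le> ennreal ((K * t powr ((1 + s) / 2 - b) * test_norm s p \<phi>) powr q)"
    proof -
      have "(\<integral>\<^sup>+x. ennreal (\<bar>\<phi> x - h t \<phi> x\<bar> powr q) \<partial>lborel) \<le> ennreal ((heat_rate b * t powr ((1 + s) / 2 - b) * ?N2) powr q)"
        unfolding h_def by (rule Lq_heat_approx[OF p q t N(2) _ b_def b]) (simp add: nn)
      also have "\<dots> = ennreal (\<bar>heat_rate b * t powr ((1 + s) / 2 - b) * ?N2\<bar> powr q)"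
      proof -
        have "0 \<le> heat_rate b"
          unfolding heat_rate_def using s b repr_const_pos C kernel_const(1) by (intro divide_nonneg_pos mult_nonneg_nonneg add_nonneg_nonneg) auto
        then show ?thesis using N by simp
      qed
      also have "\<dots> \<le> ennreal ((K * t powr ((1 + s) / 2 - b) * test_norm s p \<phi>) powr q)"
        using p q N unfolding K_def abs_mult
        by (intro ennreal_leI powr_mono2 mult_mono) auto
      finally show ?thesis .
    qed
    have 3: "\<bar>h t \<phi> x\<bar> \<le> M t * test_norm s p \<phi>" for x
    proof -
      have "\<bar>heat t x\<bar> \<le> (?C powr (p - 1) * t powr (- real DIM('a) / 2)) powr (1 / p) * ?N1"
        by (rule abs_heat_le[OF p t N(1)]) (simp add: nn)
      then have "\<bar>h t \<phi> x\<bar> \<le> M t * ?N1" unfolding h_def M_def using C by (simp add: divide_right_mono)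
      also have "\<dots> \<le> M t * test_norm s p \<phi>" by (intro mult_left_mono N M)
      finally show ?thesis .
    qed
    have 4: "\<bar>h t \<phi> x - h t \<phi> y\<bar> \<le> \<Lambda> t * norm (x - y) powr (1 / p) * test_norm s p \<phi>" for x y
    proof -
      have "\<bar>heat t x - heat t y\<bar> \<le> ((2 * ?C) powr (p - 1) * (2 * t powr (- real DIM('a) / 2 - 1 / 2) * norm (x - y))) powr (1 / p) * ?N1"
        by (rule abs_heat_diff_le[OF p t N(1)]) (simp add: nn)
      also have "\<dots> = ((2 * ?C) powr (p - 1) * (2 * t powr (- real DIM('a) / 2 - 1 / 2))) powr (1 / p) * norm (x - y) powr (1 / p) * ?N1"
        by (simp add: powr_mult mult.assoc)
      finally have "\<bar>heat t x - heat t y\<bar> / ?C \<le> \<Lambda> t * norm (x - y) powr (1 / p) * ?N1"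
        unfolding \<Lambda>_def using C by (simp add: divide_right_mono)
      then have "\<bar>h t \<phi> x - h t \<phi> y\<bar> \<le> \<Lambda> t * norm (x - y) powr (1 / p) * ?N1"
        unfolding h_def using C by (simp add: diff_divide_distrib[symmetric])
      also have "\<dots> \<le> \<Lambda> t * norm (x - y) powr (1 / p) * test_norm s p \<phi>" using M by (intro mult_left_mono N) auto
      finally show ?thesis .
    qed
    show ?thesis using 1 2 3 4 M by blast
  qed
  have Kb: "0 \<le> K" "0 < (1 + s) / 2 - b" unfolding K_def using b by auto
  have "heat_family s p q h K ((1 + s) / 2 - b) M \<Lambda>"
    unfolding heat_family_def
    by (rule conjI[OF Kb(1) conjI[OF Kb(2)]], rule allI, rule impI, rule ballI, rule main)
  then show ?thesis by blast
qed

text \<open>The supremum bound follows from the Hoelder bound. In the unit ball around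
  \<open>x\<close> some value is at most a multiple of the \<open>L^p\<close> norm, for otherwise
  the integral over the ball would be too large, and the oscillation over the ball is at most the
  Hoelder constant.\<close>

lemma test_space_holder_estimates:
  assumes s: "0 < s" "s < 1" and p: "1 \<le> p" and sp: "real DIM('a::euclidean_space) < s * p"
  shows "\<exists>K\<ge>0. \<forall>\<phi>\<in>test_space s p.
     (\<forall>x::'a. \<bar>\<phi> x\<bar> \<le> K * test_norm s p \<phi>) \<and>
     (\<forall>x y. \<bar>\<phi> x - \<phi> y\<bar> \<le> K * test_norm s p \<phi> * norm (x - y) powr (s - real DIM('a) / p))"
proof -
  define H where "H = \<bar>lipschitz_test.holder_rate TYPE('a) s p\<bar>"
  define v where "v = measure lborel (ball (0::'a) 1)"
  have v: "0 < v" unfolding v_def by simp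
  define K where "K = H + 2 * v powr (- 1 / p)"
  have H: "0 \<le> H" and HK: "H \<le> K" unfolding K_def H_def by auto
  have \<mu>: "0 < s - real DIM('a) / p" using p sp by (simp add: field_simps)
  have "(\<forall>x. \<bar>\<phi> x\<bar> \<le> K * test_norm s p \<phi>) \<and>
     (\<forall>x y. \<bar>\<phi> x - \<phi> y\<bar> \<le> K * test_norm s p \<phi> * norm (x - y) powr (s - real DIM('a) / p))"
    if \<phi>: "\<phi> \<in> test_space s p" for \<phi> :: "'a \<Rightarrow> real"
  proof -
    obtain S L where "lipschitz_test \<phi> S L s"
      using \<phi> Cc_infinity_lipschitz_test[OF _ s] unfolding test_space_def by blast
    then interpret lipschitz_test \<phi> S L s .
    note nn = test_space_nn_integral[OF s p \<phi>]
    let ?N1 = "Lp_norm lebesgue p \<phi>" and ?N2 = "Lp_norm lebesgue p (riesz_gradient s \<phi>)"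
    have N: "0 \<le> ?N1" "0 \<le> ?N2" unfolding test_norm_def by auto
    have h: "\<bar>\<phi> x - \<phi> y\<bar> \<le> H * ?N2 * norm (x - y) powr (s - real DIM('a) / p)" for x y
    proof -
      have "\<bar>\<phi> x - \<phi> y\<bar> \<le> holder_rate p * norm (x - y) powr (s - real DIM('a) / p) * ?N2"
        by (rule holder_bound[OF p N(2) sp]) (simp add: nn)
      also have "\<dots> \<le> H * norm (x - y) powr (s - real DIM('a) / p) * ?N2"
        unfolding H_def using N by (intro mult_right_mono) auto
      finally show ?thesis by (simp add: algebra_simps)
    qed
    have bd: "\<bar>\<phi> x\<bar> \<le> H * ?N2 + 2 * v powr (- 1 / p) * ?N1 + \<epsilon>" if \<epsilon>: "0 < \<epsilon>" for x \<epsilon>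
    proof -
      \<comment> \<open>\<open>\<epsilon>\<close> keeps the contradiction strict when the
        \<open>L^p\<close> norm is 0.\<close>
      define c where "c = 2 * v powr (- 1 / p) * ?N1 + \<epsilon>"
      have c: "0 < c" unfolding c_def using N \<epsilon> by (intro add_nonneg_pos) auto
      have "\<exists>y\<in>ball x 1. \<bar>\<phi> y\<bar> \<le> c"
      proof (rule ccontr)
        assume "\<not> (\<exists>y\<in>ball x 1. \<bar>\<phi> y\<bar> \<le> c)"
        then have gt: "\<bar>\<phi> y\<bar> > c" if "y \<in> ball x 1" for y using that by (auto simp: not_le)
        have "ennreal (c powr p * v) = ennreal (c powr p) * emeasure lborel (ball x 1)"
        proof -
          have "emeasure lborel (ball x 1) = ennreal v"
            unfolding v_def by (simp add: emeasure_ball content_ball)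
          then show ?thesis using v by (simp add: ennreal_mult)
        qed
        also have "\<dots> = (\<integral>\<^sup>+y. ennreal (c powr p) * indicator (ball x 1) y \<partial>lborel)"
          by (subst nn_integral_cmult_indicator) auto
        also have "\<dots> \<le> (\<integral>\<^sup>+y. ennreal (\<bar>\<phi> y\<bar> powr p) \<partial>lborel)"
        proof (rule nn_integral_mono)
          fix y
          show "ennreal (c powr p) * indicator (ball x 1) y \<le> ennreal (\<bar>\<phi> y\<bar> powr p)"
            using gt[of y] c p by (auto split: split_indicator intro!: ennreal_leI powr_mono2)
        qed
        also have "\<dots> = ennreal (?N1 powr p)" by (rule nn(1))
        finally have "c powr p * v \<le> ?N1 powr p" by (subst (asm) ennreal_le_iff) auto
        then have "(c powr p * v) powr (1 / p) \<le> (?N1 powr p) powr (1 / p)" using p v by (intro powr_mono2) auto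
        then have "c * v powr (1 / p) \<le> ?N1" using p c N by (simp add: powr_mult powr_powr)
        then have "c * v powr (1 / p) * v powr (- 1 / p) \<le> ?N1 * v powr (- 1 / p)" by (intro mult_right_mono) auto
        moreover have "v powr (1 / p) * v powr (- 1 / p) = 1" using v by (simp add: powr_add[symmetric])
        ultimately have "c * 1 \<le> ?N1 * v powr (- 1 / p)" by (simp only: mult.assoc)
        then have "c \<le> v powr (- 1 / p) * ?N1" by (simp only: mult.commute mult_1_right)
        moreover have "0 \<le> v powr (- 1 / p) * ?N1" using N by simp
        ultimately show False unfolding c_def using \<epsilon> by linarith
      qed
      then obtain y where y: "y \<in> ball x 1" "\<bar>\<phi> y\<bar> \<le> c" by blast
      have "norm (x - y) powr (s - real DIM('a) / p) \<le> 1"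
        using y \<mu> by (intro powr_le1) (auto simp: dist_norm)
      then have "H * ?N2 * norm (x - y) powr (s - real DIM('a) / p) \<le> H * ?N2 * 1"
        using H N by (intro mult_left_mono) auto
      then show ?thesis using h[of x y] y(2) unfolding c_def by linarith
    qed
    have "\<bar>\<phi> x\<bar> \<le> K * test_norm s p \<phi>" for x
    proof -
      have "\<bar>\<phi> x\<bar> \<le> H * ?N2 + 2 * v powr (- 1 / p) * ?N1"
        by (rule field_le_epsilon) (rule bd)
      also have "\<dots> \<le> K * ?N2 + K * ?N1"
        unfolding K_def using H N by (intro add_mono mult_right_mono) auto
      finally show ?thesis unfolding test_norm_def by (simp add: algebra_simps)
    qed
    moreover have "\<bar>\<phi> x - \<phi> y\<bar> \<le> K * test_norm s p \<phi> * norm (x - y) powr (s - real DIM('a) / p)" for x y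
    proof -
      have "H * ?N2 \<le> K * test_norm s p \<phi>"
        using H HK N unfolding test_norm_def by (intro mult_mono) auto
      then have "H * ?N2 * norm (x - y) powr (s - real DIM('a) / p) \<le> K * test_norm s p \<phi> * norm (x - y) powr (s - real DIM('a) / p)"
        by (intro mult_right_mono) auto
      then show ?thesis using h[of x y] by linarith
    qed
    ultimately show ?thesis by blast
  qed
  moreover have "0 \<le> K" using H HK by linarith
  ultimately show ?thesis by blast
qed

section \<open>Embeddings into Lebesgue spaces\<close>

text \<open>Diagonal argument with mutual distances below \<open>1 / (n + 1)\<close> at stage
  \<open>n\<close>. The diagonal sequence satisfies the condition of stage \<open>k\<close> from the
  index \<open>k + 1\<close> on.\<close>

lemma Cauchy_subseq_diagonal:
  fixes d :: "nat \<Rightarrow> nat \<Rightarrow> real"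
  assumes "\<And>e s. e > 0 \<Longrightarrow> strict_mono (s :: nat \<Rightarrow> nat) \<Longrightarrow>
      \<exists>r. strict_mono (r :: nat \<Rightarrow> nat) \<and> (\<forall>i j. d (s (r i)) (s (r j)) < e)"
  shows "\<exists>r. strict_mono (r :: nat \<Rightarrow> nat) \<and> (\<forall>e>0. \<exists>J. \<forall>i\<ge>J. \<forall>j\<ge>J. d (r i) (r j) < e)"
proof -
  define P where "P n s \<longleftrightarrow> (\<forall>i j. d (s i) (s j) < 1 / (real n + 1))" for n and s :: "nat \<Rightarrow> nat"
  interpret subseqs P
  proof
    fix n and s :: "nat \<Rightarrow> nat" assume "strict_mono s"
    then show "\<exists>r'. strict_mono r' \<and> P n (s \<circ> r')"
      using assms[of "1 / (real n + 1)" s] unfolding P_def by auto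
  qed
  have P: "P k (diagseq \<circ> ((+) (Suc k)))" for k
    by (rule diagseq_holds) (auto simp: P_def)
  have "\<exists>J. \<forall>i\<ge>J. \<forall>j\<ge>J. d (diagseq i) (diagseq j) < e" if e: "e > 0" for e
  proof -
    obtain k where k: "1 / (real k + 1) < e"
      using reals_Archimedean[OF e] by (auto simp: inverse_eq_divide add.commute)
    show ?thesis
    proof (intro exI[of _ "Suc k"] allI impI)
      fix i j assume "Suc k \<le> i" "Suc k \<le> j"
      then have "i = Suc k + (i - Suc k)" "j = Suc k + (j - Suc k)" by auto
      moreover have "d (diagseq (Suc k + (i - Suc k))) (diagseq (Suc k + (j - Suc k))) < 1 / (real k + 1)"
        using P[of k] unfolding P_def by (simp only: comp_apply)
      ultimately show "d (diagseq i) (diagseq j) < e" using k by simp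
    qed
  qed
  then show ?thesis using subseq_diagseq by blast
qed

lemma Lp_space_lebesgue_on:
  fixes f :: "'a::euclidean_space \<Rightarrow> real"
  assumes q: "0 < q" and f: "f \<in> borel_measurable borel" and \<Omega>: "\<Omega> \<in> sets lebesgue" and c: "0 \<le> c"
    and le: "(\<integral>\<^sup>+x. ennreal (\<bar>f x\<bar> powr q) \<partial>lborel) \<le> ennreal (c powr q)"
  shows "f \<in> Lp_space (lebesgue_on \<Omega>) q" "Lp_norm (lebesgue_on \<Omega>) q f \<le> c"
proof -
  have m: "f \<in> borel_measurable (lebesgue_on \<Omega>)"
    using f by (intro measurable_restrict_space1 measurable_completion) simp
  have "(\<integral>\<^sup>+x. ennreal (norm (f x) powr q) \<partial>lebesgue_on \<Omega>) = (\<integral>\<^sup>+x. ennreal (\<bar>f x\<bar> powr q) * indicator \<Omega> x \<partial>lborel)"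
    using \<Omega> by (simp add: nn_integral_restrict_space nn_integral_completion)
  also have "\<dots> \<le> (\<integral>\<^sup>+x. ennreal (\<bar>f x\<bar> powr q) \<partial>lborel)"
    by (intro nn_integral_mono) (auto split: split_indicator)
  also note le
  finally show "f \<in> Lp_space (lebesgue_on \<Omega>) q" "Lp_norm (lebesgue_on \<Omega>) q f \<le> c"
    using Lp_space_nn_integral[OF q m c] by auto
qed

lemma Lp_space_bounded:
  fixes f :: "'a \<Rightarrow> 'b::{second_countable_topology, real_normed_vector}"
  assumes M: "finite_measure M" and q: "0 < q" and f: "f \<in> borel_measurable M" and c: "0 \<le> c"
    and le: "\<And>x. x \<in> space M \<Longrightarrow> norm (f x) \<le> c"
  shows "f \<in> Lp_space M q" "Lp_norm M q f \<le> c * (measure M (space M) + 1) powr (1 / q)"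
proof -
  interpret finite_measure M by fact
  let ?m = "measure M (space M) + 1"
  have m: "0 < ?m" by (simp add: add_nonneg_pos)
  have "(\<integral>\<^sup>+x. ennreal (norm (f x) powr q) \<partial>M) \<le> (\<integral>\<^sup>+x. ennreal (c powr q) \<partial>M)"
    using le q by (intro nn_integral_mono ennreal_leI powr_mono2) auto
  also have "\<dots> = ennreal (c powr q * measure M (space M))"
    by (simp add: emeasure_eq_measure ennreal_mult)
  also have "\<dots> \<le> ennreal ((c * ?m powr (1 / q)) powr q)"
    using q m c by (intro ennreal_leI) (simp add: powr_mult powr_powr mult_left_mono)
  finally show "f \<in> Lp_space M q" "Lp_norm M q f \<le> c * ?m powr (1 / q)"
    using Lp_space_nn_integral[OF q f, of "c * ?m powr (1 / q)"] c by auto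
qed

lemma Lp_tendsto_finite_measure_mono:
  fixes f :: "'a \<Rightarrow> 'b::{second_countable_topology, real_normed_vector}"
  assumes M: "finite_measure M" and q: "0 < q" "q \<le> p" and p: "1 \<le> p" and lim: "Lp_tendsto M p F f"
  shows "Lp_tendsto M q F f"
proof -
  have F: "\<And>j. F j \<in> Lp_space M p" "f \<in> Lp_space M p"
    and l: "(\<lambda>j. Lp_norm M p (\<lambda>x. F j x - f x)) \<longlonglongrightarrow> 0"
    using lim unfolding Lp_tendsto_def by auto
  let ?m = "(measure M (space M) + 1) powr (1 / q)"
  have "(\<lambda>j. Lp_norm M q (\<lambda>x. F j x - f x)) \<longlonglongrightarrow> 0"
  proof (rule Lim_null_comparison)
    show "\<forall>\<^sub>F j in sequentially. norm (Lp_norm M q (\<lambda>x. F j x - f x)) \<le> ?m * Lp_norm M p (\<lambda>x. F j x - f x)"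
      using Lp_finite_measure_mono(2)[OF M q Lp_space_diff[OF p F(1) F(2)]] by simp
    show "(\<lambda>j. ?m * Lp_norm M p (\<lambda>x. F j x - f x)) \<longlonglongrightarrow> 0" using tendsto_mult_right_zero[OF l] .
  qed
  then show ?thesis using F Lp_finite_measure_mono(1)[OF M q] unfolding Lp_tendsto_def by blast
qed

lemma Lp_tendsto_diff:
  fixes f :: "'a \<Rightarrow> 'b::{second_countable_topology, real_normed_vector}"
  assumes p: "1 \<le> p" and f: "Lp_tendsto M p F f" and g: "Lp_tendsto M p G g"
  shows "Lp_tendsto M p (\<lambda>j x. F j x - G j x) (\<lambda>x. f x - g x)"
proof -
  have m: "\<And>j. F j \<in> Lp_space M p" "f \<in> Lp_space M p" "\<And>j. G j \<in> Lp_space M p" "g \<in> Lp_space M p"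
    and l: "(\<lambda>j. Lp_norm M p (\<lambda>x. F j x - f x)) \<longlonglongrightarrow> 0" "(\<lambda>j. Lp_norm M p (\<lambda>x. G j x - g x)) \<longlonglongrightarrow> 0"
    using f g unfolding Lp_tendsto_def by auto
  have "(\<lambda>j. Lp_norm M p (\<lambda>x. (F j x - G j x) - (f x - g x))) \<longlonglongrightarrow> 0"
  proof (rule Lim_null_comparison)
    have "Lp_norm M p (\<lambda>x. (F j x - G j x) - (f x - g x)) \<le> Lp_norm M p (\<lambda>x. F j x - f x) + Lp_norm M p (\<lambda>x. G j x - g x)" for j
      using Minkowski_Lp[OF p Lp_space_diff[OF p m(1) m(2)] Lp_space_minus[OF Lp_space_diff[OF p m(3) m(4)]], of j j]
      unfolding Lp_norm_minus by (simp add: algebra_simps)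
    then show "\<forall>\<^sub>F j in sequentially. norm (Lp_norm M p (\<lambda>x. (F j x - G j x) - (f x - g x)))
      \<le> Lp_norm M p (\<lambda>x. F j x - f x) + Lp_norm M p (\<lambda>x. G j x - g x)" by simp
    show "(\<lambda>j. Lp_norm M p (\<lambda>x. F j x - f x) + Lp_norm M p (\<lambda>x. G j x - g x)) \<longlonglongrightarrow> 0"
      using tendsto_add[OF l] by simp
  qed
  then show ?thesis using Lp_space_diff[OF p m(1) m(3)] Lp_space_diff[OF p m(2) m(4)] unfolding Lp_tendsto_def by simp
qed

lemma Lp_norm_tendsto:
  fixes f :: "'a \<Rightarrow> 'b::{second_countable_topology, real_normed_vector}"
  assumes p: "1 \<le> p" and f: "Lp_tendsto M p F f"
  shows "(\<lambda>j. Lp_norm M p (F j)) \<longlonglongrightarrow> Lp_norm M p f"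
proof -
  have m: "\<And>j. F j \<in> Lp_space M p" "f \<in> Lp_space M p"
    and l: "(\<lambda>j. Lp_norm M p (\<lambda>x. F j x - f x)) \<longlonglongrightarrow> 0"
    using f unfolding Lp_tendsto_def by auto
  have "\<bar>Lp_norm M p (F j) - Lp_norm M p f\<bar> \<le> Lp_norm M p (\<lambda>x. F j x - f x)" for j
    using Lp_norm_le_add[OF p m(1) m(2), of j] Lp_norm_le_add[OF p m(2) m(1), of j]
      Lp_norm_minus_commute[of M p "F j" f] by simp
  then have "(\<lambda>j. Lp_norm M p (F j) - Lp_norm M p f) \<longlonglongrightarrow> 0"
    by (intro Lim_null_comparison[OF _ l]) simp
  then show ?thesis by (simp add: LIM_zero_iff)
qed

lemma Lp_tendsto_Cauchy:
  fixes f :: "'a \<Rightarrow> 'b::{second_countable_topology, real_normed_vector}"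
  assumes p: "1 \<le> p" and f: "Lp_tendsto M p F f" and e: "0 < e"
  shows "\<exists>J. \<forall>i\<ge>J. \<forall>j\<ge>J. Lp_norm M p (\<lambda>x. F i x - F j x) < e"
proof -
  have m: "\<And>j. F j \<in> Lp_space M p" "f \<in> Lp_space M p"
    and l: "(\<lambda>j. Lp_norm M p (\<lambda>x. F j x - f x)) \<longlonglongrightarrow> 0"
    using f unfolding Lp_tendsto_def by auto
  obtain J where J: "\<And>j. j \<ge> J \<Longrightarrow> Lp_norm M p (\<lambda>x. F j x - f x) < e / 2"
    using order_tendstoD(2)[OF l, of "e / 2"] e unfolding eventually_sequentially by auto
  show ?thesis
  proof (intro exI[of _ J] allI impI)
    fix i j assume "J \<le> i" "J \<le> j"
    then show "Lp_norm M p (\<lambda>x. F i x - F j x) < e"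
      using Lp_norm_triangle[OF p m(1) m(2) m(1), of i j] J[of i] J[of j] Lp_norm_minus_commute[of M p "F j" f] by simp
  qed
qed

section \<open>From test functions to the completion\<close>

lemma has_riesz_gradientD:
  assumes "has_riesz_gradient s p u g"
  obtains \<phi> where "\<And>j. \<phi> j \<in> test_space s p" "Lp_tendsto lebesgue p \<phi> u"
    "Lp_tendsto lebesgue p (\<lambda>j. riesz_gradient s (\<phi> j)) g"
proof -
  obtain \<phi> where \<phi>: "\<And>j. \<phi> j \<in> Cc_infinity" "Lp_tendsto lebesgue p \<phi> u"
    "Lp_tendsto lebesgue p (\<lambda>j. riesz_gradient s (\<phi> j)) g"
    using assms unfolding has_riesz_gradient_def by blast
  have "\<phi> j \<in> test_space s p" for j
    using \<phi> unfolding test_space_def Lp_tendsto_def by simp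
  then show thesis using that \<phi>(2,3) by blast
qed

lemma has_riesz_gradient_diff:
  assumes s: "0 < s" "s < 1" and p: "1 \<le> p"
    and u: "has_riesz_gradient s p u g" and v: "has_riesz_gradient s p v h"
  shows "has_riesz_gradient s p (\<lambda>x. u x - v x) (\<lambda>x. g x - h x)"
proof -
  obtain \<phi> where \<phi>: "\<And>j. \<phi> j \<in> test_space s p" "Lp_tendsto lebesgue p \<phi> u"
    "Lp_tendsto lebesgue p (\<lambda>j. riesz_gradient s (\<phi> j)) g" using has_riesz_gradientD[OF u] by blast
  obtain \<psi> where \<psi>: "\<And>j. \<psi> j \<in> test_space s p" "Lp_tendsto lebesgue p \<psi> v"
    "Lp_tendsto lebesgue p (\<lambda>j. riesz_gradient s (\<psi> j)) h" using has_riesz_gradientD[OF v] by blast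
  show ?thesis
    unfolding has_riesz_gradient_def
  proof (intro exI[of _ "\<lambda>j x. \<phi> j x - \<psi> j x"] conjI allI)
    show "(\<lambda>x. \<phi> j x - \<psi> j x) \<in> Cc_infinity" for j
      using test_space_diff(1)[OF s p \<phi>(1) \<psi>(1)] unfolding test_space_def by blast
    show "Lp_tendsto lebesgue p (\<lambda>j x. \<phi> j x - \<psi> j x) (\<lambda>x. u x - v x)"
      by (rule Lp_tendsto_diff[OF p \<phi>(2) \<psi>(2)])
    show "Lp_tendsto lebesgue p (\<lambda>j. riesz_gradient s (\<lambda>x. \<phi> j x - \<psi> j x)) (\<lambda>x. g x - h x)"
      unfolding test_space_diff(2)[OF s p \<phi>(1) \<psi>(1)] by (rule Lp_tendsto_diff[OF p \<phi>(3) \<psi>(3)])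
  qed
qed

lemma bessel_space_diff:
  assumes "0 < s" "s < 1" "1 \<le> p" "u \<in> bessel_space s p" "v \<in> bessel_space s p"
  shows "(\<lambda>x. u x - v x) \<in> bessel_space s p"
proof -
  obtain g h where "has_riesz_gradient s p u g" "has_riesz_gradient s p v h"
    using assms(4,5) unfolding bessel_space_def by blast
  from has_riesz_gradient_diff[OF assms(1-3) this] show ?thesis unfolding bessel_space_def by blast
qed

text \<open>The gradient picked by \<open>SOME\<close> is itself the limit along an approximating
  sequence, and estimates in the norm are passed to the limit along that sequence.\<close>

lemma bessel_norm_gradient:
  assumes "u \<in> bessel_space s p"
  obtains g where "has_riesz_gradient s p u g" "bessel_norm s p u = Lp_norm lebesgue p u + Lp_norm lebesgue p g"
proof -
  have "\<exists>g. has_riesz_gradient s p u g" using assms unfolding bessel_space_def by blast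
  then have "has_riesz_gradient s p u (SOME g. has_riesz_gradient s p u g)" by (rule someI_ex)
  then show thesis by (rule that) (simp add: bessel_norm_def)
qed

lemma test_norm_diff_Cauchy:
  assumes s: "0 < s" "s < 1" and p: "1 \<le> p" and \<phi>: "\<And>j. \<phi> j \<in> test_space s p"
    and u: "Lp_tendsto lebesgue p \<phi> u" and g: "Lp_tendsto lebesgue p (\<lambda>j. riesz_gradient s (\<phi> j)) g" and e: "0 < e"
  shows "\<exists>J. \<forall>i\<ge>J. \<forall>j\<ge>J. test_norm s p (\<lambda>x. \<phi> i x - \<phi> j x) < e"
proof -
  have e2: "0 < e / 2" using e by simp
  obtain J1 J2 where J: "\<And>i j. i \<ge> J1 \<Longrightarrow> j \<ge> J1 \<Longrightarrow> Lp_norm lebesgue p (\<lambda>x. \<phi> i x - \<phi> j x) < e / 2"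
    "\<And>i j. i \<ge> J2 \<Longrightarrow> j \<ge> J2 \<Longrightarrow> Lp_norm lebesgue p (\<lambda>x. riesz_gradient s (\<phi> i) x - riesz_gradient s (\<phi> j) x) < e / 2"
    using Lp_tendsto_Cauchy[OF p u e2] Lp_tendsto_Cauchy[OF p g e2] by blast
  have "test_norm s p (\<lambda>x. \<phi> i x - \<phi> j x) < e" if "i \<ge> max J1 J2" "j \<ge> max J1 J2" for i j
    using J(1)[of i j] J(2)[of i j] that unfolding test_norm_def test_space_diff(2)[OF s p \<phi> \<phi>] by simp
  then show ?thesis by blast
qed

lemma test_norm_tendsto:
  assumes p: "1 \<le> p"
    and u: "Lp_tendsto lebesgue p \<phi> u" and g: "Lp_tendsto lebesgue p (\<lambda>j. riesz_gradient s (\<phi> j)) g"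
  shows "(\<lambda>j. test_norm s p (\<phi> j)) \<longlonglongrightarrow> Lp_norm lebesgue p u + Lp_norm lebesgue p g"
  unfolding test_norm_def by (intro tendsto_add Lp_norm_tendsto[OF p u] Lp_norm_tendsto[OF p g])

section \<open>Precompactness in L^q of a bounded set\<close>

lemma finite_measure_lebesgue_on_bounded:
  fixes \<Omega> :: "'a::euclidean_space set"
  assumes "bounded \<Omega>" "\<Omega> \<in> sets lebesgue"
  shows "finite_measure (lebesgue_on \<Omega>)"
  using assms by (intro finite_measure_lebesgue_on bounded_set_imp_lmeasurable)

text \<open>\<open>\<phi>\<close> is split into \<open>\<phi> - h 1 \<phi>\<close> and
  \<open>h 1 \<phi>\<close>; the time 1 is arbitrary. The second part is a bounded function, hence
  in \<open>L^q\<close> of a set of finite measure.\<close>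

lemma test_space_Lq_bound:
  fixes \<Omega> :: "'a::euclidean_space set"
  assumes s: "0 < s" "s < 1" and p: "1 \<le> p" and q: "p \<le> q"
    and sub: "real DIM('a) * (1 / p - 1 / q) < s"
    and \<Omega>: "bounded \<Omega>" "\<Omega> \<in> sets lebesgue"
  shows "\<exists>C\<ge>0. \<forall>\<phi>\<in>test_space s p. \<phi> \<in> Lp_space (lebesgue_on \<Omega>) q \<and> Lp_norm (lebesgue_on \<Omega>) q \<phi> \<le> C * test_norm s p \<phi>"
proof -
  let ?M = "lebesgue_on \<Omega>"
  have fm: "finite_measure ?M" by (rule finite_measure_lebesgue_on_bounded[OF \<Omega>])
  obtain h :: "real \<Rightarrow> ('a \<Rightarrow> real) \<Rightarrow> 'a \<Rightarrow> real" and K e M \<Lambda> where hf: "heat_family s p q h K e M \<Lambda>"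
    using heat_family_exists[OF s p q sub] by blast
  then have K: "0 \<le> K" "0 < e" unfolding heat_family_def by auto
  have q1: "1 \<le> q" and q0: "0 < q" using p q by auto
  let ?m = "(measure ?M (space ?M) + 1) powr (1 / q)"
  have "\<phi> \<in> Lp_space ?M q \<and> Lp_norm ?M q \<phi> \<le> (K + \<bar>M 1\<bar> * ?m) * test_norm s p \<phi>" if \<phi>: "\<phi> \<in> test_space s p" for \<phi>
  proof -
    note H = heat_familyD[OF hf zero_less_one \<phi>]
    have [measurable]: "\<phi> \<in> borel_measurable borel" "h 1 \<phi> \<in> borel_measurable borel"
      using test_space_borel[OF \<phi>] H(1) by auto
    have c: "0 \<le> K * test_norm s p \<phi>" "0 \<le> M 1 * test_norm s p \<phi>" using K(1) H(3) test_norm_nonneg[of s p \<phi>] by simp_all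
    have "(\<integral>\<^sup>+x. ennreal (\<bar>\<phi> x - h 1 \<phi> x\<bar> powr q) \<partial>lborel) \<le> ennreal ((K * test_norm s p \<phi>) powr q)"
      using H(2) by simp
    note 1 = Lp_space_lebesgue_on[OF q0 _ \<Omega>(2) c(1) this]
    have 1: "(\<lambda>x. \<phi> x - h 1 \<phi> x) \<in> Lp_space ?M q" "Lp_norm ?M q (\<lambda>x. \<phi> x - h 1 \<phi> x) \<le> K * test_norm s p \<phi>"
      by (rule 1, measurable)+
    have hm: "h 1 \<phi> \<in> borel_measurable ?M" by (intro measurable_restrict_space1 measurable_completion) simp
    have 2: "h 1 \<phi> \<in> Lp_space ?M q" "Lp_norm ?M q (h 1 \<phi>) \<le> M 1 * test_norm s p \<phi> * ?m"
      using Lp_space_bounded[OF fm q0 hm c(2)] H(5) by auto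
    have "\<phi> \<in> Lp_space ?M q" using Lp_space_add[OF q1 1(1) 2(1)] by simp
    moreover have "Lp_norm ?M q \<phi> \<le> K * test_norm s p \<phi> + M 1 * test_norm s p \<phi> * ?m"
      using Minkowski_Lp[OF q1 1(1) 2(1)] 1(2) 2(2) by simp
    moreover have "M 1 = \<bar>M 1\<bar>" using H(3) by simp
    ultimately show ?thesis by (simp add: algebra_simps)
  qed
  moreover have "0 \<le> K + \<bar>M 1\<bar> * ?m" using K by simp
  ultimately show ?thesis by blast
qed

text \<open>The smoothing time is fixed before the subsequence is chosen: it makes the smoothing
  error at most \<open>\<epsilon> / 4\<close> for all indices at once, and Arzela-Ascoli is applied
  to the smoothed functions at this single time. Two smoothing errors and one uniform distance add
  up to three quarters of \<open>\<epsilon>\<close>.\<close>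

lemma test_space_Lq_eps_subseq:
  fixes \<Omega> :: "'a::euclidean_space set" and \<phi> :: "nat \<Rightarrow> 'a \<Rightarrow> real"
  assumes s: "0 < s" "s < 1" and p: "1 \<le> p" and q: "p \<le> q"
    and sub: "real DIM('a) * (1 / p - 1 / q) < s"
    and \<Omega>: "bounded \<Omega>" "\<Omega> \<in> sets lebesgue"
    and \<phi>: "\<And>j. \<phi> j \<in> test_space s p" and c: "\<And>j. test_norm s p (\<phi> j) \<le> c" and \<epsilon>: "0 < \<epsilon>"
  shows "\<exists>r. strict_mono (r :: nat \<Rightarrow> nat) \<and> (\<forall>i j. Lp_norm (lebesgue_on \<Omega>) q (\<lambda>x. \<phi> (r i) x - \<phi> (r j) x) < \<epsilon>)"
proof -
  let ?M = "lebesgue_on \<Omega>"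
  have fm: "finite_measure ?M" by (rule finite_measure_lebesgue_on_bounded[OF \<Omega>])
  obtain h :: "real \<Rightarrow> ('a \<Rightarrow> real) \<Rightarrow> 'a \<Rightarrow> real" and K e M \<Lambda> where hf: "heat_family s p q h K e M \<Lambda>"
    using heat_family_exists[OF s p q sub] by blast
  then have K: "0 \<le> K" "0 < e" unfolding heat_family_def by auto
  have q1: "1 \<le> q" and q0: "0 < q" using p q by auto
  have c0: "0 \<le> c" using c[of 0] test_norm_nonneg order_trans by blast
  let ?m = "(measure ?M (space ?M) + 1) powr (1 / q)"
  have m: "0 < ?m"
  proof -
    have "0 < measure ?M (space ?M) + 1" using measure_nonneg[of ?M "space ?M"] by linarith
    then show ?thesis by simp
  qed
  \<comment> \<open>Solves \<open>t powr e = \<epsilon> / (4 * (K * c + 1))\<close>; the summand 1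
    allows \<open>K * c = 0\<close>.\<close>
  define t where "t = (\<epsilon> / (4 * (K * c + 1))) powr (1 / e)"
  have Kc: "0 < K * c + 1" using K c0 by (simp add: add_nonneg_pos)
  have t: "0 < t" unfolding t_def using \<epsilon> Kc by simp
  have te: "K * t powr e * c \<le> \<epsilon> / 4"
  proof -
    have "t powr e = \<epsilon> / (4 * (K * c + 1))" unfolding t_def using K Kc \<epsilon> by (simp add: powr_powr)
    then have "K * t powr e * c = \<epsilon> / 4 * (K * c / (K * c + 1))" by simp
    also have "\<dots> \<le> \<epsilon> / 4 * 1" using Kc \<epsilon> by (intro mult_left_mono) auto
    finally show ?thesis by simp
  qed
  note H = heat_familyD[OF hf t \<phi>]
  have cpt: "compact (closure \<Omega>)" using \<Omega>(1) by (simp add: compact_closure)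
  obtain g k where k: "strict_mono (k :: nat \<Rightarrow> nat)"
    and unif: "\<And>e. 0 < e \<Longrightarrow> \<exists>N. \<forall>n x. n \<ge> N \<and> x \<in> closure \<Omega> \<longrightarrow> norm (h t (\<phi> (k n)) x - g x) < e"
  proof (rule Arzela_Ascoli[OF cpt, of "\<lambda>j. h t (\<phi> j)" "M t * c"])
    show "norm (h t (\<phi> n) x) \<le> M t * c" for n x
      unfolding real_norm_def by (rule order_trans[OF H(5) mult_left_mono[OF c H(3)]])
    fix x and e' :: real assume e': "0 < e'"
    define d where "d = (e' / (\<Lambda> t * c + 1)) powr p"
    have Lc: "0 < \<Lambda> t * c + 1" using H(4) c0 by (simp add: add_nonneg_pos)
    have d: "0 < d" unfolding d_def using e' Lc by simp
    have "norm (h t (\<phi> n) x - h t (\<phi> n) y) < e'" if "norm (x - y) < d" for n y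
    proof -
      have "norm (x - y) powr (1 / p) \<le> d powr (1 / p)" using that p by (intro powr_mono2) auto
      also have "\<dots> = e' / (\<Lambda> t * c + 1)" unfolding d_def using p e' Lc by (simp add: powr_powr)
      finally have n: "norm (x - y) powr (1 / p) \<le> e' / (\<Lambda> t * c + 1)" .
      have "\<bar>h t (\<phi> n) x - h t (\<phi> n) y\<bar> \<le> \<Lambda> t * norm (x - y) powr (1 / p) * test_norm s p (\<phi> n)" by (rule H(6))
      also have "\<dots> \<le> \<Lambda> t * (e' / (\<Lambda> t * c + 1)) * c"
        using n c[of n] H(4) e' Lc test_norm_nonneg by (intro mult_mono mult_left_mono) auto
      also have "\<dots> = e' * (\<Lambda> t * c / (\<Lambda> t * c + 1))" by simp
      also have "\<dots> < e' * 1" using e' Lc by (intro mult_strict_left_mono) auto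
      finally show ?thesis by simp
    qed
    then show "\<exists>d>0. \<forall>n y. y \<in> closure \<Omega> \<and> norm (x - y) < d \<longrightarrow> norm (h t (\<phi> n) x - h t (\<phi> n) y) < e'"
      using d by blast
  qed blast
  \<comment> \<open>Two functions within \<open>\<delta>\<close> of \<open>g\<close> differ by at
    most \<open>2 * \<delta>\<close>, and the factor \<open>?m\<close> turns this into
    \<open>\<epsilon> / 4\<close> in \<open>L^q\<close>.\<close>
  define \<delta> where "\<delta> = \<epsilon> / (8 * ?m)"
  have \<delta>: "0 < \<delta>" unfolding \<delta>_def using \<epsilon> m by simp
  obtain N where N: "\<And>n x. n \<ge> N \<Longrightarrow> x \<in> closure \<Omega> \<Longrightarrow> norm (h t (\<phi> (k n)) x - g x) < \<delta>"
    using unif[OF \<delta>] by blast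
  define r where "r i = k (N + i)" for i
  have r: "strict_mono r" using k unfolding r_def strict_mono_def by simp
  have "Lp_norm ?M q (\<lambda>x. \<phi> (r i) x - \<phi> (r j) x) < \<epsilon>" for i j
  proof -
    have [measurable]: "\<phi> j \<in> borel_measurable borel" "h t (\<phi> j) \<in> borel_measurable borel" for j
      using test_space_borel[OF \<phi>] H(1) by auto
    have A: "(\<lambda>x. \<phi> j x - h t (\<phi> j) x) \<in> Lp_space ?M q \<and> Lp_norm ?M q (\<lambda>x. \<phi> j x - h t (\<phi> j) x) \<le> \<epsilon> / 4" for j
    proof -
      have le: "K * t powr e * test_norm s p (\<phi> j) \<le> \<epsilon> / 4"
        using te mult_left_mono[OF c[of j], of "K * t powr e"] K by simp
      have "(\<integral>\<^sup>+x. ennreal (\<bar>\<phi> j x - h t (\<phi> j) x\<bar> powr q) \<partial>lborel) \<le> ennreal ((K * t powr e * test_norm s p (\<phi> j)) powr q)"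
        by (rule H(2))
      also have "\<dots> \<le> ennreal ((\<epsilon> / 4) powr q)"
        using le K mult_nonneg_nonneg[OF mult_nonneg_nonneg[OF K(1) powr_ge_zero[of t e]] test_norm_nonneg[of s p "\<phi> j"]] q0
        by (intro ennreal_leI powr_mono2) auto
      finally have *: "(\<integral>\<^sup>+x. ennreal (\<bar>\<phi> j x - h t (\<phi> j) x\<bar> powr q) \<partial>lborel) \<le> ennreal ((\<epsilon> / 4) powr q)" .
      have mm: "(\<lambda>x. \<phi> j x - h t (\<phi> j) x) \<in> borel_measurable borel" by measurable
      have e4: "0 \<le> \<epsilon> / 4" using \<epsilon> by simp
      show ?thesis using Lp_space_lebesgue_on[OF q0 mm \<Omega>(2) e4 *] by blast
    qed
    have hm: "(\<lambda>x. h t (\<phi> (r i)) x - h t (\<phi> (r j)) x) \<in> borel_measurable ?M"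
      by (intro measurable_restrict_space1 measurable_completion) simp
    have le: "norm (h t (\<phi> (r i)) x - h t (\<phi> (r j)) x) \<le> 2 * \<delta>" if "x \<in> space ?M" for x
    proof -
      have x: "x \<in> closure \<Omega>" using that closure_subset[of \<Omega>] by auto
      show ?thesis using N[of "N + i" x] N[of "N + j" x] x unfolding r_def by simp
    qed
    have d2: "0 \<le> 2 * \<delta>" using \<delta> by simp
    have B: "(\<lambda>x. h t (\<phi> (r i)) x - h t (\<phi> (r j)) x) \<in> Lp_space ?M q"
      "Lp_norm ?M q (\<lambda>x. h t (\<phi> (r i)) x - h t (\<phi> (r j)) x) \<le> \<epsilon> / 4"
      using Lp_space_bounded[OF fm q0 hm d2 le] m unfolding \<delta>_def by auto
    have C: "Lp_norm ?M q (\<lambda>x. \<phi> (r j) x - h t (\<phi> (r j)) x) = Lp_norm ?M q (\<lambda>x. h t (\<phi> (r j)) x - \<phi> (r j) x)"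
      by (rule Lp_norm_minus_commute)
    have "Lp_norm ?M q (\<lambda>x. (\<phi> (r i) x - h t (\<phi> (r i)) x) + (h t (\<phi> (r i)) x - h t (\<phi> (r j)) x)) \<le> \<epsilon> / 4 + \<epsilon> / 4"
      using Minkowski_Lp[OF q1 A[THEN conjunct1] B(1), of "r i"] A[of "r i"] B(2) by linarith
    then have D: "Lp_norm ?M q (\<lambda>x. \<phi> (r i) x - h t (\<phi> (r j)) x) \<le> \<epsilon> / 2" by simp
    have "(\<lambda>x. (\<phi> (r i) x - h t (\<phi> (r i)) x) + (h t (\<phi> (r i)) x - h t (\<phi> (r j)) x)) \<in> Lp_space ?M q"
      by (rule Lp_space_add[OF q1 A[THEN conjunct1] B(1)])
    then have "(\<lambda>x. \<phi> (r i) x - h t (\<phi> (r j)) x) \<in> Lp_space ?M q" by simp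
    from Minkowski_Lp[OF q1 this Lp_space_minus[OF A[THEN conjunct1]], of "r j"]
    have "Lp_norm ?M q (\<lambda>x. \<phi> (r i) x - \<phi> (r j) x) \<le> \<epsilon> / 2 + \<epsilon> / 4"
      using D A[of "r j"] C by simp
    then show ?thesis using \<epsilon> by simp
  qed
  then show ?thesis using r by blast
qed

lemma test_space_Lq_convergent_subseq:
  fixes \<Omega> :: "'a::euclidean_space set" and \<phi> :: "nat \<Rightarrow> 'a \<Rightarrow> real"
  assumes s: "0 < s" "s < 1" and p: "1 \<le> p" and q: "p \<le> q"
    and sub: "real DIM('a) * (1 / p - 1 / q) < s"
    and \<Omega>: "bounded \<Omega>" "\<Omega> \<in> sets lebesgue"
    and \<phi>: "\<And>j. \<phi> j \<in> test_space s p" and c: "\<And>j. test_norm s p (\<phi> j) \<le> c"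
  shows "\<exists>r l. strict_mono (r :: nat \<Rightarrow> nat) \<and> Lp_tendsto (lebesgue_on \<Omega>) q (\<lambda>j. \<phi> (r j)) l"
proof -
  let ?M = "lebesgue_on \<Omega>"
  have fm: "finite_measure ?M" by (rule finite_measure_lebesgue_on_bounded[OF \<Omega>])
  have q1: "1 \<le> q" using p q by simp
  obtain r where r: "strict_mono (r :: nat \<Rightarrow> nat)"
    and cau: "\<forall>e>0. \<exists>J. \<forall>i\<ge>J. \<forall>j\<ge>J. Lp_norm ?M q (\<lambda>x. \<phi> (r i) x - \<phi> (r j) x) < e"
  proof -
    have "\<exists>r. strict_mono (r :: nat \<Rightarrow> nat) \<and> (\<forall>e>0. \<exists>J. \<forall>i\<ge>J. \<forall>j\<ge>J. Lp_norm ?M q (\<lambda>x. \<phi> (r i) x - \<phi> (r j) x) < e)"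
      by (rule Cauchy_subseq_diagonal[where d="\<lambda>i j. Lp_norm ?M q (\<lambda>x. \<phi> i x - \<phi> j x)"])
        (rule test_space_Lq_eps_subseq[OF s p q sub \<Omega> \<phi> c])
    then show thesis using that by blast
  qed
  have "\<exists>l. Lp_tendsto ?M q (\<lambda>j. \<phi> (r j)) l"
    by (rule Lp_complete[OF fm q1]) (use test_space_Lq_bound[OF s p q sub \<Omega>] \<phi> cau in auto)
  then show ?thesis using r by blast
qed

lemma AE_lebesgue_on:
  assumes "AE x in lebesgue. P x" "\<Omega> \<in> sets lebesgue"
  shows "AE x in lebesgue_on \<Omega>. P x"
  using assms(1) unfolding AE_restrict_space_iff[of \<Omega> lebesgue, simplified, OF assms(2)]
  by (rule eventually_mono) simp

text \<open>The bound of \<open>test_space_Lq_bound\<close>, applied to differences, makes the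
  sequence Cauchy in \<open>L^q\<close> of the set. Its limit agrees with \<open>u\<close> because a
  common subsequence converges almost everywhere to both.\<close>

lemma test_space_Lq_tendsto:
  fixes \<Omega> :: "'a::euclidean_space set" and \<phi> :: "nat \<Rightarrow> 'a \<Rightarrow> real"
  assumes s: "0 < s" "s < 1" and p: "1 \<le> p" and q: "p \<le> q"
    and sub: "real DIM('a) * (1 / p - 1 / q) < s"
    and \<Omega>: "bounded \<Omega>" "\<Omega> \<in> sets lebesgue"
    and \<phi>: "\<And>j. \<phi> j \<in> test_space s p" and u: "Lp_tendsto lebesgue p \<phi> u"
    and g: "Lp_tendsto lebesgue p (\<lambda>j. riesz_gradient s (\<phi> j)) g"
  shows "Lp_tendsto (lebesgue_on \<Omega>) q \<phi> u"
proof -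
  let ?M = "lebesgue_on \<Omega>"
  have fm: "finite_measure ?M" by (rule finite_measure_lebesgue_on_bounded[OF \<Omega>])
  have q1: "1 \<le> q" and q0: "0 < q" using p q by auto
  obtain C where C: "0 \<le> C" "\<And>\<phi>. \<phi> \<in> test_space s p \<Longrightarrow> \<phi> \<in> Lp_space ?M q \<and> Lp_norm ?M q \<phi> \<le> C * test_norm s p \<phi>"
    using test_space_Lq_bound[OF s p q sub \<Omega>] by blast
  have "\<exists>f. Lp_tendsto ?M q \<phi> f"
  proof (rule Lp_complete[OF fm q1])
    show "\<phi> j \<in> Lp_space ?M q" for j using C(2)[OF \<phi>] by blast
    fix e :: real assume e: "0 < e"
    have C1: "0 < C + 1" using C by simp
    obtain J where J: "\<And>i j. i \<ge> J \<Longrightarrow> j \<ge> J \<Longrightarrow> test_norm s p (\<lambda>x. \<phi> i x - \<phi> j x) < e / (C + 1)"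
      using test_norm_diff_Cauchy[OF s p \<phi> u g, of "e / (C + 1)"] e C1 by auto
    have "Lp_norm ?M q (\<lambda>x. \<phi> i x - \<phi> j x) < e" if "i \<ge> J" "j \<ge> J" for i j
    proof -
      have "Lp_norm ?M q (\<lambda>x. \<phi> i x - \<phi> j x) \<le> C * test_norm s p (\<lambda>x. \<phi> i x - \<phi> j x)"
        using C(2)[OF test_space_diff(1)[OF s p \<phi> \<phi>]] by blast
      also have "\<dots> \<le> (C + 1) * test_norm s p (\<lambda>x. \<phi> i x - \<phi> j x)"
        using test_norm_nonneg by (intro mult_right_mono) auto
      also have "\<dots> < e" using J[OF that] C1 by (simp add: pos_less_divide_eq mult.commute)
      finally show ?thesis .
    qed
    then show "\<exists>J. \<forall>i\<ge>J. \<forall>j\<ge>J. Lp_norm ?M q (\<lambda>x. \<phi> i x - \<phi> j x) < e" by blast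
  qed
  then obtain f where f: "Lp_tendsto ?M q \<phi> f" by blast
  obtain r1 where r1: "strict_mono r1" "AE x in lebesgue. (\<lambda>j. \<phi> (r1 j) x) \<longlonglongrightarrow> u x"
    using Lp_tendsto_AE_subseq[OF p u] by blast
  have "Lp_tendsto ?M q (\<lambda>j. \<phi> (r1 j)) f"
    using f r1(1) LIMSEQ_subseq_LIMSEQ[of "\<lambda>j. Lp_norm ?M q (\<lambda>x. \<phi> j x - f x)" 0 r1]
    unfolding Lp_tendsto_def by (auto simp: comp_def)
  then obtain r2 where r2: "strict_mono r2" "AE x in ?M. (\<lambda>j. \<phi> (r1 (r2 j)) x) \<longlonglongrightarrow> f x"
    using Lp_tendsto_AE_subseq[OF q1] by blast
  have "AE x in ?M. u x = f x"
    using r2(2) AE_lebesgue_on[OF r1(2) \<Omega>(2)]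
  proof eventually_elim
    case (elim x)
    then show ?case using LIMSEQ_subseq_LIMSEQ[OF elim(2) r2(1)] LIMSEQ_unique by (fastforce simp: comp_def)
  qed
  moreover have um: "u \<in> borel_measurable ?M"
    using u unfolding Lp_tendsto_def Lp_space_def by (auto intro: measurable_restrict_space1)
  moreover have fm: "f \<in> borel_measurable ?M" using f unfolding Lp_tendsto_def Lp_space_def by auto
  moreover have \<phi>m: "\<phi> j \<in> borel_measurable ?M" for j using f unfolding Lp_tendsto_def Lp_space_def by auto
  ultimately have eq: "AE x in ?M. u x = f x" by simp
  have "u \<in> Lp_space ?M q"
  proof -
    have "integrable ?M (\<lambda>x. norm (f x) powr q)" using f unfolding Lp_tendsto_def Lp_space_def by auto
    then have "integrable ?M (\<lambda>x. norm (u x) powr q)"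
      using um fm eq by (subst integrable_cong_AE[where g="\<lambda>x. norm (f x) powr q"]) auto
    then show ?thesis using um unfolding Lp_space_def by simp
  qed
  moreover have "Lp_norm ?M q (\<lambda>x. \<phi> j x - u x) = Lp_norm ?M q (\<lambda>x. \<phi> j x - f x)" for j
  proof -
    have "(LINT x|?M. norm (\<phi> j x - u x) powr q) = (LINT x|?M. norm (\<phi> j x - f x) powr q)"
      using um fm \<phi>m[of j] eq by (intro integral_cong_AE) auto
    then show ?thesis unfolding Lp_norm_def by simp
  qed
  ultimately show ?thesis using f unfolding Lp_tendsto_def by simp
qed

lemma restrict_Lp_space:
  assumes "u \<in> Lp_space (lebesgue_on \<Omega>) q"
  shows "restrict u \<Omega> \<in> Lp_space (lebesgue_on \<Omega>) q"
proof -
  have "restrict u \<Omega> \<in> borel_measurable (lebesgue_on \<Omega>) \<longleftrightarrow> u \<in> borel_measurable (lebesgue_on \<Omega>)"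
    by (intro measurable_cong) simp
  moreover have "integrable (lebesgue_on \<Omega>) (\<lambda>x. norm (restrict u \<Omega> x) powr q) \<longleftrightarrow> integrable (lebesgue_on \<Omega>) (\<lambda>x. norm (u x) powr q)"
    by (intro Bochner_Integration.integrable_cong) auto
  ultimately show ?thesis using assms unfolding Lp_space_def by simp
qed

text \<open>The estimates go from \<open>p\<close> to a larger exponent, so they are used with
  \<open>max p q\<close>; finiteness of the measure then brings the result down to
  \<open>q\<close>.\<close>

lemma compact_embedding_Lq:
  fixes \<Omega> :: "'a::euclidean_space set"
  assumes s: "0 < s" "s < 1" and p: "1 \<le> p" and q: "1 \<le> q"
    and sub: "real DIM('a) * (1 / p - 1 / max p q) < s"
    and \<Omega>: "bounded \<Omega>" "\<Omega> \<in> sets lebesgue"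
  shows "compact_embedding (bessel_space s p) (bessel_norm s p)
    (Lp_space (lebesgue_on \<Omega>) q) (Lp_norm (lebesgue_on \<Omega>) q) (\<lambda>u :: 'a \<Rightarrow> real. restrict u \<Omega>)"
proof -
  let ?M = "lebesgue_on \<Omega>" and ?Q = "max p q"
  have fm: "finite_measure ?M" by (rule finite_measure_lebesgue_on_bounded[OF \<Omega>])
  have Q: "p \<le> ?Q" "q \<le> ?Q" "1 \<le> ?Q" "0 < q" using p q by auto
  obtain C where C: "0 \<le> C" "\<And>\<phi>. \<phi> \<in> test_space s p \<Longrightarrow> \<phi> \<in> Lp_space ?M ?Q \<and> Lp_norm ?M ?Q \<phi> \<le> C * test_norm s p \<phi>"
    using test_space_Lq_bound[OF s p Q(1) sub \<Omega>] by blast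
  let ?m = "(measure ?M (space ?M) + 1) powr (1 / q)"
  have bound: "u \<in> Lp_space ?M ?Q \<and> Lp_norm ?M ?Q u \<le> C * bessel_norm s p u" if u: "u \<in> bessel_space s p" for u
  proof -
    obtain g where g: "has_riesz_gradient s p u g" "bessel_norm s p u = Lp_norm lebesgue p u + Lp_norm lebesgue p g"
      using bessel_norm_gradient[OF u] by blast
    obtain \<phi> where \<phi>: "\<And>j. \<phi> j \<in> test_space s p" "Lp_tendsto lebesgue p \<phi> u"
      "Lp_tendsto lebesgue p (\<lambda>j. riesz_gradient s (\<phi> j)) g" using has_riesz_gradientD[OF g(1)] by blast
    have lim: "Lp_tendsto ?M ?Q \<phi> u" by (rule test_space_Lq_tendsto[OF s p Q(1) sub \<Omega> \<phi>])
    have "Lp_norm ?M ?Q u \<le> C * bessel_norm s p u"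
    proof (rule LIMSEQ_le[OF Lp_norm_tendsto[OF Q(3) lim]])
      show "(\<lambda>j. C * test_norm s p (\<phi> j)) \<longlonglongrightarrow> C * bessel_norm s p u"
        unfolding g(2) by (intro tendsto_mult_left test_norm_tendsto[OF p \<phi>(2,3)])
      show "\<exists>N. \<forall>n\<ge>N. Lp_norm ?M ?Q (\<phi> n) \<le> C * test_norm s p (\<phi> n)" using C(2)[OF \<phi>(1)] by blast
    qed
    then show ?thesis using lim unfolding Lp_tendsto_def by blast
  qed
  have res: "Lp_norm ?M q (\<lambda>x. restrict u \<Omega> x - restrict v \<Omega> x) = Lp_norm ?M q (\<lambda>x. u x - v x)" for u v :: "'a \<Rightarrow> real"
    by (rule Lp_norm_cong_norm) simp
  show ?thesis
  proof (rule compact_embeddingI[where C="?m * C"])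
    show "0 \<le> ?m * C" using C by simp
    show "Lp_norm ?M q (\<lambda>x. f x - h x) \<le> Lp_norm ?M q (\<lambda>x. f x - g x) + Lp_norm ?M q (\<lambda>x. g x - h x)"
      if "f \<in> Lp_space ?M q" "g \<in> Lp_space ?M q" "h \<in> Lp_space ?M q" for f g h :: "'a \<Rightarrow> real"
      by (rule Lp_norm_triangle[OF q that])
    show "restrict u \<Omega> \<in> Lp_space ?M q" if "u \<in> bessel_space s p" for u :: "'a \<Rightarrow> real"
      using bound[OF that] Lp_finite_measure_mono(1)[OF fm Q(4,2)] by (intro restrict_Lp_space) blast
    show "Lp_norm ?M q (\<lambda>x. restrict u \<Omega> x - restrict v \<Omega> x) \<le> ?m * C * bessel_norm s p (\<lambda>x. u x - v x)"
      if "u \<in> bessel_space s p" "v \<in> bessel_space s p" for u v :: "'a \<Rightarrow> real"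
    proof -
      note b = bound[OF bessel_space_diff[OF s p that]]
      have "Lp_norm ?M q (\<lambda>x. u x - v x) \<le> ?m * Lp_norm ?M ?Q (\<lambda>x. u x - v x)"
        using Lp_finite_measure_mono(2)[OF fm Q(4,2)] b by blast
      also have "\<dots> \<le> ?m * (C * bessel_norm s p (\<lambda>x. u x - v x))" using b by (intro mult_left_mono) auto
      finally show ?thesis unfolding res by (simp add: mult.assoc)
    qed
    fix \<sigma> :: "nat \<Rightarrow> 'a \<Rightarrow> real" and c
    assume \<sigma>: "\<And>j. \<sigma> j \<in> bessel_space s p \<and> bessel_norm s p (\<sigma> j) \<le> c"
    \<comment> \<open>Each \<open>\<sigma> j\<close> is replaced by a test function at distance
      below \<open>1 / (j + 1)\<close>, so a convergent subsequence of the test functions gives one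
      of \<open>\<sigma>\<close>. The bound grows to \<open>c + 1\<close> because the test norms
      only converge to the norm of \<open>\<sigma> j\<close>.\<close>
    have "\<exists>\<psi>. \<psi> \<in> test_space s p \<and> test_norm s p \<psi> \<le> c + 1 \<and> Lp_norm ?M ?Q (\<lambda>x. \<psi> x - \<sigma> j x) < 1 / (real j + 1)" for j
    proof -
      obtain g where g: "has_riesz_gradient s p (\<sigma> j) g" "bessel_norm s p (\<sigma> j) = Lp_norm lebesgue p (\<sigma> j) + Lp_norm lebesgue p g"
        using bessel_norm_gradient \<sigma> by blast
      obtain \<phi> where \<phi>: "\<And>j. \<phi> j \<in> test_space s p" "Lp_tendsto lebesgue p \<phi> (\<sigma> j)"
        "Lp_tendsto lebesgue p (\<lambda>j. riesz_gradient s (\<phi> j)) g" using has_riesz_gradientD[OF g(1)] by blast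
      have "Lp_tendsto ?M ?Q \<phi> (\<sigma> j)" by (rule test_space_Lq_tendsto[OF s p Q(1) sub \<Omega> \<phi>])
      then have "(\<lambda>i. Lp_norm ?M ?Q (\<lambda>x. \<phi> i x - \<sigma> j x)) \<longlonglongrightarrow> 0" unfolding Lp_tendsto_def by blast
      then have "\<forall>\<^sub>F i in sequentially. Lp_norm ?M ?Q (\<lambda>x. \<phi> i x - \<sigma> j x) < 1 / (real j + 1)"
        by (rule order_tendstoD(2)) simp
      moreover have "\<forall>\<^sub>F i in sequentially. test_norm s p (\<phi> i) < c + 1"
        using test_norm_tendsto[OF p \<phi>(2,3)] by (rule order_tendstoD(2)) (use g \<sigma>[of j] in linarith)
      ultimately have "\<forall>\<^sub>F i in sequentially. Lp_norm ?M ?Q (\<lambda>x. \<phi> i x - \<sigma> j x) < 1 / (real j + 1) \<and> test_norm s p (\<phi> i) < c + 1"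
        by (rule eventually_conj)
      then obtain i where "Lp_norm ?M ?Q (\<lambda>x. \<phi> i x - \<sigma> j x) < 1 / (real j + 1)" "test_norm s p (\<phi> i) < c + 1"
        unfolding eventually_sequentially by blast
      then show ?thesis using \<phi>(1)[of i] less_imp_le by blast
    qed
    then obtain \<psi> where \<psi>: "\<And>j. \<psi> j \<in> test_space s p" "\<And>j. test_norm s p (\<psi> j) \<le> c + 1"
      "\<And>j. Lp_norm ?M ?Q (\<lambda>x. \<psi> j x - \<sigma> j x) < 1 / (real j + 1)" by metis
    obtain r l where r: "strict_mono (r :: nat \<Rightarrow> nat)" and l: "Lp_tendsto ?M ?Q (\<lambda>j. \<psi> (r j)) l"
      using test_space_Lq_convergent_subseq[of s p "max p q" \<Omega> \<psi>, OF s p Q(1) sub \<Omega> \<psi>(1,2)] by blast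
    have \<sigma>l: "\<And>j. \<sigma> j \<in> Lp_space ?M ?Q" using bound \<sigma> by blast
    have lQ: "l \<in> Lp_space ?M ?Q" using l unfolding Lp_tendsto_def by blast
    have \<psi>Q: "\<And>j. \<psi> j \<in> Lp_space ?M ?Q" using C(2)[OF \<psi>(1)] by blast
    have "(\<lambda>j. Lp_norm ?M ?Q (\<lambda>x. \<sigma> (r j) x - l x)) \<longlonglongrightarrow> 0"
    proof (rule Lim_null_comparison)
      show "\<forall>\<^sub>F j in sequentially. norm (Lp_norm ?M ?Q (\<lambda>x. \<sigma> (r j) x - l x)) \<le> 1 / (real (r j) + 1) + Lp_norm ?M ?Q (\<lambda>x. \<psi> (r j) x - l x)"
      proof (intro always_eventually allI)
        fix j
        show "norm (Lp_norm ?M ?Q (\<lambda>x. \<sigma> (r j) x - l x)) \<le> 1 / (real (r j) + 1) + Lp_norm ?M ?Q (\<lambda>x. \<psi> (r j) x - l x)"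
          using Lp_norm_triangle[OF Q(3) \<sigma>l \<psi>Q lQ, of "r j" "r j"] \<psi>(3)[of "r j"]
            Lp_norm_minus_commute[of ?M ?Q "\<sigma> (r j)" "\<psi> (r j)"] by simp
      qed
      have "(\<lambda>j. 1 / (real j + 1)) \<longlonglongrightarrow> 0" using LIMSEQ_inverse_real_of_nat by (simp add: inverse_eq_divide add.commute)
      then have "(\<lambda>j. 1 / (real (r j) + 1)) \<longlonglongrightarrow> 0" using LIMSEQ_subseq_LIMSEQ[OF _ r] by (fastforce simp: comp_def)
      moreover have "(\<lambda>j. Lp_norm ?M ?Q (\<lambda>x. \<psi> (r j) x - l x)) \<longlonglongrightarrow> 0" using l unfolding Lp_tendsto_def by blast
      ultimately show "(\<lambda>j. 1 / (real (r j) + 1) + Lp_norm ?M ?Q (\<lambda>x. \<psi> (r j) x - l x)) \<longlonglongrightarrow> 0"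
        using tendsto_add by fastforce
    qed
    then have "Lp_tendsto ?M ?Q (\<lambda>j. \<sigma> (r j)) l" using \<sigma>l lQ unfolding Lp_tendsto_def by blast
    then have "Lp_tendsto ?M q (\<lambda>j. \<sigma> (r j)) l" by (rule Lp_tendsto_finite_measure_mono[OF fm Q(4,2,3)])
    then have lq: "l \<in> Lp_space ?M q" "(\<lambda>j. Lp_norm ?M q (\<lambda>x. \<sigma> (r j) x - l x)) \<longlonglongrightarrow> 0"
      unfolding Lp_tendsto_def by auto
    have eq: "Lp_norm ?M q (\<lambda>x. restrict (\<sigma> (r j)) \<Omega> x - l x) = Lp_norm ?M q (\<lambda>x. \<sigma> (r j) x - l x)" for j
      by (rule Lp_norm_cong_norm) simp
    show "\<exists>l\<in>Lp_space ?M q. \<exists>r. strict_mono r \<and> (\<lambda>j. Lp_norm ?M q (\<lambda>x. restrict (\<sigma> (r j)) \<Omega> x - l x)) \<longlonglongrightarrow> 0"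
      using lq r by (intro bexI[of _ l] exI[of _ r] conjI) (simp_all only: eq)
  qed (rule Lp_norm_nonneg Lp_norm_zero Lp_norm_minus_commute)+
qed

section \<open>Embeddings into Hoelder spaces\<close>

lemma holder_norm_le:
  assumes A: "0 \<le> A" "\<And>x. x \<in> S \<Longrightarrow> \<bar>f x\<bar> \<le> A"
    and B: "0 \<le> B" "\<And>x y. x \<in> S \<Longrightarrow> y \<in> S \<Longrightarrow> \<bar>f x - f y\<bar> \<le> B * dist x y powr \<mu>"
  shows "holder_norm \<mu> S f \<le> A + B"
  unfolding holder_norm_def
proof (rule add_mono)
  show "Sup (insert 0 {\<bar>f x\<bar> | x. x \<in> S}) \<le> A" using A by (intro cSup_least) auto
  show "Sup (insert 0 {\<bar>f x - f y\<bar> / dist x y powr \<mu> | x y. x \<in> S \<and> y \<in> S}) \<le> B"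
  proof (rule cSup_least)
    fix z assume "z \<in> insert 0 {\<bar>f x - f y\<bar> / dist x y powr \<mu> | x y. x \<in> S \<and> y \<in> S}"
    then consider "z = 0" | x y where "x \<in> S" "y \<in> S" "z = \<bar>f x - f y\<bar> / dist x y powr \<mu>" by blast
    then show "z \<le> B"
    proof cases
      case 2
      then show ?thesis using B by (cases "x = y") (auto simp: divide_le_eq)
    qed (use B in simp)
  qed simp
qed

definition sup_part :: "'a set \<Rightarrow> ('a \<Rightarrow> real) \<Rightarrow> real" where
  "sup_part S f = Sup (insert 0 {\<bar>f x\<bar> | x. x \<in> S})"

definition holder_part :: "real \<Rightarrow> 'a::metric_space set \<Rightarrow> ('a \<Rightarrow> real) \<Rightarrow> real" where
  "holder_part \<mu> S f = Sup (insert 0 {\<bar>f x - f y\<bar> / dist x y powr \<mu> | x y. x \<in> S \<and> y \<in> S})"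

lemma holder_norm_parts: "holder_norm \<mu> S f = sup_part S f + holder_part \<mu> S f"
  unfolding holder_norm_def sup_part_def holder_part_def ..

lemma holder_space_parts:
  assumes f: "f \<in> holder_space \<mu> S"
  shows "0 \<le> sup_part S f" "0 \<le> holder_part \<mu> S f"
    and "x \<in> S \<Longrightarrow> \<bar>f x\<bar> \<le> sup_part S f"
    and "x \<in> S \<Longrightarrow> y \<in> S \<Longrightarrow> \<bar>f x - f y\<bar> \<le> holder_part \<mu> S f * dist x y powr \<mu>"
proof -
  obtain A where A: "\<And>x. x \<in> S \<Longrightarrow> \<bar>f x\<bar> \<le> A"
    using f unfolding holder_space_def bounded_iff by auto
  obtain C where C: "\<And>x y. x \<in> S \<Longrightarrow> y \<in> S \<Longrightarrow> \<bar>f x - f y\<bar> \<le> C * dist x y powr \<mu>"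
    using f unfolding holder_space_def by auto
  have b1: "bdd_above (insert 0 {\<bar>f x\<bar> | x. x \<in> S})"
    using A by (intro bdd_aboveI[of _ "max 0 A"]) (auto simp: le_max_iff_disj)
  have b2: "bdd_above (insert 0 {\<bar>f x - f y\<bar> / dist x y powr \<mu> | x y. x \<in> S \<and> y \<in> S})"
  proof (rule bdd_aboveI)
    fix z assume "z \<in> insert 0 {\<bar>f x - f y\<bar> / dist x y powr \<mu> | x y. x \<in> S \<and> y \<in> S}"
    then consider "z = 0" | x y where "x \<in> S" "y \<in> S" "z = \<bar>f x - f y\<bar> / dist x y powr \<mu>" by blast
    then show "z \<le> max 0 C"
    proof cases
      case 2
      then show ?thesis using C[OF 2(1,2)] by (cases "x = y") (auto simp: divide_le_eq le_max_iff_disj)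
    qed simp
  qed
  show "0 \<le> sup_part S f" unfolding sup_part_def using b1 by (intro cSup_upper) auto
  show "0 \<le> holder_part \<mu> S f" unfolding holder_part_def using b2 by (intro cSup_upper) auto
  show "\<bar>f x\<bar> \<le> sup_part S f" if "x \<in> S"
    unfolding sup_part_def using b1 that by (intro cSup_upper) auto
  show "\<bar>f x - f y\<bar> \<le> holder_part \<mu> S f * dist x y powr \<mu>" if "x \<in> S" "y \<in> S"
  proof (cases "x = y")
    case False
    have "\<bar>f x - f y\<bar> / dist x y powr \<mu> \<le> holder_part \<mu> S f"
      unfolding holder_part_def using b2 that by (intro cSup_upper) auto
    then show ?thesis using False by (simp add: divide_le_eq)
  qed simp
qed

lemma holder_spaceI:
  assumes "\<And>x. x \<in> S \<Longrightarrow> \<bar>f x\<bar> \<le> A" "\<And>x y. x \<in> S \<Longrightarrow> y \<in> S \<Longrightarrow> \<bar>f x - f y\<bar> \<le> B * dist x y powr \<mu>"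
  shows "f \<in> holder_space \<mu> S"
  using assms unfolding holder_space_def bounded_iff by auto

lemma holder_space_add:
  assumes f: "f \<in> holder_space \<mu> S" and g: "g \<in> holder_space \<mu> S"
  shows "(\<lambda>x. f x + g x) \<in> holder_space \<mu> S"
    and "holder_norm \<mu> S (\<lambda>x. f x + g x) \<le> holder_norm \<mu> S f + holder_norm \<mu> S g"
proof -
  note F = holder_space_parts[OF f] and G = holder_space_parts[OF g]
  have 1: "\<bar>f x + g x\<bar> \<le> sup_part S f + sup_part S g" if "x \<in> S" for x
    using F(3)[OF that] G(3)[OF that] by linarith
  have 2: "\<bar>(f x + g x) - (f y + g y)\<bar> \<le> (holder_part \<mu> S f + holder_part \<mu> S g) * dist x y powr \<mu>"
    if "x \<in> S" "y \<in> S" for x y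
    using F(4)[OF that] G(4)[OF that] by (simp add: distrib_right)
  show "(\<lambda>x. f x + g x) \<in> holder_space \<mu> S" using 1 2 by (rule holder_spaceI)
  have "holder_norm \<mu> S (\<lambda>x. f x + g x) \<le> (sup_part S f + sup_part S g) + (holder_part \<mu> S f + holder_part \<mu> S g)"
    using F(1,2) G(1,2) 1 2 by (intro holder_norm_le) auto
  then show "holder_norm \<mu> S (\<lambda>x. f x + g x) \<le> holder_norm \<mu> S f + holder_norm \<mu> S g"
    unfolding holder_norm_parts by simp
qed

lemma holder_space_minus: "f \<in> holder_space \<mu> S \<Longrightarrow> (\<lambda>x. - f x) \<in> holder_space \<mu> S"
  by (rule holder_spaceI[of _ _ "sup_part S f" "holder_part \<mu> S f"])
    (use holder_space_parts[of f \<mu> S] in \<open>auto simp: abs_minus_commute\<close>)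

lemma holder_space_diff:
  assumes "f \<in> holder_space \<mu> S" "g \<in> holder_space \<mu> S"
  shows "(\<lambda>x. f x - g x) \<in> holder_space \<mu> S"
  using holder_space_add(1)[OF assms(1) holder_space_minus[OF assms(2)]] by simp

lemma holder_norm_minus_commute: "holder_norm \<mu> S (\<lambda>x. f x - g x) = holder_norm \<mu> S (\<lambda>x. g x - f x)"
proof -
  have "\<bar>f x - g x - (f y - g y)\<bar> = \<bar>g x - f x - (g y - f y)\<bar>" for x y by linarith
  then show ?thesis unfolding holder_norm_def by (simp add: abs_minus_commute)
qed

lemma holder_norm_nonneg: "f \<in> holder_space \<mu> S \<Longrightarrow> 0 \<le> holder_norm \<mu> S f"
  using holder_space_parts(1,2) unfolding holder_norm_parts by fastforce

lemma holder_norm_cong: "(\<And>x. x \<in> S \<Longrightarrow> f x = g x) \<Longrightarrow> holder_norm \<mu> S f = holder_norm \<mu> S g"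
proof -
  assume eq: "\<And>x. x \<in> S \<Longrightarrow> f x = g x"
  then have "{\<bar>f x\<bar> | x. x \<in> S} = {\<bar>g x\<bar> | x. x \<in> S}"
    "{\<bar>f x - f y\<bar> / dist x y powr \<mu> | x y. x \<in> S \<and> y \<in> S} = {\<bar>g x - g y\<bar> / dist x y powr \<mu> | x y. x \<in> S \<and> y \<in> S}"
    by (metis (no_types, lifting))+
  then show ?thesis unfolding holder_norm_def by simp
qed

lemma holder_exponent_le:
  fixes d D \<mu> \<nu> :: real
  assumes d: "0 \<le> d" "d \<le> D" and \<mu>: "0 < \<mu>" "\<mu> \<le> \<nu>"
  shows "d powr \<nu> \<le> D powr (\<nu> - \<mu>) * d powr \<mu>"
proof -
  have "d powr \<nu> = d powr (\<nu> - \<mu>) * d powr \<mu>" by (simp add: powr_add[symmetric])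
  also have "\<dots> \<le> D powr (\<nu> - \<mu>) * d powr \<mu>" using d \<mu> by (intro mult_right_mono powr_mono2) auto
  finally show ?thesis .
qed

text \<open>Geometric mean of two bounds for an increment: the uniform one with weight
  \<open>1 - \<mu> / \<nu>\<close> and the Hoelder bound of exponent \<open>\<nu>\<close> with
  weight \<open>\<mu> / \<nu>\<close>. A small \<open>\<epsilon>\<close> makes the Hoelder constant
  of exponent \<open>\<mu>\<close> small because \<open>\<mu> < \<nu>\<close> leaves a positive
  power of it.\<close>

lemma holder_interpolate:
  fixes z \<epsilon> H d \<mu> \<nu> :: real
  assumes z: "0 \<le> z" "z \<le> 2 * \<epsilon>" "z \<le> H * d powr \<nu>" and H: "0 \<le> H" and \<mu>: "0 < \<mu>" "\<mu> < \<nu>"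
  shows "z \<le> (2 * \<epsilon>) powr (1 - \<mu> / \<nu>) * H powr (\<mu> / \<nu>) * d powr \<mu>"
proof -
  have "z = z powr (1 - \<mu> / \<nu>) * z powr (\<mu> / \<nu>)"
    using z by (cases "z = 0") (auto simp: powr_add[symmetric])
  also have "\<dots> \<le> (2 * \<epsilon>) powr (1 - \<mu> / \<nu>) * (H * d powr \<nu>) powr (\<mu> / \<nu>)"
    using z \<mu> by (intro mult_mono powr_mono2) auto
  also have "(H * d powr \<nu>) powr (\<mu> / \<nu>) = H powr (\<mu> / \<nu>) * d powr \<mu>"
    using \<mu> by (simp add: powr_mult powr_powr)
  finally show ?thesis by (simp add: mult.assoc)
qed

section \<open>Continuous representatives\<close>

lemma continuous_AE_eq:
  fixes v w :: "'a::euclidean_space \<Rightarrow> real"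
  assumes v: "continuous_on UNIV v" and w: "continuous_on UNIV w" and eq: "AE x in lebesgue. v x = w x"
  shows "v = w"
proof (rule ext, rule ccontr)
  fix x assume ne: "v x \<noteq> w x"
  have op: "open {x. v x \<noteq> w x}" using v w by (intro open_Collect_neq)
  have "negligible {x. v x \<noteq> w x}"
    using eq negligible_subset unfolding eventually_ae_filter_negligible by blast
  then show False using op ne open_not_negligible by blast
qed

lemma continuous_rep_eq:
  assumes "continuous_representative u v"
  shows "continuous_rep u = v"
  unfolding continuous_rep_def
proof (rule the_equality)
  fix w assume w: "continuous_representative u w"
  have "AE x in lebesgue. w x = v x"
    using w assms unfolding continuous_representative_def by (auto elim: eventually_elim2)
  then show "w = v" using w assms continuous_AE_eq unfolding continuous_representative_def by blast
qed (rule assms)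

lemma continuous_representative_diff:
  assumes "continuous_representative u v" "continuous_representative u' v'"
  shows "continuous_representative (\<lambda>x. u x - u' x) (\<lambda>x. v x - v' x)"
  using assms unfolding continuous_representative_def by (auto intro: continuous_on_diff elim: eventually_elim2)

text \<open>The supremum bound on differences makes an approximating sequence uniformly Cauchy on
  the whole space. Its limit is continuous, inherits both estimates with the norm of
  \<open>u\<close>, and equals \<open>u\<close> almost everywhere along a subsequence.\<close>

lemma bessel_space_continuous_representative:
  fixes u :: "'a::euclidean_space \<Rightarrow> real"
  assumes s: "0 < s" "s < 1" and p: "1 \<le> p"
    and K: "0 \<le> K" "\<And>\<phi> x. \<phi> \<in> test_space s p \<Longrightarrow> \<bar>\<phi> (x::'a)\<bar> \<le> K * test_norm s p \<phi>"
    "\<And>\<phi> x y. \<phi> \<in> test_space s p \<Longrightarrow> \<bar>\<phi> (x::'a) - \<phi> y\<bar> \<le> K * test_norm s p \<phi> * norm (x - y) powr \<nu>"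
    and u: "u \<in> bessel_space s p"
  shows "\<exists>v. continuous_representative u v \<and> (\<forall>x. \<bar>v x\<bar> \<le> K * bessel_norm s p u) \<and>
    (\<forall>x y. \<bar>v x - v y\<bar> \<le> K * bessel_norm s p u * norm (x - y) powr \<nu>)"
proof -
  obtain g where g: "has_riesz_gradient s p u g" "bessel_norm s p u = Lp_norm lebesgue p u + Lp_norm lebesgue p g"
    using bessel_norm_gradient[OF u] by blast
  obtain \<phi> where \<phi>: "\<And>j. \<phi> j \<in> test_space s p" "Lp_tendsto lebesgue p \<phi> u"
    "Lp_tendsto lebesgue p (\<lambda>j. riesz_gradient s (\<phi> j)) g" using has_riesz_gradientD[OF g(1)] by blast
  have "uniformly_Cauchy_on UNIV \<phi>"
    unfolding uniformly_Cauchy_on_def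
  proof (intro allI impI)
    fix e :: real assume e: "0 < e"
    have K1: "0 < K + 1" using K by simp
    obtain J where J: "\<And>i j. i \<ge> J \<Longrightarrow> j \<ge> J \<Longrightarrow> test_norm s p (\<lambda>x. \<phi> i x - \<phi> j x) < e / (K + 1)"
      using test_norm_diff_Cauchy[OF s p \<phi>, of "e / (K + 1)"] e K1 by auto
    have "dist (\<phi> i x) (\<phi> j x) < e" if "i \<ge> J" "j \<ge> J" for i j x
    proof -
      have "\<bar>\<phi> i x - \<phi> j x\<bar> \<le> K * test_norm s p (\<lambda>x. \<phi> i x - \<phi> j x)"
        by (rule K(2)[OF test_space_diff(1)[OF s p \<phi>(1) \<phi>(1)]])
      also have "\<dots> \<le> (K + 1) * test_norm s p (\<lambda>x. \<phi> i x - \<phi> j x)"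
        using test_norm_nonneg by (intro mult_right_mono) auto
      also have "\<dots> < e" using J[OF that] K1 by (simp add: pos_less_divide_eq mult.commute)
      finally show ?thesis by (simp add: dist_real_def)
    qed
    then show "\<exists>M. \<forall>x\<in>UNIV. \<forall>m\<ge>M. \<forall>n\<ge>M. dist (\<phi> m x) (\<phi> n x) < e" by blast
  qed
  then obtain v where v: "uniform_limit UNIV \<phi> v sequentially"
    using Cauchy_uniformly_convergent uniformly_convergent_on_def by blast
  have lim: "(\<lambda>j. \<phi> j x) \<longlonglongrightarrow> v x" for x using tendsto_uniform_limitI[OF v] by simp
  have cont: "continuous_on UNIV v"
    using uniform_limit_theorem[OF _ v] test_space_continuous[OF \<phi>(1)] by simp
  obtain r where r: "strict_mono r" "AE x in lebesgue. (\<lambda>j. \<phi> (r j) x) \<longlonglongrightarrow> u x"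
    using Lp_tendsto_AE_subseq[OF p \<phi>(2)] by blast
  have "AE x in lebesgue. v x = u x"
    using r(2)
  proof eventually_elim
    case (elim x)
    have "(\<lambda>j. \<phi> (r j) x) \<longlonglongrightarrow> v x" using LIMSEQ_subseq_LIMSEQ[OF lim[of x] r(1)] by (simp add: comp_def)
    then show ?case using elim LIMSEQ_unique by blast
  qed
  then have rep: "continuous_representative u v" using cont unfolding continuous_representative_def by blast
  have N: "(\<lambda>j. K * test_norm s p (\<phi> j)) \<longlonglongrightarrow> K * bessel_norm s p u"
    unfolding g(2) by (intro tendsto_mult_left test_norm_tendsto[OF p \<phi>(2,3)])
  have "\<bar>v x\<bar> \<le> K * bessel_norm s p u" for x
    by (rule LIMSEQ_le[OF tendsto_rabs[OF lim] N]) (use K(2)[OF \<phi>(1)] in blast)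
  moreover have "\<bar>v x - v y\<bar> \<le> K * bessel_norm s p u * norm (x - y) powr \<nu>" for x y
    by (rule LIMSEQ_le[OF tendsto_rabs[OF tendsto_diff[OF lim lim]] tendsto_mult_right[OF N]])
      (use K(3)[OF \<phi>(1)] in blast)
  ultimately show ?thesis using rep by blast
qed

lemma compact_embedding_holder:
  fixes \<Omega> :: "'a::euclidean_space set"
  assumes s: "0 < s" "s < 1" and p: "1 \<le> p" and sp: "real DIM('a) < s * p" and \<Omega>: "bounded \<Omega>"
  shows "\<And>u :: 'a \<Rightarrow> real. u \<in> bessel_space s p \<Longrightarrow> \<exists>v. continuous_representative u v"
    and "\<And>\<mu>. 0 < \<mu> \<Longrightarrow> \<mu> < s - real DIM('a) / p \<Longrightarrow>
      compact_embedding (bessel_space s p) (bessel_norm s p)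
        (holder_space \<mu> (closure \<Omega>)) (holder_norm \<mu> (closure \<Omega>))
        (\<lambda>u :: 'a \<Rightarrow> real. restrict (continuous_rep u) (closure \<Omega>))"
proof -
  define \<nu> where "\<nu> = s - real DIM('a) / p"
  obtain K where K: "0 \<le> K" "\<And>\<phi> x. \<phi> \<in> test_space s p \<Longrightarrow> \<bar>\<phi> (x::'a)\<bar> \<le> K * test_norm s p \<phi>"
    "\<And>\<phi> x y. \<phi> \<in> test_space s p \<Longrightarrow> \<bar>\<phi> (x::'a) - \<phi> y\<bar> \<le> K * test_norm s p \<phi> * norm (x - y) powr \<nu>"
    using test_space_holder_estimates[OF s p sp] unfolding \<nu>_def by blast
  have ex: "\<exists>v. continuous_representative u v \<and> (\<forall>x. \<bar>v x\<bar> \<le> K * bessel_norm s p u) \<and>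
      (\<forall>x y. \<bar>v x - v y\<bar> \<le> K * bessel_norm s p u * norm (x - y) powr \<nu>)"
    if "u \<in> bessel_space s p" for u :: "'a \<Rightarrow> real"
    by (rule bessel_space_continuous_representative[OF s p K that])
  have rep: "continuous_representative u (continuous_rep u)"
    and rep1: "\<bar>continuous_rep u x\<bar> \<le> K * bessel_norm s p u"
    and rep2: "\<bar>continuous_rep u x - continuous_rep u y\<bar> \<le> K * bessel_norm s p u * norm (x - y) powr \<nu>"
    if "u \<in> bessel_space s p" for u :: "'a \<Rightarrow> real" and x y
    using ex[OF that] continuous_rep_eq by metis+
  show "\<exists>v. continuous_representative u v" if "u \<in> bessel_space s p" for u :: "'a \<Rightarrow> real"
    using rep[OF that] by blast
  fix \<mu> assume \<mu>: "0 < \<mu>" "\<mu> < s - real DIM('a) / p"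
  then have \<mu>\<nu>: "\<mu> < \<nu>" "\<mu> \<le> \<nu>" "0 < \<nu>" unfolding \<nu>_def by auto
  let ?C = "closure \<Omega>"
  have cpt: "compact ?C" using \<Omega> by (simp add: compact_closure)
  define D where "D = diameter ?C"
  have D: "dist x y \<le> D" if "x \<in> ?C" "y \<in> ?C" for x y
    unfolding D_def using diameter_bounded_bound[of ?C x y] that cpt compact_imp_bounded by auto
  have bn: "0 \<le> bessel_norm s p u" for u :: "'a \<Rightarrow> real" unfolding bessel_norm_def by simp
  \<comment> \<open>On a bounded set a bound of exponent \<open>\<nu>\<close> gives one of exponent
    \<open>\<mu>\<close> at the cost of a power of the diameter.\<close>
  have hol: "(f \<in> holder_space \<mu> ?C) \<and> holder_norm \<mu> ?C f \<le> N + N * D powr (\<nu> - \<mu>)"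
    if N: "0 \<le> N" and f1: "\<And>x. x \<in> ?C \<Longrightarrow> \<bar>f x\<bar> \<le> N"
      and f2: "\<And>x y. x \<in> ?C \<Longrightarrow> y \<in> ?C \<Longrightarrow> \<bar>f x - f y\<bar> \<le> N * norm (x - y) powr \<nu>" for f :: "'a \<Rightarrow> real" and N
  proof -
    have f3: "\<bar>f x - f y\<bar> \<le> (N * D powr (\<nu> - \<mu>)) * dist x y powr \<mu>" if "x \<in> ?C" "y \<in> ?C" for x y
    proof -
      have "N * dist x y powr \<nu> \<le> N * (D powr (\<nu> - \<mu>) * dist x y powr \<mu>)"
        using holder_exponent_le[OF zero_le_dist D[OF that] \<mu>(1) \<mu>\<nu>(2)] N by (intro mult_left_mono)
      then show ?thesis using f2[OF that] by (simp add: dist_norm mult.assoc)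
    qed
    show ?thesis using holder_spaceI[OF f1 f3] holder_norm_le[OF N f1 _ f3] N by auto
  qed
  show "compact_embedding (bessel_space s p) (bessel_norm s p) (holder_space \<mu> ?C) (holder_norm \<mu> ?C)
        (\<lambda>u :: 'a \<Rightarrow> real. restrict (continuous_rep u) ?C)"
  proof (rule compact_embeddingI[where C="K + K * D powr (\<nu> - \<mu>)"])
    show "0 \<le> holder_norm \<mu> ?C (\<lambda>x. f x - g x)" if "f \<in> holder_space \<mu> ?C" "g \<in> holder_space \<mu> ?C" for f g :: "'a \<Rightarrow> real"
      using holder_norm_nonneg[OF holder_space_diff[OF that]] .
    show "holder_norm \<mu> ?C (\<lambda>x. f x - f x) = 0" for f :: "'a \<Rightarrow> real"
    proof -
      have "holder_norm \<mu> ?C (\<lambda>x. 0) \<le> 0 + 0" by (rule holder_norm_le) auto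
      moreover have "(\<lambda>x. 0) \<in> holder_space \<mu> ?C" by (rule holder_spaceI[of _ _ 0 0]) auto
      ultimately show ?thesis using holder_norm_nonneg[of "\<lambda>x. 0" \<mu> ?C] by simp
    qed
    show "holder_norm \<mu> ?C (\<lambda>x. f x - h x) \<le> holder_norm \<mu> ?C (\<lambda>x. f x - g x) + holder_norm \<mu> ?C (\<lambda>x. g x - h x)"
      if "f \<in> holder_space \<mu> ?C" "g \<in> holder_space \<mu> ?C" "h \<in> holder_space \<mu> ?C" for f g h :: "'a \<Rightarrow> real"
      using holder_space_add(2)[OF holder_space_diff[OF that(1,2)] holder_space_diff[OF that(2,3)]] by simp
    show "0 \<le> K + K * D powr (\<nu> - \<mu>)" using K by simp
    show "restrict (continuous_rep u) ?C \<in> holder_space \<mu> ?C" if "u \<in> bessel_space s p" for u :: "'a \<Rightarrow> real"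
      using hol[of "K * bessel_norm s p u" "restrict (continuous_rep u) ?C"] rep1[OF that] rep2[OF that] K bn by simp
    show "holder_norm \<mu> ?C (\<lambda>x. restrict (continuous_rep u) ?C x - restrict (continuous_rep v) ?C x)
        \<le> (K + K * D powr (\<nu> - \<mu>)) * bessel_norm s p (\<lambda>x. u x - v x)"
      if uv: "u \<in> bessel_space s p" "v \<in> bessel_space s p" for u v :: "'a \<Rightarrow> real"
    proof -
      let ?w = "\<lambda>x. u x - v x"
      have w: "?w \<in> bessel_space s p" by (rule bessel_space_diff[OF s p uv])
      \<comment> \<open>Uniqueness of the continuous representative makes
        \<open>continuous_rep\<close> compatible with differences, so the bounds for
        \<open>?w\<close> become bounds for the difference of the images.\<close>
      have eq: "continuous_rep ?w = (\<lambda>x. continuous_rep u x - continuous_rep v x)"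
        by (rule continuous_rep_eq[OF continuous_representative_diff[OF rep[OF uv(1)] rep[OF uv(2)]]])
      have "holder_norm \<mu> ?C (\<lambda>x. restrict (continuous_rep u) ?C x - restrict (continuous_rep v) ?C x) = holder_norm \<mu> ?C (continuous_rep ?w)"
        unfolding eq by (rule holder_norm_cong) simp
      also have "\<dots> \<le> K * bessel_norm s p ?w + K * bessel_norm s p ?w * D powr (\<nu> - \<mu>)"
        using hol[of "K * bessel_norm s p ?w" "continuous_rep ?w"] rep1[OF w] rep2[OF w] K bn by simp
      finally show ?thesis by (simp add: algebra_simps)
    qed
    fix \<sigma> :: "nat \<Rightarrow> 'a \<Rightarrow> real" and c
    assume \<sigma>: "\<And>j. \<sigma> j \<in> bessel_space s p \<and> bessel_norm s p (\<sigma> j) \<le> c"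
    define v where "v j = continuous_rep (\<sigma> j)" for j
    have c0: "0 \<le> c" using \<sigma>[of 0] bn order_trans by blast
    define N where "N = K * c"
    have N: "0 \<le> N" unfolding N_def using K c0 by simp
    have KN: "K * bessel_norm s p (\<sigma> j) \<le> N" for j unfolding N_def using \<sigma> K by (intro mult_left_mono) auto
    have v1: "\<bar>v j x\<bar> \<le> N" for j x using rep1[of "\<sigma> j" x] \<sigma>[of j] KN[of j] unfolding v_def by linarith
    have v2: "\<bar>v j x - v j y\<bar> \<le> N * norm (x - y) powr \<nu>" for j x y
      using rep2[of "\<sigma> j" x y] \<sigma>[of j] mult_right_mono[OF KN[of j] powr_ge_zero[of "norm (x - y)" \<nu>]] unfolding v_def by linarith
    obtain l r where r: "strict_mono (r :: nat \<Rightarrow> nat)"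
      and unif: "\<And>e. 0 < e \<Longrightarrow> \<exists>J. \<forall>n x. n \<ge> J \<and> x \<in> ?C \<longrightarrow> norm (v (r n) x - l x) < e"
    proof (rule Arzela_Ascoli[OF cpt, of v N])
      show "norm (v n x) \<le> N" for n x using v1 by simp
      fix x and e :: real assume e: "0 < e"
      define d where "d = (e / (N + 1)) powr (1 / \<nu>)"
      have N1: "0 < N + 1" using N by simp
      have d: "0 < d" unfolding d_def using e N1 by simp
      have "norm (v n x - v n y) < e" if "norm (x - y) < d" for n y
      proof -
        have "norm (x - y) powr \<nu> \<le> d powr \<nu>" using that \<mu>\<nu> by (intro powr_mono2) auto
        also have "\<dots> = e / (N + 1)" unfolding d_def using \<mu>\<nu> e N1 by (simp add: powr_powr)
        finally have "N * norm (x - y) powr \<nu> \<le> N * (e / (N + 1))" using N by (rule mult_left_mono)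
        also have "\<dots> < e" using e N by (simp add: field_simps)
        finally show ?thesis using v2[of n x y] by simp
      qed
      then show "\<exists>d>0. \<forall>n y. y \<in> ?C \<and> norm (x - y) < d \<longrightarrow> norm (v n x - v n y) < e" using d by blast
    qed blast
    have lim: "(\<lambda>j. v (r j) x) \<longlonglongrightarrow> l x" if "x \<in> ?C" for x
      using unif that by (intro LIMSEQ_I) blast
    have l1: "\<bar>l x\<bar> \<le> N" if "x \<in> ?C" for x
      by (rule LIMSEQ_le_const2[OF tendsto_rabs[OF lim[OF that]]]) (use v1 in blast)
    \<comment> \<open>The limit keeps the full exponent \<open>\<nu>\<close>, so
      \<open>v (r j) - l\<close> has a Hoelder constant of at most \<open>2 * N\<close> at exponent
      \<open>\<nu>\<close>, and interpolation applies.\<close>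
    have l2: "\<bar>l x - l y\<bar> \<le> N * norm (x - y) powr \<nu>" if "x \<in> ?C" "y \<in> ?C" for x y
      by (rule LIMSEQ_le_const2[OF tendsto_rabs[OF tendsto_diff[OF lim[OF that(1)] lim[OF that(2)]]]]) (use v2 in blast)
    have lh: "l \<in> holder_space \<mu> ?C" using hol[OF N l1 l2] by blast
    have est: "holder_norm \<mu> ?C (\<lambda>x. v (r j) x - l x) \<le> e + (2 * e) powr (1 - \<mu> / \<nu>) * (2 * N) powr (\<mu> / \<nu>)"
      if e: "0 < e" and le: "\<And>x. x \<in> ?C \<Longrightarrow> \<bar>v (r j) x - l x\<bar> < e" for e j
    proof (rule holder_norm_le)
      show "\<bar>v (r j) x - l x\<bar> \<le> e" if "x \<in> ?C" for x using le[OF that] by simp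
      fix x y assume xy: "x \<in> ?C" "y \<in> ?C"
      have "\<bar>v (r j) x - l x - (v (r j) y - l y)\<bar> \<le> 2 * e" using le[OF xy(1)] le[OF xy(2)] by linarith
      moreover have "\<bar>v (r j) x - l x - (v (r j) y - l y)\<bar> \<le> (2 * N) * dist x y powr \<nu>"
        using v2[of "r j" x y] l2[OF xy] by (simp add: dist_norm)
      ultimately show "\<bar>v (r j) x - l x - (v (r j) y - l y)\<bar> \<le> (2 * e) powr (1 - \<mu> / \<nu>) * (2 * N) powr (\<mu> / \<nu>) * dist x y powr \<mu>"
        using N \<mu> \<mu>\<nu> by (intro holder_interpolate) auto
    qed (use e in auto)
    have "(\<lambda>j. holder_norm \<mu> ?C (\<lambda>x. v (r j) x - l x)) \<longlonglongrightarrow> 0"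
    proof (rule LIMSEQ_I)
      fix \<epsilon> :: real assume \<epsilon>: "0 < \<epsilon>"
      \<comment> \<open>The bound of \<open>est\<close> tends to 0 with \<open>e\<close>, so one
        suitable \<open>e\<close> can be fixed before uniform convergence supplies the
        index.\<close>
      have "((\<lambda>e. e + (2 * e) powr (1 - \<mu> / \<nu>) * (2 * N) powr (\<mu> / \<nu>)) \<longlongrightarrow> 0) (at_right 0)"
      proof -
        have "((\<lambda>e::real. 2 * e) \<longlongrightarrow> 2 * 0) (at_right 0)" by (intro tendsto_intros)
        then have "((\<lambda>e::real. 2 * e) \<longlongrightarrow> 0) (at_right 0)" by simp
        moreover have "\<forall>\<^sub>F e in at_right (0::real). 0 \<le> 2 * e" using eventually_at_right_less[of 0] by eventually_elim simp
        moreover have "0 < 1 - \<mu> / \<nu>" using \<mu>\<nu> by simp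
        ultimately have "((\<lambda>e. (2 * e) powr (1 - \<mu> / \<nu>)) \<longlongrightarrow> 0 powr (1 - \<mu> / \<nu>)) (at_right 0)"
          by (intro tendsto_powr'[OF _ tendsto_const]) auto
        then have "((\<lambda>e. e + (2 * e) powr (1 - \<mu> / \<nu>) * (2 * N) powr (\<mu> / \<nu>)) \<longlongrightarrow> 0 + 0 powr (1 - \<mu> / \<nu>) * (2 * N) powr (\<mu> / \<nu>)) (at_right 0)"
          by (intro tendsto_add tendsto_mult_right tendsto_ident_at)
        then show ?thesis by simp
      qed
      then have "\<forall>\<^sub>F e in at_right 0. e + (2 * e) powr (1 - \<mu> / \<nu>) * (2 * N) powr (\<mu> / \<nu>) < \<epsilon>"
        using \<epsilon> by (rule order_tendstoD(2))
      then have "\<forall>\<^sub>F e in at_right 0. e + (2 * e) powr (1 - \<mu> / \<nu>) * (2 * N) powr (\<mu> / \<nu>) < \<epsilon> \<and> 0 < e"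
        using eventually_at_right_less[of 0] by (rule eventually_conj)
      then obtain e where e: "e + (2 * e) powr (1 - \<mu> / \<nu>) * (2 * N) powr (\<mu> / \<nu>) < \<epsilon>" "0 < e"
        using eventually_happens trivial_limit_at_right_real by blast
      obtain J where J: "\<And>n x. n \<ge> J \<Longrightarrow> x \<in> ?C \<Longrightarrow> norm (v (r n) x - l x) < e" using unif[OF e(2)] by blast
      have "norm (holder_norm \<mu> ?C (\<lambda>x. v (r n) x - l x) - 0) < \<epsilon>" if "n \<ge> J" for n
      proof -
        have "holder_norm \<mu> ?C (\<lambda>x. v (r n) x - l x) < \<epsilon>" using est[OF e(2), of n] J[OF that] e(1) by fastforce
        moreover have "v (r n) \<in> holder_space \<mu> ?C" using hol[OF N, of "v (r n)"] v1 v2 by blast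
        then have "0 \<le> holder_norm \<mu> ?C (\<lambda>x. v (r n) x - l x)" using holder_norm_nonneg[OF holder_space_diff[OF _ lh]] by blast
        ultimately show ?thesis by simp
      qed
      then show "\<exists>no. \<forall>n\<ge>no. norm (holder_norm \<mu> ?C (\<lambda>x. v (r n) x - l x) - 0) < \<epsilon>" by blast
    qed
    moreover have "holder_norm \<mu> ?C (\<lambda>x. restrict (continuous_rep (\<sigma> (r j))) ?C x - l x) = holder_norm \<mu> ?C (\<lambda>x. v (r j) x - l x)" for j
      by (rule holder_norm_cong) (simp add: v_def)
    ultimately have "(\<lambda>j. holder_norm \<mu> ?C (\<lambda>x. restrict (continuous_rep (\<sigma> (r j))) ?C x - l x)) \<longlonglongrightarrow> 0" by (simp only:)
    then show "\<exists>l\<in>holder_space \<mu> ?C. \<exists>r. strict_mono r \<and>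
        (\<lambda>j. holder_norm \<mu> ?C (\<lambda>x. restrict (continuous_rep (\<sigma> (r j))) ?C x - l x)) \<longlonglongrightarrow> 0"
      using lh r by blast
  qed (rule holder_norm_minus_commute)
qed

theorem theorem1p1:
  fixes \<Omega> :: "(real ^ 'n) set" and s p :: real
  assumes "0 < s" and "s < 1" and "1 \<le> p"
    and "bounded \<Omega>" and "open \<Omega>" and "lipschitz_boundary \<Omega>"
  shows
    "(s * p < real CARD('n) \<longrightarrow>
       (\<forall>q. 1 \<le> q \<and> q < real CARD('n) * p / (real CARD('n) - s * p) \<longrightarrow>
          compact_embedding
            (bessel_space s p) (bessel_norm s p)
            (Lp_space (lebesgue_on \<Omega>) q) (Lp_norm (lebesgue_on \<Omega>) q)
            (\<lambda>u :: real ^ 'n \<Rightarrow> real. restrict u \<Omega>))) \<and>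
     (s * p = real CARD('n) \<longrightarrow>
       (\<forall>q\<ge>1.
          compact_embedding
            (bessel_space s p) (bessel_norm s p)
            (Lp_space (lebesgue_on \<Omega>) q) (Lp_norm (lebesgue_on \<Omega>) q)
            (\<lambda>u :: real ^ 'n \<Rightarrow> real. restrict u \<Omega>))) \<and>
     (s * p > real CARD('n) \<longrightarrow>
       (\<forall>u \<in> (bessel_space s p :: (real ^ 'n \<Rightarrow> real) set). \<exists>v. continuous_representative u v) \<and>
       (\<forall>\<mu>. 0 < \<mu> \<and> \<mu> < s - real CARD('n) / p \<longrightarrow>
          compact_embedding
            (bessel_space s p) (bessel_norm s p)
            (holder_space \<mu> (closure \<Omega>)) (holder_norm \<mu> (closure \<Omega>))
            (\<lambda>u :: real ^ 'n \<Rightarrow> real. restrict (continuous_rep u) (closure \<Omega>))))"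
proof -
  have p0: "0 < p" using assms(3) by simp
  have meas: "\<Omega> \<in> sets lebesgue" using assms(5) by simp
  have dim: "real DIM(real ^ 'n) = real CARD('n)" by simp
  let ?n = "real CARD('n)"
  have n: "0 < ?n" by simp
  have Lq: "compact_embedding (bessel_space s p) (bessel_norm s p)
      (Lp_space (lebesgue_on \<Omega>) q) (Lp_norm (lebesgue_on \<Omega>) q) (\<lambda>u :: real ^ 'n \<Rightarrow> real. restrict u \<Omega>)"
    if "1 \<le> q" "?n * (1 / p - 1 / max p q) < s" for q
    by (rule compact_embedding_Lq[OF assms(1-3) that(1) _ assms(4) meas]) (use that dim in simp)
  \<comment> \<open>For \<open>q > p\<close> the bound on \<open>q\<close> is rewritten as
    \<open>n * (1 / p - 1 / q) < s\<close>; for \<open>q \<le> p\<close> the left-hand side is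
    0.\<close>
  have sub: "?n * (1 / p - 1 / max p q) < s"
    if sp: "s * p < ?n" and q: "1 \<le> q" "q < ?n * p / (?n - s * p)" for q
  proof (cases "q \<le> p")
    case True
    then show ?thesis using assms(1) by (simp add: max_def)
  next
    case False
    have "q * (?n - s * p) < ?n * p" using q(2) sp by (simp add: pos_less_divide_eq)
    then have "?n * (q - p) < s * (p * q)" by (simp add: algebra_simps)
    moreover have "?n * (1 / p - 1 / q) = ?n * (q - p) / (p * q)" using p0 q(1) by (simp add: field_simps)
    ultimately show ?thesis using False p0 q(1) by (simp add: max_def pos_divide_less_eq)
  qed
  have crit: "?n * (1 / p - 1 / max p q) < s" if sp: "s * p = ?n" and q: "1 \<le> q" for q
  proof -
    \<comment> \<open>With \<open>n / p = s\<close> the left-hand side is \<open>s\<close> minus a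
      positive number for every finite exponent, so no upper limit on \<open>q\<close>
      arises.\<close>
    have "?n * (1 / p - 1 / max p q) = s - ?n / max p q" using p0 sp[symmetric] by (simp add: field_simps)
    also have "\<dots> < s" using n p0 by (simp add: max_def)
    finally show ?thesis .
  qed
  have sup: "real DIM(real ^ 'n) < s * p" if "?n < s * p" using that dim by simp
  show ?thesis
    using Lq sub crit compact_embedding_holder(1)[OF assms(1-3) sup assms(4)]
      compact_embedding_holder(2)[OF assms(1-3) sup assms(4)] unfolding dim by blast
qed

end
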